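(* (1) For every integer $n \geq 2$ and every prime power $q \geq 2$ with $(n,q) \neq (4,2)$, there is a word $w(x_1,x_2) \in F_2$ such that $\mathrm{SL}_n(q)_w$ consists exactly of the identity and all transvections in $\mathrm{SL}_n(q)$. (2) For $\mathrm{SL}_4(2)$, the values of the word $w = x_1^{2\cdot 3\cdot 5\cdot 7}$ are the identity, the transvections, and the double transvections, i.e. the elements with Jordan normal form $J_2(1) \oplus J_2(1)$.
   Context: $F_2$ denotes the free group on $x_1,x_2$. For a group $G$ and a word $w$ in $x_1,\ldots,x_d$, the set of values of $w$ is $G_w := \{ w(g_1,\ldots,g_d)^{\pm 1} : g_1,\ldots,g_d \in G\}$. $\mathrm{SL}_n(q)$ is the special linear group of $n\times n$ matrices of determinant $1$ over the finite field $\mathbb{F}_q$. A transvection is an element $g \in \mathrm{SL}_n(q)$ such that $g - \mathrm{Id}$ has rank $1$ and $(g-\mathrm{Id})^2 = 0$. $J_2(1)$ denotes the $2 \times 2$ unipotent Jordan block. The word $w$ in (1) is allowed to depend on $n$ and $q$. *)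

theory Defs
  imports
    "HOL-Algebra.Group"
    "HOL-Library.Cardinality"
    "Jordan_Normal_Form.Jordan_Normal_Form"
    "Jordan_Normal_Form.DL_Rank"
begin

subsection \<open>Free groups and word maps\<close>

text \<open>
  The letter \<open>(i, True)\<close> stands for the generator \<open>x\<^sub>i\<close> and \<open>(i, False)\<close> for its inverse.
  The free group of rank \<open>d\<close> is realised on the reduced words in \<open>x\<^sub>1, \<dots>, x\<^sub>d\<close>.
\<close>

type_synonym letter = "nat \<times> bool"

definition inv_letter :: "letter \<Rightarrow> letter" where
  "inv_letter a = (fst a, \<not> snd a)"

fun reduced :: "letter list \<Rightarrow> bool" where
  "reduced (a # b # u) \<longleftrightarrow> b \<noteq> inv_letter a \<and> reduced (b # u)"
| "reduced _ \<longleftrightarrow> True"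

fun cons_red :: "letter \<Rightarrow> letter list \<Rightarrow> letter list" where
  "cons_red a [] = [a]"
| "cons_red a (b # u) = (if b = inv_letter a then u else a # b # u)"

definition free_group :: "nat \<Rightarrow> letter list monoid" where
  "free_group d =
     \<lparr>carrier = {u. reduced u \<and> fst ` set u \<subseteq> {1..d}},
      mult = (\<lambda>u v. foldr cons_red u v),
      one = []\<rparr>"

abbreviation gen :: "nat \<Rightarrow> letter list" where
  "gen i \<equiv> [(i, True)]"

fun word_eval :: "('g, 'm) monoid_scheme \<Rightarrow> (nat \<Rightarrow> 'g) \<Rightarrow> letter list \<Rightarrow> 'g" where
  "word_eval G g [] = \<one>\<^bsub>G\<^esub>"
| "word_eval G g ((i, e) # u) = (if e then g i else inv\<^bsub>G\<^esub> (g i)) \<otimes>\<^bsub>G\<^esub> word_eval G g u"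

definition word_values :: "('g, 'm) monoid_scheme \<Rightarrow> nat \<Rightarrow> letter list \<Rightarrow> 'g set" where
  "word_values G d w =
     {h. \<exists>g \<in> {1..d} \<rightarrow> carrier G. h = word_eval G g w \<or> h = inv\<^bsub>G\<^esub> (word_eval G g w)}"

lemma inv_letter_simps [simp]:
  "inv_letter (inv_letter a) = a" "inv_letter (i, e) = (i, \<not> e)" "fst (inv_letter a) = fst a"
  by (auto simp: inv_letter_def)

lemma reduced_tl: "reduced (a # u) \<Longrightarrow> reduced u"
  by (cases u) auto

lemma reduced_cons_red: "reduced u \<Longrightarrow> reduced (cons_red a u)"
  by (cases u) (auto dest: reduced_tl)

lemma set_cons_red: "set (cons_red a u) \<subseteq> insert a (set u)"
  by (cases u) auto

lemma cons_red_inv: "reduced u \<Longrightarrow> cons_red a (cons_red (inv_letter a) u) = u"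
  by (cases u rule: reduced.cases) auto

lemma cons_red_reduced: "reduced (a # u) \<Longrightarrow> cons_red a u = a # u"
  by (cases u) auto

lemma reduced_foldr: "reduced v \<Longrightarrow> reduced (foldr cons_red u v)"
  by (induction u) (auto intro: reduced_cons_red)

lemma set_foldr: "set (foldr cons_red u v) \<subseteq> set u \<union> set v"
proof (induction u)
  case (Cons a u)
  then show ?case using set_cons_red[of a "foldr cons_red u v"] by auto
qed simp

lemma foldr_cons_red:
  "reduced w \<Longrightarrow> foldr cons_red (cons_red a u) w = cons_red a (foldr cons_red u w)"
  by (cases u) (auto simp: cons_red_inv reduced_foldr)

lemma foldr_assoc:
  "reduced w \<Longrightarrow> foldr cons_red (foldr cons_red u v) w = foldr cons_red u (foldr cons_red v w)"
  by (induction u) (simp_all add: foldr_cons_red)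

lemma foldr_Nil: "reduced u \<Longrightarrow> foldr cons_red u [] = u"
proof (induction u)
  case (Cons a u)
  then show ?case using reduced_tl[of a u] cons_red_reduced[of a u] by simp
qed simp

lemma foldr_left_inverse:
  assumes "reduced u"
  shows "foldr cons_red (foldr cons_red (rev (map inv_letter u)) []) u = []"
proof -
  have "foldr cons_red (rev (map inv_letter u)) u = []" using assms
  proof (induction u)
    case (Cons a u)
    then show ?case by (auto dest: reduced_tl)
  qed simp
  with assms show ?thesis by (simp add: foldr_assoc)
qed

lemma group_free_group: "group (free_group d)"
proof (rule groupI)
  fix u v assume "u \<in> carrier (free_group d)" "v \<in> carrier (free_group d)"
  then show "u \<otimes>\<^bsub>free_group d\<^esub> v \<in> carrier (free_group d)"
    using set_foldr[of u v] by (fastforce simp: free_group_def reduced_foldr)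
next
  fix u assume u: "u \<in> carrier (free_group d)"
  let ?v = "foldr cons_red (rev (map inv_letter u)) []"
  have "?v \<in> carrier (free_group d)"
    using u set_foldr[of "rev (map inv_letter u)" "[]"]
    by (fastforce simp: free_group_def reduced_foldr)
  moreover have "?v \<otimes>\<^bsub>free_group d\<^esub> u = \<one>\<^bsub>free_group d\<^esub>"
    using u foldr_left_inverse by (simp add: free_group_def)
  ultimately show "\<exists>v \<in> carrier (free_group d). v \<otimes>\<^bsub>free_group d\<^esub> u = \<one>\<^bsub>free_group d\<^esub>"
    by blast
qed (auto simp: free_group_def foldr_assoc)

lemma (in group) word_eval_closed:
  "g \<in> {1..d} \<rightarrow> carrier G \<Longrightarrow> fst ` set u \<subseteq> {1..d} \<Longrightarrow> word_eval G g u \<in> carrier G"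
proof (induction u)
  case (Cons a u)
  then show ?case by (cases a) (auto simp: Pi_iff intro!: m_closed)
qed simp

lemma (in group) word_eval_cons_red:
  assumes "g \<in> {1..d} \<rightarrow> carrier G" "fst ` set (a # u) \<subseteq> {1..d}"
  shows "word_eval G g (cons_red a u) = word_eval G g [a] \<otimes> word_eval G g u"
proof -
  obtain i e where a: "a = (i, e)" by force
  have i: "g i \<in> carrier G" using assms a by auto
  show ?thesis
  proof (cases u)
    case Nil
    then show ?thesis using a i by auto
  next
    case (Cons b v)
    moreover have v: "word_eval G g v \<in> carrier G"
      using assms Cons by (intro word_eval_closed) auto
    moreover have "word_eval G g u \<in> carrier G"
      using assms by (intro word_eval_closed) auto
    moreover have "g i \<otimes> (inv (g i) \<otimes> word_eval G g v) = word_eval G g v"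
      "inv (g i) \<otimes> (g i \<otimes> word_eval G g v) = word_eval G g v"
      using i v by (simp_all flip: m_assoc)
    ultimately show ?thesis using a i by auto
  qed
qed

lemma (in group) word_eval_hom:
  assumes g: "g \<in> {1..d} \<rightarrow> carrier G"
  shows "word_eval G g \<in> hom (free_group d) G"
proof (rule homI)
  fix u assume "u \<in> carrier (free_group d)"
  then show "word_eval G g u \<in> carrier G"
    using word_eval_closed[OF g] by (auto simp: free_group_def)
next
  fix u v assume u: "u \<in> carrier (free_group d)" and v: "v \<in> carrier (free_group d)"
  have "word_eval G g (foldr cons_red u v) = word_eval G g u \<otimes> word_eval G g v"
    if "fst ` set u \<subseteq> {1..d}" "fst ` set v \<subseteq> {1..d}" for u v
    using that
  proof (induction u)
    case Nil
    then show ?case using word_eval_closed[OF g, of v] by simp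
  next
    case (Cons a u)
    obtain i e where a: "a = (i, e)" by force
    have i: "g i \<in> carrier G" using g Cons.prems a by auto
    have cl: "word_eval G g u \<in> carrier G" "word_eval G g v \<in> carrier G"
      using Cons.prems by (auto intro!: word_eval_closed[OF g])
    have "fst ` set (a # foldr cons_red u v) \<subseteq> {1..d}"
      using Cons.prems set_foldr[of u v] by fastforce
    from word_eval_cons_red[OF g this] show ?case
      using Cons a i cl by (simp add: m_assoc)
  qed
  then show "word_eval G g (u \<otimes>\<^bsub>free_group d\<^esub> v) = word_eval G g u \<otimes> word_eval G g v"
    using u v by (simp add: free_group_def)
qed

subsection \<open>Special linear groups\<close>

definition SL :: "nat \<Rightarrow> 'a::comm_ring_1 mat monoid" where
  "SL n = \<lparr>carrier = {A \<in> carrier_mat n n. det A = 1}, mult = (*), one = 1\<^sub>m n\<rparr>"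

lemma group_SL: "group (SL n :: 'a::field mat monoid)"
proof (rule groupI)
  fix A :: "'a mat" assume "A \<in> carrier (SL n)"
  then have A: "A \<in> carrier_mat n n" "det A = 1" by (auto simp: SL_def)
  have inv: "adj_mat A \<in> carrier_mat n n" "adj_mat A * A = 1\<^sub>m n"
    using adj_mat[OF A(1)] A(2) by auto
  with A have "det (adj_mat A) = 1"
    by (metis det_mult det_one mult.right_neutral)
  with inv show "\<exists>B \<in> carrier (SL n). B \<otimes>\<^bsub>SL n\<^esub> A = \<one>\<^bsub>SL n\<^esub>"
    by (auto simp: SL_def)
qed (auto simp: SL_def det_mult)

definition transvections :: "nat \<Rightarrow> 'a::field mat set" where
  "transvections n =
     {A \<in> carrier (SL n). vec_space.rank n (A - 1\<^sub>m n) = 1 \<and>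
        (A - 1\<^sub>m n) * (A - 1\<^sub>m n) = 0\<^sub>m n n}"

text \<open>
  A list \<open>[(k\<^sub>1, a\<^sub>1), \<dots>]\<close> given to \<^const>\<open>jordan_nf\<close> is the list of block sizes and eigenvalues.
\<close>

definition double_transvections :: "'a::field mat set" where
  "double_transvections = {A \<in> carrier (SL 4). jordan_nf A [(2, 1), (2, 1)]}"

end

theory Submission
  imports "HOL-Algebra.Algebraic_Closure_Type" "HOL-Algebra.Sylow" "HOL-Number_Theory.Number_Theory" Defs
begin

text \<open>
  Write \<open>q\<close> for the order of the field and \<open>p\<close> for its characteristic. A transvection is a matrix
  \<open>transv v f = 1 + v f\<^sup>T\<close> with \<open>v, f \<noteq> 0\<close> and \<open>f \<bullet> v = 0\<close>. For \<open>n \<ge> 3\<close> any two transvections are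
  conjugate in \<open>SL\<^sub>n(q)\<close>, and the value set of a word is closed under conjugation and inversion.
  Hence it suffices to exhibit a word map that takes values only in the identity and the
  transvections and that is not constant (\<open>word_values_transvections\<close>).

  Let \<open>M = \<Prod>\<^sub>d\<^sub>\<le>\<^sub>n (q\<^sup>d - 1)\<close>. Every irreducible polynomial of degree \<open>d\<close> that is not a multiple
  of \<open>X\<close> divides \<open>X\<^sup>M - 1\<close> when \<open>d \<le> n\<close>, so \<open>z = x\<^sup>M\<close> is unipotent for every \<open>x\<close> in \<open>SL\<^sub>n(q)\<close>
  (\<open>semisimple_part_nilpotent\<close>), and \<open>M\<close> is prime to \<open>p\<close>. For \<open>n = 2\<close> a unipotent element is the
  identity or a transvection and the word \<open>x\<^sup>M\<close> works. For \<open>n = p + 1\<close> one has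
  \<open>z\<^sup>p - 1 = (z - 1)\<^sup>n\<^sup>-\<^sup>1\<close>, a power of a nilpotent matrix that has rank at most one, and the word
  \<open>x\<^sup>M\<^sup>p\<close> works; this settles \<open>SL\<^sub>3\<close> in characteristic 2 and \<open>SL\<^sub>4\<close> in characteristic 3.

  In all other cases \<open>z\<close> may have a large Jordan block, and such elements have to be filtered out.
  The filter is a second power \<open>t = x\<^sup>e\<close> such that for every \<open>x\<close> either \<open>t\<close> is a scalar matrix or
  \<open>z\<close> is the identity or a transvection. The word is the \<open>M\<close>-th power of the commutator of \<open>z\<close> and
  \<open>z\<^sup>h\<close>, or for \<open>n = 3\<close> of two elements \<open>z\<^sup>h\<close>, where \<open>h\<close> is a conjugate of \<open>t\<close>. If \<open>t\<close> is scalar,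
  then \<open>z\<^sup>h = z\<close> and the commutator is trivial. If \<open>z\<close> is a transvection, then the commutator is
  governed by \<open>2 \<times> 2\<close> matrices, and its \<open>M\<close>-th power is the identity or a transvection
  (\<open>transvection_commutator_power\<close>).

  The filters are as follows. For \<open>n = 3\<close> and \<open>p \<noteq> 2\<close> take \<open>e\<close> a power of \<open>p\<close>: if \<open>z - 1\<close> has rank
  2, then its kernel is a line, and \<open>x\<close> has a single eigenvalue (\<open>one_dim_kernel_scalar_power\<close>).
  For \<open>n \<ge> 5\<close> let \<open>e\<close> be a power of \<open>p\<close> times the least common multiple of the \<open>q\<^sup>d - 1\<close> with
  \<open>d < n - 2\<close>. Then \<open>t \<noteq> 1\<close> forces an irreducible polynomial \<open>f\<close> of degree at least \<open>n - 2\<close> to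
  have a kernel at \<open>x\<close>, and counting the elements of the kernel and of the image of \<open>z - 1\<close> shows
  that \<open>z - 1\<close> has rank at most one (\<open>large_prime_kernel\<close>). For \<open>n = 4\<close> the same count leaves the
  exceptional elements with \<open>f(x)\<^sup>2 = 0\<close> for an irreducible quadratic \<open>f\<close>. They are removed by a
  second filter: \<open>f\<close> divides \<open>X\<^sup>e - c\<close> for some constant \<open>c\<close>, where \<open>e = q + 1\<close>, or \<open>e = 3\<close> when
  \<open>q = 5\<close>, so that \<open>x\<^sup>e\<close> raised to a power of \<open>p\<close> is scalar. The two filters are combined by
  letting \<open>h\<close> be the conjugate of the one by a conjugate of the other.

  That these word maps are not constant is shown by block diagonal elements with a Jordan block of
  size 2 and a further block of size \<open>n - 2\<close> with other eigenvalues. For \<open>n \<ge> 5\<close> the latter is the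
  companion matrix of a norm-one element of \<open>GF(q\<^sup>n\<^sup>-\<^sup>2)\<close> that survives the filter; it exists
  because the value at \<open>q\<close> of the cyclotomic polynomial of index at least 3 exceeds \<open>(q - 1)\<^sup>2\<close>
  (\<open>power_minus_1_not_dvd_Lcm\<close>).

  For \<open>SL\<^sub>4(2)\<close> the number 105 is the least common multiple of \<open>2\<^sup>d - 1\<close> for \<open>d \<le> 4\<close>, hence
  \<open>u = x\<^sup>1\<^sup>0\<^sup>5\<close> is unipotent and \<open>u\<^sup>2 - 1 = (u - 1)\<^sup>2\<close> has square zero; a nonzero matrix of square
  zero has rank 1 or 2, which gives the transvections and the double transvections.
\<close>

section \<open>Finite fields and polynomials over them\<close>

no_notation fps_nth (infixl "$" 75)

lemma prime_CHAR_finite_field: "prime CHAR('a::{field,finite})"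
  using prime_CHAR_semidom finite_imp_CHAR_pos[where 'a='a] by simp

lemma card_gt_1: "CARD('a::{field,finite}) > 1"
proof -
  have "card {0,1::'a} \<le> CARD('a)" by (rule card_mono) auto
  then show ?thesis by simp
qed

lemma power_card_eq_same:
  fixes x :: "'a :: {field,finite}"
  shows "x ^ CARD('a) = x"
proof (cases "x = 0")
  case False
  have "x * (\<Prod>y\<in>UNIV-{0}. x * y) = x * x ^ (CARD('a) - 1) * \<Prod>(UNIV-{0})"
    by (simp add: prod.distrib mult_ac card_Diff_singleton)
  also have "x * x ^ (CARD('a) - 1) = x ^ CARD('a)"
    using card_gt_1[where 'a='a] by (simp flip: power_Suc)
  also have "(\<Prod>y\<in>UNIV-{0}. x * y) = (\<Prod>y\<in>UNIV-{0}. y)"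
    by (rule prod.reindex_bij_witness[of _ "\<lambda>y. y / x" "\<lambda>y. x * y"]) (use False in auto)
  finally show ?thesis by simp
qed (use card_gt_1[where 'a='a] in auto)

lemma power_card_minus_1:
  fixes x :: "'a :: {field,finite}"
  assumes "x \<noteq> 0"
  shows "x ^ (CARD('a) - 1) = 1"
proof -
  have "x * x ^ (CARD('a) - 1) = x ^ CARD('a)"
    using card_gt_1[where 'a='a] by (simp flip: power_Suc)
  then show ?thesis using assms by (simp add: power_card_eq_same)
qed

text \<open>
  A subgroup of order \<open>r\<close> of the additive group contains an element of additive order \<open>r\<close>.
\<close>

lemma prime_dvd_CARD_imp_CHAR:
  assumes "prime r" "r dvd CARD('a::{field,finite})"
  shows "r = CHAR('a)"
proof -
  define G :: "'a monoid" where "G = \<lparr>carrier = UNIV, monoid.mult = (+), one = 0\<rparr>"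
  interpret G: Group.group G
    by (rule groupI) (auto simp: G_def add.assoc intro: exI[of _ "- _"])
  have pow: "x [^]\<^bsub>G\<^esub> k = of_nat k * x" for x :: 'a and k :: nat
    by (induction k) (auto simp: G_def algebra_simps nat_pow_def)
  obtain m where m: "CARD('a) = r ^ 1 * m" using assms by auto
  obtain H where H: "subgroup H G" "card H = r"
    using sylow_thm[of r G 1 m] assms(1) m G.is_group by (auto simp: Coset.order_def G_def)
  have "card H > 1" using H assms prime_gt_1_nat by auto
  then have "\<not> H \<subseteq> {0}" using card_mono[of "{0::'a}" H] by auto
  then obtain x where x: "x \<in> H" "x \<noteq> 0" by auto
  have finH: "finite H" using \<open>card H > 1\<close> card.infinite by force
  interpret H: Group.group "G\<lparr>carrier := H\<rparr>" using H(1) by (rule G.subgroup_imp_group)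
  have "x [^]\<^bsub>G\<lparr>carrier := H\<rparr>\<^esub> Coset.order (G\<lparr>carrier := H\<rparr>) = \<one>\<^bsub>G\<lparr>carrier := H\<rparr>\<^esub>"
    by (rule H.pow_order_eq_1) (use x finH in \<open>auto\<close>)
  then have "x [^]\<^bsub>G\<^esub> r = \<one>\<^bsub>G\<^esub>" using H by (simp add: Coset.order_def nat_pow_def)
  then have "of_nat r * x = 0" unfolding pow by (simp add: G_def)
  then have "CHAR('a) dvd r" using x by (simp add: of_nat_eq_0_iff_char_dvd)
  then show ?thesis using assms(1) prime_CHAR_finite_field[where 'a='a] primes_dvd_imp_eq[of "CHAR('a)" r] by simp
qed

lemma CARD_eq_CHAR_power: "\<exists>k>0. CARD('a::{field,finite}) = CHAR('a) ^ k"
proof -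
  let ?q = "CARD('a)"
  have q: "?q > 1" by (rule card_gt_1)
  have p: "prime CHAR('a)" by (rule prime_CHAR_finite_field)
  define k where "k = multiplicity CHAR('a) ?q"
  obtain m where m: "?q = CHAR('a) ^ k * m" unfolding k_def using multiplicity_dvd by blast
  have "m = 1"
  proof (rule ccontr)
    assume "m \<noteq> 1"
    then obtain r where r: "prime r" "r dvd m" using prime_factor_nat by blast
    then have "r = CHAR('a)" using m by (intro prime_dvd_CARD_imp_CHAR) auto
    then have "CHAR('a) ^ Suc k dvd ?q" using r m by (metis dvd_mult dvd_refl mult_dvd_mono power_Suc2)
    then show False using q p multiplicity_geI[of ?q "CHAR('a)" "Suc k"] not_prime_unit
      by (auto simp: k_def)
  qed
  then have "?q = CHAR('a) ^ k" using m by simp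
  moreover from this q have "k > 0" by (cases k) auto
  ultimately show ?thesis by blast
qed

lemma card_poly_degree_less:
  "card {g :: 'a::{field,finite} poly. g = 0 \<or> degree g < d} = CARD('a) ^ d"
  "finite {g :: 'a::{field,finite} poly. g = 0 \<or> degree g < d}"
proof -
  let ?P = "\<lambda>d. {g :: 'a poly. g = 0 \<or> degree g < d}"
  have "card (?P d) = CARD('a) ^ d \<and> finite (?P d)"
  proof (induction d)
    case (Suc d)
    have eq: "?P (Suc d) = (\<lambda>(a, g). pCons a g) ` (UNIV \<times> ?P d)"
    proof (intro Set.set_eqI iffI)
      fix g :: "'a poly" assume g: "g \<in> ?P (Suc d)"
      obtain a h where gh: "g = pCons a h" by (cases g)
      have "h \<in> ?P d" using g gh by (cases "h = 0") auto
      then show "g \<in> (\<lambda>(a, g). pCons a g) ` (UNIV \<times> ?P d)" using gh by auto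
    next
      fix g :: "'a poly" assume "g \<in> (\<lambda>(a, g). pCons a g) ` (UNIV \<times> ?P d)"
      then obtain a h where "g = pCons a h" "h = 0 \<or> degree h < d" by auto
      then show "g \<in> ?P (Suc d)" by (cases "h = 0") auto
    qed
    have inj: "inj_on (\<lambda>(a, g). pCons a g) (UNIV \<times> ?P d)" by (auto simp: inj_on_def)
    show ?case unfolding eq using Suc inj by (simp add: card_image card_cartesian_product)
  qed auto
  then show "card (?P d) = CARD('a) ^ d" "finite (?P d)" by auto
qed

text \<open>
  Fermat's argument: multiplication by \<open>X\<close> permutes the \<open>q\<^sup>d - 1\<close> nonzero residues modulo \<open>f\<close>,
  where \<open>d\<close> is the degree of \<open>f\<close>. Comparing the product of all residues before and after gives the
  claim.
\<close>

lemma prime_poly_dvd_X_power_minus_1: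
  fixes f :: "'a :: {field,finite} poly"
  assumes f: "prime_elem f" and nX: "\<not> f dvd [:0, 1:]"
  shows "f dvd [:0, 1:] ^ (CARD('a) ^ degree f - 1) - 1"
proof -
  define U :: "'a poly" where "U = [:0, 1:]"
  define R where "R = {g :: 'a poly. g = 0 \<or> degree g < degree f} - {0}"
  have fR: "finite R" using card_poly_degree_less(2)[of "degree f"] by (simp add: R_def)
  have cR: "card R = CARD('a) ^ degree f - 1"
    using card_poly_degree_less[of "degree f", where 'a='a] by (simp add: R_def)
  have f0: "f \<noteq> 0" using f by auto
  have ndvd: "\<not> f dvd g" if "g \<in> R" for g
    using that f0 dvd_imp_degree_le[of f g] by (auto simp: R_def)
  have pm: "f dvd U * h \<longleftrightarrow> f dvd h" for h
    using nX unfolding U_def prime_elem_dvd_mult_iff[OF f] by blast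
  have deg: "degree f > 0"
    using prime_elem_not_unit[OF f] f0 by (auto simp: is_unit_iff_degree)
  have step: "U * g mod f \<in> R" if "g \<in> R" for g
  proof -
    have "\<not> f dvd U * g" using ndvd[OF that] by (simp add: pm)
    then show ?thesis using degree_mod_less'[of f "U * g"] f0 by (auto simp: R_def dvd_eq_mod_eq_0)
  qed
  have inj: "inj_on (\<lambda>g. U * g mod f) R"
  proof (rule inj_onI)
    fix g h assume gh: "g \<in> R" "h \<in> R" "U * g mod f = U * h mod f"
    then have "f dvd U * (g - h)" by (simp add: mod_eq_dvd_iff right_diff_distrib)
    then have d: "f dvd g - h" by (simp only: pm)
    have "g - h = 0 \<or> degree (g - h) < degree f"
      using gh degree_diff_less[of g "degree f" h] by (auto simp: R_def)
    then show "g = h" using d dvd_imp_degree_le[of f "g - h"] by (cases "g - h = 0") auto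
  qed
  have im: "(\<lambda>g. U * g mod f) ` R = R"
    using step by (intro endo_inj_surj fR inj) auto
  have "(\<Prod>g\<in>R. g) = (\<Prod>g\<in>R. U * g mod f)"
    using prod.reindex[OF inj, of "\<lambda>g. g"] im by simp
  then have "(\<Prod>g\<in>R. g) mod f = (\<Prod>g\<in>R. U * g mod f) mod f" by simp
  also have "\<dots> = (\<Prod>g\<in>R. U * g) mod f" by (rule mod_prod_eq)
  also have "(\<Prod>g\<in>R. U * g) = U ^ card R * (\<Prod>g\<in>R. g)" by (simp add: prod.distrib)
  finally have "f dvd U ^ card R * (\<Prod>g\<in>R. g) - (\<Prod>g\<in>R. g)"
    by (simp add: mod_eq_dvd_iff dvd_diff_commute)
  then have "f dvd (U ^ card R - 1) * (\<Prod>g\<in>R. g)" by (simp add: algebra_simps)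
  moreover have "\<not> f dvd (\<Prod>g\<in>R. g)"
    using fR ndvd
    by (induction R rule: finite_induct) (use f deg in \<open>auto simp: prime_elem_dvd_mult_iff\<close>)
  ultimately show ?thesis using f cR by (simp add: prime_elem_dvd_mult_iff U_def)
qed

lemma prime_poly_no_root:
  fixes f :: "'a::field poly"
  assumes f: "prime_elem f" "2 \<le> degree f"
  shows "poly f r \<noteq> 0"
proof
  assume "poly f r = 0"
  then obtain g where g: "f = [:- r, 1:] * g" unfolding poly_eq_0_iff_dvd by (elim dvdE)
  have g0: "g \<noteq> 0" using g f(1) by auto
  have "irreducible f" using f(1) by (rule prime_elem_imp_irreducible)
  then have "is_unit [:- r, 1:] \<or> is_unit g" unfolding g by (rule irreducibleD) simp
  then have "degree g = 0" by (auto simp: is_unit_iff_degree g0)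
  then have "degree f = 1" unfolding g using g0 by (subst degree_mult_eq) simp_all
  then show False using f(2) by simp
qed

lemma exists_prime_elem_poly_dvd:
  fixes g :: "'a :: field poly"
  assumes "degree g > 0"
  shows "\<exists>f. prime_elem f \<and> f dvd g \<and> degree f > 0"
  using assms
proof (induction "degree g" arbitrary: g rule: less_induct)
  case less
  show ?case
  proof (cases "Factorial_Ring.irreducible g")
    case True
    then show ?thesis
      using less.prems field_poly_irreducible_imp_prime by (intro exI[of _ g]) simp
  next
    case False
    have g0: "g \<noteq> 0" using less.prems by (metis degree_0 less_irrefl)
    have g: "g \<noteq> 0" "\<not> g dvd 1" using g0 less.prems is_unit_iff_degree[OF g0] by simp_all
    then obtain a b where ab: "g = a * b" "\<not> a dvd 1" "\<not> b dvd 1"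
      using False Factorial_Ring.irreducibleI[OF g] by metis
    have nz: "a \<noteq> 0" "b \<noteq> 0" using g(1) unfolding ab(1) by simp_all
    have d: "degree a > 0" "degree b > 0"
      using ab(2,3) is_unit_iff_degree[OF nz(1)] is_unit_iff_degree[OF nz(2)] nz by simp_all
    have "degree g = degree a + degree b" unfolding ab(1) using nz by (rule degree_mult_eq)
    then have "degree a < degree g" using d by simp
    from less.hyps[OF this d(1)] obtain f where f: "prime_elem f" "f dvd a" "degree f > 0" by blast
    have "f dvd g" unfolding ab(1) using f(2) by (rule dvd_mult2)
    then show ?thesis using f by blast
  qed
qed

section \<open>Polynomials evaluated at a matrix\<close>

lemma zero_smult_mat [simp]: "(0::'a::mult_zero) \<cdot>\<^sub>m A = 0\<^sub>m (dim_row A) (dim_col A)"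
  by auto

lemma one_smult_mat [simp]: "(1::'a::monoid_mult) \<cdot>\<^sub>m A = A"
  by auto

text \<open>
  Square matrices of one size are not a type of their own, hence Horner's scheme instead of
  evaluation in a ring.
\<close>

definition mat_poly :: "nat \<Rightarrow> 'a::comm_ring_1 mat \<Rightarrow> 'a poly \<Rightarrow> 'a mat" where
  "mat_poly n A g = fold_coeffs (\<lambda>a B. a \<cdot>\<^sub>m 1\<^sub>m n + A * B) g (0\<^sub>m n n)"

lemma mat_poly_0 [simp]: "mat_poly n A 0 = 0\<^sub>m n n"
  by (simp add: mat_poly_def)

lemma mat_poly_pCons:
  assumes "A \<in> carrier_mat n n"
  shows "mat_poly n A (pCons a g) = a \<cdot>\<^sub>m 1\<^sub>m n + A * mat_poly n A g"
proof (cases "g = 0 \<and> a = 0")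
  case True
  then show ?thesis using assms by (auto simp: mat_poly_def)
next
  case False
  then show ?thesis by (auto simp: mat_poly_def)
qed

lemma mat_poly_carrier [simp]:
  assumes "A \<in> carrier_mat n n"
  shows "mat_poly n A g \<in> carrier_mat n n"
  using assms by (induction g) (auto simp: mat_poly_pCons)

lemma mat_poly_const:
  assumes "A \<in> carrier_mat n n"
  shows "mat_poly n A [:a:] = a \<cdot>\<^sub>m 1\<^sub>m n"
  using assms by (simp add: mat_poly_pCons)

lemma mat_poly_1 [simp]:
  assumes "A \<in> carrier_mat n n"
  shows "mat_poly n A 1 = 1\<^sub>m n"
  using mat_poly_const[OF assms, of 1] by (auto simp: one_pCons)

lemma mat_poly_X [simp]:
  assumes "A \<in> carrier_mat n n"
  shows "mat_poly n A [:0, 1:] = A"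
  using assms by (simp add: mat_poly_pCons)

lemma mat_poly_add:
  assumes A: "A \<in> carrier_mat n n"
  shows "mat_poly n A (g + h) = mat_poly n A g + mat_poly n A h"
proof (induction g h rule: poly_induct2)
  case 0
  show ?case by auto
next
  case (pCons a g b h)
  have "mat_poly n A (pCons a g + pCons b h) =
      (a + b) \<cdot>\<^sub>m 1\<^sub>m n + A * (mat_poly n A g + mat_poly n A h)"
    using A pCons by (simp add: mat_poly_pCons)
  also have "\<dots> = (a \<cdot>\<^sub>m 1\<^sub>m n + b \<cdot>\<^sub>m 1\<^sub>m n) + (A * mat_poly n A g + A * mat_poly n A h)"
    using A by (subst mult_add_distrib_mat[of A n n _ n]) (auto simp: add_smult_distrib_right_mat[of _ n n])
  also have "\<dots> = mat_poly n A (pCons a g) + mat_poly n A (pCons b h)"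
    using A by (intro eq_matI) (auto simp: mat_poly_pCons carrier_matD[OF mat_poly_carrier[OF A]])
  finally show ?case .
qed

lemma mat_poly_smult:
  assumes A: "A \<in> carrier_mat n n"
  shows "mat_poly n A (smult c g) = c \<cdot>\<^sub>m mat_poly n A g"
proof (induction g)
  case 0
  show ?case by simp
next
  case (pCons a g)
  have "mat_poly n A (smult c (pCons a g)) = (c * a) \<cdot>\<^sub>m 1\<^sub>m n + A * (c \<cdot>\<^sub>m mat_poly n A g)"
    using A pCons by (simp add: mat_poly_pCons)
  also have "\<dots> = (c * a) \<cdot>\<^sub>m 1\<^sub>m n + c \<cdot>\<^sub>m (A * mat_poly n A g)"
    using A by (subst mult_smult_distrib[of A n n _ n]) auto
  also have "\<dots> = c \<cdot>\<^sub>m mat_poly n A (pCons a g)"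
    using A by (intro eq_matI)
      (auto simp: mat_poly_pCons algebra_simps carrier_matD[OF mat_poly_carrier[OF A]])
  finally show ?case .
qed

lemma mat_poly_diff:
  assumes A: "A \<in> carrier_mat n n"
  shows "mat_poly n A (g - h) = mat_poly n A g - mat_poly n A h"
proof -
  have "mat_poly n A (g - h) = mat_poly n A (g + smult (-1) h)" by simp
  also have "\<dots> = mat_poly n A g - mat_poly n A h"
    unfolding mat_poly_add[OF A] mat_poly_smult[OF A]
    by (intro eq_matI) (auto simp: carrier_matD[OF mat_poly_carrier[OF A]])
  finally show ?thesis .
qed

lemma mat_poly_mult:
  assumes A: "A \<in> carrier_mat n n"
  shows "mat_poly n A (g * h) = mat_poly n A g * mat_poly n A h"
proof (induction g)
  case 0
  show ?case using mat_poly_carrier[OF A] by (simp add: left_mult_zero_mat[of _ n n])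
next
  case (pCons a g)
  have C: "mat_poly n A h \<in> carrier_mat n n" "mat_poly n A g \<in> carrier_mat n n" using A by auto
  then have D: "A * (mat_poly n A g * mat_poly n A h) \<in> carrier_mat n n"
    by (intro mult_carrier_mat[OF A mult_carrier_mat])
  have "mat_poly n A (pCons a g * h) = a \<cdot>\<^sub>m mat_poly n A h + A * (mat_poly n A g * mat_poly n A h)"
    using A pCons(2) C
    by (simp add: mat_poly_add mat_poly_smult mat_poly_pCons[OF A, of 0] left_add_zero_mat[OF D])
  also have "\<dots> = (a \<cdot>\<^sub>m 1\<^sub>m n) * mat_poly n A h + (A * mat_poly n A g) * mat_poly n A h"
    using A C by (simp add: mult_smult_assoc_mat[OF one_carrier_mat C(1)]
      left_mult_one_mat[OF C(1)] assoc_mult_mat[OF A C(2) C(1)])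
  also have "\<dots> = mat_poly n A (pCons a g) * mat_poly n A h"
    using A C by (simp add: mat_poly_pCons add_mult_distrib_mat[of _ n n _ _ n])
  finally show ?case .
qed

lemma mat_poly_power:
  assumes A: "A \<in> carrier_mat n n"
  shows "mat_poly n A (g ^ k) = mat_poly n A g ^\<^sub>m k"
proof (induction k)
  case 0
  then show ?case using A carrier_matD[OF mat_poly_carrier[OF A]] by simp
next
  case (Suc k)
  then show ?case using A by (simp add: power_Suc2 mat_poly_mult del: power_Suc)
qed

lemma mat_poly_X_power:
  assumes A: "A \<in> carrier_mat n n"
  shows "mat_poly n A ([:0, 1:] ^ k) = A ^\<^sub>m k"
  using A by (simp add: mat_poly_power)

lemma mult_mat_zero_vec:
  fixes A :: "'a::semiring_0 mat"
  assumes "A \<in> carrier_mat n m"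
  shows "A *\<^sub>v 0\<^sub>v m = 0\<^sub>v n"
  using assms by (intro eq_vecI) auto

lemma zero_mat_mult_vec:
  fixes v :: "'a::semiring_0 vec"
  assumes "v \<in> carrier_vec m"
  shows "0\<^sub>m n m *\<^sub>v v = 0\<^sub>v n"
  using assms by (intro eq_vecI) (auto simp: scalar_prod_def)

lemma mat_poly_vec_carrier [simp]:
  assumes "A \<in> carrier_mat n n" "v \<in> carrier_vec n"
  shows "mat_poly n A g *\<^sub>v v \<in> carrier_vec n"
  using assms by (intro mult_mat_vec_carrier[of _ n n]) simp_all

lemma mat_poly_mult_vec:
  assumes A: "A \<in> carrier_mat n n" and v: "v \<in> carrier_vec n"
  shows "mat_poly n A (g * h) *\<^sub>v v = mat_poly n A g *\<^sub>v (mat_poly n A h *\<^sub>v v)"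
  using assms by (simp add: mat_poly_mult assoc_mult_mat_vec[of _ n n _ n])

lemma mat_poly_kernel_dvd:
  assumes A: "A \<in> carrier_mat n n" and v: "v \<in> carrier_vec n"
    and "g dvd h" "mat_poly n A g *\<^sub>v v = 0\<^sub>v n"
  shows "mat_poly n A h *\<^sub>v v = 0\<^sub>v n"
proof -
  obtain k where "h = k * g" using assms(3) by (metis dvd_def mult.commute)
  then show ?thesis using assms mat_poly_carrier[OF A, of k]
    by (simp add: mat_poly_mult_vec[OF A v] mult_mat_zero_vec[of _ n n])
qed

lemma mat_poly_mod_kernel:
  fixes A :: "'a::field mat"
  assumes A: "A \<in> carrier_mat n n" and v: "v \<in> carrier_vec n"
    and "mat_poly n A g *\<^sub>v v = 0\<^sub>v n" "mat_poly n A h *\<^sub>v v = 0\<^sub>v n"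
  shows "mat_poly n A (h mod g) *\<^sub>v v = 0\<^sub>v n"
proof -
  have "mat_poly n A (h div g * g) *\<^sub>v v = 0\<^sub>v n"
    by (rule mat_poly_kernel_dvd[OF A v _ assms(3)]) simp
  then have "mat_poly n A (h - h div g * g) *\<^sub>v v = 0\<^sub>v n"
    using assms by (simp add: mat_poly_diff[OF A] minus_mult_distrib_mat_vec[of _ n n])
  then show ?thesis by (simp add: minus_div_mult_eq_mod)
qed

text \<open>
  The polynomials that kill \<open>v\<close> form an ideal; it is proper since \<open>v \<noteq> 0\<close> and contains the maximal
  ideal generated by \<open>f\<close>.
\<close>

lemma mat_poly_prime_kernel:
  fixes A :: "'a::field mat"
  assumes A: "A \<in> carrier_mat n n" and v: "v \<in> carrier_vec n" "v \<noteq> 0\<^sub>v n"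
    and f: "prime_elem f" "mat_poly n A f *\<^sub>v v = 0\<^sub>v n"
    and g: "mat_poly n A g *\<^sub>v v = 0\<^sub>v n"
  shows "f dvd g"
proof -
  define P where "P = (\<lambda>h. h \<noteq> 0 \<and> mat_poly n A h *\<^sub>v v = 0\<^sub>v n)"
  have "P f" using f by (auto simp: P_def)
  then obtain m where m: "P m" "\<And>h. P h \<Longrightarrow> degree m \<le> degree h"
    using exists_least_iff[of "\<lambda>d. \<exists>h. P h \<and> degree h = d"] by (metis not_less)
  have m_dvd: "m dvd h" if "mat_poly n A h *\<^sub>v v = 0\<^sub>v n" for h
  proof (rule ccontr)
    assume "\<not> m dvd h"
    then have "h mod m \<noteq> 0" by (simp add: dvd_eq_mod_eq_0)
    moreover have "mat_poly n A (h mod m) *\<^sub>v v = 0\<^sub>v n"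
      using mat_poly_mod_kernel[OF A v(1)] that m by (auto simp: P_def)
    ultimately have "P (h mod m)" by (simp add: P_def)
    then show False using m(2)[of "h mod m"] degree_mod_less'[of m h] \<open>h mod m \<noteq> 0\<close> m(1)
      by (auto simp: P_def)
  qed
  have "\<not> m dvd 1"
  proof
    assume "m dvd 1"
    then have "mat_poly n A 1 *\<^sub>v v = 0\<^sub>v n"
      using mat_poly_kernel_dvd[OF A v(1)] m(1) by (auto simp: P_def)
    then show False using v A by simp
  qed
  moreover obtain k where k: "f = m * k" using m_dvd[OF f(2)] by (metis dvdE)
  ultimately have "k dvd 1"
    using f(1) Factorial_Ring.irreducibleD[OF prime_elem_imp_irreducible[OF f(1)] k] by blast
  then have "f dvd m" unfolding k by simp
  then show ?thesis using m_dvd[OF g] dvd_trans by blast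
qed

lemma mat_mult_unit_vec:
  fixes A :: "'a::semiring_1 mat"
  assumes "A \<in> carrier_mat n m" "i < m"
  shows "A *\<^sub>v unit_vec m i = col A i"
  using assms by (intro eq_vecI) (auto simp: scalar_prod_right_unit)

lemma mat_eq_on_vecI:
  fixes A B :: "'a::comm_ring_1 mat"
  assumes "A \<in> carrier_mat n m" "B \<in> carrier_mat n m"
    and "\<And>v. v \<in> carrier_vec m \<Longrightarrow> A *\<^sub>v v = B *\<^sub>v v"
  shows "A = B"
proof (rule mat_col_eqI)
  fix i assume "i < dim_col B"
  then show "col A i = col B i" using assms(3)[of "unit_vec m i"] assms(1,2)
    by (simp add: mat_mult_unit_vec[of _ n m])
qed (use assms in auto)

lemma carrier_vec_eq_image:
  "carrier_vec n = (\<lambda>f. vec n f) ` ({..<n} \<rightarrow>\<^sub>E (UNIV :: 'a set))"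
proof (intro Set.set_eqI iffI)
  fix v :: "'a vec" assume v: "v \<in> carrier_vec n"
  then have "v = vec n (restrict (\<lambda>i. v $ i) {..<n})" by auto
  then show "v \<in> (\<lambda>f. vec n f) ` ({..<n} \<rightarrow>\<^sub>E UNIV)" using restrict_PiE_iff[of "($) v" "{..<n}" "\<lambda>_. UNIV"]
    by (intro image_eqI[of v _ "restrict (($) v) {..<n}"]) simp_all
next
  fix v :: "'a vec" assume "v \<in> (\<lambda>f. vec n f) ` ({..<n} \<rightarrow>\<^sub>E UNIV)"
  then show "v \<in> carrier_vec n" by (elim imageE) simp
qed

lemma card_carrier_vec: "card (carrier_vec n :: 'a::finite vec set) = CARD('a) ^ n"
proof -
  have "inj_on (\<lambda>f. vec n f) ({..<n} \<rightarrow>\<^sub>E (UNIV :: 'a set))"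
  proof (rule inj_onI)
    fix f g :: "nat \<Rightarrow> 'a" assume fg: "f \<in> {..<n} \<rightarrow>\<^sub>E UNIV" "g \<in> {..<n} \<rightarrow>\<^sub>E UNIV" "vec n f = vec n g"
    have "f i = g i" if "i < n" for i using fg(3) that by (metis index_vec)
    then show "f = g" using fg by (auto intro: PiE_ext)
  qed
  then show ?thesis unfolding carrier_vec_eq_image by (simp add: card_image card_PiE)
qed

lemma finite_carrier_vec: "finite (carrier_vec n :: 'a::finite vec set)"
  unfolding carrier_vec_eq_image by (intro finite_imageI finite_PiE) auto

text \<open>
  Linear independence of \<open>v, A v, \<dots>, A\<^sup>d\<^sup>-\<^sup>1 v\<close>, phrased as a cardinality. Counting elements of
  subspaces replaces dimensions throughout.
\<close>

lemma card_orbit: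
  fixes A :: "'a::{field,finite} mat"
  assumes A: "A \<in> carrier_mat n n" and v: "v \<in> carrier_vec n"
    and indep: "\<And>g. g \<noteq> 0 \<Longrightarrow> degree g < d \<Longrightarrow> mat_poly n A g *\<^sub>v v \<noteq> 0\<^sub>v n"
  shows "card ((\<lambda>g. mat_poly n A g *\<^sub>v v) ` {g. g = 0 \<or> degree g < d}) = CARD('a) ^ d"
proof -
  have "inj_on (\<lambda>g. mat_poly n A g *\<^sub>v v) {g. g = 0 \<or> degree g < d}"
  proof (rule inj_onI, rule ccontr)
    fix g h assume gh: "g \<in> {g. g = 0 \<or> degree g < d}" "h \<in> {g. g = 0 \<or> degree g < d}"
      "mat_poly n A g *\<^sub>v v = mat_poly n A h *\<^sub>v v" "g \<noteq> h"
    have "mat_poly n A (g - h) *\<^sub>v v = 0\<^sub>v n"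
      using gh(3) A v by (simp add: mat_poly_diff minus_mult_distrib_mat_vec[of _ n n]
        minus_cancel_vec[OF mat_poly_vec_carrier])
    moreover have "degree (g - h) < d"
      using gh degree_diff_less[of g d h] by (cases "g = 0"; cases "h = 0") auto
    ultimately show False using indep[of "g - h"] gh(4) by auto
  qed
  then show ?thesis by (simp add: card_image card_poly_degree_less)
qed

lemma exists_annihilator:
  fixes A :: "'a::{field,finite} mat"
  assumes A: "A \<in> carrier_mat n n" and v: "v \<in> carrier_vec n"
  shows "\<exists>g. g \<noteq> 0 \<and> degree g \<le> n \<and> mat_poly n A g *\<^sub>v v = 0\<^sub>v n"
proof (rule ccontr)
  assume "\<not> ?thesis"
  then have "card ((\<lambda>g. mat_poly n A g *\<^sub>v v) ` {g. g = 0 \<or> degree g < Suc n}) = CARD('a) ^ Suc n"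
    by (intro card_orbit[OF A v]) (metis less_Suc_eq_le)
  moreover have "card ((\<lambda>g. mat_poly n A g *\<^sub>v v) ` {g. g = 0 \<or> degree g < Suc n}) \<le>
      card (carrier_vec n :: 'a vec set)"
    using A v by (intro card_mono finite_carrier_vec subsetI) (elim imageE, simp only: mat_poly_vec_carrier)
  ultimately show False using card_gt_1[where 'a='a] by (simp add: card_carrier_vec)
qed

text \<open>
  Every vector is killed by a nonzero polynomial of degree at most \<open>n\<close>. Split off its prime
  factors one at a time: each of them can be omitted or has a nontrivial kernel, and in the second
  case it divides \<open>h\<close>; so \<open>h\<^sup>n\<close> kills the vector. This is the source of all statements of the form
  that some power of \<open>x\<close> is unipotent or scalar.
\<close>

lemma mat_poly_power_eq_0:
  fixes A :: "'a::{field,finite} mat"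
  assumes A: "A \<in> carrier_mat n n"
    and dvd: "\<And>f v. prime_elem f \<Longrightarrow> v \<in> carrier_vec n \<Longrightarrow> v \<noteq> 0\<^sub>v n \<Longrightarrow>
      mat_poly n A f *\<^sub>v v = 0\<^sub>v n \<Longrightarrow> f dvd h"
  shows "mat_poly n A (h ^ n) = 0\<^sub>m n n"
proof -
  have kill: "mat_poly n A (h ^ degree g) *\<^sub>v v = 0\<^sub>v n"
    if "g \<noteq> 0" "v \<in> carrier_vec n" "mat_poly n A g *\<^sub>v v = 0\<^sub>v n" for g v
    using that
  proof (induction "degree g" arbitrary: g v rule: less_induct)
    case less
    show ?case
    proof (cases "degree g = 0")
      case True
      then obtain c where "g = [:c:]" by (metis degree_eq_zeroE)
      then have "g dvd 1" using less.prems(1) True is_unit_iff_degree by blast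
      from mat_poly_kernel_dvd[OF A less.prems(2) this less.prems(3)] True
      show ?thesis by simp
    next
      case False
      then have "degree g > 0" by simp
      from exists_prime_elem_poly_dvd[OF this]
      obtain f where f: "prime_elem f" "degree f > 0" "f dvd g" by (elim exE conjE)
      from f(3) obtain k where g: "g = f * k" by (elim dvdE)
      define w where "w = mat_poly n A k *\<^sub>v v"
      have w: "w \<in> carrier_vec n" using A less.prems by (simp add: w_def mult_mat_vec_carrier[of _ n n])
      have fw: "mat_poly n A f *\<^sub>v w = 0\<^sub>v n"
        using less.prems(3) unfolding w_def g mat_poly_mult_vec[OF A less.prems(2)] .
      have k: "k \<noteq> 0" "degree k < degree g" "degree g \<noteq> 0"
        using f(2) less.prems(1) degree_mult_eq[of f k] unfolding g by simp_all
      have kill_k: "mat_poly n A (h * h ^ degree k) *\<^sub>v v = 0\<^sub>v n"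
      proof (cases "w = 0\<^sub>v n")
        case True
        then have "mat_poly n A (h ^ degree k) *\<^sub>v v = 0\<^sub>v n"
          using less.hyps[OF k(2) k(1) less.prems(2)] by (simp add: w_def)
        then show ?thesis by (rule mat_poly_kernel_dvd[OF A less.prems(2) dvd_triv_right])
      next
        case False
        then have "mat_poly n A h *\<^sub>v w = 0\<^sub>v n"
          using mat_poly_kernel_dvd[OF A w dvd[OF f(1) w False fw] fw] by simp
        then have "mat_poly n A k *\<^sub>v (mat_poly n A h *\<^sub>v v) = 0\<^sub>v n"
          unfolding w_def mat_poly_mult_vec[OF A less.prems(2), symmetric] by (simp only: mult.commute)
        moreover have "mat_poly n A h *\<^sub>v v \<in> carrier_vec n"
          using A less.prems by (simp add: mult_mat_vec_carrier[of _ n n])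
        ultimately have "mat_poly n A (h ^ degree k) *\<^sub>v (mat_poly n A h *\<^sub>v v) = 0\<^sub>v n"
          using less.hyps[OF k(2) k(1)] by simp
        then show ?thesis
          unfolding mat_poly_mult_vec[OF A less.prems(2), symmetric] by (simp only: mult.commute)
      qed
      have "h * h ^ degree k dvd h ^ degree g"
        using le_imp_power_dvd[of "Suc (degree k)" "degree g" h] k(2) by (simp only: power_Suc Suc_le_eq)
      then show ?thesis by (rule mat_poly_kernel_dvd[OF A less.prems(2) _ kill_k])
    qed
  qed
  show ?thesis
  proof (rule mat_eq_on_vecI[of _ n n])
    fix v :: "'a vec" assume v: "v \<in> carrier_vec n"
    obtain g where g: "g \<noteq> 0" "degree g \<le> n" "mat_poly n A g *\<^sub>v v = 0\<^sub>v n"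
      using exists_annihilator[OF A v] by auto
    have "mat_poly n A (h ^ n) *\<^sub>v v = 0\<^sub>v n"
      by (rule mat_poly_kernel_dvd[OF A v le_imp_power_dvd[OF g(2)] kill[OF g(1) v g(3)]])
    then show "mat_poly n A (h ^ n) *\<^sub>v v = 0\<^sub>m n n *\<^sub>v v"
      using v by (simp add: zero_mat_mult_vec)
  qed (simp_all only: mat_poly_carrier[OF A] zero_carrier_mat)
qed

section \<open>Matrices of rank one and transvections\<close>

definition outer_prod :: "'a::comm_ring_1 vec \<Rightarrow> 'a vec \<Rightarrow> 'a mat" where
  "outer_prod v f = mat (dim_vec v) (dim_vec f) (\<lambda>(i, j). v $ i * f $ j)"

lemma outer_prod_carrier [simp]:
  "v \<in> carrier_vec n \<Longrightarrow> f \<in> carrier_vec m \<Longrightarrow> outer_prod v f \<in> carrier_mat n m"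
  by (simp add: outer_prod_def)

lemma outer_prod_dim [simp]:
  "dim_row (outer_prod v f) = dim_vec v" "dim_col (outer_prod v f) = dim_vec f"
  by (simp_all add: outer_prod_def)

lemma outer_prod_index [simp]:
  "i < dim_vec v \<Longrightarrow> j < dim_vec f \<Longrightarrow> outer_prod v f $$ (i, j) = v $ i * f $ j"
  by (simp add: outer_prod_def)

lemma mult_outer_prod:
  assumes "A \<in> carrier_mat m n" "v \<in> carrier_vec n"
  shows "A * outer_prod v f = outer_prod (A *\<^sub>v v) f"
  using assms by (intro eq_matI) (auto simp: scalar_prod_def sum_distrib_right mult.assoc intro!: sum.cong)

lemma outer_prod_mult:
  assumes "A \<in> carrier_mat m n" "f \<in> carrier_vec m"
  shows "outer_prod v f * A = outer_prod v (A\<^sup>T *\<^sub>v f)"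
  using assms by (intro eq_matI) (auto simp: scalar_prod_def sum_distrib_left mult_ac intro!: sum.cong)

lemma outer_prod_mult_vec:
  assumes "f \<in> carrier_vec n" "w \<in> carrier_vec n"
  shows "outer_prod v f *\<^sub>v w = (f \<bullet> w) \<cdot>\<^sub>v v"
  using assms by (intro eq_vecI) (auto simp: scalar_prod_def sum_distrib_left sum_distrib_right mult_ac intro!: sum.cong)

lemma outer_prod_mult_outer_prod:
  assumes "f \<in> carrier_vec n" "w \<in> carrier_vec n"
  shows "outer_prod v f * outer_prod w g = (f \<bullet> w) \<cdot>\<^sub>m outer_prod v g"
  using assms by (intro eq_matI) (auto simp: scalar_prod_def sum_distrib_left sum_distrib_right mult_ac intro!: sum.cong)

lemma vec_neq_zeroE:
  assumes "v \<in> carrier_vec n" "v \<noteq> 0\<^sub>v n"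
  obtains i where "i < n" "v $ i \<noteq> 0"
  using assms by (metis carrier_vecD eq_vecI index_zero_vec(1,2))

lemma outer_prod_neq_0:
  fixes v f :: "'a::idom vec"
  assumes "v \<in> carrier_vec n" "v \<noteq> 0\<^sub>v n" "f \<in> carrier_vec n" "f \<noteq> 0\<^sub>v n"
  shows "outer_prod v f \<noteq> 0\<^sub>m n n"
proof -
  obtain i where i: "i < n" "v $ i \<noteq> 0" using assms(1,2) by (rule vec_neq_zeroE)
  obtain j where j: "j < n" "f $ j \<noteq> 0" using assms(3,4) by (rule vec_neq_zeroE)
  have "outer_prod v f $$ (i, j) \<noteq> 0\<^sub>m n n $$ (i, j)" using i j assms by simp
  then show ?thesis by metis
qed

lemma outer_prod_0 [simp]: "outer_prod (0\<^sub>v n) f = 0\<^sub>m n (dim_vec f)" "outer_prod v (0\<^sub>v n) = 0\<^sub>m (dim_vec v) n"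
  by (intro eq_matI; simp)+

lemma outer_prodI:
  fixes N :: "'a::field mat"
  assumes N: "N \<in> carrier_mat n n" and c: "c \<in> carrier_vec n"
    and cols: "\<And>j. j < n \<Longrightarrow> \<exists>a. col N j = a \<cdot>\<^sub>v c"
  shows "\<exists>f \<in> carrier_vec n. N = outer_prod c f"
proof -
  obtain a where a: "\<And>j. j < n \<Longrightarrow> col N j = a j \<cdot>\<^sub>v c" using cols by metis
  have "N $$ (i, j) = c $ i * a j" if "i < n" "j < n" for i j
  proof -
    have "N $$ (i, j) = col N j $ i" using N that by simp
    also have "\<dots> = c $ i * a j" unfolding a[OF that(2)] using c that by (simp add: mult.commute)
    finally show ?thesis .
  qed
  then have "N = outer_prod c (vec n a)" using N c by (intro eq_matI) auto
  then show ?thesis by (intro bexI[of _ "vec n a"]) auto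
qed

lemma lin_comb_0_imp_multiple:
  fixes c d :: "'a::field vec"
  assumes "c \<in> carrier_vec n" "d \<in> carrier_vec n" "c \<noteq> 0\<^sub>v n"
    and "a \<cdot>\<^sub>v c + b \<cdot>\<^sub>v d = 0\<^sub>v n" "a \<noteq> 0 \<or> b \<noteq> 0"
  shows "\<exists>e. d = e \<cdot>\<^sub>v c"
proof -
  have eq: "a * c $ i + b * d $ i = 0" if "i < n" for i
    using arg_cong[OF assms(4), of "\<lambda>v. v $ i"] that assms(1,2) by simp
  have "b \<noteq> 0"
  proof
    assume "b = 0"
    obtain i where "i < n" "c $ i \<noteq> 0" using assms(1,3) by (rule vec_neq_zeroE)
    then show False using eq[of i] \<open>b = 0\<close> assms(5) by simp
  qed
  have "d = (- a / b) \<cdot>\<^sub>v c"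
  proof (rule eq_vecI)
    fix i assume i: "i < dim_vec ((- a / b) \<cdot>\<^sub>v c)"
    then have "b * d $ i = - (a * c $ i)" using eq[of i] assms(1) by (simp add: eq_neg_iff_add_eq_0 add.commute)
    then show "d $ i = ((- a / b) \<cdot>\<^sub>v c) $ i" using \<open>b \<noteq> 0\<close> i by (simp add: field_simps)
  qed (use assms(1,2) in simp)
  then show ?thesis by blast
qed

lemma rank_eq_1_imp_outer_prod:
  fixes N :: "'a::field mat"
  assumes N: "N \<in> carrier_mat n n" and r: "vec_space.rank n N = 1"
  shows "\<exists>v\<in>carrier_vec n. \<exists>f\<in>carrier_vec n. N = outer_prod v f"
proof -
  interpret V: vec_space "TYPE('a)" n .
  have "N \<noteq> 0\<^sub>m n n" using r V.rank_0I[of n] by auto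
  have "\<exists>j<n. col N j \<noteq> 0\<^sub>v n"
  proof (rule ccontr)
    assume "\<not> ?thesis"
    then have "N = 0\<^sub>m n n" using N by (intro mat_col_eqI) auto
    then show False using \<open>N \<noteq> 0\<^sub>m n n\<close> by simp
  qed
  then obtain k where k: "k < n" "col N k \<noteq> 0\<^sub>v n" by blast
  have kc: "col N k \<in> carrier_vec n" using k N by simp
  have "\<exists>a. col N j = a \<cdot>\<^sub>v col N k" if j: "j < n" for j
  proof (rule ccontr)
    assume no: "\<nexists>a. col N j = a \<cdot>\<^sub>v col N k"
    let ?S = "{col N k, col N j}"
    have jc: "col N j \<in> carrier_vec n" using j N by simp
    have ne: "col N k \<noteq> col N j" using no one_smult_vec by metis
    have "V.lin_indpt ?S"
    proof
      assume dep: "V.lin_dep ?S"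
      have S: "?S \<subseteq> carrier_vec n" using kc jc by simp
      obtain a w where a: "V.lincomb a ?S = 0\<^sub>v n" "w \<in> ?S" "a w \<noteq> 0"
        using V.finite_lin_dep[OF _ dep] S by auto
      have "a (col N k) \<cdot>\<^sub>v col N k + a (col N j) \<cdot>\<^sub>v col N j = 0\<^sub>v n"
      proof (rule eq_vecI)
        fix i assume i: "i < dim_vec (0\<^sub>v n :: 'a vec)"
        then have "V.lincomb a ?S $ i = (\<Sum>x\<in>?S. a x * x $ i)"
          using S by (intro V.lincomb_index) auto
        then show "(a (col N k) \<cdot>\<^sub>v col N k + a (col N j) \<cdot>\<^sub>v col N j) $ i = 0\<^sub>v n $ i"
          using a(1) i ne kc jc N by simp
      qed (use N in simp)
      moreover have "a (col N k) \<noteq> 0 \<or> a (col N j) \<noteq> 0" using a by auto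
      ultimately show False using lin_comb_0_imp_multiple[OF kc jc k(2)] no by metis
    qed
    moreover have "?S \<subseteq> set (cols N)" using k j N by (auto simp: cols_def)
    ultimately have "card ?S \<le> V.rank N" using V.rank_ge_card_indpt[OF N] by blast
    then show False using r ne by simp
  qed
  then show ?thesis using outer_prodI[OF N kc] kc by blast
qed

lemma rank_outer_prod:
  fixes v f :: "'a::field vec"
  assumes v: "v \<in> carrier_vec n" "v \<noteq> 0\<^sub>v n" and f: "f \<in> carrier_vec n" "f \<noteq> 0\<^sub>v n"
  shows "vec_space.rank n (outer_prod v f) = 1"
proof -
  interpret V: vec_space "TYPE('a)" n .
  let ?N = "outer_prod v f"
  have N: "?N \<in> carrier_mat n n" using v f by simp
  have "V.rank ?N \<le> 1"
    by (rule V.rank_le_1_product_entries[OF N, of "\<lambda>i. v $ i" "\<lambda>j. f $ j"]) simp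
  moreover have "V.rank ?N \<noteq> 0"
  proof
    assume r: "V.rank ?N = 0"
    obtain k where k: "k < n" "f $ k \<noteq> 0" using f by (rule vec_neq_zeroE)
    have ck: "col ?N k = f $ k \<cdot>\<^sub>v v" using k v f by (intro eq_vecI) auto
    obtain i where i: "i < n" "v $ i \<noteq> 0" using v by (rule vec_neq_zeroE)
    have kc: "col ?N k \<in> carrier_vec n" using k N by simp
    have "V.lin_indpt {col ?N k}"
    proof
      assume dep: "V.lin_dep {col ?N k}"
      obtain a w where a: "V.lincomb a {col ?N k} = 0\<^sub>v n" "w \<in> {col ?N k}" "a w \<noteq> 0"
        using V.finite_lin_dep[OF _ dep] kc by auto
      have "V.lincomb a {col ?N k} $ i = (\<Sum>x\<in>{col ?N k}. a x * x $ i)"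
        using kc i by (intro V.lincomb_index) auto
      then show False using a i k ck v by simp
    qed
    moreover have "{col ?N k} \<subseteq> set (cols ?N)" using k N by (auto simp: cols_def)
    ultimately have "card {col ?N k} \<le> V.rank ?N" using V.rank_ge_card_indpt[OF N] by blast
    then show False using r by simp
  qed
  ultimately show ?thesis by simp
qed

lemma SL_carrier_iff: "A \<in> carrier (SL n) \<longleftrightarrow> A \<in> carrier_mat n n \<and> det A = 1"
  by (simp add: SL_def)

text \<open>
  Transvections in terms of a vector and a functional, the form in which all computations take
  place.
\<close>

lemma transvections_iff:
  fixes A :: "'a::field mat"
  shows "A \<in> transvections n \<longleftrightarrow> A \<in> carrier (SL n) \<and>
    (\<exists>v f. v \<in> carrier_vec n \<and> f \<in> carrier_vec n \<and> v \<noteq> 0\<^sub>v n \<and> f \<noteq> 0\<^sub>v n \<and> f \<bullet> v = 0 \<and>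
      A = 1\<^sub>m n + outer_prod v f)"
proof
  assume A: "A \<in> transvections n"
  then have c: "A \<in> carrier_mat n n" "A \<in> carrier (SL n)" and r: "vec_space.rank n (A - 1\<^sub>m n) = 1"
    and sq: "(A - 1\<^sub>m n) * (A - 1\<^sub>m n) = 0\<^sub>m n n"
    by (auto simp: transvections_def SL_carrier_iff)
  obtain v f where vf: "v \<in> carrier_vec n" "f \<in> carrier_vec n" "A - 1\<^sub>m n = outer_prod v f"
    using rank_eq_1_imp_outer_prod[OF minus_carrier_mat[OF one_carrier_mat] r] c by blast
  have nz: "outer_prod v f \<noteq> 0\<^sub>m n n"
    using r vec_space.rank_0I[of n n, where 'a='a] unfolding vf(3) by auto
  have v: "v \<noteq> 0\<^sub>v n" "f \<noteq> 0\<^sub>v n" using nz vf by auto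
  have z: "(f \<bullet> v) \<cdot>\<^sub>m outer_prod v f = 0\<^sub>m n n"
    using sq unfolding vf(3) outer_prod_mult_outer_prod[OF vf(2,1)] .
  obtain i where i: "i < n" "v $ i \<noteq> 0" using vf(1) v(1) by (rule vec_neq_zeroE)
  obtain j where j: "j < n" "f $ j \<noteq> 0" using vf(2) v(2) by (rule vec_neq_zeroE)
  have "(f \<bullet> v) * (v $ i * f $ j) = 0"
    using arg_cong[OF z, of "\<lambda>M. M $$ (i, j)"] vf(1,2) i j by simp
  then have "f \<bullet> v = 0" using i j by simp
  moreover have "A = 1\<^sub>m n + outer_prod v f" unfolding vf(3)[symmetric] using c by auto
  ultimately show "A \<in> carrier (SL n) \<and>
    (\<exists>v f. v \<in> carrier_vec n \<and> f \<in> carrier_vec n \<and> v \<noteq> 0\<^sub>v n \<and> f \<noteq> 0\<^sub>v n \<and> f \<bullet> v = 0 \<and>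
      A = 1\<^sub>m n + outer_prod v f)" using c vf v by blast
next
  assume "A \<in> carrier (SL n) \<and>
    (\<exists>v f. v \<in> carrier_vec n \<and> f \<in> carrier_vec n \<and> v \<noteq> 0\<^sub>v n \<and> f \<noteq> 0\<^sub>v n \<and> f \<bullet> v = 0 \<and>
      A = 1\<^sub>m n + outer_prod v f)"
  then obtain v f where vf: "A \<in> carrier (SL n)" "v \<in> carrier_vec n" "f \<in> carrier_vec n"
    "v \<noteq> 0\<^sub>v n" "f \<noteq> 0\<^sub>v n" "f \<bullet> v = 0" "A = 1\<^sub>m n + outer_prod v f" by blast
  have eq: "A - 1\<^sub>m n = outer_prod v f" unfolding vf(7) using vf(2,3) by auto
  have "outer_prod v f * outer_prod v f = 0\<^sub>m n n"
    using vf by (simp add: outer_prod_mult_outer_prod[of _ n])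
  then show "A \<in> transvections n"
    using vf(1) rank_outer_prod[OF vf(2,4,3,5)] by (simp add: transvections_def eq)
qed

lemma card_image_mult_card_kernel:
  fixes N :: "'a::{field,finite} mat"
  assumes N: "N \<in> carrier_mat n n"
  shows "card ((\<lambda>v. N *\<^sub>v v) ` carrier_vec n) * card {v \<in> carrier_vec n. N *\<^sub>v v = 0\<^sub>v n} = CARD('a) ^ n"
proof -
  let ?V = "carrier_vec n :: 'a vec set" and ?K = "{v \<in> carrier_vec n. N *\<^sub>v v = 0\<^sub>v n}"
  have fib: "card {u \<in> ?V. N *\<^sub>v u = w} = card ?K" if w: "w \<in> (\<lambda>v. N *\<^sub>v v) ` ?V" for w
  proof -
    obtain v where v: "v \<in> ?V" "w = N *\<^sub>v v" using w by blast
    have "bij_betw (\<lambda>u. v + u) ?K {u \<in> ?V. N *\<^sub>v u = w}"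
    proof (rule bij_betw_byWitness[where f' = "\<lambda>u. u - v"])
      show "\<forall>a\<in>?K. v + a - v = a" using v by (auto intro!: eq_vecI)
      show "\<forall>a'\<in>{u \<in> ?V. N *\<^sub>v u = w}. v + (a' - v) = a'" using v by (auto intro!: eq_vecI)
      show "(\<lambda>u. v + u) ` ?K \<subseteq> {u \<in> ?V. N *\<^sub>v u = w}"
        using v N by (auto simp: mult_add_distrib_mat_vec[of N n n] right_zero_vec[of _ n])
      show "(\<lambda>u. u - v) ` {u \<in> ?V. N *\<^sub>v u = w} \<subseteq> ?K"
        using v N by (auto simp: mult_minus_distrib_mat_vec[of N n n] minus_cancel_vec[of _ n])
    qed
    then show ?thesis by (simp add: bij_betw_same_card)
  qed
  have "card ?V = (\<Sum>w\<in>(\<lambda>v. N *\<^sub>v v) ` ?V. card {u \<in> ?V. N *\<^sub>v u = w})"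
    using sum.image_gen[OF finite_carrier_vec, of "\<lambda>_. 1::nat" n "\<lambda>v. N *\<^sub>v v"] by simp
  also have "\<dots> = (\<Sum>w\<in>(\<lambda>v. N *\<^sub>v v) ` ?V. card ?K)" by (rule sum.cong) (simp_all only: fib)
  finally show ?thesis by (simp add: card_carrier_vec)
qed

text \<open>
  An image with fewer than \<open>q\<^sup>2\<close> elements contains no two independent vectors.
\<close>

lemma outer_prod_if_small_image:
  fixes N :: "'a::{field,finite} mat"
  assumes N: "N \<in> carrier_mat n n" and small: "card ((\<lambda>v. N *\<^sub>v v) ` carrier_vec n) < CARD('a)\<^sup>2"
  shows "\<exists>v\<in>carrier_vec n. \<exists>f\<in>carrier_vec n. N = outer_prod v f"
proof (cases "\<exists>j<n. col N j \<noteq> 0\<^sub>v n")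
  case False
  then have "N = 0\<^sub>m n n" using N by (intro mat_col_eqI) auto
  then show ?thesis by (intro bexI[of _ "0\<^sub>v n"]) auto
next
  case True
  then obtain k where k: "k < n" "col N k \<noteq> 0\<^sub>v n" by blast
  have kc: "col N k \<in> carrier_vec n" using k N by simp
  have "\<exists>a. col N j = a \<cdot>\<^sub>v col N k" if j: "j < n" for j
  proof (rule ccontr)
    assume no: "\<nexists>a. col N j = a \<cdot>\<^sub>v col N k"
    have jc: "col N j \<in> carrier_vec n" using j N by simp
    let ?h = "\<lambda>(a, b). a \<cdot>\<^sub>v col N k + b \<cdot>\<^sub>v col N j"
    have inj: "inj_on ?h (UNIV :: ('a \<times> 'a) set)"
    proof (rule inj_onI, clarify)
      fix a b a' b' assume eq: "a \<cdot>\<^sub>v col N k + b \<cdot>\<^sub>v col N j = a' \<cdot>\<^sub>v col N k + b' \<cdot>\<^sub>v col N j"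
      have "(a - a') \<cdot>\<^sub>v col N k + (b - b') \<cdot>\<^sub>v col N j = 0\<^sub>v n"
      proof (rule eq_vecI)
        fix i assume i: "i < dim_vec (0\<^sub>v n :: 'a vec)"
        show "((a - a') \<cdot>\<^sub>v col N k + (b - b') \<cdot>\<^sub>v col N j) $ i = 0\<^sub>v n $ i"
          using arg_cong[OF eq, of "\<lambda>v. v $ i"] i N by (simp add: algebra_simps)
      qed (use N in simp)
      then show "a = a' \<and> b = b'" using lin_comb_0_imp_multiple[OF kc jc k(2)] no
        by (metis right_minus_eq)
    qed
    have sub: "?h ` UNIV \<subseteq> (\<lambda>v. N *\<^sub>v v) ` carrier_vec n"
    proof clarify
      fix a b
      have "N *\<^sub>v (a \<cdot>\<^sub>v unit_vec n k + b \<cdot>\<^sub>v unit_vec n j) = a \<cdot>\<^sub>v col N k + b \<cdot>\<^sub>v col N j"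
        using N k j by (simp add: mult_add_distrib_mat_vec[of N n n] mult_mat_vec[of N n n] mat_mult_unit_vec[OF N])
      then show "a \<cdot>\<^sub>v col N k + b \<cdot>\<^sub>v col N j \<in> (\<lambda>v. N *\<^sub>v v) ` carrier_vec n"
        by (intro image_eqI[of _ _ "a \<cdot>\<^sub>v unit_vec n k + b \<cdot>\<^sub>v unit_vec n j"]) auto
    qed
    have "card (?h ` UNIV) = CARD('a)\<^sup>2" using inj by (simp add: card_image card_prod power2_eq_square)
    moreover have "card (?h ` UNIV) \<le> card ((\<lambda>v. N *\<^sub>v v) ` carrier_vec n)"
      using sub by (intro card_mono finite_imageI finite_carrier_vec)
    ultimately show False using small by simp
  qed
  then show ?thesis using outer_prodI[OF N kc] kc by blast
qed

lemma nilpotent_outer_prod_square: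
  fixes v f :: "'a::field vec"
  assumes v: "v \<in> carrier_vec n" and f: "f \<in> carrier_vec n"
    and nil: "outer_prod v f ^\<^sub>m k = 0\<^sub>m n n"
  shows "outer_prod v f * outer_prod v f = 0\<^sub>m n n"
proof (cases "v = 0\<^sub>v n \<or> f = 0\<^sub>v n")
  case True
  then show ?thesis using v f by auto
next
  case False
  let ?N = "outer_prod v f"
  have pow: "?N ^\<^sub>m Suc j = (f \<bullet> v) ^ j \<cdot>\<^sub>m ?N" for j
  proof (induction j)
    case 0
    then show ?case using v f by simp
  next
    case (Suc j)
    have "?N ^\<^sub>m Suc (Suc j) = ((f \<bullet> v) ^ j \<cdot>\<^sub>m ?N) * ?N" unfolding Suc[symmetric] by simp
    also have "\<dots> = (f \<bullet> v) ^ j \<cdot>\<^sub>m (?N * ?N)" using v f by (intro mult_smult_assoc_mat[of _ n n _ n]) auto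
    also have "\<dots> = (f \<bullet> v) ^ Suc j \<cdot>\<^sub>m ?N"
      unfolding outer_prod_mult_outer_prod[OF f v] by (auto simp: mult_ac)
    finally show ?case .
  qed
  have "?N ^\<^sub>m Suc k = 0\<^sub>m n n" using nil v f by simp
  then have z: "(f \<bullet> v) ^ k \<cdot>\<^sub>m ?N = 0\<^sub>m n n" unfolding pow .
  obtain i where i: "i < n" "v $ i \<noteq> 0" using v False vec_neq_zeroE by metis
  obtain j where j: "j < n" "f $ j \<noteq> 0" using f False vec_neq_zeroE by metis
  have "(f \<bullet> v) ^ k * (v $ i * f $ j) = 0"
    using arg_cong[OF z, of "\<lambda>M. M $$ (i, j)"] i j v f by simp
  then have "f \<bullet> v = 0" using i j by simp
  then show ?thesis unfolding outer_prod_mult_outer_prod[OF f v] using v f by simp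
qed

text \<open>
  If \<open>N\<^sup>n\<^sup>-\<^sup>1 \<noteq> 0\<close> then \<open>N\<close> is a single Jordan block, and \<open>N\<^sup>n\<^sup>-\<^sup>1\<close> has a kernel of codimension
  one: it contains the \<open>n - 1\<close> independent vectors \<open>N v, \<dots>, N\<^sup>n\<^sup>-\<^sup>1 v\<close>.
\<close>

lemma nilpotent_power_outer_prod:
  fixes N :: "'a::{field,finite} mat"
  assumes N: "N \<in> carrier_mat n n" and nil: "N ^\<^sub>m n = 0\<^sub>m n n" and n: "n > 0"
  shows "\<exists>v\<in>carrier_vec n. \<exists>f\<in>carrier_vec n. N ^\<^sub>m (n - 1) = outer_prod v f"
proof (cases "\<exists>v\<in>carrier_vec n. N ^\<^sub>m (n - 1) *\<^sub>v v \<noteq> 0\<^sub>v n")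
  case False
  have "N ^\<^sub>m (n - 1) = 0\<^sub>m n n"
    by (rule mat_eq_on_vecI[of _ n n]) (use False N in \<open>auto simp: zero_mat_mult_vec\<close>)
  then show ?thesis by (intro bexI[of _ "0\<^sub>v n"]) auto
next
  case True
  then obtain v where v: "v \<in> carrier_vec n" "N ^\<^sub>m (n - 1) *\<^sub>v v \<noteq> 0\<^sub>v n" by blast
  define U :: "'a poly" where "U = [:0, 1:]"
  have U: "mat_poly n N (U ^ k) = N ^\<^sub>m k" for k unfolding U_def by (rule mat_poly_X_power[OF N])
  have U1: "mat_poly n N U = N" unfolding U_def by (rule mat_poly_X[OF N])
  have pU: "prime_elem U" unfolding U_def
    by (rule field_poly_irreducible_imp_prime, rule irreducible_linear_field_poly) simp
  define u where "u = N ^\<^sub>m (n - 1) *\<^sub>v v"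
  have u: "u \<in> carrier_vec n" "u \<noteq> 0\<^sub>v n"
    using v N mult_mat_vec_carrier[OF pow_carrier_mat[OF N] v(1)] by (auto simp: u_def)
  have "N *\<^sub>v u = mat_poly n N (U * U ^ (n - 1)) *\<^sub>v v"
    unfolding mat_poly_mult_vec[OF N v(1)] U U1 u_def ..
  also have "U * U ^ (n - 1) = U ^ n" using n by (cases n) simp_all
  finally have Nu: "mat_poly n N U *\<^sub>v u = 0\<^sub>v n"
    unfolding U U1 nil using v by (simp add: zero_mat_mult_vec)
  have big: "U ^ i dvd h" if "i \<le> n" "mat_poly n N h *\<^sub>v v = 0\<^sub>v n" for i h
    using that
  proof (induction i)
    case 0
    then show ?case by simp
  next
    case (Suc i)
    from Suc.IH[OF Suc_leD[OF Suc.prems(1)] Suc.prems(2)]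
    obtain k where k: "h = U ^ i * k" by (elim dvdE)
    have e: "U ^ (n - 1 - i) * h = k * U ^ (n - 1)"
      unfolding k using Suc.prems(1) by (simp add: mult_ac flip: power_add)
    have "mat_poly n N (U ^ (n - 1 - i) * h) *\<^sub>v v = 0\<^sub>v n"
      by (rule mat_poly_kernel_dvd[OF N v(1) _ Suc.prems(2)]) (rule dvd_triv_right)
    then have "mat_poly n N k *\<^sub>v u = 0\<^sub>v n"
      unfolding e mat_poly_mult_vec[OF N v(1)] U u_def .
    then have "U dvd k" by (rule mat_poly_prime_kernel[OF N u pU Nu])
    then show ?case unfolding k power_Suc2 by (rule mult_dvd_mono[OF dvd_refl])
  qed
  define w where "w = N *\<^sub>v v"
  have w: "w \<in> carrier_vec n" using N v(1) unfolding w_def by simp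
  have orb: "card ((\<lambda>g. mat_poly n N g *\<^sub>v w) ` {g. g = 0 \<or> degree g < n - 1}) = CARD('a) ^ (n - 1)"
  proof (rule card_orbit[OF N w])
    fix g :: "'a poly" assume g: "g \<noteq> 0" "degree g < n - 1"
    show "mat_poly n N g *\<^sub>v w \<noteq> 0\<^sub>v n"
    proof
      assume "mat_poly n N g *\<^sub>v w = 0\<^sub>v n"
      then have "mat_poly n N (g * U) *\<^sub>v v = 0\<^sub>v n"
        unfolding mat_poly_mult_vec[OF N v(1)] U1 w_def .
      then have "U ^ n dvd g * U" by (rule big[OF order_refl])
      moreover have "g * U \<noteq> 0" using g by (simp add: U_def)
      ultimately have "degree (U ^ n) \<le> degree (g * U)" by (rule dvd_imp_degree_le)
      moreover have "degree (U ^ n) = n" by (simp add: U_def degree_power_eq)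
      moreover have "degree (g * U) = degree g + 1" using g by (simp add: U_def degree_mult_eq)
      ultimately show False using g(2) by simp
    qed
  qed
  have sub: "(\<lambda>g. mat_poly n N g *\<^sub>v w) ` {g. g = 0 \<or> degree g < n - 1} \<subseteq>
      {v \<in> carrier_vec n. N ^\<^sub>m (n - 1) *\<^sub>v v = 0\<^sub>v n}"
  proof clarify
    fix g :: "'a poly"
    have "N ^\<^sub>m (n - 1) *\<^sub>v (mat_poly n N g *\<^sub>v w) = mat_poly n N (U ^ (n - 1) * (g * U)) *\<^sub>v v"
      unfolding mat_poly_mult_vec[OF N v(1)] U U1 w_def ..
    also have "U ^ (n - 1) * (g * U) = g * U ^ n"
      using n by (cases n) (simp_all add: mult_ac)
    also have "mat_poly n N (g * U ^ n) *\<^sub>v v = 0\<^sub>v n"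
      unfolding mat_poly_mult_vec[OF N v(1)] U nil
      using v mult_mat_zero_vec[OF mat_poly_carrier[OF N]] by (simp add: zero_mat_mult_vec)
    finally show "mat_poly n N g *\<^sub>v w \<in> carrier_vec n \<and> N ^\<^sub>m (n - 1) *\<^sub>v (mat_poly n N g *\<^sub>v w) = 0\<^sub>v n"
      using N w by simp
  qed
  have fin: "finite {v \<in> carrier_vec n. N ^\<^sub>m (n - 1) *\<^sub>v v = 0\<^sub>v n}"
    by (rule finite_subset[OF _ finite_carrier_vec[of n]]) simp
  have ker: "CARD('a) ^ (n - 1) \<le> card {v \<in> carrier_vec n. N ^\<^sub>m (n - 1) *\<^sub>v v = 0\<^sub>v n}"
    using card_mono[OF fin sub] unfolding orb .
  have "card ((\<lambda>v. N ^\<^sub>m (n - 1) *\<^sub>v v) ` carrier_vec n) \<le> CARD('a)"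
  proof (rule ccontr)
    assume "\<not> ?thesis"
    then have "CARD('a) * CARD('a) ^ (n - 1) < card ((\<lambda>v. N ^\<^sub>m (n - 1) *\<^sub>v v) ` carrier_vec n) *
        card {v \<in> carrier_vec n. N ^\<^sub>m (n - 1) *\<^sub>v v = 0\<^sub>v n}"
      using ker card_gt_1[where 'a='a] by (intro mult_less_le_imp_less) auto
    then show False
      using card_image_mult_card_kernel[OF pow_carrier_mat[OF N]] n by (cases n) auto
  qed
  also have "CARD('a) < CARD('a)\<^sup>2" using card_gt_1[where 'a='a] by (simp add: power2_eq_square)
  finally show ?thesis by (rule outer_prod_if_small_image[OF pow_carrier_mat[OF N]])
qed

section \<open>Kernels of irreducible polynomials at a matrix\<close>

lemma smult_zero_vec [simp]: "a \<cdot>\<^sub>v 0\<^sub>v n = (0\<^sub>v n :: 'a::mult_zero vec)"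
  by (intro eq_vecI) simp_all

lemma card_prime_orbit:
  fixes A :: "'a::{field,finite} mat"
  assumes A: "A \<in> carrier_mat n n" and v: "v \<in> carrier_vec n" "v \<noteq> 0\<^sub>v n"
    and f: "prime_elem f" "mat_poly n A f *\<^sub>v v = 0\<^sub>v n"
  shows "card ((\<lambda>g. mat_poly n A g *\<^sub>v v) ` {g. g = 0 \<or> degree g < degree f}) = CARD('a) ^ degree f"
proof (rule card_orbit[OF A v(1)])
  fix g :: "'a poly" assume g: "g \<noteq> 0" "degree g < degree f"
  show "mat_poly n A g *\<^sub>v v \<noteq> 0\<^sub>v n"
  proof
    assume "mat_poly n A g *\<^sub>v v = 0\<^sub>v n"
    then have "f dvd g" by (rule mat_poly_prime_kernel[OF A v f])
    then show False using dvd_imp_degree_le[OF _ g(1)] g(2) by fastforce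
  qed
qed

lemma degree_prime_le_dim:
  fixes A :: "'a::{field,finite} mat"
  assumes A: "A \<in> carrier_mat n n" and v: "v \<in> carrier_vec n" "v \<noteq> 0\<^sub>v n"
    and f: "prime_elem f" "mat_poly n A f *\<^sub>v v = 0\<^sub>v n"
  shows "degree f \<le> n"
proof -
  have "card ((\<lambda>g. mat_poly n A g *\<^sub>v v) ` {g. g = 0 \<or> degree g < degree f}) \<le>
      card (carrier_vec n :: 'a vec set)"
    using A v by (intro card_mono finite_carrier_vec subsetI) (elim imageE, simp only: mat_poly_vec_carrier)
  then have "CARD('a) ^ degree f \<le> CARD('a) ^ n"
    unfolding card_prime_orbit[OF A v f] card_carrier_vec .
  then show ?thesis using card_gt_1[where 'a='a] by simp
qed

lemma degree_prime_poly_pos: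
  fixes f :: "'a::field poly"
  assumes "prime_elem f"
  shows "degree f > 0"
  using prime_elem_not_unit[OF assms] prime_elem_not_zeroI[OF assms] is_unit_iff_degree[of f] assms
  by (metis gr0I prime_elem_def)

lemma prime_kernel_not_dvd_X:
  fixes A :: "'a::field mat"
  assumes A: "A \<in> carrier_mat n n" and v: "v \<in> carrier_vec n" "v \<noteq> 0\<^sub>v n" and det: "det A \<noteq> 0"
    and f: "mat_poly n A f *\<^sub>v v = 0\<^sub>v n"
  shows "\<not> f dvd [:0, 1:]"
proof
  assume "f dvd [:0, 1:]"
  from mat_poly_kernel_dvd[OF A v(1) this f] have "A *\<^sub>v v = 0\<^sub>v n" unfolding mat_poly_X[OF A] .
  then show False using det_0_iff_vec_prod_zero_field[OF A] det v by blast
qed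

lemma X_power_minus_1_dvd:
  assumes "a dvd b"
  shows "(y::'a::comm_ring_1) ^ a - 1 dvd y ^ b - 1"
proof -
  obtain c where c: "b = a * c" using assms by (elim dvdE)
  have "y ^ b - 1 = (y ^ a - 1) * (\<Sum>i<c. (y ^ a) ^ i)"
    unfolding c power_mult by (rule power_diff_1_eq)
  then show ?thesis by (simp only: dvd_triv_left)
qed

lemma prime_kernel_dvd_X_power_minus_1:
  fixes A :: "'a::{field,finite} mat"
  assumes A: "A \<in> carrier_mat n n" and v: "v \<in> carrier_vec n" "v \<noteq> 0\<^sub>v n" and det: "det A \<noteq> 0"
    and f: "prime_elem f" "mat_poly n A f *\<^sub>v v = 0\<^sub>v n"
    and e: "CARD('a) ^ degree f - 1 dvd e"
  shows "f dvd [:0, 1:] ^ e - 1"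
  by (rule dvd_trans[OF prime_poly_dvd_X_power_minus_1[OF f(1) prime_kernel_not_dvd_X[OF A v det f(2)]]
        X_power_minus_1_dvd[OF e]])

text \<open>
  The irreducible polynomials with a nontrivial kernel at an invertible \<open>A\<close> have degree at most
  \<open>n\<close> and are not multiples of \<open>X\<close>, so all of them divide \<open>X\<^sup>M - 1\<close>.
\<close>

lemma power_minus_1_nilpotent:
  fixes A :: "'a::{field,finite} mat"
  assumes A: "A \<in> carrier_mat n n" and det: "det A \<noteq> 0"
    and M: "\<And>d. 1 \<le> d \<Longrightarrow> d \<le> n \<Longrightarrow> CARD('a) ^ d - 1 dvd M"
  shows "(A ^\<^sub>m M - 1\<^sub>m n) ^\<^sub>m n = 0\<^sub>m n n"
proof -
  have "mat_poly n A (([:0, 1:] ^ M - 1) ^ n) = 0\<^sub>m n n"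
  proof (rule mat_poly_power_eq_0[OF A])
    fix f v assume f: "prime_elem f" "mat_poly n A f *\<^sub>v v = 0\<^sub>v n" and v: "v \<in> carrier_vec n" "v \<noteq> 0\<^sub>v n"
    have "CARD('a) ^ degree f - 1 dvd M"
      using degree_prime_poly_pos[OF f(1)] degree_prime_le_dim[OF A v f] by (intro M) simp_all
    then show "f dvd [:0, 1:] ^ M - 1" by (rule prime_kernel_dvd_X_power_minus_1[OF A v det f])
  qed
  then show ?thesis by (simp add: mat_poly_power[OF A] mat_poly_diff[OF A] mat_poly_X[OF A] mat_poly_1[OF A])
qed

lemma X_power_minus_const_CHAR_power:
  fixes c :: "'a::{field,finite}"
  shows "([:0, 1:] ^ e - [:c:]) ^ (CHAR('a) ^ k) = [:0, 1:] ^ (e * CHAR('a) ^ k) - [:c ^ CHAR('a) ^ k:]"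
proof -
  have p: "prime CHAR('a poly)" using prime_CHAR_finite_field[where 'a='a] by simp
  have P: "CHAR('a) ^ k = CHAR('a poly) ^ k" by simp
  have "([:0, 1:] ^ e - [:c:] + [:c:]) ^ (CHAR('a) ^ k) =
      ([:0, 1:] ^ e - [:c:]) ^ (CHAR('a) ^ k) + [:c:] ^ (CHAR('a) ^ k)"
    by (rule freshmans_dream'[OF p P])
  then show ?thesis by (simp add: power_mult poly_const_pow algebra_simps)
qed

text \<open>
  If \<open>X\<^sup>e - c\<close> is nilpotent at \<open>A\<close>, then raising it to a large power of the characteristic kills
  it, and by the binomial theorem in characteristic \<open>p\<close> this power is again of the form
  \<open>X\<^sup>e\<^sup>' - c'\<close>.
\<close>

lemma scalar_power_if_prime_kernels_dvd:
  fixes A :: "'a::{field,finite} mat"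
  assumes A: "A \<in> carrier_mat n n" and k: "n \<le> CHAR('a) ^ k"
    and dvd: "\<And>f v. prime_elem f \<Longrightarrow> v \<in> carrier_vec n \<Longrightarrow> v \<noteq> 0\<^sub>v n \<Longrightarrow>
      mat_poly n A f *\<^sub>v v = 0\<^sub>v n \<Longrightarrow> f dvd [:0, 1:] ^ e - [:c:]"
  shows "A ^\<^sub>m (e * CHAR('a) ^ k) = c ^ CHAR('a) ^ k \<cdot>\<^sub>m 1\<^sub>m n"
proof -
  let ?h = "[:0, 1:] ^ e - [:c:]"
  have z: "mat_poly n A (?h ^ n) = 0\<^sub>m n n" by (rule mat_poly_power_eq_0[OF A dvd])
  have "?h ^ (CHAR('a) ^ k) = ?h ^ (CHAR('a) ^ k - n) * ?h ^ n" using k by (simp flip: power_add)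
  then have "mat_poly n A (?h ^ (CHAR('a) ^ k)) = 0\<^sub>m n n"
    using mat_poly_carrier[OF A] by (simp add: mat_poly_mult[OF A] z right_mult_zero_mat[of _ n n])
  then have z: "A ^\<^sub>m (e * CHAR('a) ^ k) - c ^ CHAR('a) ^ k \<cdot>\<^sub>m 1\<^sub>m n = 0\<^sub>m n n"
    unfolding X_power_minus_const_CHAR_power
    by (simp add: mat_poly_diff[OF A] mat_poly_X_power[OF A] mat_poly_const[OF A])
  show ?thesis
  proof (rule eq_matI)
    fix i j assume ij: "i < dim_row (c ^ CHAR('a) ^ k \<cdot>\<^sub>m 1\<^sub>m n)" "j < dim_col (c ^ CHAR('a) ^ k \<cdot>\<^sub>m 1\<^sub>m n)"
    show "(A ^\<^sub>m (e * CHAR('a) ^ k)) $$ (i, j) = (c ^ CHAR('a) ^ k \<cdot>\<^sub>m 1\<^sub>m n) $$ (i, j)"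
      using arg_cong[OF z, of "\<lambda>M. M $$ (i, j)"] ij A by simp
  qed (use A in simp_all)
qed

text \<open>
  Let \<open>d\<close> be the degree of \<open>f\<close> and \<open>W\<close> the cyclic subspace of \<open>u\<close>, of order \<open>q\<^sup>d\<close> and contained in
  the kernel of \<open>N\<close>. A further vector \<open>w\<close> in the kernel outside \<open>W\<close> leaves fewer than \<open>q\<^sup>2\<close>
  elements for the image. Otherwise a vector \<open>w \<in> W\<close> lies in the image, the image contains its
  cyclic subspace, and image and kernel both have at least \<open>q\<^sup>d\<close> elements; this forces
  \<open>2 d = n = 4\<close> and equality of image and kernel with cyclic subspaces that \<open>f\<close> kills.
\<close>

lemma large_prime_kernel:
  fixes A :: "'a::{field,finite} mat"
  assumes A: "A \<in> carrier_mat n n" and N: "N = mat_poly n A h" and nil: "N ^\<^sub>m n = 0\<^sub>m n n"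
    and f: "prime_elem f" "f dvd h" and u: "u \<in> carrier_vec n" "u \<noteq> 0\<^sub>v n" "mat_poly n A f *\<^sub>v u = 0\<^sub>v n"
    and deg: "n \<le> degree f + 2" "2 \<le> degree f"
  shows "(\<exists>v\<in>carrier_vec n. \<exists>g\<in>carrier_vec n. N = outer_prod v g) \<or>
    n = 4 \<and> degree f = 2 \<and> mat_poly n A (f ^ 2) = 0\<^sub>m n n"
proof -
  let ?q = "CARD('a)" and ?d = "degree f"
  let ?V = "carrier_vec n :: 'a vec set"
  let ?Im = "(\<lambda>v. N *\<^sub>v v) ` ?V" and ?K = "{v \<in> ?V. N *\<^sub>v v = 0\<^sub>v n}"
  let ?P = "{g. g = 0 \<or> degree g < ?d}"
  let ?W = "\<lambda>v. (\<lambda>g. mat_poly n A g *\<^sub>v v) ` ?P"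
  have q: "?q > 1" by (rule card_gt_1)
  have Nc: "N \<in> carrier_mat n n" unfolding N using A by simp
  have N_vec: "N *\<^sub>v (mat_poly n A g *\<^sub>v v) = mat_poly n A g *\<^sub>v (N *\<^sub>v v)" if "v \<in> ?V" for g v
    unfolding N mat_poly_mult_vec[OF A that, symmetric] by (simp only: mult.commute)
  have fin: "finite ?Im" "finite ?K" using finite_subset[OF _ finite_carrier_vec[of n, where 'a='a]]
    by (auto intro!: finite_imageI finite_carrier_vec)
  have count: "card ?Im * card ?K = ?q ^ n" by (rule card_image_mult_card_kernel[OF Nc])
  have dn: "?d \<le> n" by (rule degree_prime_le_dim[OF A u(1,2) f(1) u(3)])
  have cW: "card (?W v) = ?q ^ ?d" if "v \<in> ?V" "v \<noteq> 0\<^sub>v n" "mat_poly n A f *\<^sub>v v = 0\<^sub>v n" for v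
    by (rule card_prime_orbit[OF A that(1,2) f(1) that(3)])
  have WK: "?W u \<subseteq> ?K"
  proof clarify
    fix g
    have "N *\<^sub>v u = 0\<^sub>v n" unfolding N by (rule mat_poly_kernel_dvd[OF A u(1) f(2) u(3)])
    then show "mat_poly n A g *\<^sub>v u \<in> ?V \<and> N *\<^sub>v (mat_poly n A g *\<^sub>v u) = 0\<^sub>v n"
      using A u(1) by (simp add: N_vec mult_mat_zero_vec[of _ n n])
  qed
  have Kge: "?q ^ ?d \<le> card ?K" using card_mono[OF fin(2) WK] cW[OF u] by simp
  show ?thesis
  proof (cases "N = 0\<^sub>m n n")
    case True
    then show ?thesis by (intro disjI1 bexI[of _ "0\<^sub>v n"]) auto
  next
    case False
    define k where "k = (LEAST k. N ^\<^sub>m k = 0\<^sub>m n n)"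
    have k: "N ^\<^sub>m k = 0\<^sub>m n n" unfolding k_def using nil by (rule LeastI)
    have k0: "N ^\<^sub>m j \<noteq> 0\<^sub>m n n" if "j < k" for j using that not_less_Least unfolding k_def by blast
    have "k \<noteq> 0"
    proof
      assume "k = 0"
      then have "1\<^sub>m n = (0\<^sub>m n n :: 'a mat)" using k Nc by simp
      then have "N = 0\<^sub>m n n" using Nc by (metis left_mult_one_mat left_mult_zero_mat)
      then show False using False by simp
    qed
    moreover have "k \<noteq> 1" using k False Nc by auto
    ultimately obtain j where j: "k = Suc (Suc j)" by (metis One_nat_def not0_implies_Suc)
    obtain v where v: "v \<in> ?V" "N ^\<^sub>m Suc j *\<^sub>v v \<noteq> 0\<^sub>v n"
    proof (rule ccontr)
      assume "\<not> thesis"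
      then have "N ^\<^sub>m Suc j = 0\<^sub>m n n"
        using that Nc by (intro mat_eq_on_vecI[of _ n n]) (auto simp: zero_mat_mult_vec simp del: pow_mat.simps)
      then show False using k0[of "Suc j"] j by simp
    qed
    (* The last nonzero vector of the chain v, N v, N^2 v, ...; it lies both in the kernel and in
       the image of N. *)
    define w where "w = N *\<^sub>v (N ^\<^sub>m j *\<^sub>v v)"
    have comm: "N ^\<^sub>m i * N = N * N ^\<^sub>m i" for i
      unfolding N mat_poly_power[OF A, symmetric] mat_poly_mult[OF A, symmetric] by (simp only: mult.commute)
    have cv: "N ^\<^sub>m i *\<^sub>v v \<in> ?V" for i
      using mult_mat_vec_carrier[OF pow_carrier_mat[OF Nc] v(1)] .
    have step: "N *\<^sub>v (N ^\<^sub>m i *\<^sub>v v) = N ^\<^sub>m Suc i *\<^sub>v v" for i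
      using Nc v(1) by (simp add: comm assoc_mult_mat_vec[of _ n n _ n])
    have w: "w \<in> ?V" "w \<noteq> 0\<^sub>v n" using cv[of "Suc j"] v(2) unfolding w_def step by auto
    have Nw: "N *\<^sub>v w = 0\<^sub>v n"
      unfolding w_def step using k v(1) unfolding j by (simp only: zero_mat_mult_vec)
    show ?thesis
    proof (cases "w \<in> ?W u")
      case False
      let ?h = "\<lambda>(g, a). mat_poly n A g *\<^sub>v u + a \<cdot>\<^sub>v w"
      have gu: "mat_poly n A g *\<^sub>v u \<in> ?V" for g using A u(1) by simp
      have inj: "inj_on ?h (?P \<times> (UNIV :: 'a set))"
      proof (rule inj_onI, clarify)
        fix g a g' a' assume g: "g = 0 \<or> degree g < ?d" "g' = 0 \<or> degree g' < ?d"
          and eq: "mat_poly n A g *\<^sub>v u + a \<cdot>\<^sub>v w = mat_poly n A g' *\<^sub>v u + a' \<cdot>\<^sub>v w"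
        have aa: "a = a'"
        proof (rule ccontr)
          assume ne: "a \<noteq> a'"
          define g'' where "g'' = smult (1 / (a' - a)) (g - g')"
          have "w = mat_poly n A g'' *\<^sub>v u"
          proof (rule eq_vecI)
            fix i assume "i < dim_vec (mat_poly n A g'' *\<^sub>v u)"
            then have i: "i < n" using A carrier_matD[OF mat_poly_carrier[OF A]] by simp
            have "(mat_poly n A g *\<^sub>v u) $ i + a * w $ i = (mat_poly n A g' *\<^sub>v u) $ i + a' * w $ i"
              using arg_cong[OF eq, of "\<lambda>v. v $ i"] i w(1) carrier_vecD[OF gu] by simp
            then have e: "(a' - a) * w $ i = (mat_poly n A g *\<^sub>v u) $ i - (mat_poly n A g' *\<^sub>v u) $ i"
              by (simp add: algebra_simps)
            have "mat_poly n A g'' *\<^sub>v u = 1 / (a' - a) \<cdot>\<^sub>v (mat_poly n A g *\<^sub>v u - mat_poly n A g' *\<^sub>v u)"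
              unfolding g''_def mat_poly_smult[OF A] mat_poly_diff[OF A]
              using A u(1) carrier_vecD[OF u(1)] carrier_matD[OF mat_poly_carrier[OF A]]
              by (intro eq_vecI) (auto simp: scalar_prod_def algebra_simps sum_subtractf sum_divide_distrib[symmetric] diff_divide_distrib simp flip: sum_distrib_left)
            then show "w $ i = (mat_poly n A g'' *\<^sub>v u) $ i"
              using e ne i carrier_vecD[OF gu] by (simp add: field_simps)
          qed (use w(1) carrier_vecD[OF gu] in simp)
          moreover have "g'' \<in> ?P"
            using g degree_diff_less[of g ?d g'] unfolding g''_def
            by (cases "g = 0"; cases "g' = 0") auto
          ultimately show False using False by blast
        qed
        have "mat_poly n A g *\<^sub>v u = mat_poly n A g' *\<^sub>v u"
        proof (rule eq_vecI)
          fix i assume "i < dim_vec (mat_poly n A g' *\<^sub>v u)"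
          then show "(mat_poly n A g *\<^sub>v u) $ i = (mat_poly n A g' *\<^sub>v u) $ i"
            using arg_cong[OF eq, of "\<lambda>v. v $ i"] w(1) aa carrier_vecD[OF gu] by simp
        qed (simp only: carrier_vecD[OF gu])
        moreover have "inj_on (\<lambda>g. mat_poly n A g *\<^sub>v u) ?P"
          using cW[OF u] by (intro eq_card_imp_inj_on card_poly_degree_less) (simp add: card_poly_degree_less)
        ultimately have "g = g'" using g by (auto dest: inj_onD)
        then show "g = g' \<and> a = a'" using aa by simp
      qed
      have "?h ` (?P \<times> UNIV) \<subseteq> ?K"
      proof clarify
        fix g a
        have "N *\<^sub>v (mat_poly n A g *\<^sub>v u) = 0\<^sub>v n" if "g \<in> ?P" using WK that by blast
        moreover assume "g = 0 \<or> degree g < ?d"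
        ultimately show "mat_poly n A g *\<^sub>v u + a \<cdot>\<^sub>v w \<in> ?V \<and> N *\<^sub>v (mat_poly n A g *\<^sub>v u + a \<cdot>\<^sub>v w) = 0\<^sub>v n"
          using gu w(1) Nw Nc by (simp add: mult_add_distrib_mat_vec[of N n n] mult_mat_vec[of N n n] smult_zero_vec)
      qed
      from card_mono[OF fin(2) this] have "?q ^ ?d * ?q \<le> card ?K"
        using card_image[OF inj] by (simp add: card_cartesian_product card_poly_degree_less)
      then have K: "?q ^ Suc ?d \<le> card ?K" by (simp add: mult.commute)
      have "card ?Im < ?q ^ 2"
      proof (rule ccontr)
        assume "\<not> ?thesis"
        then have "?q ^ 2 * ?q ^ Suc ?d \<le> ?q ^ n" unfolding count[symmetric] using K by (intro mult_le_mono) simp_all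
        then have "?q ^ (2 + Suc ?d) \<le> ?q ^ n" by (simp only: power_add)
        then have "2 + Suc ?d \<le> n" using q power_le_imp_le_exp by blast
        then show False using deg by simp
      qed
      then show ?thesis using outer_prod_if_small_image[OF Nc] by blast
    next
      case True
      then obtain g0 where g0: "w = mat_poly n A g0 *\<^sub>v u" by blast
      have fw: "mat_poly n A f *\<^sub>v w = 0\<^sub>v n"
        unfolding g0 mat_poly_mult_vec[OF A u(1), symmetric]
        by (rule mat_poly_kernel_dvd[OF A u(1) _ u(3)]) (rule dvd_triv_left)
      have WIm: "?W w \<subseteq> ?Im"
      proof clarify
        fix g
        have "mat_poly n A g *\<^sub>v w = N *\<^sub>v (mat_poly n A g *\<^sub>v (N ^\<^sub>m j *\<^sub>v v))"
          unfolding w_def N_vec[OF cv] ..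
        then show "mat_poly n A g *\<^sub>v w \<in> ?Im" using mat_poly_vec_carrier[OF A cv] by simp
      qed
      have Imge: "?q ^ ?d \<le> card ?Im" using card_mono[OF fin(1) WIm] cW[OF w fw] by simp
      have "?q ^ ?d * ?q ^ ?d \<le> ?q ^ n" unfolding count[symmetric] using Imge Kge by (rule mult_le_mono)
      then have "?q ^ (?d + ?d) \<le> ?q ^ n" by (simp only: power_add)
      then have "?d + ?d \<le> n" using q power_le_imp_le_exp by blast
      then have d: "?d = 2" "n = 4" using deg by simp_all
      have "card ?Im \<le> ?q ^ 2"
      proof (rule ccontr)
        assume "\<not> ?thesis"
        then have "?q ^ 2 * ?q ^ 2 < ?q ^ n" unfolding count[symmetric] using Kge q
          by (intro mult_less_le_imp_less) (simp_all add: d)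
        then show False unfolding d by (simp flip: power_add)
      qed
      then have Im: "card ?Im = ?q ^ 2" using Imge d by simp
      then have "?q ^ 2 * card ?K = ?q ^ 2 * ?q ^ 2" using count unfolding d by (simp flip: power_add)
      then have Kc: "card ?K = ?q ^ 2" using q mult_left_cancel[of "?q ^ 2" "card ?K" "?q ^ 2"] by simp
      have KW: "?W u = ?K" using cW[OF u] d Kc by (intro card_subset_eq[OF fin(2) WK]) simp
      have "?W w = ?Im" using cW[OF w fw] d Im by (intro card_subset_eq[OF fin(1) WIm]) simp
      have fN: "mat_poly n A f *\<^sub>v (N *\<^sub>v x) = 0\<^sub>v n" if x: "x \<in> ?V" for x
      proof -
        have "N *\<^sub>v x \<in> ?W w" unfolding \<open>?W w = ?Im\<close> using x by blast
        then obtain g where g: "N *\<^sub>v x = mat_poly n A g *\<^sub>v w" by blast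
        show ?thesis unfolding g mat_poly_mult_vec[OF A w(1), symmetric]
          by (rule mat_poly_kernel_dvd[OF A w(1) _ fw]) (rule dvd_triv_left)
      qed
      have "mat_poly n A (f ^ 2) = 0\<^sub>m n n"
      proof (rule mat_eq_on_vecI[of _ n n])
        fix x assume x: "x \<in> ?V"
        have "mat_poly n A f *\<^sub>v x \<in> ?K"
          using fN[OF x] N_vec[OF x] A x by simp
        then obtain g where g: "mat_poly n A f *\<^sub>v x = mat_poly n A g *\<^sub>v u" using KW by blast
        have "mat_poly n A f *\<^sub>v (mat_poly n A f *\<^sub>v x) = 0\<^sub>v n"
          unfolding g mat_poly_mult_vec[OF A u(1), symmetric]
          by (rule mat_poly_kernel_dvd[OF A u(1) _ u(3)]) (rule dvd_triv_left)
        then show "mat_poly n A (f ^ 2) *\<^sub>v x = 0\<^sub>m n n *\<^sub>v x"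
          using x by (simp only: power2_eq_square mat_poly_mult_vec[OF A x] zero_mat_mult_vec)
      qed (use A in simp_all)
      then show ?thesis using d by blast
    qed
  qed
qed

section \<open>Commutators of two transvections\<close>

definition transv :: "'a::comm_ring_1 vec \<Rightarrow> 'a vec \<Rightarrow> 'a mat" where
  "transv v f = 1\<^sub>m (dim_vec v) + outer_prod v f"

lemma transv_carrier [simp]:
  "v \<in> carrier_vec n \<Longrightarrow> f \<in> carrier_vec n \<Longrightarrow> transv v f \<in> carrier_mat n n"
  by (simp add: transv_def)

lemma transv_mult_vec:
  assumes "v \<in> carrier_vec n" "f \<in> carrier_vec n" "u \<in> carrier_vec n"
  shows "transv v f *\<^sub>v u = u + (f \<bullet> u) \<cdot>\<^sub>v v"
  using assms by (simp add: transv_def add_mult_distrib_mat_vec[of _ n n] outer_prod_mult_vec)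

lemma transv_0 [simp]:
  assumes "f \<in> carrier_vec n"
  shows "transv (0\<^sub>v n) f = 1\<^sub>m n"
  using assms by (simp add: transv_def)

lemmas mult_carrier_square = mult_carrier_mat[of _ n n _ n for n]
lemmas assoc_square_vec = assoc_mult_mat_vec[of _ n n _ n for n]

lemma transvection_power:
  fixes v :: "'a::comm_ring_1 vec"
  assumes v: "v \<in> carrier_vec n" and f: "f \<in> carrier_vec n" and fv: "f \<bullet> v = 0"
  shows "transv v f ^\<^sub>m k = transv (of_nat k \<cdot>\<^sub>v v) f"
proof (induction k)
  case 0
  have "(of_nat 0 \<cdot>\<^sub>v v) = 0\<^sub>v n" using v by (intro eq_vecI) simp_all
  then show ?case using v f by (simp add: transv_def)
next
  case (Suc k)
  have T: "transv v f \<in> carrier_mat n n" "transv (of_nat k \<cdot>\<^sub>v v) f \<in> carrier_mat n n"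
    "transv (of_nat (Suc k) \<cdot>\<^sub>v v) f \<in> carrier_mat n n"
    using v f by (simp_all del: of_nat_Suc)
  show ?case unfolding pow_mat.simps Suc
  proof (rule mat_eq_on_vecI[OF mult_carrier_square[OF T(2,1)] T(3)])
    fix u :: "'a vec" assume u: "u \<in> carrier_vec n"
    have "transv (of_nat k \<cdot>\<^sub>v v) f * transv v f *\<^sub>v u = u + (f \<bullet> u) \<cdot>\<^sub>v v + (f \<bullet> u) \<cdot>\<^sub>v (of_nat k \<cdot>\<^sub>v v)"
      unfolding assoc_square_vec[OF T(2,1) u]
      using v f u fv by (simp add: transv_mult_vec[of _ n] scalar_prod_add_distrib[of _ n])
    also have "\<dots> = transv (of_nat (Suc k) \<cdot>\<^sub>v v) f *\<^sub>v u"
      using v f u by (subst transv_mult_vec) (auto simp: algebra_simps intro!: eq_vecI)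
    finally show "transv (of_nat k \<cdot>\<^sub>v v) f * transv v f *\<^sub>v u = transv (of_nat (Suc k) \<cdot>\<^sub>v v) f *\<^sub>v u" .
  qed
qed

lemma transvection_inverse:
  fixes v :: "'a::comm_ring_1 vec"
  assumes v: "v \<in> carrier_vec n" and f: "f \<in> carrier_vec n" and fv: "f \<bullet> v = 0"
  shows "transv (- v) f * transv v f = 1\<^sub>m n"
proof -
  have T: "transv (- v) f \<in> carrier_mat n n" "transv v f \<in> carrier_mat n n" using v f by simp_all
  show ?thesis
  proof (rule mat_eq_on_vecI[OF mult_carrier_square[OF T] one_carrier_mat])
    fix u :: "'a vec" assume u: "u \<in> carrier_vec n"
    have "transv (- v) f * transv v f *\<^sub>v u = u + (f \<bullet> u) \<cdot>\<^sub>v v + (f \<bullet> u) \<cdot>\<^sub>v (- v)"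
      unfolding assoc_square_vec[OF T u]
      using v f u fv by (simp add: transv_mult_vec[of _ n] scalar_prod_add_distrib[of _ n])
    also have "\<dots> = 1\<^sub>m n *\<^sub>v u" using v u by (intro eq_vecI) simp_all
    finally show "transv (- v) f * transv v f *\<^sub>v u = 1\<^sub>m n *\<^sub>v u" .
  qed
qed

text \<open>
  With \<open>g \<bullet> v = 0\<close> the two transvections generate a Heisenberg group, whose commutators are
  central transvections.
\<close>

lemma transvection_commutator_heisenberg:
  fixes v :: "'a::comm_ring_1 vec"
  assumes v: "v \<in> carrier_vec n" and f: "f \<in> carrier_vec n" and fv: "f \<bullet> v = 0"
    and w: "w \<in> carrier_vec n" and g: "g \<in> carrier_vec n" and gw: "g \<bullet> w = 0" and gv: "g \<bullet> v = 0"
  shows "transv v f * transv w g * (transv (- v) f * transv (- w) g) = transv ((f \<bullet> w) \<cdot>\<^sub>v v) g"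
proof -
  define a b where "a = (\<lambda>u. f \<bullet> u)" and "b = (\<lambda>u. g \<bullet> u)"
  have m: "- v \<in> carrier_vec n" "- w \<in> carrier_vec n" using v w by simp_all
  have T: "transv v f \<in> carrier_mat n n" "transv w g \<in> carrier_mat n n"
    "transv (- v) f \<in> carrier_mat n n" "transv (- w) g \<in> carrier_mat n n"
    using v f w g by simp_all
  note TT = mult_carrier_square[OF T(1,2)] mult_carrier_square[OF T(3,4)]
  show ?thesis
  proof (rule mat_eq_on_vecI[OF mult_carrier_square[OF TT]])
    fix u :: "'a vec" assume u: "u \<in> carrier_vec n"
    have e1: "transv (- w) g *\<^sub>v u = u + b u \<cdot>\<^sub>v (- w)"
      using w g u by (simp add: transv_mult_vec[of _ n] b_def)
    have e2: "transv (- v) f *\<^sub>v (u + b u \<cdot>\<^sub>v (- w)) = u + b u \<cdot>\<^sub>v (- w) + (a u - b u * (f \<bullet> w)) \<cdot>\<^sub>v (- v)"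
      using v w f g u fv gw gv by (simp add: transv_mult_vec[of _ n] scalar_prod_add_distrib[of _ n] a_def b_def)
    have e3: "transv w g *\<^sub>v (u + b u \<cdot>\<^sub>v (- w) + (a u - b u * (f \<bullet> w)) \<cdot>\<^sub>v (- v)) = u + b u \<cdot>\<^sub>v (- w) + (a u - b u * (f \<bullet> w)) \<cdot>\<^sub>v (- v) + b u \<cdot>\<^sub>v w"
      using v w f g u fv gw gv by (simp add: transv_mult_vec[of _ n] scalar_prod_add_distrib[of _ n] a_def b_def)
    have e4: "transv v f *\<^sub>v (u + b u \<cdot>\<^sub>v (- w) + (a u - b u * (f \<bullet> w)) \<cdot>\<^sub>v (- v) + b u \<cdot>\<^sub>v w) = u + b u \<cdot>\<^sub>v (- w) + (a u - b u * (f \<bullet> w)) \<cdot>\<^sub>v (- v) + b u \<cdot>\<^sub>v w + a u \<cdot>\<^sub>v v"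
      using v w f g u fv gw gv by (simp add: transv_mult_vec[of _ n] scalar_prod_add_distrib[of _ n] a_def b_def)
    have e5: "u + b u \<cdot>\<^sub>v (- w) + (a u - b u * (f \<bullet> w)) \<cdot>\<^sub>v (- v) + b u \<cdot>\<^sub>v w + a u \<cdot>\<^sub>v v = transv ((f \<bullet> w) \<cdot>\<^sub>v v) g *\<^sub>v u"
      using v w f g u by (subst transv_mult_vec) (auto simp: algebra_simps a_def b_def intro!: eq_vecI)
    show "transv v f * transv w g * (transv (- v) f * transv (- w) g) *\<^sub>v u = transv ((f \<bullet> w) \<cdot>\<^sub>v v) g *\<^sub>v u"
      unfolding assoc_square_vec[OF TT u] assoc_square_vec[OF T(3,4) u] e1 e2
      by (subst assoc_square_vec[OF T(1,2)]) (use u v w in \<open>simp_all only: e3 e4 e5, simp_all\<close>)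
  qed (use v w f g in simp)
qed

lemma transvection_commutator_heisenberg':
  fixes v :: "'a::comm_ring_1 vec"
  assumes v: "v \<in> carrier_vec n" and f: "f \<in> carrier_vec n" and fv: "f \<bullet> v = 0"
    and w: "w \<in> carrier_vec n" and g: "g \<in> carrier_vec n" and gw: "g \<bullet> w = 0" and fw: "f \<bullet> w = 0"
  shows "transv v f * transv w g * (transv (- v) f * transv (- w) g) = transv ((- (g \<bullet> v)) \<cdot>\<^sub>v w) f"
proof -
  define a b where "a = (\<lambda>u. f \<bullet> u)" and "b = (\<lambda>u. g \<bullet> u)"
  have m: "- v \<in> carrier_vec n" "- w \<in> carrier_vec n" using v w by simp_all
  have T: "transv v f \<in> carrier_mat n n" "transv w g \<in> carrier_mat n n"
    "transv (- v) f \<in> carrier_mat n n" "transv (- w) g \<in> carrier_mat n n"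
    using v f w g by simp_all
  note TT = mult_carrier_square[OF T(1,2)] mult_carrier_square[OF T(3,4)]
  show ?thesis
  proof (rule mat_eq_on_vecI[OF mult_carrier_square[OF TT]])
    fix u :: "'a vec" assume u: "u \<in> carrier_vec n"
    have e1: "transv (- w) g *\<^sub>v u = u + b u \<cdot>\<^sub>v (- w)"
      using w g u by (simp add: transv_mult_vec[of _ n] b_def)
    have e2: "transv (- v) f *\<^sub>v (u + b u \<cdot>\<^sub>v (- w)) = u + b u \<cdot>\<^sub>v (- w) + a u \<cdot>\<^sub>v (- v)"
      using v w f g u fv gw fw by (simp add: transv_mult_vec[of _ n] scalar_prod_add_distrib[of _ n] a_def b_def)
    have e3: "transv w g *\<^sub>v (u + b u \<cdot>\<^sub>v (- w) + a u \<cdot>\<^sub>v (- v)) = u + b u \<cdot>\<^sub>v (- w) + a u \<cdot>\<^sub>v (- v) + (b u - a u * (g \<bullet> v)) \<cdot>\<^sub>v w"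
      using v w f g u fv gw fw by (simp add: transv_mult_vec[of _ n] scalar_prod_add_distrib[of _ n] a_def b_def)
    have e4: "transv v f *\<^sub>v (u + b u \<cdot>\<^sub>v (- w) + a u \<cdot>\<^sub>v (- v) + (b u - a u * (g \<bullet> v)) \<cdot>\<^sub>v w) = u + b u \<cdot>\<^sub>v (- w) + a u \<cdot>\<^sub>v (- v) + (b u - a u * (g \<bullet> v)) \<cdot>\<^sub>v w + a u \<cdot>\<^sub>v v"
      using v w f g u fv gw fw by (simp add: transv_mult_vec[of _ n] scalar_prod_add_distrib[of _ n] a_def b_def)
    have e5: "u + b u \<cdot>\<^sub>v (- w) + a u \<cdot>\<^sub>v (- v) + (b u - a u * (g \<bullet> v)) \<cdot>\<^sub>v w + a u \<cdot>\<^sub>v v = transv ((- (g \<bullet> v)) \<cdot>\<^sub>v w) f *\<^sub>v u"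
      using v w f g u by (subst transv_mult_vec) (auto simp: algebra_simps a_def b_def intro!: eq_vecI)
    show "transv v f * transv w g * (transv (- v) f * transv (- w) g) *\<^sub>v u = transv ((- (g \<bullet> v)) \<cdot>\<^sub>v w) f *\<^sub>v u"
      unfolding assoc_square_vec[OF TT u] assoc_square_vec[OF T(3,4) u] e1 e2
      by (subst assoc_square_vec[OF T(1,2)]) (use u v w in \<open>simp_all only: e3 e4 e5, simp_all\<close>)
  qed (use v w f g in simp)
qed

lemma mat_mult_assoc_dim:
  fixes A B C :: "'a::semiring_0 mat"
  assumes "dim_col A = dim_row B" "dim_col B = dim_row C"
  shows "A * B * C = A * (B * C)"
  using assms by (intro assoc_mult_mat[of A "dim_row A" "dim_row B" B "dim_row C" C "dim_col C"]) auto

lemma mat_distrib_dim: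
  fixes A B C :: "'a::semiring_0 mat"
  shows "dim_col A = dim_row B \<Longrightarrow> dim_row B = dim_row C \<Longrightarrow> dim_col B = dim_col C \<Longrightarrow> A * (B + C) = A * B + A * C"
    and "dim_col A = dim_row C \<Longrightarrow> dim_row A = dim_row B \<Longrightarrow> dim_col A = dim_col B \<Longrightarrow> (A + B) * C = A * C + B * C"
  by (rule mult_add_distrib_mat[of _ "dim_row A" "dim_row B" _ "dim_col B"], auto)
    (rule add_mult_distrib_mat[of _ "dim_row B" "dim_row C" _ _ "dim_col C"], auto)

lemma mat_add_assoc_dim:
  fixes A B C :: "'a::semiring_0 mat"
  assumes "dim_row B = dim_row C" "dim_col B = dim_col C"
    "dim_row A = dim_row B" "dim_col A = dim_col B"
  shows "A + B + C = A + (B + C)"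
  using assms by (intro assoc_add_mat[of A "dim_row A" "dim_col A"]) auto

lemmas mat_ring_simps = mat_mult_assoc_dim mat_distrib_dim mat_add_assoc_dim

text \<open>
  Both \<open>Z \<mapsto> 1 + B Z F\<close> and \<open>Z \<mapsto> 1 + Z (F B)\<close> turn the operation \<open>Z + Y + Z (F B) Y\<close> into
  multiplication. Products of matrices that differ from the identity by rank two are thus
  controlled by \<open>2 \<times> 2\<close> matrices.
\<close>

lemma one_plus_sandwich_mult:
  fixes B :: "'a::comm_ring_1 mat"
  assumes B: "B \<in> carrier_mat n m" and F: "F \<in> carrier_mat m n"
    and Z: "Z \<in> carrier_mat m m" and Y: "Y \<in> carrier_mat m m"
  shows "(1\<^sub>m n + B * Z * F) * (1\<^sub>m n + B * Y * F) = 1\<^sub>m n + B * (Z + Y + Z * (F * B) * Y) * F"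
    "(1\<^sub>m m + Z * (F * B)) * (1\<^sub>m m + Y * (F * B)) = 1\<^sub>m m + (Z + Y + Z * (F * B) * Y) * (F * B)"
proof -
  have d: "dim_row B = n" "dim_col B = m" "dim_row F = m" "dim_col F = n" "dim_row Z = m" "dim_col Z = m"
    "dim_row Y = m" "dim_col Y = m" using B F Z Y by auto
  show "(1\<^sub>m n + B * Z * F) * (1\<^sub>m n + B * Y * F) = 1\<^sub>m n + B * (Z + Y + Z * (F * B) * Y) * F"
    by (simp add: d mat_ring_simps comm_add_mat[of "B * (Y * F)" n n])
  show "(1\<^sub>m m + Z * (F * B)) * (1\<^sub>m m + Y * (F * B)) = 1\<^sub>m m + (Z + Y + Z * (F * B) * Y) * (F * B)"
    by (simp add: d mat_ring_simps comm_add_mat[of "Y * (F * B)" m m])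
qed

lemma det_2:
  fixes A :: "'a::comm_ring_1 mat"
  assumes A: "A \<in> carrier_mat 2 2"
  shows "det A = A $$ (0, 0) * A $$ (1, 1) - A $$ (0, 1) * A $$ (1, 0)"
proof -
  have "{..<2::nat} = {0, 1}" by auto
  then show ?thesis
    using laplace_expansion_column[OF A, of 0] A
    by (simp add: cofactor_def mat_delete_def det_single mult.commute)
qed

lemma sum_up_to_2: "(\<Sum>i = 0..<2::nat. h i) = h 0 + h (1::nat)"
  by (simp add: numeral_2_eq_2)

lemma square_zero_outer_prod:
  fixes p :: "'a::field vec"
  assumes p: "p \<in> carrier_vec n" and r: "r \<in> carrier_vec n"
    and sq: "outer_prod p r * outer_prod p r = 0\<^sub>m n n"
  shows "\<exists>p'\<in>carrier_vec n. outer_prod p r = outer_prod p' r \<and> r \<bullet> p' = 0"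
proof (cases "r \<bullet> p = 0")
  case False
  have z: "(r \<bullet> p) \<cdot>\<^sub>m outer_prod p r = 0\<^sub>m n n" using sq unfolding outer_prod_mult_outer_prod[OF r p] .
  have "outer_prod p r = 0\<^sub>m n n"
  proof (rule eq_matI)
    fix i j assume "i < dim_row (0\<^sub>m n n)" "j < dim_col (0\<^sub>m n n)"
    then show "outer_prod p r $$ (i, j) = 0\<^sub>m n n $$ (i, j)"
      using arg_cong[OF z, of "\<lambda>M. M $$ (i, j)"] False p r by simp
  qed (use p r in simp_all)
  then show ?thesis using r by (intro bexI[of _ "0\<^sub>v n"]) simp_all
qed (use p in blast)

text \<open>
  If \<open>g \<bullet> v\<close> or \<open>f \<bullet> w\<close> vanishes, the commutator itself is a transvection or trivial. Otherwise
  both transvections act on the plane spanned by \<open>v\<close> and \<open>w\<close> with determinant 1, and trivially on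
  its complement, the common kernel of \<open>f\<close> and \<open>g\<close>. The \<open>M\<close>-th power of a \<open>2 \<times> 2\<close> matrix of
  determinant 1 is unipotent, hence differs from the identity by rank at most one.
\<close>

lemma transvection_commutator_power:
  fixes v :: "'a::{field,finite} vec"
  assumes v: "v \<in> carrier_vec n" and f: "f \<in> carrier_vec n" and fv: "f \<bullet> v = 0"
    and w: "w \<in> carrier_vec n" and g: "g \<in> carrier_vec n" and gw: "g \<bullet> w = 0"
    and M: "\<And>d. 1 \<le> d \<Longrightarrow> d \<le> 2 \<Longrightarrow> CARD('a) ^ d - 1 dvd M"
  shows "\<exists>p\<in>carrier_vec n. \<exists>r\<in>carrier_vec n. r \<bullet> p = 0 \<and>
    (transv v f * transv w g * (transv (- v) f * transv (- w) g)) ^\<^sub>m M = transv p r"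
proof -
  let ?C = "transv v f * transv w g * (transv (- v) f * transv (- w) g)"
  consider "g \<bullet> v = 0" | "f \<bullet> w = 0" | "g \<bullet> v \<noteq> 0" "f \<bullet> w \<noteq> 0" by blast
  then show ?thesis
  proof cases
    case 1
    let ?p = "(f \<bullet> w) \<cdot>\<^sub>v v"
    have "g \<bullet> ?p = 0" "?p \<in> carrier_vec n" using v g 1 by simp_all
    then show ?thesis
      unfolding transvection_commutator_heisenberg[OF v f fv w g gw 1]
      using g by (subst transvection_power[of _ n]) (simp_all, intro bexI[of _ "of_nat M \<cdot>\<^sub>v ?p"] bexI[of _ g], simp_all)
  next
    case 2
    let ?p = "(- (g \<bullet> v)) \<cdot>\<^sub>v w"
    have "f \<bullet> ?p = 0" "?p \<in> carrier_vec n" using w f 2 by simp_all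
    then show ?thesis
      unfolding transvection_commutator_heisenberg'[OF v f fv w g gw 2]
      using f by (subst transvection_power[of _ n]) (simp_all, intro bexI[of _ "of_nat M \<cdot>\<^sub>v ?p"] bexI[of _ f], simp_all)
  next
    case 3
    define a b where "a = f \<bullet> w" and "b = g \<bullet> v"
    have ab: "a \<noteq> 0" "b \<noteq> 0" using 3 by (simp_all add: a_def b_def)
    (* The columns of B are v and w, the rows of F are f and g. The four factors of the commutator
       have the form 1 + B Z F, and G = F B is the invertible matrix with off-diagonal entries a
       and b. *)
    define B where "B = mat n 2 (\<lambda>(i, j). if j = 0 then v $ i else w $ i)"
    define F where "F = mat 2 n (\<lambda>(i, j). if i = 0 then f $ j else g $ j)"
    define G where "G = F * B"
    have B: "B \<in> carrier_mat n 2" and F: "F \<in> carrier_mat 2 n" by (simp_all add: B_def F_def)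
    have G: "G \<in> carrier_mat 2 2" using B F by (simp add: G_def)
    have G_idx: "G $$ (0, 0) = 0" "G $$ (0, 1) = a" "G $$ (1, 0) = b" "G $$ (1, 1) = 0"
      using v w f g fv gw by (simp_all add: G_def B_def F_def scalar_prod_def a_def b_def)
    define ph where "ph = (\<lambda>Z. 1\<^sub>m n + B * Z * F)"
    define ps where "ps = (\<lambda>Z. 1\<^sub>m 2 + Z * G)"
    define ast where "ast = (\<lambda>Z Y. Z + Y + Z * G * Y)"
    have ast: "ast Z Y \<in> carrier_mat 2 2" if "Z \<in> carrier_mat 2 2" "Y \<in> carrier_mat 2 2" for Z Y
      using that G by (simp add: ast_def)
    have hom: "ph Z * ph Y = ph (ast Z Y)" "ps Z * ps Y = ps (ast Z Y)"
      if "Z \<in> carrier_mat 2 2" "Y \<in> carrier_mat 2 2" for Z Y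
      using one_plus_sandwich_mult[OF B F that] by (simp_all add: ph_def ps_def ast_def G_def)
    define E where "E = (\<lambda>k c. mat 2 2 (\<lambda>(i, j). if i = k \<and> j = k then c else (0::'a)))"
    have E: "E k c \<in> carrier_mat 2 2" for k c by (simp add: E_def)
    have BEF: "B * E 0 c * F = outer_prod (c \<cdot>\<^sub>v v) f" "B * E 1 c * F = outer_prod (c \<cdot>\<^sub>v w) g" for c
      using v w f g
      by (auto simp: B_def F_def E_def scalar_prod_def sum_up_to_2 mult_ac intro!: eq_matI)
    have phE: "transv v f = ph (E 0 1)" "transv w g = ph (E 1 1)"
      "transv (- v) f = ph (E 0 (-1))" "transv (- w) g = ph (E 1 (-1))"
      using v w f g unfolding ph_def BEF transv_def
      by (auto intro!: eq_matI)
    have psE: "ps (E k c) \<in> carrier_mat 2 2" for k c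
      unfolding ps_def using mult_carrier_mat[OF E G] by simp
    have det_E: "det (ps (E 0 c)) = 1" "det (ps (E 1 c)) = 1" for c
      unfolding det_2[OF psE] using G G_idx
      by (simp_all add: ps_def E_def scalar_prod_def sum_up_to_2)
    define Z1 where "Z1 = ast (ast (E 0 1) (E 1 1)) (ast (E 0 (-1)) (E 1 (-1)))"
    have Z1: "Z1 \<in> carrier_mat 2 2" unfolding Z1_def by (intro ast E)
    have C: "?C = ph Z1" unfolding phE Z1_def by (simp add: hom ast E)
    have psc: "ps Z \<in> carrier_mat 2 2" if "Z \<in> carrier_mat 2 2" for Z using that G by (simp add: ps_def)
    have "ps Z1 = (ps (E 0 1) * ps (E 1 1)) * (ps (E 0 (-1)) * ps (E 1 (-1)))"
      unfolding Z1_def by (simp add: hom ast E)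
    then have det: "det (ps Z1) \<noteq> 0"
      by (simp add: det_mult[of _ 2] mult_carrier_mat[of _ 2 2] psc E det_E E[unfolded One_nat_def] det_E[unfolded One_nat_def])
    have "\<exists>Z\<in>carrier_mat 2 2. ph Z1 ^\<^sub>m k = ph Z \<and> ps Z1 ^\<^sub>m k = ps Z" for k
    proof (induction k)
      case 0
      show ?case using B F G Z1 by (intro bexI[of _ "0\<^sub>m 2 2"]) (auto simp: ph_def ps_def)
    next
      case (Suc k)
      then obtain Z where Z: "Z \<in> carrier_mat 2 2" "ph Z1 ^\<^sub>m k = ph Z" "ps Z1 ^\<^sub>m k = ps Z" by blast
      then show ?case by (intro bexI[of _ "ast Z Z1"]) (simp_all add: hom ast Z1)
    qed
    then obtain Z where Z: "Z \<in> carrier_mat 2 2" "ph Z1 ^\<^sub>m M = ph Z" "ps Z1 ^\<^sub>m M = ps Z" by blast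
    define N where "N = Z * G"
    have Nc: "N \<in> carrier_mat 2 2" using Z G by (simp add: N_def)
    have "ps Z1 ^\<^sub>m M - 1\<^sub>m 2 = N"
      unfolding Z(3) N_def using Z(1) G by (intro eq_matI) (auto simp: ps_def)
    then have nil: "N ^\<^sub>m 2 = 0\<^sub>m 2 2"
      using power_minus_1_nilpotent[OF psc[OF Z1] det, of M] M by simp
    obtain p r where pr: "p \<in> carrier_vec 2" "r \<in> carrier_vec 2" "N = outer_prod p r"
      using nilpotent_power_outer_prod[OF Nc nil] Nc by auto
    define H where "H = mat 2 2 (\<lambda>(i, j). if i = 0 \<and> j = 1 then 1 / b else if i = 1 \<and> j = 0 then 1 / a else (0::'a))"
    have H: "H \<in> carrier_mat 2 2" by (simp add: H_def)
    have "G * H = 1\<^sub>m 2"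
    proof (rule eq_matI)
      fix i j assume "i < dim_row (1\<^sub>m 2 :: 'a mat)" "j < dim_col (1\<^sub>m 2 :: 'a mat)"
      then have "i = 0 \<or> i = 1" "j = 0 \<or> j = 1" by auto
      then show "(G * H) $$ (i, j) = 1\<^sub>m 2 $$ (i, j)"
        using G G_idx ab by (auto simp: H_def scalar_prod_def sum_up_to_2)
    qed (use G H in simp_all)
    then have XH: "Z = N * H" unfolding N_def using Z(1) G H by (simp add: assoc_mult_mat[of _ 2 2 _ 2 _ 2])
    have HF: "H * F \<in> carrier_mat 2 n" using H F by simp
    define P where "P = B *\<^sub>v p"
    define R where "R = (H * F)\<^sup>T *\<^sub>v r"
    have PR: "P \<in> carrier_vec n" "R \<in> carrier_vec n"
      using B HF pr by (auto simp: P_def R_def intro!: mult_mat_vec_carrier)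
    have BXF: "B * Z * F = outer_prod P R"
    proof -
      have "B * Z * F = (B * N) * (H * F)"
        unfolding XH using B Nc H F by (simp add: assoc_mult_mat[of _ n 2 _ 2 _ 2] assoc_mult_mat[of _ n 2 _ 2 _ n]
          assoc_mult_mat[of _ 2 2 _ 2 _ n])
      also have "\<dots> = outer_prod P (R)"
        unfolding pr(3) P_def R_def using B HF pr by (simp add: mult_outer_prod[of _ n 2] outer_prod_mult[of _ 2 n])
      finally show ?thesis .
    qed
    have NN: "N * N = 0\<^sub>m 2 2" using nil Nc by (simp add: numeral_2_eq_2)
    have ZF: "Z * F = N * (H * F)" using XH Nc H F by (simp add: assoc_mult_mat[of _ 2 2 _ 2 _ n])
    have dims: "dim_row B = n" "dim_col B = 2" "dim_row F = 2" "dim_col F = n" "dim_row Z = 2" "dim_col Z = 2"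
      using B F Z(1) by auto
    have "(B * Z * F) * (B * Z * F) = B * ((Z * (F * B)) * (Z * F))"
      by (simp add: mat_mult_assoc_dim dims)
    also have "(Z * (F * B)) * (Z * F) = N * (N * (H * F))" unfolding ZF by (simp add: N_def G_def)
    also have "N * (N * (H * F)) = (N * N) * (H * F)"
      using Nc HF by (simp add: assoc_mult_mat[of _ 2 2 _ 2 _ n])
    also have "B * \<dots> = 0\<^sub>m n n"
      unfolding NN left_mult_zero_mat[OF HF] using right_mult_zero_mat[OF B] by simp
    finally have "outer_prod P R * outer_prod P R = 0\<^sub>m n n" unfolding BXF .
    then obtain P' where P': "P' \<in> carrier_vec n" "outer_prod P R = outer_prod P' R" "R \<bullet> P' = 0"
      using square_zero_outer_prod[OF PR] by blast
    have "?C ^\<^sub>m M = transv P' R"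
      unfolding C Z(2) using P'(1,2) by (simp add: ph_def BXF transv_def)
    then show ?thesis using P' PR by blast
  qed
qed

section \<open>Word maps and conjugacy of transvections\<close>

lemma SL_simps [simp]:
  "A \<otimes>\<^bsub>SL n\<^esub> B = A * B" "\<one>\<^bsub>SL n\<^esub> = 1\<^sub>m n"
  by (simp_all add: SL_def)

lemma SL_pow [simp]:
  assumes "A \<in> carrier (SL n)"
  shows "A [^]\<^bsub>SL n\<^esub> (k::nat) = A ^\<^sub>m k"
  using assms by (induction k) (auto simp: SL_carrier_iff nat_pow_def)

lemma SL_carrier_mat: "A \<in> carrier (SL n) \<Longrightarrow> A \<in> carrier_mat n n"
  by (simp add: SL_carrier_iff)

lemma SL_mult_closed: "A \<in> carrier (SL n) \<Longrightarrow> B \<in> carrier (SL n) \<Longrightarrow> A * B \<in> carrier (SL n :: 'a::field mat monoid)"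
  using group.is_monoid[OF group_SL] monoid.m_closed SL_simps(1) by metis

lemma SL_pow_closed: "A \<in> carrier (SL n) \<Longrightarrow> A ^\<^sub>m k \<in> carrier (SL n :: 'a::field mat monoid)"
  using group.is_monoid[OF group_SL] monoid.nat_pow_closed SL_pow by metis

lemma SL_inv:
  assumes "A \<in> carrier (SL n :: 'a::field mat monoid)"
  shows "inv\<^bsub>SL n\<^esub> A \<in> carrier (SL n)" "inv\<^bsub>SL n\<^esub> A * A = 1\<^sub>m n" "A * inv\<^bsub>SL n\<^esub> A = 1\<^sub>m n"
  using group.inv_closed[OF group_SL assms] group.l_inv[OF group_SL assms] group.r_inv[OF group_SL assms]
  by simp_all

lemma transv_SL_inv:
  fixes v :: "'a::field vec"
  assumes v: "v \<in> carrier_vec n" and f: "f \<in> carrier_vec n" and fv: "f \<bullet> v = 0"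
    and SL: "transv v f \<in> carrier (SL n)"
  shows "inv\<^bsub>SL n\<^esub> (transv v f) = transv (- v) f"
proof -
  have inv: "transv (- v) f * transv v f = 1\<^sub>m n" by (rule transvection_inverse[OF v f fv])
  have "det (transv (- v) f) * det (transv v f) = 1"
    using det_mult[of "transv (- v) f" n "transv v f"] v f inv by simp
  then have "transv (- v) f \<in> carrier (SL n)" using SL v f by (simp add: SL_carrier_iff)
  from group.inv_equality[OF group_SL _ SL this] inv show ?thesis by simp
qed

text \<open>
  All assignments that send 1 to \<open>x\<close> and 2 to \<open>y\<close> are admitted, so that the values at other
  indices need not be fixed.
\<close>

definition is_word_map :: "('g, 'm) monoid_scheme \<Rightarrow> ('g \<Rightarrow> 'g \<Rightarrow> 'g) \<Rightarrow> bool" where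
  "is_word_map G F \<longleftrightarrow> (\<exists>w \<in> carrier (free_group 2).
     \<forall>x \<in> carrier G. \<forall>y \<in> carrier G. \<forall>g. g 1 = x \<and> g 2 = y \<longrightarrow> word_eval G g w = F x y)"

lemma one_to_two: "{1..2::nat} = {1, 2}" by auto

lemma gen_carrier: "i \<in> {1..d} \<Longrightarrow> gen i \<in> carrier (free_group d)"
  by (simp add: free_group_def)

lemma Pi_one_two: "g 1 \<in> A \<Longrightarrow> g 2 \<in> A \<Longrightarrow> g \<in> {1..2::nat} \<rightarrow> A"
  unfolding one_to_two by simp

lemma is_word_map_proj:
  assumes G: "Group.group G"
  shows "is_word_map G (\<lambda>x y. x)" "is_word_map G (\<lambda>x y. y)"
proof -
  interpret Group.group G by (rule G)
  show "is_word_map G (\<lambda>x y. x)"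
    unfolding is_word_map_def by (rule bexI[OF _ gen_carrier[of 1]]) auto
  show "is_word_map G (\<lambda>x y. y)"
    unfolding is_word_map_def by (rule bexI[OF _ gen_carrier[of 2]]) auto
qed

lemma is_word_map_mult:
  assumes G: "Group.group G" and "is_word_map G F" "is_word_map G H"
  shows "is_word_map G (\<lambda>x y. F x y \<otimes>\<^bsub>G\<^esub> H x y)"
proof -
  obtain u where u: "u \<in> carrier (free_group 2)"
    "\<And>x y g. x \<in> carrier G \<Longrightarrow> y \<in> carrier G \<Longrightarrow> g 1 = x \<Longrightarrow> g 2 = y \<Longrightarrow> word_eval G g u = F x y"
    using assms(2) unfolding is_word_map_def by blast
  obtain v where v: "v \<in> carrier (free_group 2)"
    "\<And>x y g. x \<in> carrier G \<Longrightarrow> y \<in> carrier G \<Longrightarrow> g 1 = x \<Longrightarrow> g 2 = y \<Longrightarrow> word_eval G g v = H x y"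
    using assms(3) unfolding is_word_map_def by blast
  have "word_eval G g (u \<otimes>\<^bsub>free_group 2\<^esub> v) = F x y \<otimes>\<^bsub>G\<^esub> H x y"
    if "x \<in> carrier G" "y \<in> carrier G" "g 1 = x" "g 2 = y" for x y g
  proof -
    have "g \<in> {1..2} \<rightarrow> carrier G" using that by (intro Pi_one_two) simp_all
    then show ?thesis
      using hom_mult[OF group.word_eval_hom[OF G] u(1) v(1)] u(2)[OF that] v(2)[OF that] by metis
  qed
  moreover have "u \<otimes>\<^bsub>free_group 2\<^esub> v \<in> carrier (free_group 2)"
    using u(1) v(1) group.is_monoid[OF group_free_group] by (intro monoid.m_closed)
  ultimately show ?thesis unfolding is_word_map_def by metis
qed

lemma is_word_map_inv:
  assumes G: "Group.group G" and "is_word_map G F"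
  shows "is_word_map G (\<lambda>x y. inv\<^bsub>G\<^esub> (F x y))"
proof -
  obtain u where u: "u \<in> carrier (free_group 2)"
    "\<And>x y g. x \<in> carrier G \<Longrightarrow> y \<in> carrier G \<Longrightarrow> g 1 = x \<Longrightarrow> g 2 = y \<Longrightarrow> word_eval G g u = F x y"
    using assms(2) unfolding is_word_map_def by blast
  have "word_eval G g (inv\<^bsub>free_group 2\<^esub> u) = inv\<^bsub>G\<^esub> (F x y)"
    if "x \<in> carrier G" "y \<in> carrier G" "g 1 = x" "g 2 = y" for x y g
  proof -
    have "g \<in> {1..2} \<rightarrow> carrier G" using that by (intro Pi_one_two) simp_all
    then have "group_hom (free_group 2) G (word_eval G g)"
      using group.word_eval_hom[OF G] group_free_group G by (simp add: group_hom_def group_hom_axioms_def)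
    from group_hom.hom_inv[OF this u(1)] show ?thesis using u(2)[OF that] by simp
  qed
  moreover have "inv\<^bsub>free_group 2\<^esub> u \<in> carrier (free_group 2)"
    by (rule group.inv_closed[OF group_free_group u(1)])
  ultimately show ?thesis unfolding is_word_map_def by metis
qed

lemma is_word_map_pow:
  assumes G: "Group.group G" and "is_word_map G F"
  shows "is_word_map G (\<lambda>x y. F x y [^]\<^bsub>G\<^esub> (k::nat))"
proof (induction k)
  case 0
  have "[] \<in> carrier (free_group 2)" by (simp add: free_group_def)
  then show ?case unfolding is_word_map_def by (intro bexI[of _ "[]"]) (simp_all add: nat_pow_def)
next
  case (Suc k)
  show ?case using is_word_map_mult[OF G Suc assms(2)] by (simp add: nat_pow_def)
qed

lemma word_eval_one:
  assumes G: "Group.group G"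
  shows "word_eval G (\<lambda>_. \<one>\<^bsub>G\<^esub>) u = \<one>\<^bsub>G\<^esub>"
proof (induction u)
  case (Cons a u)
  interpret Group.group G by (rule G)
  show ?case using Cons by (cases a) simp
qed simp

lemma word_eval_group_hom:
  assumes h: "group_hom G H h" and g: "g \<in> {1..d} \<rightarrow> carrier G" and u: "fst ` set u \<subseteq> {1..d}"
  shows "word_eval H (\<lambda>i. h (g i)) u = h (word_eval G g u)"
  using u
proof (induction u)
  case Nil
  show ?case using group_hom.hom_one[OF h] by simp
next
  case (Cons a u)
  obtain i e where a: "a = (i, e)" by force
  have G: "Group.group G" using h by (simp add: group_hom_def)
  have i: "g i \<in> carrier G" using g Cons.prems a by auto
  have c: "word_eval G g u \<in> carrier G"
    using Cons.prems by (intro group.word_eval_closed[OF G g]) auto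
  show ?case
    using Cons group_hom.hom_mult[OF h i c] group_hom.hom_mult[OF h group.inv_closed[OF G i] c]
      group_hom.hom_inv[OF h i] by (simp add: a)
qed

lemma transv_eq: "v \<in> carrier_vec n \<Longrightarrow> transv v f = 1\<^sub>m n + outer_prod v f"
  by (simp add: transv_def)

lemma transvections_transv:
  fixes A :: "'a::field mat"
  shows "A \<in> transvections n \<longleftrightarrow> A \<in> carrier (SL n) \<and>
    (\<exists>v f. v \<in> carrier_vec n \<and> f \<in> carrier_vec n \<and> v \<noteq> 0\<^sub>v n \<and> f \<noteq> 0\<^sub>v n \<and> f \<bullet> v = 0 \<and> A = transv v f)"
  unfolding transvections_iff using transv_eq by metis

lemma transv_in_transvections:
  fixes v :: "'a::field vec"
  assumes "v \<in> carrier_vec n" "f \<in> carrier_vec n" "f \<bullet> v = 0" "transv v f \<in> carrier (SL n)"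
  shows "transv v f \<in> {1\<^sub>m n} \<union> transvections n"
proof (cases "v = 0\<^sub>v n \<or> f = 0\<^sub>v n")
  case True
  then have "transv v f = 1\<^sub>m n" using assms by (auto simp: transv_def)
  then show ?thesis by simp
next
  case False
  then show ?thesis using assms transvections_transv by blast
qed

lemma det_nonzero_inverse:
  fixes A :: "'a::field mat"
  assumes A: "A \<in> carrier_mat n n" and d: "det A \<noteq> 0"
  shows "\<exists>B\<in>carrier_mat n n. A * B = 1\<^sub>m n \<and> B * A = 1\<^sub>m n"
proof -
  have "inverse (det A) \<cdot>\<^sub>m adj_mat A \<in> carrier_mat n n" using adj_mat(1)[OF A] by simp
  moreover have "A * (inverse (det A) \<cdot>\<^sub>m adj_mat A) = 1\<^sub>m n"
    using mult_smult_distrib[OF A adj_mat(1)[OF A]] adj_mat(2)[OF A] d by auto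
  moreover have "(inverse (det A) \<cdot>\<^sub>m adj_mat A) * A = 1\<^sub>m n"
    using mult_smult_assoc_mat[OF adj_mat(1)[OF A] A] adj_mat(3)[OF A] d by auto
  ultimately show ?thesis by blast
qed

lemma exists_index_permutation:
  assumes "i < n" "j < n" "i \<noteq> (j::nat)"
  shows "\<exists>\<sigma>. bij_betw \<sigma> {..<n} {..<n} \<and> \<sigma> 0 = j \<and> \<sigma> 1 = i"
proof -
  define t where "t = Transposition.transpose 0 j"
  define \<sigma> where "\<sigma> = Transposition.transpose (t 1) i \<circ> t"
  have n: "1 < n" using assms by linarith
  have t1: "t 1 < n" "t 1 \<noteq> j" using assms n by (auto simp: t_def Transposition.transpose_def)
  have "bij_betw t {..<n} {..<n}"
    using assms n by (intro bij_betw_byWitness[of _ t]) (auto simp: t_def Transposition.transpose_def)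
  moreover have "bij_betw (Transposition.transpose (t 1) i) {..<n} {..<n}"
    using assms t1 by (intro bij_betw_byWitness[of _ "Transposition.transpose (t 1) i"]) (auto simp: Transposition.transpose_def)
  ultimately have "bij_betw \<sigma> {..<n} {..<n}" unfolding \<sigma>_def by (rule bij_betw_trans)
  moreover have "\<sigma> 0 = j" using t1 assms by (auto simp: \<sigma>_def t_def Transposition.transpose_def)
  moreover have "\<sigma> 1 = i" by (simp add: \<sigma>_def)
  ultimately show ?thesis by blast
qed

text \<open>
  Choose a basis with first vector \<open>v\<close> in which \<open>f\<close> is the second coordinate. From the third
  vector on there is freedom to rescale within the kernel of \<open>f\<close>, which makes the determinant of
  the base change 1; this is where \<open>n \<ge> 3\<close> enters.
\<close>

lemma transv_conjugate_standard:
  fixes v :: "'a::field vec"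
  assumes n: "n \<ge> 3" and v: "v \<in> carrier_vec n" "v \<noteq> 0\<^sub>v n" and f: "f \<in> carrier_vec n" "f \<noteq> 0\<^sub>v n"
    and fv: "f \<bullet> v = 0"
  shows "\<exists>P \<in> carrier (SL n). transv v f * P = P * transv (unit_vec n 0) (unit_vec n 1)"
proof -
  obtain i where i: "i < n" "f $ i \<noteq> 0" using f by (rule vec_neq_zeroE)
  have sum: "(\<Sum>r<n. f $ r * v $ r) = 0" using fv v f by (simp add: scalar_prod_def atLeast0LessThan)
  have "\<exists>j<n. j \<noteq> i \<and> v $ j \<noteq> 0"
  proof (rule ccontr)
    assume "\<not> ?thesis"
    then have z: "\<And>j. j < n \<Longrightarrow> j \<noteq> i \<Longrightarrow> v $ j = 0" by blast
    have "(\<Sum>r<n. f $ r * v $ r) = f $ i * v $ i"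
      using i(1) by (subst sum.remove[of _ i]) (auto intro!: sum.neutral simp: z)
    then have "v $ i = 0" using sum i by simp
    then have "v $ k = 0" if "k < n" for k using z[OF that] by (cases "k = i") simp_all
    then have "v = 0\<^sub>v n" using v(1) by (intro eq_vecI) simp_all
    then show False using v by simp
  qed
  then obtain j where j: "j < n" "j \<noteq> i" "v $ j \<noteq> 0" by blast
  obtain \<sigma> where \<sigma>: "bij_betw \<sigma> {..<n} {..<n}" "\<sigma> 0 = j" "\<sigma> 1 = i"
    using exists_index_permutation[OF i(1) j(1)] j(2) by blast
  have \<sigma>_less: "\<sigma> c < n" if "c < n" for c using \<sigma>(1) that bij_betwE by blast
  have \<sigma>_inj: "\<sigma> c = \<sigma> c' \<longleftrightarrow> c = c'" if "c < n" "c' < n" for c c'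
    using \<sigma>(1) that unfolding bij_betw_def by (auto dest: inj_onD)
  (* Column 0 is v, column 1 takes the value 1 under f, and the other columns are unit vectors
     corrected at i so as to lie in the kernel of f. The index j, at which v is nonzero and which
     is left out, makes them independent. *)
  define Q where "Q = mat n n (\<lambda>(r, c). if c = 0 then v $ r else if c = 1 then (if r = i then 1 / f $ i else 0)
      else (if r = \<sigma> c then 1 else 0) - (if r = i then f $ (\<sigma> c) / f $ i else 0))"
  have Q: "Q \<in> carrier_mat n n" by (simp add: Q_def)
  have fQ: "Q\<^sup>T *\<^sub>v f = unit_vec n 1"
  proof (rule eq_vecI)
    fix c assume "c < dim_vec (unit_vec n 1 :: 'a vec)"
    then have c: "c < n" by simp
    have e: "(Q\<^sup>T *\<^sub>v f) $ c = (\<Sum>r<n. Q $$ (r, c) * f $ r)"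
      using c Q f by (simp add: scalar_prod_def atLeast0LessThan)
    consider "c = 0" | "c = 1" | "c \<noteq> 0" "c \<noteq> 1" by blast
    then have "(\<Sum>r<n. Q $$ (r, c) * f $ r) = (if c = 1 then 1 else 0)"
    proof cases
      case 1
      then show ?thesis using c sum by (simp add: Q_def mult.commute)
    next
      case 2
      have "(\<Sum>r<n. Q $$ (r, c) * f $ r) = (\<Sum>r<n. if r = i then 1 / f $ i * f $ r else 0)"
        using c 2 by (intro sum.cong) (auto simp: Q_def)
      then show ?thesis using i 2 by simp
    next
      case 3
      have "(\<Sum>r<n. Q $$ (r, c) * f $ r) =
          (\<Sum>r<n. (if r = \<sigma> c then f $ r else 0) - (if r = i then f $ (\<sigma> c) / f $ i * f $ r else 0))"
        using c 3 by (intro sum.cong) (auto simp: Q_def left_diff_distrib)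
      also have "\<dots> = f $ (\<sigma> c) - f $ (\<sigma> c) / f $ i * f $ i"
        using \<sigma>_less[OF c] i by (simp add: sum_subtractf)
      finally show ?thesis using i 3 by simp
    qed
    then show "(Q\<^sup>T *\<^sub>v f) $ c = unit_vec n 1 $ c" unfolding e using c n by simp
  qed (use Q in simp)
  have "det Q \<noteq> 0"
  proof
    assume "det Q = 0"
    then obtain a where a: "a \<in> carrier_vec n" "a \<noteq> 0\<^sub>v n" "Q *\<^sub>v a = 0\<^sub>v n"
      using det_0_iff_vec_prod_zero_field[OF Q] by blast
    have row: "(\<Sum>c<n. Q $$ (r, c) * a $ c) = 0" if "r < n" for r
      using arg_cong[OF a(3), of "\<lambda>v. v $ r"] that Q a(1) by (simp add: scalar_prod_def atLeast0LessThan)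
    have "unit_vec n 1 \<bullet> a = f \<bullet> (Q *\<^sub>v a)"
      unfolding fQ[symmetric] using transpose_vec_mult_scalar[of "Q" n n a f] Q a f by simp
    then have a1: "a $ 1 = 0" using a n f by simp
    have "Q $$ (j, c) = 0" if "c < n" "c \<noteq> 0" for c
      using that j \<sigma>(2) \<sigma>_inj[of 0 c] by (simp add: Q_def)
    then have "(\<Sum>c<n. Q $$ (j, c) * a $ c) = Q $$ (j, 0) * a $ 0"
      using n by (subst sum.remove[of _ 0]) (auto intro!: sum.neutral)
    then have a0: "a $ 0 = 0" using row[OF j(1)] n j by (simp add: Q_def)
    have "a $ c = 0" if c: "c < n" for c
    proof (cases "c = 0 \<or> c = 1")
      case False
      have ne: "\<sigma> c \<noteq> i" using \<sigma>_inj[of c 1] c n False \<sigma>(3) by auto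
      have "Q $$ (\<sigma> c, c') * a $ c' = 0" if "c' < n" "c' \<noteq> c" for c'
        using that \<sigma>_less[OF c] ne a0 \<sigma>_inj[OF c that(1)] by (cases "c' = 0") (simp_all add: Q_def)
      then have "(\<Sum>c'\<in>{..<n} - {c}. Q $$ (\<sigma> c, c') * a $ c') = 0" by (intro sum.neutral ballI) simp
      then have "(\<Sum>c'<n. Q $$ (\<sigma> c, c') * a $ c') = Q $$ (\<sigma> c, c) * a $ c"
        using c by (subst sum.remove[of _ c]) simp_all
      then show ?thesis using row[OF \<sigma>_less[OF c]] c False ne \<sigma>_less[OF c] by (simp add: Q_def)
    qed (use a0 a1 in auto)
    then have "a = 0\<^sub>v n" using a(1) by (intro eq_vecI) auto
    then show False using a(2) by simp
  qed
  (* Rescaling the third column corrects the determinant without affecting v and f. *)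
  define D where "D = multrow_mat n 2 (1 / det Q)"
  have D: "D \<in> carrier_mat n n" by (simp add: D_def)
  have detD: "det D = 1 / det Q" unfolding D_def using n by (intro det_multrow_mat) simp
  define P where "P = Q * D"
  have Pc: "P \<in> carrier_mat n n" using Q D by (simp add: P_def mult_carrier_square)
  have detP: "det P = 1" unfolding P_def using det_mult[OF Q D] detD \<open>det Q \<noteq> 0\<close> by simp
  have Pe: "P *\<^sub>v unit_vec n 0 = v"
  proof -
    have "D *\<^sub>v unit_vec n 0 = unit_vec n 0"
      using n by (subst mat_mult_unit_vec[OF D]) (auto simp: D_def)
    then have "P *\<^sub>v unit_vec n 0 = Q *\<^sub>v unit_vec n 0"
      unfolding P_def using assoc_square_vec[OF Q D, of "unit_vec n 0"] by simp
    also have "\<dots> = v" using n v by (subst mat_mult_unit_vec[OF Q]) (auto simp: Q_def)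
    finally show ?thesis .
  qed
  have fP: "P\<^sup>T *\<^sub>v f = unit_vec n 1"
  proof -
    have "P\<^sup>T *\<^sub>v f = D\<^sup>T *\<^sub>v (Q\<^sup>T *\<^sub>v f)"
      unfolding P_def transpose_mult[OF Q D] using Q D f by (intro assoc_square_vec) auto
    also have "\<dots> = unit_vec n 1"
      unfolding fQ using n D by (subst mat_mult_unit_vec[of _ n n]) (auto simp: D_def)
    finally show ?thesis .
  qed
  have "transv v f * P = P + outer_prod v f * P"
    unfolding transv_eq[OF v(1)] using Pc v f by (simp add: add_mult_distrib_mat[of _ n n _ _ n])
  also have "outer_prod v f * P = P * outer_prod (unit_vec n 0) (unit_vec n 1)"
    using outer_prod_mult[OF Pc f(1), of v] mult_outer_prod[OF Pc, of "unit_vec n 0"] by (simp add: fP Pe)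
  also have "P + \<dots> = P * transv (unit_vec n 0) (unit_vec n 1)"
    using Pc by (simp add: transv_eq[of _ n] mult_add_distrib_mat[of _ n n _ n])
  finally show ?thesis using Pc detP SL_carrier_iff by blast
qed

lemma det_transv_standard: "n \<ge> 2 \<Longrightarrow> det (transv (unit_vec n 0) (unit_vec n 1) :: 'a::field mat) = 1"
proof -
  assume "n \<ge> 2"
  then have "transv (unit_vec n 0) (unit_vec n 1) = addrow_mat n (1::'a) 0 1"
    by (intro eq_matI) (auto simp: transv_def)
  then show ?thesis by (simp add: det_addrow_mat)
qed

lemma transv_in_SL:
  fixes v :: "'a::field vec"
  assumes n: "n \<ge> 3" and v: "v \<in> carrier_vec n" and f: "f \<in> carrier_vec n" and fv: "f \<bullet> v = 0"
  shows "transv v f \<in> carrier (SL n)"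
proof (cases "v = 0\<^sub>v n \<or> f = 0\<^sub>v n")
  case True
  then have "transv v f = 1\<^sub>m n" using v f by (auto simp: transv_def)
  then show ?thesis by (simp add: SL_carrier_iff)
next
  case False
  then obtain P where P: "P \<in> carrier (SL n)" "transv v f * P = P * transv (unit_vec n 0) (unit_vec n 1)"
    using transv_conjugate_standard[OF n v _ f _ fv] by blast
  have Pc: "P \<in> carrier_mat n n" "det P = 1" using P(1) by (simp_all add: SL_carrier_iff)
  have "det (transv v f) * det P = det P * det (transv (unit_vec n 0) (unit_vec n 1) :: 'a mat)"
    using det_mult[OF transv_carrier[OF v f] Pc(1)] det_mult[OF Pc(1), of "transv (unit_vec n 0) (unit_vec n 1)"] P(2)
    by simp
  then show ?thesis using Pc(2) det_transv_standard[of n] n v f by (simp add: SL_carrier_iff)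
qed

lemma transvections_conjugate:
  fixes A B :: "'a::field mat"
  assumes n: "n \<ge> 3" and A: "A \<in> transvections n" and B: "B \<in> transvections n"
  shows "\<exists>P \<in> carrier (SL n). B = P * A * inv\<^bsub>SL n\<^esub> P"
proof -
  let ?E = "transv (unit_vec n 0) (unit_vec n 1) :: 'a mat"
  obtain P where P: "P \<in> carrier (SL n)" "A * P = P * ?E"
    using A transv_conjugate_standard[OF n] unfolding transvections_transv by metis
  obtain R where R: "R \<in> carrier (SL n)" "B * R = R * ?E"
    using B transv_conjugate_standard[OF n] unfolding transvections_transv by metis
  let ?P' = "inv\<^bsub>SL n\<^esub> P"
  define S where "S = R * ?P'"
  have S: "S \<in> carrier (SL n)" unfolding S_def by (intro SL_mult_closed R SL_inv P)
  have AB: "A \<in> carrier (SL n)" "B \<in> carrier (SL n)" using A B by (simp_all add: transvections_transv)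
  have c: "A \<in> carrier_mat n n" "B \<in> carrier_mat n n" "P \<in> carrier_mat n n" "R \<in> carrier_mat n n"
    "?P' \<in> carrier_mat n n" "S \<in> carrier_mat n n" "?E \<in> carrier_mat n n" "inv\<^bsub>SL n\<^esub> S \<in> carrier_mat n n"
    using AB P(1) R(1) S SL_inv(1)[OF P(1)] SL_inv(1)[OF S] by (simp_all add: SL_carrier_iff)
  note d = carrier_matD[OF c(1)] carrier_matD[OF c(2)] carrier_matD[OF c(3)] carrier_matD[OF c(4)]
    carrier_matD[OF c(5)] carrier_matD[OF c(6)] carrier_matD[OF c(7)] carrier_matD[OF c(8)]
  have "A = A * (P * ?P')" using SL_inv(3)[OF P(1)] c by simp
  also have "\<dots> = P * ?E * ?P'" unfolding P(2)[symmetric] by (simp only: mat_mult_assoc_dim d)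
  finally have "S * A = R * ((?P' * P) * (?E * ?P'))"
    unfolding S_def by (simp only: mat_mult_assoc_dim d dim_col_mat index_mult_mat)
  also have "\<dots> = (R * ?E) * ?P'"
    unfolding SL_inv(2)[OF P(1)] using d by (simp add: mat_mult_assoc_dim)
  also have "\<dots> = B * S"
    unfolding R(2)[symmetric] S_def by (simp only: mat_mult_assoc_dim d)
  finally have "S * A * inv\<^bsub>SL n\<^esub> S = B * (S * inv\<^bsub>SL n\<^esub> S)"
    by (simp only: mat_mult_assoc_dim d)
  then have "S * A * inv\<^bsub>SL n\<^esub> S = B" using SL_inv(3)[OF S] c by simp
  then show ?thesis using S by (intro bexI[of _ S]) simp_all
qed

lemma transvections_inv:
  fixes A :: "'a::field mat"
  assumes "A \<in> transvections n"
  shows "inv\<^bsub>SL n\<^esub> A \<in> transvections n"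
proof -
  obtain v f where vf: "A \<in> carrier (SL n)" "v \<in> carrier_vec n" "f \<in> carrier_vec n" "v \<noteq> 0\<^sub>v n" "f \<noteq> 0\<^sub>v n"
    "f \<bullet> v = 0" "A = transv v f" using assms unfolding transvections_transv by blast
  have "- v \<noteq> 0\<^sub>v n" using vf(2,4) by (metis uminus_uminus_vec uminus_zero_vec)
  moreover have "inv\<^bsub>SL n\<^esub> A = transv (- v) f"
    using transv_SL_inv[OF vf(2,3,6)] vf(1) unfolding vf(7) by blast
  ultimately show ?thesis using vf SL_inv(1)[OF vf(1)] unfolding transvections_transv
    by (metis uminus_carrier_vec scalar_prod_uminus_right carrier_vecD neg_equal_0_iff_equal)
qed

text \<open>
  Conjugation is an automorphism, so it commutes with the evaluation of words; as soon as one
  transvection is a value, all of them are.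
\<close>

lemma word_values_transvections:
  fixes F :: "'a::field mat \<Rightarrow> 'a mat \<Rightarrow> 'a mat"
  assumes n: "n \<ge> 3" and F: "is_word_map (SL n) F"
    and val: "\<And>x y. x \<in> carrier (SL n) \<Longrightarrow> y \<in> carrier (SL n) \<Longrightarrow> F x y \<in> {1\<^sub>m n} \<union> transvections n"
    and ex: "\<exists>x\<in>carrier (SL n). \<exists>y\<in>carrier (SL n). F x y \<noteq> 1\<^sub>m n"
  shows "\<exists>w\<in>carrier (free_group 2). word_values (SL n :: 'a mat monoid) 2 w = {1\<^sub>m n} \<union> transvections n"
proof -
  let ?G = "SL n :: 'a mat monoid"
  interpret G: Group.group ?G by (rule group_SL)
  obtain w where w: "w \<in> carrier (free_group 2)"
    "\<And>x y g. x \<in> carrier ?G \<Longrightarrow> y \<in> carrier ?G \<Longrightarrow> g 1 = x \<Longrightarrow> g 2 = y \<Longrightarrow> word_eval ?G g w = F x y"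
    using F unfolding is_word_map_def by blast
  have wset: "fst ` set w \<subseteq> {1..2}" using w(1) by (auto simp: free_group_def)
  have "word_values ?G 2 w = {1\<^sub>m n} \<union> transvections n"
  proof (intro Set.equalityI subsetI)
    fix h assume "h \<in> word_values ?G 2 w"
    then obtain g where g: "g \<in> {1..2} \<rightarrow> carrier ?G"
      "h = word_eval ?G g w \<or> h = inv\<^bsub>?G\<^esub> (word_eval ?G g w)" unfolding word_values_def by blast
    have g12: "g 1 \<in> carrier ?G" "g 2 \<in> carrier ?G" using g(1) by auto
    have "word_eval ?G g w = F (g 1) (g 2)" using w(2)[OF g12] by simp
    then have "word_eval ?G g w \<in> {1\<^sub>m n} \<union> transvections n" using val[OF g12] by simp
    then show "h \<in> {1\<^sub>m n} \<union> transvections n"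
      using g(2) transvections_inv G.inv_one by auto
  next
    fix h :: "'a mat" assume h: "h \<in> {1\<^sub>m n} \<union> transvections n"
    show "h \<in> word_values ?G 2 w"
    proof (cases "h = 1\<^sub>m n")
      case True
      have "word_eval ?G (\<lambda>_. \<one>\<^bsub>?G\<^esub>) w = h" unfolding word_eval_one[OF group_SL] True by simp
      moreover have "(\<lambda>_. \<one>\<^bsub>?G\<^esub>) \<in> {1..2} \<rightarrow> carrier ?G" using G.one_closed by (intro Pi_I)
      ultimately show ?thesis unfolding word_values_def by blast
    next
      case False
      obtain x y where xy: "x \<in> carrier ?G" "y \<in> carrier ?G" "F x y \<noteq> 1\<^sub>m n" using ex by blast
      then have T: "F x y \<in> transvections n" using val[OF xy(1,2)] by simp
      obtain P where P: "P \<in> carrier ?G" "h = P * F x y * inv\<^bsub>?G\<^esub> P"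
        using transvections_conjugate[OF n T] False h by blast
      define g where "g = (\<lambda>i::nat. if i = 1 then x else y)"
      have g: "g \<in> {1..2} \<rightarrow> carrier ?G" using xy by (auto simp: g_def)
      have hom: "group_hom ?G ?G (\<lambda>z. P \<otimes>\<^bsub>?G\<^esub> z \<otimes>\<^bsub>?G\<^esub> inv\<^bsub>?G\<^esub> P)"
      proof (rule group_hom.intro, rule group_SL, rule group_SL, rule group_hom_axioms.intro, rule homI)
        fix a b assume ab: "a \<in> carrier ?G" "b \<in> carrier ?G"
        have "inv\<^bsub>?G\<^esub> P \<otimes>\<^bsub>?G\<^esub> (P \<otimes>\<^bsub>?G\<^esub> (b \<otimes>\<^bsub>?G\<^esub> inv\<^bsub>?G\<^esub> P)) = b \<otimes>\<^bsub>?G\<^esub> inv\<^bsub>?G\<^esub> P"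
          using P(1) ab by (metis G.inv_closed G.l_inv G.l_one G.m_assoc G.m_closed)
        then show "P \<otimes>\<^bsub>?G\<^esub> (a \<otimes>\<^bsub>?G\<^esub> b) \<otimes>\<^bsub>?G\<^esub> inv\<^bsub>?G\<^esub> P =
          P \<otimes>\<^bsub>?G\<^esub> a \<otimes>\<^bsub>?G\<^esub> inv\<^bsub>?G\<^esub> P \<otimes>\<^bsub>?G\<^esub> (P \<otimes>\<^bsub>?G\<^esub> b \<otimes>\<^bsub>?G\<^esub> inv\<^bsub>?G\<^esub> P)"
          using P(1) ab by (simp only: G.m_assoc G.m_closed G.inv_closed)
      qed (use P(1) in \<open>simp only: G.m_closed G.inv_closed\<close>)
      have "word_eval ?G (\<lambda>i. P \<otimes>\<^bsub>?G\<^esub> g i \<otimes>\<^bsub>?G\<^esub> inv\<^bsub>?G\<^esub> P) w = h"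
        unfolding word_eval_group_hom[OF hom g wset] using w(2)[OF xy(1,2), of g] P(2) by (simp add: g_def)
      moreover have "(\<lambda>i. P \<otimes>\<^bsub>?G\<^esub> g i \<otimes>\<^bsub>?G\<^esub> inv\<^bsub>?G\<^esub> P) \<in> {1..2} \<rightarrow> carrier ?G"
        using g P(1) by (intro Pi_I G.m_closed G.inv_closed) auto
      ultimately show ?thesis unfolding word_values_def by blast
    qed
  qed
  then show ?thesis using w(1) by blast
qed

section \<open>Unipotent powers; dimension 2 and dimension p + 1\<close>

text \<open>
  A common multiple of the orders of all semisimple elements of \<open>GL\<^sub>n(q)\<close> that is prime to the
  characteristic.
\<close>

definition semisimple_exponent :: "'a::{field,finite} itself \<Rightarrow> nat \<Rightarrow> nat" where
  "semisimple_exponent _ n = (\<Prod>d=1..n. CARD('a) ^ d - 1)"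

lemma semisimple_exponent_dvd:
  assumes "1 \<le> d" "d \<le> n"
  shows "CARD('a) ^ d - 1 dvd semisimple_exponent TYPE('a::{field,finite}) n"
  unfolding semisimple_exponent_def using assms by (intro dvd_prodI) simp_all

lemma of_nat_CARD: "of_nat CARD('a) = (0::'a::{field,finite})"
proof -
  obtain k where k: "k > 0" "CARD('a) = CHAR('a) ^ k" using CARD_eq_CHAR_power[where 'a='a] by blast
  then show ?thesis by simp
qed

lemma of_nat_CARD_power_minus_1:
  assumes "d \<ge> 1"
  shows "of_nat (CARD('a) ^ d - 1) = (-1::'a::{field,finite})"
proof -
  have "CARD('a) ^ d \<ge> 1" using card_gt_1[where 'a='a] by simp
  then have "of_nat (CARD('a) ^ d - 1) = of_nat CARD('a) ^ d - (1::'a)" by simp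
  then show ?thesis using assms by (simp only: of_nat_CARD) simp
qed

lemma of_nat_semisimple_exponent: "of_nat (semisimple_exponent TYPE('a) n) \<noteq> (0::'a::{field,finite})"
proof -
  have "of_nat (semisimple_exponent TYPE('a) n) = (\<Prod>d=1..n. (-1::'a))"
    unfolding semisimple_exponent_def of_nat_prod
    by (intro prod.cong refl of_nat_CARD_power_minus_1) simp
  then show ?thesis by simp
qed

lemma coprime_CHAR:
  assumes "of_nat M \<noteq> (0::'a::{field,finite})"
  shows "coprime M (CHAR('a) ^ k)"
proof -
  have "\<not> CHAR('a) dvd M" using assms by (simp add: of_nat_eq_0_iff_char_dvd)
  then have "coprime CHAR('a) M" using prime_CHAR_finite_field[where 'a='a] by (simp add: prime_imp_coprime)
  then show ?thesis by (simp add: coprime_commute)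
qed

lemma unipotent_in_transvections:
  fixes z :: "'a::field mat"
  assumes z: "z \<in> carrier (SL n)" and vf: "v \<in> carrier_vec n" "f \<in> carrier_vec n" "z - 1\<^sub>m n = outer_prod v f"
    and nil: "(z - 1\<^sub>m n) ^\<^sub>m k = 0\<^sub>m n n"
  shows "z \<in> {1\<^sub>m n} \<union> transvections n"
proof -
  have "outer_prod v f * outer_prod v f = 0\<^sub>m n n"
    using nilpotent_outer_prod_square[OF vf(1,2)] nil vf(3) by simp
  then obtain p where p: "p \<in> carrier_vec n" "outer_prod v f = outer_prod p f" "f \<bullet> p = 0"
    using square_zero_outer_prod[OF vf(1,2)] by blast
  have zc: "z \<in> carrier_mat n n" using z by (rule SL_carrier_mat)
  have "z = 1\<^sub>m n + (z - 1\<^sub>m n)" using zc by (intro eq_matI) auto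
  then have "z = transv p f" unfolding transv_eq[OF p(1)] vf(3) p(2) .
  then show ?thesis using transv_in_transvections[OF p(1) vf(2) p(3)] z by simp
qed

lemma transvections_transvE:
  fixes z :: "'a::field mat"
  assumes "z \<in> {1\<^sub>m n} \<union> transvections n"
  obtains v f where "v \<in> carrier_vec n" "f \<in> carrier_vec n" "f \<bullet> v = 0" "z = transv v f" "z \<in> carrier (SL n)"
proof (cases "z = 1\<^sub>m n")
  case True
  have "z = transv (0\<^sub>v n) (0\<^sub>v n)" using True by simp
  then show ?thesis using that[of "0\<^sub>v n" "0\<^sub>v n"] True by (simp add: SL_carrier_iff)
next
  case False
  then have "z \<in> transvections n" using assms by simp
  then show ?thesis using that unfolding transvections_transv by metis
qed

definition comm_mat :: "nat \<Rightarrow> 'a::field mat \<Rightarrow> 'a mat \<Rightarrow> 'a mat" where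
  "comm_mat n A B = A * B * (inv\<^bsub>SL n\<^esub> A * inv\<^bsub>SL n\<^esub> B)"

definition conj_mat :: "nat \<Rightarrow> 'a::field mat \<Rightarrow> 'a mat \<Rightarrow> 'a mat" where
  "conj_mat n P A = inv\<^bsub>SL n\<^esub> P * A * P"

lemma comm_mat_closed: "A \<in> carrier (SL n) \<Longrightarrow> B \<in> carrier (SL n) \<Longrightarrow> comm_mat n A B \<in> carrier (SL n)"
  unfolding comm_mat_def by (intro SL_mult_closed SL_inv)

lemma conj_mat_closed: "P \<in> carrier (SL n) \<Longrightarrow> A \<in> carrier (SL n) \<Longrightarrow> conj_mat n P A \<in> carrier (SL n)"
  unfolding conj_mat_def by (intro SL_mult_closed SL_inv)

lemma comm_mat_self:
  fixes A :: "'a::field mat"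
  assumes A: "A \<in> carrier (SL n)"
  shows "comm_mat n A A = 1\<^sub>m n"
proof -
  note c = SL_carrier_mat[OF A] SL_carrier_mat[OF SL_inv(1)[OF A]]
  have "comm_mat n A A = A * ((A * inv\<^bsub>SL n\<^esub> A) * inv\<^bsub>SL n\<^esub> A)"
    unfolding comm_mat_def using c by (simp add: mat_mult_assoc_dim carrier_matD[OF c(1)] carrier_matD[OF c(2)])
  then show ?thesis using SL_inv(3)[OF A] c by simp
qed

lemma conj_mat_commuting:
  fixes A :: "'a::field mat"
  assumes A: "A \<in> carrier_mat n n" and P: "P \<in> carrier (SL n)" and comm: "A * P = P * A"
  shows "conj_mat n P A = A"
proof -
  note c = SL_carrier_mat[OF P] SL_carrier_mat[OF SL_inv(1)[OF P]]
  have "conj_mat n P A = (inv\<^bsub>SL n\<^esub> P * P) * A"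
    unfolding conj_mat_def using A comm
    by (simp add: mat_mult_assoc_dim carrier_matD[OF c(1)] carrier_matD[OF c(2)])
  then show ?thesis using SL_inv(2)[OF P] A by simp
qed

lemma scalar_mat_commutes:
  fixes A :: "'a::field mat"
  assumes "A \<in> carrier_mat n n"
  shows "(c \<cdot>\<^sub>m 1\<^sub>m n) * A = A * (c \<cdot>\<^sub>m 1\<^sub>m n)"
  using assms by (simp add: mult_smult_assoc_mat[of _ n n _ n] mult_smult_distrib[of _ n n _ n])

lemma conj_mat_transv:
  fixes v :: "'a::field vec"
  assumes P: "P \<in> carrier (SL n)" and v: "v \<in> carrier_vec n" and f: "f \<in> carrier_vec n"
  shows "conj_mat n P (transv v f) = transv (inv\<^bsub>SL n\<^esub> P *\<^sub>v v) (P\<^sup>T *\<^sub>v f)"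
    and "inv\<^bsub>SL n\<^esub> P *\<^sub>v v \<in> carrier_vec n" "P\<^sup>T *\<^sub>v f \<in> carrier_vec n"
    and "(P\<^sup>T *\<^sub>v f) \<bullet> (inv\<^bsub>SL n\<^esub> P *\<^sub>v v) = f \<bullet> v"
proof -
  let ?P = "inv\<^bsub>SL n\<^esub> P"
  note c = SL_carrier_mat[OF P] SL_carrier_mat[OF SL_inv(1)[OF P]]
  show v': "?P *\<^sub>v v \<in> carrier_vec n" and f': "P\<^sup>T *\<^sub>v f \<in> carrier_vec n"
    using c v f by (auto intro!: mult_mat_vec_carrier)
  have "conj_mat n P (transv v f) = ?P * P + ?P * outer_prod v f * P"
    unfolding conj_mat_def transv_eq[OF v] using c v f
    by (simp add: mult_add_distrib_mat[of _ n n _ n] add_mult_distrib_mat[of _ n n _ _ n])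
  also have "?P * outer_prod v f * P = outer_prod (?P *\<^sub>v v) (P\<^sup>T *\<^sub>v f)"
    using c v f by (simp add: mult_outer_prod[of _ n n] outer_prod_mult[of _ n n])
  finally show "conj_mat n P (transv v f) = transv (?P *\<^sub>v v) (P\<^sup>T *\<^sub>v f)"
    unfolding SL_inv(2)[OF P] transv_eq[OF v'] .
  have "(P\<^sup>T *\<^sub>v f) \<bullet> (?P *\<^sub>v v) = f \<bullet> (P *\<^sub>v (?P *\<^sub>v v))"
    using transpose_vec_mult_scalar[OF c(1) v' f] .
  also have "P *\<^sub>v (?P *\<^sub>v v) = v"
    using assoc_square_vec[OF c v] SL_inv(3)[OF P] v by simp
  finally show "(P\<^sup>T *\<^sub>v f) \<bullet> (?P *\<^sub>v v) = f \<bullet> v" .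
qed

lemma conj_mat_transvections:
  fixes z :: "'a::field mat"
  assumes P: "P \<in> carrier (SL n)" and z: "z \<in> {1\<^sub>m n} \<union> transvections n"
  shows "conj_mat n P z \<in> {1\<^sub>m n} \<union> transvections n"
proof -
  obtain v f where vf: "v \<in> carrier_vec n" "f \<in> carrier_vec n" "f \<bullet> v = 0" "z = transv v f" "z \<in> carrier (SL n)"
    using z by (rule transvections_transvE)
  show ?thesis
    using transv_in_transvections[OF conj_mat_transv(2,3)[OF P vf(1,2)]] conj_mat_transv(1,4)[OF P vf(1,2)]
      conj_mat_closed[OF P vf(5)] vf(3,4) by simp
qed

lemma comm_mat_transv:
  fixes v :: "'a::field vec"
  assumes "v \<in> carrier_vec n" "f \<in> carrier_vec n" "f \<bullet> v = 0" "transv v f \<in> carrier (SL n)"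
    and "w \<in> carrier_vec n" "g \<in> carrier_vec n" "g \<bullet> w = 0" "transv w g \<in> carrier (SL n)"
  shows "comm_mat n (transv v f) (transv w g) = transv v f * transv w g * (transv (- v) f * transv (- w) g)"
  unfolding comm_mat_def transv_SL_inv[OF assms(1-4)] transv_SL_inv[OF assms(5-8)] ..

lemma comm_mat_power_transvections:
  fixes z :: "'a::{field,finite} mat"
  assumes n: "n \<ge> 2" and z: "z \<in> {1\<^sub>m n} \<union> transvections n" and y: "y \<in> {1\<^sub>m n} \<union> transvections n"
  shows "comm_mat n z y ^\<^sub>m semisimple_exponent TYPE('a) n \<in> {1\<^sub>m n} \<union> transvections n"
proof -
  let ?M = "semisimple_exponent TYPE('a) n"
  obtain v f where vf: "v \<in> carrier_vec n" "f \<in> carrier_vec n" "f \<bullet> v = 0" "z = transv v f" "z \<in> carrier (SL n)"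
    using z by (rule transvections_transvE)
  obtain w g where wg: "w \<in> carrier_vec n" "g \<in> carrier_vec n" "g \<bullet> w = 0" "y = transv w g" "y \<in> carrier (SL n)"
    using y by (rule transvections_transvE)
  have "CARD('a) ^ d - 1 dvd ?M" if "1 \<le> d" "d \<le> 2" for d
    using that n by (intro semisimple_exponent_dvd) auto
  from transvection_commutator_power[OF vf(1-3) wg(1-3) this]
  obtain p r where pr: "p \<in> carrier_vec n" "r \<in> carrier_vec n" "r \<bullet> p = 0" "comm_mat n z y ^\<^sub>m ?M = transv p r"
    using comm_mat_transv[OF vf(1-3) _ wg(1-3)] vf(4,5) wg(4,5) by auto
  have "transv p r \<in> carrier (SL n)"
    unfolding pr(4)[symmetric] by (intro SL_pow_closed comm_mat_closed vf wg)
  then show ?thesis unfolding pr(4) by (rule transv_in_transvections[OF pr(1-3)])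
qed

lemma transv_neq_1:
  fixes v :: "'a::field vec"
  assumes "v \<in> carrier_vec n" "f \<in> carrier_vec n" "v \<noteq> 0\<^sub>v n" "f \<noteq> 0\<^sub>v n"
  shows "transv v f \<noteq> 1\<^sub>m n"
proof
  assume "transv v f = 1\<^sub>m n"
  then have "1\<^sub>m n + outer_prod v f - 1\<^sub>m n = 0\<^sub>m n n" using assms by (simp add: transv_eq)
  moreover have "1\<^sub>m n + outer_prod v f - 1\<^sub>m n = outer_prod v f" using assms by (intro eq_matI) auto
  ultimately show False using outer_prod_neq_0[OF assms(1,3,2,4)] by simp
qed

lemma smult_vec_nonzero:
  fixes v :: "'a::field vec"
  assumes "v \<in> carrier_vec n" "v \<noteq> 0\<^sub>v n" "c \<noteq> 0"
  shows "c \<cdot>\<^sub>v v \<noteq> 0\<^sub>v n"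
proof
  assume z: "c \<cdot>\<^sub>v v = 0\<^sub>v n"
  obtain i where "i < n" "v $ i \<noteq> 0" using assms(1,2) by (rule vec_neq_zeroE)
  then show False using arg_cong[OF z, of "\<lambda>v. v $ i"] assms by simp
qed

lemma scalar_prod_nonzero:
  fixes v :: "'a::field vec"
  assumes "f \<in> carrier_vec n" "v \<in> carrier_vec n" "f \<bullet> v \<noteq> 0"
  shows "f \<noteq> 0\<^sub>v n" "v \<noteq> 0\<^sub>v n"
  using assms by auto

lemma transv_power_neq_1:
  fixes v :: "'a::{field,finite} vec"
  assumes "v \<in> carrier_vec n" "f \<in> carrier_vec n" "v \<noteq> 0\<^sub>v n" "f \<noteq> 0\<^sub>v n" "f \<bullet> v = 0" "of_nat M \<noteq> (0::'a)"
  shows "transv v f ^\<^sub>m M \<noteq> 1\<^sub>m n"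
  unfolding transvection_power[OF assms(1,2,5)]
  using assms by (intro transv_neq_1 smult_vec_nonzero) simp_all

text \<open>
  Under these orthogonality relations the commutator is a nontrivial transvection, of order \<open>p\<close>.
\<close>

lemma comm_mat_power_neq_1:
  fixes v :: "'a::{field,finite} vec"
  assumes v: "v \<in> carrier_vec n" "f \<in> carrier_vec n" "f \<bullet> v = 0" "transv v f \<in> carrier (SL n)"
    and w: "w \<in> carrier_vec n" "g \<in> carrier_vec n" "g \<bullet> w = 0" "transv w g \<in> carrier (SL n)"
    and gv: "g \<bullet> v = 0" and fw: "f \<bullet> w \<noteq> 0"
    and g0: "g \<noteq> 0\<^sub>v n" and v0: "v \<noteq> 0\<^sub>v n"
  shows "comm_mat n (transv v f) (transv w g) ^\<^sub>m semisimple_exponent TYPE('a) n \<noteq> 1\<^sub>m n"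
  unfolding comm_mat_transv[OF v w] transvection_commutator_heisenberg[OF v(1-3) w(1-3) gv]
  using v(1) w(2) gv fw g0 v0
  by (intro transv_power_neq_1 smult_vec_nonzero of_nat_semisimple_exponent) simp_all

lemma pow_mat_add:
  fixes A :: "'a::semiring_1 mat"
  assumes A: "A \<in> carrier_mat n n"
  shows "A ^\<^sub>m (k + l) = A ^\<^sub>m k * A ^\<^sub>m l"
proof (induction l)
  case 0
  then show ?case using pow_carrier_mat[OF A, of k] A by simp
next
  case (Suc l)
  then show ?case using A by (simp add: assoc_mult_mat[of _ n n _ n _ n])
qed

lemma pow_mat_mult:
  fixes A :: "'a::semiring_1 mat"
  assumes A: "A \<in> carrier_mat n n"
  shows "A ^\<^sub>m (k * l) = (A ^\<^sub>m k) ^\<^sub>m l"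
proof (induction l)
  case 0
  then show ?case using pow_carrier_mat[OF A, of k] A by simp
next
  case (Suc l)
  have "A ^\<^sub>m (k * Suc l) = A ^\<^sub>m (k * l + k)" by (simp add: add.commute)
  then show ?case unfolding pow_mat_add[OF A] Suc by simp
qed

lemma one_mat_pow [simp]: "1\<^sub>m n ^\<^sub>m k = (1\<^sub>m n :: 'a::semiring_1 mat)"
  by (induction k) simp_all

lemma pow_eq_1_if_coprime:
  fixes A :: "'a::field mat"
  assumes A: "A \<in> carrier_mat n n" and k: "A ^\<^sub>m k = 1\<^sub>m n" and l: "A ^\<^sub>m l = 1\<^sub>m n" and cop: "coprime k l"
  shows "A = 1\<^sub>m n"
proof (cases "k = 0")
  case True
  then have "l = 1" using cop by simp
  then show ?thesis using l A by simp
next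
  case False
  obtain x y where xy: "k * x = l * y + 1"
    using bezout_nat[OF False, of l] cop by auto
  have "A ^\<^sub>m (k * x) = A ^\<^sub>m (l * y) * A" unfolding xy by simp
  then show ?thesis unfolding pow_mat_mult[OF A] k l using A by simp
qed

lemma power_CHAR_minus_1:
  fixes A :: "'a::{field,finite} mat"
  assumes A: "A \<in> carrier_mat n n"
  shows "A ^\<^sub>m (CHAR('a) ^ k) - 1\<^sub>m n = (A - 1\<^sub>m n) ^\<^sub>m (CHAR('a) ^ k)"
proof -
  have "mat_poly n A (([:0, 1:] ^ 1 - [:1:]) ^ (CHAR('a) ^ k)) = A ^\<^sub>m (CHAR('a) ^ k) - 1\<^sub>m n"
    unfolding X_power_minus_const_CHAR_power
    by (simp add: mat_poly_diff[OF A] mat_poly_X_power[OF A] mat_poly_const[OF A])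
  then show ?thesis
    by (simp only: power_one_right mat_poly_power[OF A] mat_poly_diff[OF A] mat_poly_const[OF A]
      mat_poly_X[OF A] one_smult_mat)
qed

lemma semisimple_part_nilpotent:
  fixes x :: "'a::{field,finite} mat"
  assumes "x \<in> carrier (SL n)"
  shows "(x ^\<^sub>m semisimple_exponent TYPE('a) n - 1\<^sub>m n) ^\<^sub>m n = 0\<^sub>m n n"
  using assms by (intro power_minus_1_nilpotent semisimple_exponent_dvd) (simp_all add: SL_carrier_iff)

lemma is_word_map_SL:
  fixes F :: "'a::field mat \<Rightarrow> 'a mat \<Rightarrow> 'a mat"
  assumes "is_word_map (SL n) F" "\<And>x y. x \<in> carrier (SL n) \<Longrightarrow> y \<in> carrier (SL n) \<Longrightarrow> F x y = H x y"
  shows "is_word_map (SL n) H"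
  using assms unfolding is_word_map_def by metis

text \<open>
  Here transvections need not be conjugate, but every transvection \<open>h\<close> is the \<open>M\<close>-th power of a
  power of itself.
\<close>

theorem word_values_SL2:
  "\<exists>w\<in>carrier (free_group 2). word_values (SL 2 :: 'a::{field,finite} mat monoid) 2 w = {1\<^sub>m 2} \<union> transvections 2"
proof -
  let ?G = "SL 2 :: 'a mat monoid" and ?M = "semisimple_exponent TYPE('a) 2"
  interpret G: Group.group ?G by (rule group_SL)
  obtain w where w: "w \<in> carrier (free_group 2)"
    "\<And>x y g. x \<in> carrier ?G \<Longrightarrow> y \<in> carrier ?G \<Longrightarrow> g 1 = x \<Longrightarrow> g 2 = y \<Longrightarrow> word_eval ?G g w = x [^]\<^bsub>?G\<^esub> ?M"
    using is_word_map_pow[OF group_SL is_word_map_proj(1)[OF group_SL], of 2 ?M]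
    unfolding is_word_map_def by blast
  have val: "x ^\<^sub>m ?M \<in> {1\<^sub>m 2} \<union> transvections 2" if x: "x \<in> carrier ?G" for x
  proof -
    let ?z = "x ^\<^sub>m ?M"
    have z: "?z \<in> carrier ?G" by (rule SL_pow_closed[OF x])
    have nil: "(?z - 1\<^sub>m 2) ^\<^sub>m 2 = 0\<^sub>m 2 2" by (rule semisimple_part_nilpotent[OF x])
    have zc: "?z - 1\<^sub>m 2 \<in> carrier_mat 2 2" using SL_carrier_mat[OF z] by (intro minus_carrier_mat) simp
    obtain v f where "v \<in> carrier_vec 2" "f \<in> carrier_vec 2" "?z - 1\<^sub>m 2 = outer_prod v f"
      using nilpotent_power_outer_prod[OF zc nil] zc by auto
    then show ?thesis using unipotent_in_transvections[OF z _ _ _ nil] by blast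
  qed
  have "word_values ?G 2 w = {1\<^sub>m 2} \<union> transvections 2"
  proof (intro Set.equalityI subsetI)
    fix h assume "h \<in> word_values ?G 2 w"
    then obtain g where g: "g \<in> {1..2} \<rightarrow> carrier ?G"
      "h = word_eval ?G g w \<or> h = inv\<^bsub>?G\<^esub> (word_eval ?G g w)" unfolding word_values_def by blast
    have g12: "g 1 \<in> carrier ?G" "g 2 \<in> carrier ?G" using g(1) by auto
    have "word_eval ?G g w \<in> {1\<^sub>m 2} \<union> transvections 2"
      using w(2)[OF g12] val[OF g12(1)] g12(1) by simp
    then show "h \<in> {1\<^sub>m 2} \<union> transvections 2" using g(2) transvections_inv G.inv_one by auto
  next
    fix h :: "'a mat" assume "h \<in> {1\<^sub>m 2} \<union> transvections 2"
    then obtain v f where vf: "v \<in> carrier_vec 2" "f \<in> carrier_vec 2" "f \<bullet> v = 0" "h = transv v f" "h \<in> carrier ?G"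
      by (rule transvections_transvE)
    have hc: "h \<in> carrier_mat 2 2" using vf by simp
    (* An inverse of M modulo p exists since h has order p and M is prime to p. *)
    obtain k where k: "[?M * k = 1] (mod CHAR('a))"
      using cong_solve_coprime_nat[OF coprime_CHAR[OF of_nat_semisimple_exponent, of 2 1, where 'a='a]] by auto
    have "(h ^\<^sub>m k) ^\<^sub>m ?M = transv (of_nat (k * ?M) \<cdot>\<^sub>v v) f"
      unfolding pow_mat_mult[OF hc, symmetric] unfolding vf(4) transvection_power[OF vf(1-3)] ..
    also have "of_nat (k * ?M) = (of_nat 1 :: 'a)"
      unfolding of_nat_eq_iff_cong_CHAR using k by (simp add: mult.commute)
    finally have e: "(h ^\<^sub>m k) ^\<^sub>m ?M = h" using vf(4) by simp
    have hk: "h ^\<^sub>m k \<in> carrier ?G" by (rule SL_pow_closed[OF vf(5)])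
    have "word_eval ?G (\<lambda>_. h ^\<^sub>m k) w = h" using w(2)[OF hk hk, of "\<lambda>_. h ^\<^sub>m k"] hk e by simp
    moreover have "(\<lambda>_. h ^\<^sub>m k) \<in> {1..2} \<rightarrow> carrier ?G" using hk by simp
    ultimately show "h \<in> word_values ?G 2 w"
      unfolding word_values_def
      by (intro CollectI bexI[of _ "\<lambda>_. h ^\<^sub>m k"] disjI1) (simp_all only:)
  qed
  then show ?thesis using w(1) by blast
qed

text \<open>
  For \<open>z = x\<^sup>M\<close> one has \<open>z\<^sup>p - 1 = (z - 1)\<^sup>p = (z - 1)\<^sup>n\<^sup>-\<^sup>1\<close>, which has rank at most one. A full
  Jordan block shows that the word is not trivial.
\<close>

lemma SL_power_word_values:
  assumes n: "n = CHAR('a::{field,finite}) + 1" "n \<ge> 3"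
  shows "\<exists>w\<in>carrier (free_group 2). word_values (SL n :: 'a mat monoid) 2 w = {1\<^sub>m n} \<union> transvections n"
proof (rule word_values_transvections[OF n(2)])
  let ?p = "CHAR('a)" and ?M = "semisimple_exponent TYPE('a) n"
  show "is_word_map (SL n) (\<lambda>x (y :: 'a mat). x ^\<^sub>m (?M * ?p))"
    by (rule is_word_map_SL[OF is_word_map_pow[OF group_SL is_word_map_proj(1)[OF group_SL]]]) simp
  have pow_p: "z ^\<^sub>m ?p - 1\<^sub>m n = (z - 1\<^sub>m n) ^\<^sub>m ?p" if "z \<in> carrier_mat n n" for z :: "'a mat"
    using power_CHAR_minus_1[OF that, of 1] by simp
  show "x ^\<^sub>m (?M * ?p) \<in> {1\<^sub>m n} \<union> transvections n" if x: "x \<in> carrier (SL n)" "y \<in> carrier (SL n)" for x y :: "'a mat"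
  proof -
    let ?N = "x ^\<^sub>m ?M - 1\<^sub>m n"
    note c = SL_carrier_mat[OF x(1)]
    have Nc: "?N \<in> carrier_mat n n" using pow_carrier_mat[OF c] by (intro minus_carrier_mat) simp
    have nil: "?N ^\<^sub>m n = 0\<^sub>m n n" by (rule semisimple_part_nilpotent[OF x(1)])
    obtain v f where vf: "v \<in> carrier_vec n" "f \<in> carrier_vec n" "?N ^\<^sub>m (n - 1) = outer_prod v f"
      using nilpotent_power_outer_prod[OF Nc nil] n by auto
    have e: "x ^\<^sub>m (?M * ?p) - 1\<^sub>m n = ?N ^\<^sub>m (n - 1)"
      unfolding pow_mat_mult[OF c] pow_p[OF pow_carrier_mat[OF c]] using n(1) by simp
    have "(?N ^\<^sub>m (n - 1)) ^\<^sub>m n = (?N ^\<^sub>m n) ^\<^sub>m (n - 1)"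
      unfolding pow_mat_mult[OF Nc, symmetric] by (simp only: mult.commute)
    also have "\<dots> = 0\<^sub>m n n"
      unfolding nil using n by (cases "n - 1") auto
    finally show ?thesis
      using unipotent_in_transvections[OF SL_pow_closed[OF x(1)] vf(1,2), of "?M * ?p" n] vf(3) e by simp
  qed
  define J where "J = jordan_block n (1::'a)"
  have J: "J \<in> carrier_mat n n" by (simp add: J_def)
  have "upper_triangular J" by (auto simp: J_def jordan_block_def)
  then have "det J = 1" using det_upper_triangular[OF _ J] by (simp add: prod_list_diag_prod J_def jordan_block_def)
  then have JSL: "J \<in> carrier (SL n)" using J by (simp add: SL_carrier_iff)
  have "J ^\<^sub>m (?M * ?p) \<noteq> 1\<^sub>m n"
  proof
    assume 1: "J ^\<^sub>m (?M * ?p) = 1\<^sub>m n"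
    have J0: "J - 1\<^sub>m n = jordan_block n 0" by (intro eq_matI) (auto simp: J_def jordan_block_def)
    have p: "?p > 1" using prime_CHAR_finite_field[where 'a='a] by (rule prime_gt_1_nat)
    have "J ^\<^sub>m ?p ^ n - 1\<^sub>m n = jordan_block n 0 ^\<^sub>m (?p ^ n)"
      unfolding power_CHAR_minus_1[OF J] J0 ..
    also have "\<dots> = 0\<^sub>m n n"
      unfolding jordan_block_zero_pow using power_gt_expt[of ?p n] p by (intro eq_matI) auto
    finally have z: "J ^\<^sub>m ?p ^ n - 1\<^sub>m n = 0\<^sub>m n n" .
    have Jp: "J ^\<^sub>m ?p ^ n = 1\<^sub>m n"
    proof (rule eq_matI)
      fix i j assume "i < dim_row (1\<^sub>m n :: 'a mat)" "j < dim_col (1\<^sub>m n :: 'a mat)"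
      then show "(J ^\<^sub>m ?p ^ n) $$ (i, j) = 1\<^sub>m n $$ (i, j)"
        using arg_cong[OF z, of "\<lambda>M. M $$ (i, j)"] pow_carrier_mat[OF J, of "?p ^ n"] by simp
    qed (use J in simp_all)
    have "(J ^\<^sub>m ?p) ^\<^sub>m (?p ^ n) = 1\<^sub>m n"
      unfolding pow_mat_mult[OF J, symmetric] mult.commute[of ?p] unfolding pow_mat_mult[OF J] Jp by simp
    moreover have "(J ^\<^sub>m ?p) ^\<^sub>m ?M = 1\<^sub>m n"
      unfolding pow_mat_mult[OF J, symmetric] using 1 by (simp only: mult.commute)
    ultimately have "J ^\<^sub>m ?p = 1\<^sub>m n"
      using pow_eq_1_if_coprime[OF pow_carrier_mat[OF J] _ _ coprime_CHAR[OF of_nat_semisimple_exponent]] by blast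
    then have "jordan_block n 0 ^\<^sub>m ?p = (0\<^sub>m n n :: 'a mat)"
      using pow_p[OF J] unfolding J0 by (metis minus_r_inv_mat one_carrier_mat)
    then have "(jordan_block n 0 ^\<^sub>m ?p) $$ (0, ?p) = (0\<^sub>m n n :: 'a mat) $$ (0, ?p)" by simp
    then show False unfolding jordan_block_zero_pow using n by simp
  qed
  then show "\<exists>x\<in>carrier (SL n :: 'a mat monoid). \<exists>y\<in>carrier (SL n :: 'a mat monoid). x ^\<^sub>m (?M * ?p) \<noteq> 1\<^sub>m n"
    using JSL by auto
qed

section \<open>Dimension 3 in odd characteristic\<close>

lemma sum_up_to_3: "(\<Sum>i = 0..<3::nat. h i) = h 0 + h 1 + h (2::nat)"
  by (simp add: numeral_3_eq_3 numeral_2_eq_2)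

definition mat3 :: "'a list list \<Rightarrow> 'a mat" where
  "mat3 L = mat 3 3 (\<lambda>(i, j). L ! i ! j)"

lemma mat3_carrier [simp]: "mat3 L \<in> carrier_mat 3 3" "dim_row (mat3 L) = 3" "dim_col (mat3 L) = 3"
  by (simp_all add: mat3_def)

lemma mat3_index [simp]: "i < 3 \<Longrightarrow> j < 3 \<Longrightarrow> mat3 L $$ (i, j) = L ! i ! j"
  by (simp add: mat3_def)

lemma less_3_cases: "(i::nat) < 3 \<Longrightarrow> i = 0 \<or> i = 1 \<or> i = 2"
  by auto

lemma mat3_mult:
  "mat3 [[a0, a1, a2], [a3, a4, a5], [a6, a7, a8]] * mat3 [[b0, b1, b2], [b3, b4, b5], [b6, b7, b8]] =
   mat3 [[a0 * b0 + a1 * b3 + a2 * b6, a0 * b1 + a1 * b4 + a2 * b7, a0 * b2 + a1 * b5 + a2 * b8],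
     [a3 * b0 + a4 * b3 + a5 * b6, a3 * b1 + a4 * b4 + a5 * b7, a3 * b2 + a4 * b5 + a5 * b8],
     [a6 * b0 + a7 * b3 + a8 * b6, a6 * b1 + a7 * b4 + a8 * b7, a6 * b2 + a7 * b5 + (a8::'a::semiring_0) * b8]]"
  by (rule eq_matI) (auto dest!: less_3_cases simp: scalar_prod_def sum_up_to_3)

lemma mat3_one: "1\<^sub>m 3 = mat3 [[1, 0, 0], [0, 1, 0], [0, 0, 1]]"
  by (rule eq_matI) (auto dest!: less_3_cases)

definition vec3 :: "'a list \<Rightarrow> 'a vec" where
  "vec3 L = vec 3 (\<lambda>i. L ! i)"

lemma vec3_carrier [simp]: "vec3 L \<in> carrier_vec 3" "dim_vec (vec3 L) = 3"
  by (simp_all add: vec3_def)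

lemma vec3_index [simp]: "i < 3 \<Longrightarrow> vec3 L $ i = L ! i"
  by (simp add: vec3_def)

lemma mat3_mult_vec:
  "mat3 [[a0, a1, a2], [a3, a4, a5], [a6, a7, a8]] *\<^sub>v vec3 [x, y, z] =
   vec3 [a0 * x + a1 * y + a2 * z, a3 * x + a4 * y + a5 * z, a6 * x + a7 * y + (a8::'a::semiring_0) * z]"
  by (rule eq_vecI) (auto dest!: less_3_cases simp: scalar_prod_def sum_up_to_3)

lemma scalar_prod_vec3: "vec3 [a, b, c] \<bullet> vec3 [x, y, z] = a * x + b * y + c * (z::'a::semiring_0)"
  by (simp add: scalar_prod_def sum_up_to_3)

lemma mat3_transpose:
  "(mat3 [[a0, a1, a2], [a3, a4, a5], [a6, a7, a8]])\<^sup>T = mat3 [[a0, a3, a6], [a1, a4, a7], [a2, a5, a8]]"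
  by (rule eq_matI) (auto dest!: less_3_cases)

lemma det_mat_2: "det (mat 2 2 h) = h (0, 0) * h (1, 1) - h (0, 1) * (h (1, 0) :: 'a::comm_ring_1)"
  by (subst det_2) simp_all

lemma det_mat3:
  fixes a0 :: "'a::comm_ring_1"
  shows "det (mat3 [[a0, a1, a2], [a3, a4, a5], [a6, a7, a8]]) =
    a0 * (a4 * a8 - a5 * a7) - a1 * (a3 * a8 - a5 * a6) + a2 * (a3 * a7 - a4 * a6)"
proof -
  let ?A = "mat3 [[a0, a1, a2], [a3, a4, a5], [a6, a7, a8]]"
  have "{..<3::nat} = {0, 1, 2}" by auto
  then have "det ?A = (\<Sum>j\<in>{0, 1, 2::nat}. ?A $$ (0, j) * cofactor ?A 0 j)"
    using laplace_expansion_row[of ?A 3 0] by simp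
  also have "\<dots> = a0 * cofactor ?A 0 0 + a1 * cofactor ?A 0 1 + a2 * cofactor ?A 0 2" by simp
  also have "cofactor ?A 0 0 = a4 * a8 - a5 * a7"
    by (simp add: cofactor_def mat_delete_def det_mat_2)
  also have "cofactor ?A 0 1 = a5 * a6 - a3 * a8"
    by (simp add: cofactor_def mat_delete_def det_mat_2)
  also have "cofactor ?A 0 2 = a3 * a7 - a4 * a6"
    by (simp add: cofactor_def mat_delete_def det_mat_2)
  finally show ?thesis by (simp add: algebra_simps)
qed

lemma smult_one_mat_mult_vec:
  fixes v :: "'a::comm_ring_1 vec"
  assumes "v \<in> carrier_vec n"
  shows "(c \<cdot>\<^sub>m 1\<^sub>m n) *\<^sub>v v = c \<cdot>\<^sub>v v"
proof (rule eq_vecI)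
  fix i assume "i < dim_vec (c \<cdot>\<^sub>v v)"
  then show "((c \<cdot>\<^sub>m 1\<^sub>m n) *\<^sub>v v) $ i = (c \<cdot>\<^sub>v v) $ i"
    using assms by (simp add: scalar_prod_def if_distrib[of "\<lambda>a. c * a * _"] sum.If_cases)
qed (use assms in simp)

text \<open>
  The kernel of \<open>N\<close> is a line, and \<open>x\<close> acts on it by some scalar \<open>a\<close>. Any vector killed by an
  irreducible polynomial \<open>f\<close> is moved by a power of \<open>N\<close> to a nonzero vector of that line, still
  killed by \<open>f\<close>; so \<open>f\<close> divides \<open>X - a\<close>. Thus \<open>a\<close> is the only eigenvalue of \<open>x\<close>.
\<close>

lemma one_dim_kernel_scalar_power:
  fixes x :: "'a::{field,finite} mat"
  assumes x: "x \<in> carrier_mat n n" and n: "n > 0" and N: "N = mat_poly n x h" and nil: "N ^\<^sub>m n = 0\<^sub>m n n"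
    and ker: "card {v \<in> carrier_vec n. N *\<^sub>v v = 0\<^sub>v n} \<le> CARD('a)" and k: "n \<le> CHAR('a) ^ k"
  shows "\<exists>c. x ^\<^sub>m (CHAR('a) ^ k) = c \<cdot>\<^sub>m 1\<^sub>m n"
proof -
  let ?K = "{v \<in> carrier_vec n. N *\<^sub>v v = 0\<^sub>v n}"
  have Nc: "N \<in> carrier_mat n n" unfolding N using x by simp
  have climb: "\<exists>j. N ^\<^sub>m j *\<^sub>v u \<noteq> 0\<^sub>v n \<and> N *\<^sub>v (N ^\<^sub>m j *\<^sub>v u) = 0\<^sub>v n"
    if u: "u \<in> carrier_vec n" "u \<noteq> 0\<^sub>v n" for u
  proof -
    define m where "m = (LEAST m. N ^\<^sub>m m *\<^sub>v u = 0\<^sub>v n)"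
    have "N ^\<^sub>m n *\<^sub>v u = 0\<^sub>v n" unfolding nil by (rule zero_mat_mult_vec[OF u(1)])
    then have m: "N ^\<^sub>m m *\<^sub>v u = 0\<^sub>v n" unfolding m_def by (rule LeastI)
    have m_min: "N ^\<^sub>m j *\<^sub>v u \<noteq> 0\<^sub>v n" if "j < m" for j using not_less_Least that unfolding m_def by blast
    have "m \<noteq> 0"
    proof
      assume "m = 0"
      then show False using m u Nc by simp
    qed
    then obtain j where j: "m = Suc j" by (cases m) auto
    have "N ^\<^sub>m Suc j = N * N ^\<^sub>m j"
      unfolding N mat_poly_power[OF x, symmetric] mat_poly_mult[OF x, symmetric] by simp
    then have "N *\<^sub>v (N ^\<^sub>m j *\<^sub>v u) = 0\<^sub>v n"
      using m assoc_square_vec[OF Nc pow_carrier_mat[OF Nc] u(1)] unfolding j by metis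
    then show ?thesis using m_min[of j] unfolding j by blast
  qed
  have "unit_vec n 0 \<in> carrier_vec n" "unit_vec n 0 \<noteq> (0\<^sub>v n :: 'a vec)" using n by simp_all
  from climb[OF this] obtain j0 where j0: "N ^\<^sub>m j0 *\<^sub>v unit_vec n 0 \<noteq> 0\<^sub>v n"
    "N *\<^sub>v (N ^\<^sub>m j0 *\<^sub>v unit_vec n 0) = 0\<^sub>v n" by blast
  define e where "e = N ^\<^sub>m j0 *\<^sub>v unit_vec n 0"
  have e: "e \<in> carrier_vec n" "e \<noteq> 0\<^sub>v n" "N *\<^sub>v e = 0\<^sub>v n"
    using j0 mult_mat_vec_carrier[OF pow_carrier_mat[OF Nc] unit_vec_carrier] by (auto simp: e_def)
  have finK: "finite ?K" by (rule finite_subset[OF _ finite_carrier_vec[of n]]) simp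
  have sub: "(\<lambda>a. a \<cdot>\<^sub>v e) ` UNIV \<subseteq> ?K"
    using e Nc by (auto simp: mult_mat_vec[of N n n])
  have "inj (\<lambda>a. a \<cdot>\<^sub>v e)"
  proof (rule injI)
    fix a b assume eq: "a \<cdot>\<^sub>v e = b \<cdot>\<^sub>v e"
    obtain i where "i < n" "e $ i \<noteq> 0" using e(1,2) by (rule vec_neq_zeroE)
    then show "a = b" using arg_cong[OF eq, of "\<lambda>v. v $ i"] e(1) by simp
  qed
  then have "card ((\<lambda>a. a \<cdot>\<^sub>v e) ` UNIV) = CARD('a)" by (simp add: card_image)
  then have K: "(\<lambda>a. a \<cdot>\<^sub>v e) ` UNIV = ?K" using ker card_mono[OF finK sub] by (intro card_subset_eq[OF finK sub]) simp
  have comm: "N *\<^sub>v (mat_poly n x g *\<^sub>v v) = mat_poly n x g *\<^sub>v (N *\<^sub>v v)" if "v \<in> carrier_vec n" for g v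
    unfolding N mat_poly_mult_vec[OF x that, symmetric] by (simp only: mult.commute)
  have "x *\<^sub>v e \<in> ?K"
    using comm[OF e(1), of "[:0, 1:]"] e x by (simp add: mult_mat_zero_vec[OF x])
  then obtain a where a: "x *\<^sub>v e = a \<cdot>\<^sub>v e" using K by blast
  have kill: "mat_poly n x ([:0, 1:] ^ 1 - [:a:]) *\<^sub>v e = 0\<^sub>v n"
  proof -
    have "mat_poly n x ([:0, 1:] ^ 1 - [:a:]) *\<^sub>v e = x *\<^sub>v e - a \<cdot>\<^sub>v e"
      using x e(1) by (simp only: power_one_right mat_poly_diff[OF x] mat_poly_X[OF x] mat_poly_const[OF x])
        (simp add: minus_mult_distrib_mat_vec[of _ n n] smult_one_mat_mult_vec)
    then show ?thesis using a e(1) by simp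
  qed
  have "f dvd [:0, 1:] ^ 1 - [:a:]"
    if f: "prime_elem f" and u: "u \<in> carrier_vec n" "u \<noteq> 0\<^sub>v n" "mat_poly n x f *\<^sub>v u = 0\<^sub>v n" for f u
  proof -
    obtain j where j: "N ^\<^sub>m j *\<^sub>v u \<noteq> 0\<^sub>v n" "N *\<^sub>v (N ^\<^sub>m j *\<^sub>v u) = 0\<^sub>v n" using climb[OF u(1,2)] by blast
    have "N ^\<^sub>m j *\<^sub>v u \<in> ?K" using j(2) mult_mat_vec_carrier[OF pow_carrier_mat[OF Nc] u(1)] by simp
    then obtain c where c: "N ^\<^sub>m j *\<^sub>v u = c \<cdot>\<^sub>v e" using K by blast
    have c0: "c \<noteq> 0" using j(1) e(1) unfolding c by auto
    have "mat_poly n x f *\<^sub>v (N ^\<^sub>m j *\<^sub>v u) = mat_poly n x (f * h ^ j) *\<^sub>v u"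
      unfolding N mat_poly_power[OF x, symmetric] mat_poly_mult_vec[OF x u(1)] ..
    also have "\<dots> = 0\<^sub>v n" by (rule mat_poly_kernel_dvd[OF x u(1) _ u(3)]) (rule dvd_triv_left)
    finally have "c \<cdot>\<^sub>v (mat_poly n x f *\<^sub>v e) = 0\<^sub>v n"
      unfolding c using mult_mat_vec[OF mat_poly_carrier[OF x] e(1)] by simp
    then have "mat_poly n x f *\<^sub>v e = 0\<^sub>v n"
      using smult_vec_nonzero[OF mat_poly_vec_carrier[OF x e(1)] _ c0] by blast
    then show ?thesis using mat_poly_prime_kernel[OF x e(1,2) f _ kill] by blast
  qed
  from scalar_power_if_prime_kernels_dvd[OF x k this] show ?thesis by auto
qed

lemma card_kernel_le:
  fixes N :: "'a::{field,finite} mat"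
  assumes N: "N \<in> carrier_mat 3 3"
    and not_outer: "\<And>v f. v \<in> carrier_vec 3 \<Longrightarrow> f \<in> carrier_vec 3 \<Longrightarrow> N \<noteq> outer_prod v f"
  shows "card {v \<in> carrier_vec 3. N *\<^sub>v v = 0\<^sub>v 3} \<le> CARD('a)"
proof (rule ccontr)
  assume "\<not> ?thesis"
  moreover have "CARD('a)\<^sup>2 \<le> card ((\<lambda>v. N *\<^sub>v v) ` carrier_vec 3)"
    using outer_prod_if_small_image[OF N] not_outer by (meson not_le)
  ultimately have "CARD('a)\<^sup>2 * CARD('a) < card ((\<lambda>v. N *\<^sub>v v) ` carrier_vec 3) *
      card {v \<in> carrier_vec 3. N *\<^sub>v v = 0\<^sub>v 3}"
    using card_gt_1[where 'a='a] by (intro mult_le_less_imp_less) auto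
  then show False unfolding card_image_mult_card_kernel[OF N] by (simp add: power2_eq_square power3_eq_cube)
qed

lemma CHAR_power_ge: "n \<le> CHAR('a::{field,finite}) ^ n"
proof -
  have "CHAR('a) > Suc 0" using prime_gt_1_nat[OF prime_CHAR_finite_field[where 'a='a]] by simp
  then show ?thesis using power_gt_expt less_imp_le by blast
qed

lemma mat_diff_eq_0_imp_eq:
  fixes A :: "'a::ab_group_add mat"
  assumes "A \<in> carrier_mat n m" "B \<in> carrier_mat n m" "A - B = 0\<^sub>m n m"
  shows "A = B"
proof (rule eq_matI)
  fix i j assume "i < dim_row B" "j < dim_col B"
  then show "A $$ (i, j) = B $$ (i, j)" using arg_cong[OF assms(3), of "\<lambda>M. M $$ (i, j)"] assms(1,2) by simp
qed (use assms in auto)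

lemma SL_inv_eqI:
  fixes A :: "'a::field mat"
  assumes "A \<in> carrier (SL n)" "B \<in> carrier (SL n)" "B * A = 1\<^sub>m n"
  shows "inv\<^bsub>SL n\<^esub> A = B"
  using group.inv_equality[OF group_SL _ assms(1,2)] assms(3) by simp

lemma SL_powers_commute:
  fixes x :: "'a::field mat"
  assumes "x \<in> carrier (SL n)"
  shows "x ^\<^sub>m k * x ^\<^sub>m l = x ^\<^sub>m l * x ^\<^sub>m k"
  using pow_mat_add[OF SL_carrier_mat[OF assms]] by (metis add.commute)

lemma conj_mat_scalar:
  fixes y :: "'a::field mat"
  assumes "y \<in> carrier (SL n)"
  shows "conj_mat n y (c \<cdot>\<^sub>m 1\<^sub>m n) = c \<cdot>\<^sub>m 1\<^sub>m n"
  using assms by (intro conj_mat_commuting scalar_mat_commutes) (simp_all add: SL_carrier_mat)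

lemma is_word_map_comm_mat:
  fixes F H :: "'a::field mat \<Rightarrow> 'a mat \<Rightarrow> 'a mat"
  assumes "is_word_map (SL n) F" "is_word_map (SL n) H"
  shows "is_word_map (SL n) (\<lambda>x y. comm_mat n (F x y) (H x y))"
  unfolding comm_mat_def using assms
  by (auto intro!: is_word_map_mult[OF group_SL, unfolded SL_simps] is_word_map_inv[OF group_SL])

lemma is_word_map_conj_mat:
  fixes F H :: "'a::field mat \<Rightarrow> 'a mat \<Rightarrow> 'a mat"
  assumes "is_word_map (SL n) F" "is_word_map (SL n) H"
  shows "is_word_map (SL n) (\<lambda>x y. conj_mat n (F x y) (H x y))"
  unfolding conj_mat_def using assms
  by (auto intro!: is_word_map_mult[OF group_SL, unfolded SL_simps] is_word_map_inv[OF group_SL])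

lemma is_word_map_pow_mat:
  fixes F :: "'a::field mat \<Rightarrow> 'a mat \<Rightarrow> 'a mat"
  assumes "is_word_map (SL n) F"
    and "\<And>x y. x \<in> carrier (SL n) \<Longrightarrow> y \<in> carrier (SL n) \<Longrightarrow> F x y \<in> carrier (SL n)"
  shows "is_word_map (SL n) (\<lambda>x y. F x y ^\<^sub>m k)"
  by (rule is_word_map_SL[OF is_word_map_pow[OF group_SL assms(1)]]) (simp add: assms(2))

text \<open>
  The word is the \<open>M\<close>-th power of the commutator of two conjugates of \<open>z = x\<^sup>M\<close>, by the conjugates
  \<open>t\<^sup>y\<close> and \<open>t\<^sup>(\<^sup>y\<^sup>y\<^sup>)\<close> of a \<open>p\<close>-power \<open>t\<close> of \<open>x\<close>. If \<open>z - 1\<close> has rank 2, then \<open>t\<close> is scalar and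
  the conjugates coincide.
\<close>

theorem word_values_SL3_odd:
  assumes odd: "CHAR('a::{field,finite}) \<noteq> 2"
  shows "\<exists>w\<in>carrier (free_group 2). word_values (SL 3 :: 'a mat monoid) 2 w = {1\<^sub>m 3} \<union> transvections 3"
proof -
  let ?G = "SL 3 :: 'a mat monoid" and ?M = "semisimple_exponent TYPE('a) 3" and ?P = "CHAR('a) ^ 3"
  define z where "z = (\<lambda>x :: 'a mat. x ^\<^sub>m ?M)"
  define t where "t = (\<lambda>x :: 'a mat. x ^\<^sub>m ?P)"
  define F where "F = (\<lambda>x y. comm_mat 3 (conj_mat 3 (conj_mat 3 y (t x)) (z x))
    (conj_mat 3 (conj_mat 3 (y * y) (t x)) (z x)) ^\<^sub>m ?M)"
  have zG: "z x \<in> carrier ?G" and tG: "t x \<in> carrier ?G" if "x \<in> carrier ?G" for x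
    using SL_pow_closed[OF that] by (simp_all add: z_def t_def)
  have hG: "conj_mat 3 (conj_mat 3 y (t x)) (z x) \<in> carrier ?G"
    if "x \<in> carrier ?G" "y \<in> carrier ?G" for x y
    using that by (intro conj_mat_closed zG tG)
  show ?thesis
  proof (rule word_values_transvections[of 3 F])
    have wz: "is_word_map ?G (\<lambda>x y. z x)" "is_word_map ?G (\<lambda>x y. t x)"
      unfolding z_def t_def by (rule is_word_map_pow_mat[OF is_word_map_proj(1)[OF group_SL]], assumption)+
    have wy: "is_word_map ?G (\<lambda>x y. y)" "is_word_map ?G (\<lambda>x y. y * y)"
      using is_word_map_mult[OF group_SL is_word_map_proj(2)[OF group_SL] is_word_map_proj(2)[OF group_SL]]
        is_word_map_proj(2)[OF group_SL] by simp_all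
    show "is_word_map ?G F" unfolding F_def
      by (intro is_word_map_pow_mat is_word_map_comm_mat is_word_map_conj_mat wz wy comm_mat_closed hG SL_mult_closed)
    show "F x y \<in> {1\<^sub>m 3} \<union> transvections 3" if x: "x \<in> carrier ?G" and y: "y \<in> carrier ?G" for x y
    proof (cases "z x \<in> {1\<^sub>m 3} \<union> transvections 3")
      case True
      then show ?thesis unfolding F_def
        by (intro comm_mat_power_transvections conj_mat_transvections conj_mat_closed SL_mult_closed tG x y) simp_all
    next
      case False
      let ?N = "z x - 1\<^sub>m 3"
      note xc = SL_carrier_mat[OF x]
      have Nc: "?N \<in> carrier_mat 3 3" using SL_carrier_mat[OF zG[OF x]] by (intro minus_carrier_mat) simp
      have nil: "?N ^\<^sub>m 3 = 0\<^sub>m 3 3" unfolding z_def by (rule semisimple_part_nilpotent[OF x])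
      have N: "?N = mat_poly 3 x ([:0, 1:] ^ ?M - 1)"
        by (simp only: z_def mat_poly_diff[OF xc] mat_poly_X_power[OF xc] mat_poly_1[OF xc])
      have "?N \<noteq> outer_prod v f" if "v \<in> carrier_vec 3" "f \<in> carrier_vec 3" for v f
        using unipotent_in_transvections[OF zG[OF x] that _ nil] False by blast
      from one_dim_kernel_scalar_power[OF xc _ N nil card_kernel_le[OF Nc this] CHAR_power_ge]
      obtain c where c: "t x = c \<cdot>\<^sub>m 1\<^sub>m 3" unfolding t_def by auto
      have "conj_mat 3 y' (t x) = t x" if "y' \<in> carrier ?G" for y'
        unfolding c by (rule conj_mat_scalar[OF that])
      then have "F x y = comm_mat 3 (conj_mat 3 (t x) (z x)) (conj_mat 3 (t x) (z x)) ^\<^sub>m ?M"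
        unfolding F_def using y SL_mult_closed by metis
      also have "\<dots> = 1\<^sub>m 3" using comm_mat_self[OF conj_mat_closed[OF tG[OF x] zG[OF x]]] by simp
      finally show ?thesis by simp
    qed
    let ?v = "vec3 [0, 1, 0] :: 'a vec" and ?f = "vec3 [0, 0, 1] :: 'a vec"
    (* For x = D U the power z is a power of the transvection U and t = D. The base change Y is
       such that D conjugated by Y and by Y Y moves U to two transvections that do not commute. *)
    define D where "D = mat3 [[1, 0, 0], [0, -1, 0], [0, 0, -1 :: 'a]]"
    define U where "U = transv ?v ?f"
    define Y where "Y = mat3 [[0, 1, 0], [-1, 1, 0], [1, 0, 1 :: 'a]]"
    define Y' where "Y' = mat3 [[1, -1, 0], [1, 0, 0], [-1, 1, 1 :: 'a]]"
    have fv: "?f \<bullet> ?v = 0" by (simp add: scalar_prod_vec3)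
    have D: "D \<in> carrier ?G" and Y: "Y \<in> carrier ?G" and Y': "Y' \<in> carrier ?G"
      by (simp_all add: SL_carrier_iff D_def Y_def Y'_def det_mat3)
    have U: "U \<in> carrier ?G" unfolding U_def by (rule transv_in_SL) (simp_all add: fv)
    have DD: "D * D = 1\<^sub>m 3" by (simp add: D_def mat3_mult mat3_one)
    have U3: "U = mat3 [[1, 0, 0], [0, 1, 1], [0, 0, 1]]"
      by (rule eq_matI) (auto dest!: less_3_cases simp: U_def transv_def)
    have DU: "D * U = U * D" by (simp add: D_def U3 mat3_mult)
    define x where "x = D * U"
    have x: "x \<in> carrier ?G" unfolding x_def by (rule SL_mult_closed[OF D U])
    have xpow: "x ^\<^sub>m k = D ^\<^sub>m k * U ^\<^sub>m k" for k
      using monoid.pow_mult_distrib[OF group.is_monoid[OF group_SL] _ D U, of k] DU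
      using SL_pow[OF D] SL_pow[OF U] SL_pow[OF x] unfolding x_def by (simp only: SL_simps)
    have Dpow: "D ^\<^sub>m k = (if even k then 1\<^sub>m 3 else D)" for k
      using DD SL_carrier_mat[OF D] by (induction k) auto
    have Upow: "U ^\<^sub>m k = transv (of_nat k \<cdot>\<^sub>v ?v) ?f" for k
      unfolding U_def by (rule transvection_power[of _ 3]) (simp_all add: fv)
    have oddq: "odd CARD('a)"
      using CARD_eq_CHAR_power[where 'a='a] odd prime_odd_nat[OF prime_CHAR_finite_field[where 'a='a]]
        prime_ge_2_nat[OF prime_CHAR_finite_field[where 'a='a]] by fastforce
    have oddP: "odd ?P"
      using odd prime_odd_nat[OF prime_CHAR_finite_field[where 'a='a]]
        prime_ge_2_nat[OF prime_CHAR_finite_field[where 'a='a]] by fastforce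
    have "even (CARD('a) ^ 1 - 1)" using oddq by simp
    then have evM: "even ?M" using semisimple_exponent_dvd[of 1 3, where 'a='a] by (meson dvd_trans le_numeral_extra(4) one_le_numeral)
    have zx: "z x = transv (of_nat ?M \<cdot>\<^sub>v ?v) ?f"
      unfolding z_def xpow Dpow Upow using evM by (simp add: left_mult_one_mat[of _ 3 3])
    have "U ^\<^sub>m ?P = 1\<^sub>m 3"
    proof -
      have "of_nat ?P \<cdot>\<^sub>v ?v = 0\<^sub>v 3" by (intro eq_vecI) simp_all
      then show ?thesis unfolding Upow by simp
    qed
    then have tx: "t x = D" using oddP SL_carrier_mat[OF D] by (simp add: t_def xpow Dpow)
    have invY: "inv\<^bsub>?G\<^esub> Y = Y'"
      by (rule SL_inv_eqI[OF Y Y']) (simp add: Y_def Y'_def mat3_mult mat3_one)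
    have YY: "Y * Y \<in> carrier ?G" "Y' * Y' \<in> carrier ?G" by (intro SL_mult_closed Y Y')+
    have invYY: "inv\<^bsub>?G\<^esub> (Y * Y) = Y' * Y'"
      by (rule SL_inv_eqI[OF YY]) (simp add: Y_def Y'_def mat3_mult mat3_one)
    define A where "A = mat3 [[-1, 2, 0], [0, 1, 0], [0, -2, -1 :: 'a]]"
    define B where "B = mat3 [[-1, 0, 0], [-2, 1, 0], [2, -2, -1 :: 'a]]"
    have A: "conj_mat 3 Y D = A" by (simp add: conj_mat_def invY) (simp add: Y_def Y'_def D_def A_def mat3_mult)
    have B: "conj_mat 3 (Y * Y) D = B" by (simp add: conj_mat_def invYY) (simp add: Y_def Y'_def D_def B_def mat3_mult)
    have AG: "A \<in> carrier ?G" and BG: "B \<in> carrier ?G" unfolding A[symmetric] B[symmetric]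
      by (intro conj_mat_closed Y YY D)+
    have invA: "inv\<^bsub>?G\<^esub> A = A" by (rule SL_inv_eqI[OF AG AG]) (simp add: A_def mat3_mult mat3_one)
    have invB: "inv\<^bsub>?G\<^esub> B = B" by (rule SL_inv_eqI[OF BG BG]) (simp add: B_def mat3_mult mat3_one)
    let ?m = "of_nat ?M :: 'a"
    have mv: "?m \<cdot>\<^sub>v ?v = vec3 [0, ?m, 0]" by (rule eq_vecI) (auto dest!: less_3_cases)
    have v: "vec3 [0, ?m, 0] \<in> carrier_vec 3" and f: "?f \<in> carrier_vec 3" by simp_all
    have fmv: "?f \<bullet> vec3 [0, ?m, 0] = 0" by (simp add: scalar_prod_vec3)
    let ?v1 = "vec3 [2 * ?m, ?m, - (2 * ?m)]" and ?f1 = "vec3 [0, -2, -1 :: 'a]"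
    let ?v2 = "vec3 [0, ?m, - (2 * ?m)]" and ?f2 = "vec3 [2, -2, -1 :: 'a]"
    have z1: "conj_mat 3 A (z x) = transv ?v1 ?f1"
      unfolding zx mv conj_mat_transv(1)[OF AG v f] invA
      by (simp add: A_def mat3_mult_vec mat3_transpose mult.commute)
    have z2: "conj_mat 3 B (z x) = transv ?v2 ?f2"
      unfolding zx mv conj_mat_transv(1)[OF BG v f] invB
      by (simp add: B_def mat3_mult_vec mat3_transpose mult.commute)
    have m0: "?m \<noteq> 0" by (rule of_nat_semisimple_exponent)
    have two: "(2::'a) \<noteq> 0"
    proof
      assume "(2::'a) = 0"
      then have "of_nat 2 = (0::'a)" by simp
      then have "CHAR('a) dvd 2" by (simp only: of_nat_eq_0_iff_char_dvd)
      then show False using odd prime_ge_2_nat[OF prime_CHAR_finite_field[where 'a='a]] dvd_imp_le[of "CHAR('a)" 2] by simp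
    qed
    have "F x Y = comm_mat 3 (transv ?v1 ?f1) (transv ?v2 ?f2) ^\<^sub>m ?M"
      unfolding F_def tx A B z1 z2 ..
    also have "comm_mat 3 (transv ?v1 ?f1) (transv ?v2 ?f2) =
        transv (- (?f2 \<bullet> ?v1) \<cdot>\<^sub>v ?v2) ?f1"
    proof -
      have z: "?f1 \<bullet> ?v1 = 0" "?f2 \<bullet> ?v2 = 0" "?f1 \<bullet> ?v2 = 0" by (simp_all add: scalar_prod_vec3)
      note c = vec3_carrier(1)[of "[2 * ?m, ?m, - (2 * ?m)]"] vec3_carrier(1)[of "[0, -2, -1 :: 'a]"]
        vec3_carrier(1)[of "[0, ?m, - (2 * ?m)]"] vec3_carrier(1)[of "[2, -2, -1 :: 'a]"]
      have s: "transv ?v1 ?f1 \<in> carrier ?G" "transv ?v2 ?f2 \<in> carrier ?G"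
        by (intro transv_in_SL c z order_refl)+
      show ?thesis
        unfolding comm_mat_transv[OF c(1,2) z(1) s(1) c(3,4) z(2) s(2)]
        by (rule transvection_commutator_heisenberg'[OF c(1,2) z(1) c(3,4) z(2,3)])
    qed
    also have "\<dots> ^\<^sub>m ?M \<noteq> 1\<^sub>m 3"
    proof (rule transv_power_neq_1[OF _ _ _ _ _ of_nat_semisimple_exponent])
      have "?f2 \<bullet> ?v1 = 2 * 2 * ?m" by (simp add: scalar_prod_vec3)
      then have "- (?f2 \<bullet> ?v1) \<noteq> 0" using m0 two by (simp only: mult_eq_0_iff neg_equal_0_iff_equal) simp
      moreover have "?v2 \<noteq> 0\<^sub>v 3"
      proof
        assume "?v2 = 0\<^sub>v 3"
        then have "?v2 $ 1 = 0\<^sub>v 3 $ 1" by (rule arg_cong)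
        then show False using m0 by simp
      qed
      ultimately show "- (?f2 \<bullet> ?v1) \<cdot>\<^sub>v ?v2 \<noteq> 0\<^sub>v 3" by (intro smult_vec_nonzero) simp_all
      show "?f1 \<noteq> 0\<^sub>v 3"
      proof
        assume "?f1 = 0\<^sub>v 3"
        then have "?f1 $ 2 = 0\<^sub>v 3 $ 2" by (rule arg_cong)
        then show False by simp
      qed
      show "?f1 \<bullet> (- (?f2 \<bullet> ?v1) \<cdot>\<^sub>v ?v2) = 0" by (simp add: scalar_prod_vec3)
    qed simp_all
    finally show "\<exists>x\<in>carrier ?G. \<exists>y\<in>carrier ?G. F x y \<noteq> 1\<^sub>m 3" using x Y by blast
  qed simp
qed

section \<open>A norm-one element of large order\<close>

lemma gcd_power_minus_1_dvd:
  fixes q :: nat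
  assumes q: "q \<ge> 2" and m: "m > 0" and d: "d > 0"
  shows "gcd (q ^ m - 1) (q ^ d - 1) dvd q ^ gcd m d - 1"
proof -
  let ?r = "gcd (q ^ m - 1) (q ^ d - 1)"
  have cong1: "[q ^ k = 1] (mod r) \<longleftrightarrow> r dvd q ^ k - 1" for k r :: nat
    using q by (intro cong_altdef_nat) simp
  have "[q ^ m = 1] (mod ?r)" "[q ^ d = 1] (mod ?r)" unfolding cong1 by (rule gcd_dvd1, rule gcd_dvd2)
  then have "ord ?r q dvd m" "ord ?r q dvd d" by (simp_all only: ord_divides)
  then have "ord ?r q dvd gcd m d" by (rule gcd_greatest)
  then have "[q ^ gcd m d = 1] (mod ?r)" by (simp only: ord_divides)
  then show ?thesis unfolding cong1 .
qed

lemma gcd_Lcm_dvd: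
  fixes a W :: nat
  assumes "finite S" "\<And>s. s \<in> S \<Longrightarrow> gcd a s dvd W"
  shows "gcd a (Lcm S) dvd W"
  using assms
proof (induction S rule: finite_induct)
  case (insert s S)
  have "gcd a (Lcm (insert s S)) = lcm (gcd a s) (gcd a (Lcm S))"
    using lcm_gcd_distrib gcd_lcm_distrib[of a s "Lcm S"] by simp
  moreover have "gcd a s dvd W" "gcd a (Lcm S) dvd W" using insert by auto
  ultimately show ?case by (simp only: lcm_least)
qed simp

text \<open>
  Every linear factor of \<open>S\<close> has norm at least \<open>q - 1 \<ge> 1\<close> at \<open>q\<close>.
\<close>

lemma norm_poly_ge_1:
  fixes S :: "complex poly" and q :: real
  assumes S: "S \<noteq> 0" and roots: "\<And>z. poly S z = 0 \<Longrightarrow> norm z = 1"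
    and lead: "norm (lead_coeff S) \<ge> 1" and q: "q \<ge> 2"
  shows "norm (poly S (of_real q)) \<ge> 1"
proof -
  obtain A where A: "S = smult (lead_coeff S) (\<Prod>x\<in>#A. [:- x, 1:])"
    using alg_closed_imp_factorization[OF S] by blast
  have prod: "norm (poly (\<Prod>x\<in>#B. [:- x, 1:]) (of_real q)) \<ge> 1" if "\<And>x. x \<in># B \<Longrightarrow> norm x = 1" for B :: "complex multiset"
    using that
  proof (induction B)
    case (add x B)
    have "norm (of_real q - x) \<ge> norm (of_real q :: complex) - norm x" by (rule norm_triangle_ineq2)
    then have "norm (of_real q - x) \<ge> 1" using add.prems[of x] q by simp
    moreover have "norm (poly (\<Prod>x\<in>#B. [:- x, 1:]) (of_real q)) \<ge> 1" using add by simp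
    ultimately have "1 * 1 \<le> norm (of_real q - x) * norm (poly (\<Prod>x\<in>#B. [:- x, 1:]) (of_real q))"
      by (intro mult_mono) simp_all
    then show ?case by (simp add: norm_mult left_diff_distrib[symmetric])
  qed simp
  have "norm x = 1" if "x \<in># A" for x
  proof (rule roots)
    have "[:- x, 1:] dvd (\<Prod>x\<in>#A. [:- x, 1:])" using that by (intro dvd_prod_mset) simp
    then have "poly (\<Prod>x\<in>#A. [:- x, 1:]) x = 0" by (simp add: poly_eq_0_iff_dvd)
    then show "poly S x = 0" by (subst A) simp
  qed
  then have "1 * 1 \<le> norm (lead_coeff S) * norm (poly (\<Prod>x\<in>#A. [:- x, 1:]) (of_real q))"
    using lead prod by (intro mult_mono) simp_all
  also have "\<dots> = norm (poly S (of_real q))" by (subst (3) A) (simp add: norm_mult)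
  finally show ?thesis by simp
qed

text \<open>
  The least common multiple in \<open>\<int>[X]\<close> of the \<open>X\<^sup>d - 1\<close>. When \<open>D\<close> consists of proper divisors of
  \<open>m\<close>, its roots are not primitive \<open>m\<close>-th roots of unity, and its cofactor in \<open>X\<^sup>m - 1\<close> plays the
  part of the cyclotomic polynomial.
\<close>

lemma exists_lcm_X_power_minus_1:
  fixes D :: "nat set"
  assumes "finite D" "\<forall>d\<in>D. d > 0 \<and> d dvd m" "m > 0"
  shows "\<exists>Q :: int poly. (\<forall>d\<in>D. [:0, 1:] ^ d - 1 dvd Q) \<and> Q dvd [:0, 1:] ^ m - 1 \<and>
    (\<forall>z::complex. poly (of_int_poly Q) z = 0 \<longrightarrow> (\<exists>d\<in>D. z ^ d = 1))"
  using assms(1,2)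
proof (induction D rule: finite_induct)
  case empty
  show ?case by (intro exI[of _ 1]) simp
next
  case (insert d D)
  then obtain Q :: "int poly" where Q: "\<forall>d\<in>D. [:0, 1:] ^ d - 1 dvd Q" "Q dvd [:0, 1:] ^ m - 1"
    "\<And>z::complex. poly (of_int_poly Q) z = 0 \<Longrightarrow> \<exists>d\<in>D. z ^ d = 1" by auto
  let ?X = "[:0, 1:] ^ d - 1 :: int poly"
  show ?case
  proof (intro exI[of _ "lcm Q ?X"] conjI ballI allI impI)
    fix e assume "e \<in> insert d D"
    then show "[:0, 1:] ^ e - 1 dvd lcm Q ?X"
    proof
      assume "e = d" then show ?thesis by simp
    next
      assume "e \<in> D"
      then have "[:0, 1:] ^ e - 1 dvd Q" using Q(1) by blast
      then show ?thesis by (rule dvd_trans) (rule dvd_lcm1)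
    qed
  next
    have "?X dvd [:0, 1:] ^ m - 1" using insert.prems by (intro X_power_minus_1_dvd) simp
    then show "lcm Q ?X dvd [:0, 1:] ^ m - 1" using Q(2) by (rule lcm_least[rotated])
  next
    fix z :: complex assume z: "poly (of_int_poly (lcm Q ?X)) z = 0"
    have "lcm Q ?X dvd Q * ?X" by (rule lcm_least) simp_all
    then have "of_int_poly (lcm Q ?X) dvd (of_int_poly (Q * ?X) :: complex poly)" by (rule of_int_poly_hom.hom_dvd)
    then have "poly (of_int_poly (Q * ?X)) z = 0" using z by (elim dvdE) simp
    then have "poly (of_int_poly Q) z = 0 \<or> poly (of_int_poly ?X) z = 0"
      by (simp only: of_int_poly_hom.hom_mult poly_mult mult_eq_0_iff)
    moreover have "poly (of_int_poly ?X) z = z ^ d - 1"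
      by (simp add: of_int_poly_hom.hom_minus of_int_poly_hom.hom_power)
    ultimately show "\<exists>d\<in>insert d D. z ^ d = 1" using Q(3) by auto
  qed
qed

lemma cis_root_of_unity_primitive:
  assumes "0 < d" "d < m"
  shows "cis (2 * pi / real m) ^ d \<noteq> 1"
proof
  assume "cis (2 * pi / real m) ^ d = 1"
  then have "cos (real d * (2 * pi / real m)) = 1" unfolding Complex.DeMoivre by (simp add: complex_eq_iff)
  then obtain k :: int where "real d * (2 * pi / real m) = of_int k * 2 * pi" unfolding cos_one_2pi_int by blast
  then have k: "real d = of_int k * real m" using assms pi_gt_zero by (simp add: field_simps)
  then have "int d = k * int m" by (metis of_int_eq_iff of_int_mult of_int_of_nat_eq)
  then have "int m dvd int d" by simp
  then have "m dvd d" by simp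
  then show False using assms by (auto dest: dvd_imp_le)
qed

text \<open>
  Only the divisors \<open>d\<close> of \<open>m\<close> matter, because \<open>gcd (q\<^sup>m - 1) (q\<^sup>d - 1)\<close> divides \<open>q\<^sup>e - 1\<close> for
  \<open>e = gcd m d\<close>. Write \<open>X\<^sup>m - 1 = Q R\<close> with \<open>Q\<close> the least common multiple of the \<open>X\<^sup>d - 1\<close> for the
  proper divisors \<open>d\<close> of \<open>m\<close>. Divisibility would force \<open>R(q)\<close> to divide \<open>(q - 1)\<^sup>2\<close>. But \<open>R\<close> has
  two conjugate primitive roots of unity among its roots, whose linear factors are larger than
  \<open>q - 1\<close> at \<open>q\<close>.
\<close>

lemma power_minus_1_not_dvd_Lcm:
  fixes q m :: nat
  assumes q: "q \<ge> 2" and m: "m \<ge> 3"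
  shows "\<not> q ^ m - 1 dvd Lcm ((\<lambda>d. q ^ d - 1) ` {1..<m}) * (q - 1)\<^sup>2"
proof
  let ?L = "Lcm ((\<lambda>d. q ^ d - 1) ` {1..<m})" and ?D = "{d. 0 < d \<and> d < m \<and> d dvd m}"
  assume dvd: "q ^ m - 1 dvd ?L * (q - 1)\<^sup>2"
  have "finite ?D" "\<forall>d\<in>?D. d > 0 \<and> d dvd m" "m > 0" using m by simp_all
  from exists_lcm_X_power_minus_1[OF this]
  obtain Q :: "int poly" where Q': "(\<forall>d\<in>?D. [:0, 1:] ^ d - 1 dvd Q) \<and> Q dvd [:0, 1:] ^ m - 1 \<and>
    (\<forall>z::complex. poly (of_int_poly Q) z = 0 \<longrightarrow> (\<exists>d\<in>?D. z ^ d = 1))" by (elim exE)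
  note Q = Q'[THEN conjunct1] Q'[THEN conjunct2, THEN conjunct1]
    Q'[THEN conjunct2, THEN conjunct2, rule_format]
  (* R vanishes at the primitive m-th roots of unity. *)
  obtain R where R: "[:0, 1:] ^ m - 1 = Q * R" using Q(2) by (elim dvdE)
  let ?q = "int q" and ?W = "nat \<bar>poly Q (int q)\<bar>"
  have QR: "?q ^ m - 1 = poly Q ?q * poly R ?q"
    using arg_cong[OF R, of "\<lambda>p. poly p ?q"] by simp
  have pos: "?q ^ m - 1 > 0" using q m by (simp add: one_less_power)
  have gcd_W: "gcd (q ^ m - 1) s dvd ?W" if s: "s \<in> (\<lambda>d. q ^ d - 1) ` {1..<m}" for s
  proof -
    obtain d where d: "s = q ^ d - 1" "1 \<le> d" "d < m" using s by auto
    have "gcd m d \<le> d" using d by (intro dvd_imp_le) auto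
    then have "gcd m d < m" using d by linarith
    then have g: "gcd m d \<in> ?D" using d m by auto
    have "[:0, 1:] ^ gcd m d - 1 dvd Q" using Q(1) g by blast
    then have "?q ^ gcd m d - 1 dvd poly Q ?q" by (elim dvdE) simp
    moreover have "?q ^ gcd m d - 1 = int (q ^ gcd m d - 1)" using q by (simp add: of_nat_diff)
    ultimately have "q ^ gcd m d - 1 dvd ?W" unfolding dvd_nat_abs_iff by simp
    moreover have "gcd (q ^ m - 1) s dvd q ^ gcd m d - 1"
      unfolding d(1) using q m d by (intro gcd_power_minus_1_dvd) simp_all
    ultimately show ?thesis by (rule dvd_trans[rotated])
  qed
  have "gcd (q ^ m - 1) ?L dvd ?W" using gcd_W by (intro gcd_Lcm_dvd) simp_all
  moreover have "q ^ m - 1 dvd gcd (q ^ m - 1) ?L * (q - 1)\<^sup>2"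
  proof -
    have "q ^ m - 1 dvd gcd ((q ^ m - 1) * (q - 1)\<^sup>2) (?L * (q - 1)\<^sup>2)" using dvd by (intro gcd_greatest) simp_all
    then show ?thesis by (simp add: gcd_mult_distrib_nat mult.commute)
  qed
  ultimately have "q ^ m - 1 dvd ?W * (q - 1)\<^sup>2" by (meson dvd_refl dvd_trans mult_dvd_mono)
  then have "int (q ^ m - 1) dvd int (?W * (q - 1)\<^sup>2)" by (simp only: int_dvd_int_iff)
  moreover have "int (q ^ m - 1) = ?q ^ m - 1" "int (?W * (q - 1)\<^sup>2) = \<bar>poly Q ?q\<bar> * (?q - 1)\<^sup>2"
    using q by (simp_all add: of_nat_diff)
  ultimately have "poly Q ?q * poly R ?q dvd poly Q ?q * (?q - 1)\<^sup>2"
    unfolding QR by (simp add: abs_mult dvd_abs_iff abs_if split: if_splits)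
  then have "poly R ?q dvd (?q - 1)\<^sup>2" using pos unfolding QR by auto
  then have "\<bar>poly R ?q\<bar> \<le> (?q - 1)\<^sup>2" using q zdvd_imp_le[of "\<bar>poly R ?q\<bar>" "(?q - 1)\<^sup>2"] by simp
  then have upper: "norm (poly (of_int_poly R) (of_real (real q)) :: complex) \<le> (real q - 1)\<^sup>2"
  proof -
    have "poly (of_int_poly R) (of_real (real q)) = (of_int (poly R ?q) :: complex)"
      using of_int_hom.poly_map_poly[of R ?q] by (simp only: of_int_of_nat_eq of_real_of_nat_eq)
    then have "norm (poly (of_int_poly R) (of_real (real q)) :: complex) = of_int \<bar>poly R ?q\<bar>" by simp
    also have "\<dots> \<le> of_int ((?q - 1)\<^sup>2)" using \<open>\<bar>poly R ?q\<bar> \<le> (?q - 1)\<^sup>2\<close> by (simp only: of_int_le_iff)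
    finally show ?thesis by simp
  qed
  let ?R = "of_int_poly R :: complex poly"
  have QRc: "[:0, 1:] ^ m - 1 = of_int_poly Q * ?R"
  proof -
    have "of_int_poly ([:0, 1:] ^ m - 1) = (of_int_poly (Q * R) :: complex poly)" unfolding R ..
    then show ?thesis by (simp add: of_int_poly_hom.hom_mult of_int_poly_hom.hom_minus of_int_poly_hom.hom_power)
  qed
  have zm: "z ^ m - 1 = poly (of_int_poly Q) z * poly ?R z" for z
    using arg_cong[OF QRc, of "\<lambda>p. poly p z"] by simp
  let ?z = "cis (2 * pi / real m)"
  have z1: "?z ^ m = 1" using m by (simp add: Complex.DeMoivre)
  have Qz: "poly (of_int_poly Q) ?z \<noteq> 0" using Q(3)[of ?z] cis_root_of_unity_primitive[of _ m] by blast
  have Rz: "poly ?R ?z = 0" using zm[of ?z] z1 Qz by simp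
  have cz: "cnj ?z ^ m = 1" using arg_cong[OF z1, of cnj] by simp
  have Qcz: "poly (of_int_poly Q) (cnj ?z) \<noteq> 0"
  proof
    assume "poly (of_int_poly Q) (cnj ?z) = 0"
    then obtain d where d: "d \<in> ?D" "cnj ?z ^ d = 1" using Q(3) by blast
    have "?z ^ d = 1" using arg_cong[OF d(2), of cnj] by simp
    then show False using cis_root_of_unity_primitive[of d m] d(1) by simp
  qed
  have Rcz: "poly ?R (cnj ?z) = 0" using zm[of "cnj ?z"] cz Qcz by simp
  have ne: "?z \<noteq> cnj ?z"
  proof
    assume "?z = cnj ?z"
    then have "?z ^ 2 = ?z * cnj ?z" by (simp add: power2_eq_square)
    then have "?z ^ 2 = 1" by (simp add: cis_mult cis_cnj)
    then show False using cis_root_of_unity_primitive[of 2 m] m by simp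
  qed
  obtain R1 where R1: "?R = [:- ?z, 1:] * R1" using Rz unfolding poly_eq_0_iff_dvd by (elim dvdE)
  have "poly R1 (cnj ?z) = 0" using Rcz ne unfolding R1 by simp
  then obtain S where S: "R1 = [:- cnj ?z, 1:] * S" unfolding poly_eq_0_iff_dvd by (elim dvdE)
  have R0: "R \<noteq> 0" using pos unfolding QR by auto
  have lead: "lead_coeff ?R = of_int (lead_coeff R)" by simp
  have S0: "S \<noteq> 0" using R0 R1 S by auto
  have "lead_coeff ?R = lead_coeff S" unfolding R1 S lead_coeff_mult by simp
  then have "lead_coeff S = of_int (lead_coeff R)" using lead by simp
  then have "norm (lead_coeff S) = of_int \<bar>lead_coeff R\<bar>" by simp
  moreover have "\<bar>lead_coeff R\<bar> \<ge> 1" using R0 by (simp add: int_one_le_iff_zero_less)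
  ultimately have leadS: "norm (lead_coeff S) \<ge> 1" by (simp only: of_int_1_le_iff)
  have "norm z = 1" if "poly S z = 0" for z
  proof -
    have "z ^ m = 1" using zm[of z] that unfolding R1 S by simp
    then have "norm z ^ m = 1" by (metis norm_power norm_one)
    then show ?thesis using m power_eq_iff_eq_base[of m "norm z" 1] by simp
  qed
  then have "norm (poly S (of_real (real q))) \<ge> 1" using q by (intro norm_poly_ge_1 S0 leadS) simp_all
  moreover have zz: "norm (of_real (real q) - ?z) > real q - 1" "norm (of_real (real q) - cnj ?z) > real q - 1"
  proof -
    have "cos (2 * pi / real m) \<noteq> 1"
    proof
      assume "cos (2 * pi / real m) = 1"
      moreover have "sin (2 * pi / real m) = 0" using calculation sin_cos_squared_add[of "2 * pi / real m"] by simp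
      ultimately have "?z ^ 1 = 1" by (simp add: complex_eq_iff)
      then show False using cis_root_of_unity_primitive[of 1 m] m by simp
    qed
    then have c: "cos (2 * pi / real m) < 1" using cos_le_one[of "2 * pi / real m"] by linarith
    have "(norm (of_real (real q) - ?z))\<^sup>2 = (real q - cos (2 * pi / real m))\<^sup>2 + (sin (2 * pi / real m))\<^sup>2"
      by (simp add: cmod_power2)
    also have "\<dots> = (real q)\<^sup>2 - 2 * real q * cos (2 * pi / real m) + 1"
      using sin_cos_squared_add[of "2 * pi / real m"] by (simp add: power2_eq_square algebra_simps)
    also have "\<dots> > (real q)\<^sup>2 - 2 * real q * 1 + 1" using c q by simp
    also have "(real q)\<^sup>2 - 2 * real q * 1 + 1 = (real q - 1)\<^sup>2" by (simp add: power2_eq_square algebra_simps)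
    finally show 1: "norm (of_real (real q) - ?z) > real q - 1" by (rule power_less_imp_less_base) simp
    have "of_real (real q) - cnj ?z = cnj (of_real (real q) - ?z)" by simp
    then show "norm (of_real (real q) - cnj ?z) > real q - 1" using 1 by (simp only: complex_mod_cnj)
  qed
  ultimately have "(real q - 1) * (real q - 1) * 1 <
      norm (of_real (real q) - ?z) * norm (of_real (real q) - cnj ?z) * norm (poly S (of_real (real q)))"
    using q by (intro mult_less_le_imp_less mult_strict_mono) simp_all
  also have "\<dots> = norm (poly ?R (of_real (real q)))" unfolding R1 S poly_mult norm_mult by simp
  finally show False using upper by (simp add: power2_eq_square)
qed

lemma card_roots_if_no_double_root:
  fixes p :: "'b::alg_closed_field poly"
  assumes "p \<noteq> 0" "\<And>a. poly p a = 0 \<Longrightarrow> poly (pderiv p) a \<noteq> 0"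
  shows "card {a. poly p a = 0} = degree p"
  using assms
proof (induction "degree p" arbitrary: p)
  case 0
  then obtain c where "p = [:c:]" using degree_eq_zeroE by metis
  then show ?case using 0 by simp
next
  case (Suc k)
  obtain a where a: "poly p a = 0" using Suc.hyps(2) alg_closed_imp_poly_has_root[of p] by auto
  then obtain g where p: "p = [:- a, 1:] * g" unfolding poly_eq_0_iff_dvd by (elim dvdE)
  have g0: "g \<noteq> 0" using Suc.prems(1) p by auto
  have d: "poly (pderiv p) b = poly g b + (b - a) * poly (pderiv g) b" for b
    unfolding p pderiv_mult by (simp add: pderiv_pCons left_diff_distrib)
  have deg: "degree p = Suc (degree g)" unfolding p using g0 by (subst degree_mult_eq) simp_all
  have "card {b. poly g b = 0} = degree g"
  proof (rule Suc.hyps(1)[OF _ g0])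
    show "k = degree g" using Suc.hyps(2) deg by simp
    fix b assume b: "poly g b = 0"
    then have "poly p b = 0" unfolding p by simp
    then have "poly (pderiv p) b \<noteq> 0" by (rule Suc.prems(2))
    then show "poly (pderiv g) b \<noteq> 0" unfolding d using b by auto
  qed
  moreover have "{b. poly p b = 0} = insert a {b. poly g b = 0}" unfolding p by auto
  moreover have "poly g a \<noteq> 0" using Suc.prems(2)[OF a] unfolding d by simp
  moreover have "finite {b. poly g b = 0}" by (rule poly_roots_finite[OF g0])
  ultimately show ?case using deg by simp
qed

text \<open>
  There are exactly \<open>K\<close> roots of unity of order dividing \<open>K\<close>, and those that also satisfy
  \<open>a\<^sup>E = 1\<close> have order dividing \<open>gcd K E < K\<close>.
\<close>

lemma exists_root_of_unity:
  assumes K: "of_nat K \<noteq> (0 :: 'b::alg_closed_field)" and not: "\<not> K dvd E"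
  shows "\<exists>a::'b. a ^ K = 1 \<and> a ^ E \<noteq> 1"
proof (rule ccontr)
  assume no: "\<not> ?thesis"
  have K0: "K > 0" using K by (cases K) auto
  have pe: "poly (monom 1 k - 1) a = a ^ k - 1" for k and a :: 'b by (simp add: poly_monom)
  have deg: "degree (monom 1 k - 1 :: 'b poly) = k" "monom 1 k - 1 \<noteq> (0 :: 'b poly)" if "k > 0" for k
  proof -
    show "degree (monom 1 k - 1 :: 'b poly) = k"
      unfolding diff_conv_add_uminus
      using that degree_add_eq_left[of "- 1" "monom (1::'b) k"] by (simp add: degree_monom_eq)
    then show "monom 1 k - 1 \<noteq> (0 :: 'b poly)" using that by force
  qed
  have card: "card {a. poly (monom 1 K - 1) a = (0::'b)} = K"
  proof -
    have "poly (pderiv (monom 1 K - 1)) a \<noteq> 0" if "poly (monom 1 K - 1) a = 0" for a :: 'b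
    proof -
      have "a ^ K = 1" using that unfolding pe by simp
      then have "a \<noteq> 0" using K0 by (auto simp: power_0_left)
      then show ?thesis using K by (simp add: pderiv_diff pderiv_monom poly_monom)
    qed
    then show ?thesis using card_roots_if_no_double_root[OF deg(2)[OF K0]] deg(1)[OF K0] by simp
  qed
  have "a ^ gcd K E = 1" if "a ^ K = 1" "a ^ E = 1" for a :: 'b
  proof -
    obtain x y where xy: "K * x = E * y + gcd K E" using bezout_nat[of K E] K0 by auto
    have "a ^ (K * x) = 1" "a ^ (E * y) = 1" by (simp_all add: power_mult that)
    then show ?thesis unfolding xy power_add by simp
  qed
  then have sub: "{a. poly (monom 1 K - 1) a = (0::'b)} \<subseteq> {a. poly (monom 1 (gcd K E) - 1) a = 0}"
    using no unfolding pe by auto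
  have g: "gcd K E > 0" using K0 by simp
  have "card {a. poly (monom 1 (gcd K E) - 1) a = (0::'b)} \<le> gcd K E"
    using card_poly_roots_bound[OF deg(2)[OF g]] unfolding deg(1)[OF g] .
  moreover have "card {a. poly (monom 1 K - 1) a = (0::'b)} \<le> card {a. poly (monom 1 (gcd K E) - 1) a = (0::'b)}"
    using sub by (intro card_mono poly_roots_finite[OF deg(2)[OF g]])
  ultimately have "K \<le> gcd K E" using card by linarith
  then have "gcd K E = K" using K0 gcd_dvd1[of K E] dvd_imp_le[of "gcd K E" K] by linarith
  then show False using not gcd_dvd2[of K E] by simp
qed

text \<open>
  The \<open>q\<close> elements of the field are all the roots of \<open>X\<^sup>q - X\<close>.
\<close>

lemma range_to_ac_iff:
  fixes x :: "'a::{field,finite} alg_closure"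
  shows "x \<in> range to_ac \<longleftrightarrow> x ^ CARD('a) = x"
proof -
  let ?q = "CARD('a)" and ?p = "monom 1 CARD('a) - [:0, 1:] :: 'a alg_closure poly"
  have q: "?q > 1" by (rule card_gt_1)
  have deg: "degree ?p = ?q"
    unfolding diff_conv_add_uminus
    using q degree_add_eq_left[of "- [:0, 1:]" "monom (1 :: 'a alg_closure) ?q"] by (simp add: degree_monom_eq)
  then have p0: "?p \<noteq> 0" using q by force
  have pe: "poly ?p x = x ^ ?q - x" for x by (simp add: poly_monom)
  have sub: "range to_ac \<subseteq> {x. poly ?p x = 0}"
  proof
    fix x assume "x \<in> range (to_ac :: 'a \<Rightarrow> 'a alg_closure)"
    then obtain y where y: "x = to_ac y" by blast
    show "x \<in> {x. poly ?p x = 0}" unfolding pe y using power_card_eq_same[of y] by (simp flip: to_ac_power)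
  qed
  have "card (range (to_ac :: 'a \<Rightarrow> 'a alg_closure)) = ?q" by (rule card_image[OF inj_to_ac])
  moreover have "card {x. poly ?p x = 0} \<le> ?q" using card_poly_roots_bound[OF p0] deg by simp
  ultimately have "range to_ac = {x. poly ?p x = 0}"
    by (intro card_seteq poly_roots_finite[OF p0] sub) simp
  then show ?thesis unfolding pe by auto
qed

lemma add_power_CARD:
  fixes x y :: "'a::{field,finite} alg_closure"
  shows "(x + y) ^ CARD('a) = x ^ CARD('a) + y ^ CARD('a)"
proof -
  obtain k where "CARD('a) = CHAR('a) ^ k" using CARD_eq_CHAR_power[where 'a='a] by blast
  then show ?thesis
    using freshmans_dream'[of "CHAR('a) ^ k" k x y] prime_CHAR_finite_field[where 'a='a] by simp
qed

lemma coeff_conjugates_prod: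
  fixes a :: "'a::{field,finite} alg_closure"
  shows "coeff (\<Prod>i<m. [:- (a ^ CARD('a) ^ i), 1:]) j ^ CARD('a) = coeff (\<Prod>i<m. [:- (a ^ CARD('a) ^ Suc i), 1:]) j"
proof (induction m arbitrary: j)
  case (Suc m)
  have c: "coeff (p * [:b, 1:]) j = b * coeff p j + (if j = 0 then 0 else coeff p (j - 1))"
    for p :: "'a alg_closure poly" and b by (simp add: coeff_pCons mult.commute split: nat.splits)
  have q: "CARD('a) > 0" by simp
  have neg: "(- b) ^ CARD('a) = - (b ^ CARD('a))" for b :: "'a alg_closure"
    using add_power_CARD[of b "- b"] q by (simp add: power_0_left add_eq_0_iff)
  show ?case
    unfolding prod.lessThan_Suc c
    by (cases "j = 0") (simp_all only: if_True if_False simp_thms add_power_CARD power_mult_distrib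
      neg Suc.IH power_mult[symmetric] power_Suc2[symmetric] add_0_right refl)
qed (simp add: power_0_left)

definition companion :: "nat \<Rightarrow> (nat \<Rightarrow> 'a::comm_ring_1) \<Rightarrow> 'a mat" where
  "companion m c = mat m m (\<lambda>(i, j). if j = m - 1 then c i else if i = Suc j then 1 else 0)"

lemma companion_carrier [simp]: "companion m c \<in> carrier_mat m m"
  "dim_row (companion m c) = m" "dim_col (companion m c) = m"
  by (simp_all add: companion_def)

lemma det_companion:
  assumes "m > 0"
  shows "det (companion m c) = (-1) ^ (m - 1) * c 0"
proof -
  let ?C = "companion m c"
  have "det ?C = (\<Sum>j<m. ?C $$ (0, j) * cofactor ?C 0 j)" using assms by (intro laplace_expansion_row) simp_all
  also have "\<dots> = (\<Sum>j\<in>{m - 1}. ?C $$ (0, j) * cofactor ?C 0 j)"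
    using assms by (intro sum.mono_neutral_right) (auto simp: companion_def)
  also have "\<dots> = c 0 * cofactor ?C 0 (m - 1)" using assms by (simp add: companion_def)
  also have "mat_delete ?C 0 (m - 1) = 1\<^sub>m (m - 1)"
    by (rule eq_matI) (auto simp: mat_delete_def companion_def)
  then have "cofactor ?C 0 (m - 1) = (-1) ^ (m - 1)" by (simp add: cofactor_def)
  finally show ?thesis by (simp add: mult.commute)
qed

text \<open>
  This identifies coordinate vectors with elements of the extension generated by \<open>a\<close> and turns a
  companion matrix into multiplication by \<open>a\<close>.
\<close>

definition power_eval :: "nat \<Rightarrow> 'a::field alg_closure \<Rightarrow> 'a vec \<Rightarrow> 'a alg_closure" where
  "power_eval m a v = (\<Sum>i<m. to_ac (v $ i) * a ^ i)"

lemma power_eval_companion: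
  fixes v :: "'a::field vec"
  assumes m: "m > 0" and v: "v \<in> carrier_vec m" and a: "a ^ m = (\<Sum>i<m. to_ac (c i) * a ^ i)"
  shows "power_eval m a (companion m c *\<^sub>v v) = a * power_eval m a v"
proof -
  obtain k where k: "m = Suc k" using m by (cases m) auto
  have ent: "(companion m c *\<^sub>v v) $ i = c i * v $ k + (if i = 0 then 0 else v $ (i - 1))" if "i < m" for i
  proof -
    have "(companion m c *\<^sub>v v) $ i = (\<Sum>j<m. companion m c $$ (i, j) * v $ j)"
      using that v by (simp add: scalar_prod_def companion_def lessThan_atLeast0)
    also have "\<dots> = (\<Sum>j<k. (if i = Suc j then 1 else 0) * v $ j) + c i * v $ k"
      using that unfolding k by (simp add: companion_def)
    also have "(\<Sum>j<k. (if i = Suc j then 1 else 0) * v $ j) = (if i = 0 then 0 else v $ (i - 1))"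
    proof (cases i)
      case (Suc l)
      have "(\<Sum>j<k. (if i = Suc j then 1 else 0) * v $ j) = (\<Sum>j\<in>{l}. v $ j)"
        using that Suc k by (intro sum.mono_neutral_cong_right) auto
      then show ?thesis using Suc by simp
    qed simp
    finally show ?thesis by (simp add: add.commute)
  qed
  have "power_eval m a (companion m c *\<^sub>v v) =
      (\<Sum>i<m. to_ac (c i) * a ^ i) * to_ac (v $ k) + (\<Sum>i<m. to_ac (if i = 0 then 0 else v $ (i - 1)) * a ^ i)"
    unfolding power_eval_def sum_distrib_right sum.distrib[symmetric]
    by (intro sum.cong refl) (simp add: ent algebra_simps del: index_mult_mat_vec)
  also have "(\<Sum>i<m. to_ac (if i = 0 then 0 else v $ (i - 1)) * a ^ i) = (\<Sum>i<k. to_ac (v $ i) * a ^ Suc i)"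
    unfolding k sum.lessThan_Suc_shift by simp
  also have "(\<Sum>i<m. to_ac (c i) * a ^ i) * to_ac (v $ k) = a ^ m * to_ac (v $ k)" by (simp only: a)
  also have "a ^ m * to_ac (v $ k) + (\<Sum>i<k. to_ac (v $ i) * a ^ Suc i) = a * power_eval m a v"
    unfolding power_eval_def k sum.lessThan_Suc distrib_left sum_distrib_left by (simp add: algebra_simps)
  finally show ?thesis .
qed

text \<open>
  A \<open>K\<close>-th root of unity \<open>a\<close> in the algebraic closure, for \<open>K = (q\<^sup>m - 1) / (q - 1)\<close>, lies in the
  extension of degree \<open>m\<close> and has norm \<open>a\<^sup>K = 1\<close>. Multiplication by \<open>a\<close> is given by the companion
  matrix of the product of \<open>X - a'\<close> over the \<open>m\<close> conjugates \<open>a'\<close> of \<open>a\<close>; it has determinant 1 and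
  its \<open>E\<close>-th power is not the identity if \<open>a\<^sup>E \<noteq> 1\<close>.
\<close>

lemma exists_SL_not_killed:
  assumes m: "m > 0" and E: "\<not> (\<Sum>i<m. CARD('a::{field,finite}) ^ i) dvd E"
  shows "\<exists>C \<in> carrier (SL m :: 'a mat monoid). C ^\<^sub>m E \<noteq> 1\<^sub>m m"
proof -
  let ?q = "CARD('a)"
  let ?K = "\<Sum>i<m. ?q ^ i"
  have "of_nat ?K = (1::'a alg_closure)"
  proof -
    have "of_nat ?q = (to_ac (of_nat ?q) :: 'a alg_closure)" by (rule to_ac_of_nat[symmetric])
    then have q0: "of_nat ?q = (0 :: 'a alg_closure)" unfolding of_nat_CARD by simp
    obtain k where k: "m = Suc k" using m by (cases m) auto
    show ?thesis unfolding k sum.lessThan_Suc_shift by (simp add: q0)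
  qed
  then obtain a :: "'a alg_closure" where a: "a ^ ?K = 1" "a ^ E \<noteq> 1"
    using exists_root_of_unity[OF _ E, where 'b="'a alg_closure"] by auto
  have aqm: "a ^ ?q ^ m = a"
  proof -
    have "int (?q ^ m) = int ((?q - 1) * ?K + 1)"
      using power_diff_1_eq[of "int ?q" m] card_gt_1[where 'a='a] by (simp add: of_nat_diff)
    then have "?q ^ m = (?q - 1) * ?K + 1" by (simp only: of_nat_eq_iff)
    moreover have "a ^ ((?q - 1) * ?K) = 1" by (metis a(1) mult.commute power_mult power_one)
    ultimately show ?thesis by (simp only: power_add power_one_right mult_1)
  qed
  (* The norm polynomial of a; Frobenius permutes its factors cyclically, so its coefficients lie
     in the field. *)
  define g where "g = (\<Prod>i<m. [:- (a ^ ?q ^ i), 1:])"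
  have gS: "(\<Prod>i<m. [:- (a ^ ?q ^ Suc i), 1:]) = g"
  proof -
    obtain k where k: "m = Suc k" using m by (cases m) auto
    have "(\<Prod>i<m. [:- (a ^ ?q ^ Suc i), 1:]) = (\<Prod>i<k. [:- (a ^ ?q ^ Suc i), 1:]) * [:- (a ^ ?q ^ 0), 1:]"
      using aqm unfolding k by simp
    also have "\<dots> = g" unfolding g_def k prod.lessThan_Suc_shift by (rule mult.commute)
    finally show ?thesis .
  qed
  have fx: "coeff g j ^ ?q = coeff g j" for j
    using coeff_conjugates_prod[of a m j] gS unfolding g_def by simp
  define c where "c i = - of_ac (coeff g i)" for i
  have toc: "to_ac (c i) = - coeff g i" for i
    unfolding c_def using range_to_ac_iff[of "coeff g i"] fx[of i] by (simp add: to_ac_of_ac)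
  have deg: "degree g = m" unfolding g_def by (subst degree_prod_eq_sum_degree) simp_all
  have lead: "coeff g m = 1"
    using deg lead_coeff_prod[of "\<lambda>i. [:- (a ^ ?q ^ i), 1:]" "{..<m}"] unfolding g_def by simp
  have ga: "poly g a = 0" unfolding g_def poly_prod using m by (intro prod_zero) (auto intro!: bexI[of _ 0])
  have am: "a ^ m = (\<Sum>i<m. to_ac (c i) * a ^ i)"
  proof -
    have "0 = (\<Sum>i\<le>m. coeff g i * a ^ i)" using ga unfolding poly_altdef deg by simp
    also have "\<dots> = (\<Sum>i<m. coeff g i * a ^ i) + a ^ m"
      unfolding lessThan_Suc_atMost[symmetric] sum.lessThan_Suc lead by simp
    finally show ?thesis unfolding toc by (simp add: sum_negf eq_neg_iff_add_eq_0 add.commute)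
  qed
  have "coeff g 0 = (-1) ^ m"
  proof -
    have "coeff g 0 = (\<Prod>i<m. - (a ^ ?q ^ i))" unfolding g_def poly_0_coeff_0[symmetric] poly_prod by simp
    also have "\<dots> = (-1) ^ m * (\<Prod>i<m. a ^ ?q ^ i)" by (simp add: prod_uminus)
    also have "(\<Prod>i<m. a ^ ?q ^ i) = 1" using a(1) by (simp add: power_sum)
    finally show ?thesis by simp
  qed
  then have "to_ac ((-1) ^ (m - 1) * c 0) = 1" using m unfolding to_ac_mult toc
    by (cases m) (simp_all flip: power_mult_distrib)
  then have det: "(-1) ^ (m - 1) * c 0 = 1" by (metis to_ac_1 to_ac_eq_iff)
  let ?C = "companion m c"
  have C: "?C \<in> carrier (SL m)" using det det_companion[OF m, of c] by (simp add: SL_carrier_iff)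
  have ev: "power_eval m a (?C ^\<^sub>m k *\<^sub>v unit_vec m 0) = a ^ k" for k
  proof (induction k)
    case 0
    have "power_eval m a (unit_vec m 0) = (\<Sum>i\<in>{0}. to_ac (unit_vec m 0 $ i) * a ^ i)"
      unfolding power_eval_def using m by (intro sum.mono_neutral_right) auto
    then show ?case using m by simp
  next
    case (Suc k)
    have "?C ^\<^sub>m Suc k = ?C * ?C ^\<^sub>m k" using pow_mat_add[OF companion_carrier(1)[of m c], of 1 k] by simp
    then have "?C ^\<^sub>m Suc k *\<^sub>v unit_vec m 0 = ?C *\<^sub>v (?C ^\<^sub>m k *\<^sub>v unit_vec m 0)"
      by (simp only:) (rule assoc_square_vec[of _ m], simp_all)
    then show ?case using power_eval_companion[OF m _ am, of "?C ^\<^sub>m k *\<^sub>v unit_vec m 0"] Suc.IH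
      mult_mat_vec_carrier[of "?C ^\<^sub>m k" m m] by simp
  qed
  have "?C ^\<^sub>m E \<noteq> 1\<^sub>m m"
  proof
    assume "?C ^\<^sub>m E = 1\<^sub>m m"
    then have "a ^ E = power_eval m a (1\<^sub>m m *\<^sub>v unit_vec m 0)" using ev[of E] by simp
    also have "\<dots> = 1" using ev[of 0] by simp
    finally show False using a(2) by simp
  qed
  then show ?thesis using C by blast
qed

section \<open>Dimension at least 5\<close>

lemma functional_separating_from_line:
  fixes a c :: "'a::field vec"
  assumes a: "a \<in> carrier_vec n" and c: "c \<in> carrier_vec n" and not: "\<And>x. c \<noteq> x \<cdot>\<^sub>v a"
  shows "\<exists>f\<in>carrier_vec n. f \<bullet> a = 0 \<and> f \<bullet> c \<noteq> 0"
proof (cases "a = 0\<^sub>v n")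
  case True
  then have "c \<noteq> 0\<^sub>v n" using not[of 1] by simp
  then obtain i where i: "i < n" "c $ i \<noteq> 0" using vec_neq_zeroE[OF c] by blast
  then show ?thesis using True a c by (intro bexI[of _ "unit_vec n i"]) simp_all
next
  case False
  then obtain i where i: "i < n" "a $ i \<noteq> 0" using vec_neq_zeroE[OF a] by blast
  let ?d = "c - (c $ i / a $ i) \<cdot>\<^sub>v a"
  have d: "?d \<in> carrier_vec n" using a c by simp
  have "?d \<noteq> 0\<^sub>v n"
  proof
    assume "?d = 0\<^sub>v n"
    have "c = (c $ i / a $ i) \<cdot>\<^sub>v a"
    proof (rule eq_vecI)
      fix j assume "j < dim_vec ((c $ i / a $ i) \<cdot>\<^sub>v a)"
      then show "c $ j = ((c $ i / a $ i) \<cdot>\<^sub>v a) $ j"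
        using arg_cong[OF \<open>?d = 0\<^sub>v n\<close>, of "\<lambda>v. v $ j"] a c by simp
    qed (use a c in simp)
    then show False using not by blast
  qed
  then obtain j where j: "j < n" "?d $ j \<noteq> 0" using vec_neq_zeroE[OF d] by blast
  let ?f = "unit_vec n j - (a $ j / a $ i) \<cdot>\<^sub>v unit_vec n i"
  have f: "?f \<bullet> w = w $ j - a $ j / a $ i * w $ i" if "w \<in> carrier_vec n" for w
    using that i j by (simp add: minus_scalar_prod_distrib[of _ n])
  have "?f \<bullet> a = 0" "?f \<bullet> c \<noteq> 0" using f[OF a] f[OF c] i j a c by (simp_all add: mult.commute)
  then show ?thesis by (intro bexI[of _ ?f]) simp_all
qed

text \<open>
  Projecting along \<open>a\<close> reduces this to the separation of a vector from a line.
\<close>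

lemma functional_separating_from_plane:
  fixes a b c :: "'a::field vec"
  assumes a: "a \<in> carrier_vec n" and b: "b \<in> carrier_vec n" and c: "c \<in> carrier_vec n"
    and not: "\<And>x y. c \<noteq> x \<cdot>\<^sub>v a + y \<cdot>\<^sub>v b"
  shows "\<exists>f\<in>carrier_vec n. f \<bullet> a = 0 \<and> f \<bullet> b = 0 \<and> f \<bullet> c \<noteq> 0"
proof (cases "a = 0\<^sub>v n")
  case True
  then have "c \<noteq> y \<cdot>\<^sub>v b" for y using not[of 0 y] b by simp
  then show ?thesis using functional_separating_from_line[OF b c] True by auto
next
  case False
  then obtain i where i: "i < n" "a $ i \<noteq> 0" using vec_neq_zeroE[OF a] by blast
  define pr where "pr w = w - (w $ i / a $ i) \<cdot>\<^sub>v a" for w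
  have pr: "pr w \<in> carrier_vec n" if "w \<in> carrier_vec n" for w using that a by (simp add: pr_def)
  have "pr c \<noteq> x \<cdot>\<^sub>v pr b" for x
  proof
    assume eq: "pr c = x \<cdot>\<^sub>v pr b"
    have "c = (c $ i / a $ i - x * (b $ i / a $ i)) \<cdot>\<^sub>v a + x \<cdot>\<^sub>v b"
    proof (rule eq_vecI)
      fix j assume "j < dim_vec ((c $ i / a $ i - x * (b $ i / a $ i)) \<cdot>\<^sub>v a + x \<cdot>\<^sub>v b)"
      then have "c $ j - c $ i / a $ i * a $ j = x * (b $ j - b $ i / a $ i * a $ j)"
        using arg_cong[OF eq, of "\<lambda>v. v $ j"] a b c by (simp add: pr_def)
      then show "c $ j = ((c $ i / a $ i - x * (b $ i / a $ i)) \<cdot>\<^sub>v a + x \<cdot>\<^sub>v b) $ j"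
        using a b c \<open>j < _\<close> by (simp add: algebra_simps)
    qed (use b c in simp)
    then show False using not by blast
  qed
  then obtain f where f: "f \<in> carrier_vec n" "f \<bullet> pr b = 0" "f \<bullet> pr c \<noteq> 0"
    using functional_separating_from_line[OF pr[OF b] pr[OF c]] by blast
  let ?g = "f - ((f \<bullet> a) / a $ i) \<cdot>\<^sub>v unit_vec n i"
  have g: "?g \<bullet> w = f \<bullet> pr w" if w: "w \<in> carrier_vec n" for w
    using w a i f(1) by (simp add: pr_def minus_scalar_prod_distrib[of _ n] scalar_prod_minus_distrib[of _ n])
  have "?g \<bullet> a = 0" using g[OF a] i a f(1) by (simp add: pr_def scalar_prod_minus_distrib[of _ n])
  then show ?thesis using g[OF b] g[OF c] f by (intro bexI[of _ ?g]) simp_all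
qed

lemma smult_mat_mult_vec:
  fixes A :: "'a::comm_ring_1 mat"
  assumes "A \<in> carrier_mat n m" "v \<in> carrier_vec m"
  shows "(c \<cdot>\<^sub>m A) *\<^sub>v v = c \<cdot>\<^sub>v (A *\<^sub>v v)"
  using assms by (intro eq_vecI) (auto simp: scalar_prod_def sum_distrib_left mult.assoc)

lemma mat_poly_eigenvector:
  fixes A :: "'a::field mat"
  assumes A: "A \<in> carrier_mat n n" and e: "e \<in> carrier_vec n" and Ae: "A *\<^sub>v e = c \<cdot>\<^sub>v e"
  shows "mat_poly n A f *\<^sub>v e = poly f c \<cdot>\<^sub>v e"
proof (induction f)
  case 0
  show ?case using e by (simp add: zero_mat_mult_vec) (intro eq_vecI; simp)
next
  case (pCons a f)
  have "mat_poly n A (pCons a f) *\<^sub>v e = (a \<cdot>\<^sub>m 1\<^sub>m n) *\<^sub>v e + (A * mat_poly n A f) *\<^sub>v e"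
    unfolding mat_poly_pCons[OF A] using A e by (intro add_mult_distrib_mat_vec[of _ n n]) (simp_all add: mult_carrier_square)
  also have "(A * mat_poly n A f) *\<^sub>v e = A *\<^sub>v (poly f c \<cdot>\<^sub>v e)"
    unfolding pCons.IH[symmetric] using A e by (intro assoc_square_vec[of _ n]) simp_all
  also have "\<dots> = poly f c \<cdot>\<^sub>v (c \<cdot>\<^sub>v e)" unfolding Ae[symmetric] by (rule mult_mat_vec[OF A e])
  finally show ?case unfolding smult_one_mat_mult_vec[OF e]
    by simp (intro eq_vecI; simp add: algebra_simps)
qed

text \<open>
  The minimal polynomial of \<open>w + e\<close> is divisible by \<open>(X - 1) f\<close>, of degree at least 3. So
  \<open>u = w + e\<close> is not in the span of \<open>t u\<close> and \<open>t\<^sup>2 u\<close>; a functional that separates it from them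
  gives the claim with \<open>v = t u\<close>.
\<close>

lemma cyclic_vector_functional:
  fixes t :: "'a::field mat"
  assumes t: "t \<in> carrier (SL n)" and f: "prime_elem f" "2 \<le> degree f"
    and w: "w \<in> carrier_vec n" "w \<noteq> 0\<^sub>v n" "mat_poly n t f *\<^sub>v w = 0\<^sub>v n"
    and e: "e \<in> carrier_vec n" "e \<noteq> 0\<^sub>v n" "t *\<^sub>v e = e"
  shows "\<exists>v\<in>carrier_vec n. \<exists>h\<in>carrier_vec n. h \<bullet> v = 0 \<and> h \<bullet> (t *\<^sub>v v) = 0 \<and> h \<bullet> (inv\<^bsub>SL n\<^esub> t *\<^sub>v v) \<noteq> 0"
proof -
  note tc = SL_carrier_mat[OF t]
  define u where "u = w + e"
  have u: "u \<in> carrier_vec n" using w e by (simp add: u_def)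
  have tu: "t *\<^sub>v u \<in> carrier_vec n" and ttu: "t *\<^sub>v (t *\<^sub>v u) \<in> carrier_vec n" using tc u by simp_all
  have te: "t *\<^sub>v e = 1 \<cdot>\<^sub>v e" using e by simp
  have f1: "poly f 1 \<noteq> 0" by (rule prime_poly_no_root[OF f])
  have "u \<noteq> x \<cdot>\<^sub>v (t *\<^sub>v u) + y \<cdot>\<^sub>v (t *\<^sub>v (t *\<^sub>v u))" for x y
  proof
    assume eq: "u = x \<cdot>\<^sub>v (t *\<^sub>v u) + y \<cdot>\<^sub>v (t *\<^sub>v (t *\<^sub>v u))"
    define g where "g = 1 - (smult x [:0, 1:] + smult y ([:0, 1:] * [:0, 1:]))"
    have "mat_poly n t g *\<^sub>v u = 0\<^sub>v n"
    proof -
      have "mat_poly n t g = 1\<^sub>m n - (x \<cdot>\<^sub>m t + y \<cdot>\<^sub>m (t * t))"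
        unfolding g_def mat_poly_diff[OF tc] mat_poly_add[OF tc] mat_poly_smult[OF tc] mat_poly_mult[OF tc]
          mat_poly_X[OF tc] mat_poly_1[OF tc] ..
      also have "\<dots> *\<^sub>v u = 1\<^sub>m n *\<^sub>v u - (x \<cdot>\<^sub>m t + y \<cdot>\<^sub>m (t * t)) *\<^sub>v u"
        using tc u by (intro minus_mult_distrib_mat_vec[of _ n n]) simp_all
      also have "(x \<cdot>\<^sub>m t + y \<cdot>\<^sub>m (t * t)) *\<^sub>v u = (x \<cdot>\<^sub>m t) *\<^sub>v u + (y \<cdot>\<^sub>m (t * t)) *\<^sub>v u"
        using tc u by (intro add_mult_distrib_mat_vec[of _ n n]) simp_all
      also have "\<dots> = x \<cdot>\<^sub>v (t *\<^sub>v u) + y \<cdot>\<^sub>v (t *\<^sub>v (t *\<^sub>v u))"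
        using tc u by (simp add: smult_mat_mult_vec[of _ n n] assoc_square_vec[of _ n])
      also have "\<dots> = u" by (rule eq[symmetric])
      finally show ?thesis using u by simp
    qed
    then have gu: "mat_poly n t g *\<^sub>v w + poly g 1 \<cdot>\<^sub>v e = 0\<^sub>v n"
      unfolding u_def mat_poly_eigenvector[OF tc e(1) te, symmetric]
      using mult_add_distrib_mat_vec[OF mat_poly_carrier[OF tc, of g] w(1) e(1)] by simp
    have fg: "mat_poly n t f *\<^sub>v (mat_poly n t g *\<^sub>v w) = 0\<^sub>v n"
      unfolding mat_poly_mult_vec[OF tc w(1), symmetric] mult.commute[of f g]
      unfolding mat_poly_mult_vec[OF tc w(1)] w(3) by (rule mult_mat_zero_vec[OF mat_poly_carrier[OF tc]])
    have gw: "mat_poly n t g *\<^sub>v w \<in> carrier_vec n" using tc w by simp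
    have "0\<^sub>v n = mat_poly n t f *\<^sub>v (mat_poly n t g *\<^sub>v w + poly g 1 \<cdot>\<^sub>v e)"
      unfolding gu by (rule mult_mat_zero_vec[OF mat_poly_carrier[OF tc], symmetric])
    also have "\<dots> = 0\<^sub>v n + poly g 1 \<cdot>\<^sub>v (poly f 1 \<cdot>\<^sub>v e)"
      using mult_add_distrib_mat_vec[OF mat_poly_carrier[OF tc, of f] gw, of "poly g 1 \<cdot>\<^sub>v e"] e(1)
        mult_mat_vec[OF mat_poly_carrier[OF tc, of f] e(1), of "poly g 1"]
      by (simp add: fg mat_poly_eigenvector[OF tc e(1) te])
    finally have "(poly g 1 * poly f 1) \<cdot>\<^sub>v e = 0\<^sub>v n" using e(1) by (simp add: smult_smult_assoc)
    then have g1: "poly g 1 = 0" using smult_vec_nonzero[OF e(1,2), of "poly g 1 * poly f 1"] f1 by auto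
    have "0 \<cdot>\<^sub>v e = 0\<^sub>v n" by (intro eq_vecI) (use e(1) in simp_all)
    then have "mat_poly n t g *\<^sub>v w = 0\<^sub>v n" using gu gw unfolding g1 by simp
    then have "f dvd g" by (rule mat_poly_prime_kernel[OF tc w(1,2) f(1) w(3)])
    then obtain h where h: "g = f * h" by (elim dvdE)
    have c0: "coeff g 0 = 1" by (simp add: g_def)
    have "degree g \<le> 2" unfolding g_def
      by (intro degree_diff_le degree_add_le) (simp_all add: degree_smult_le[THEN order_trans])
    moreover have fh: "f \<noteq> 0" "h \<noteq> 0" using c0 h by auto
    ultimately have "degree h = 0" using f(2) unfolding h by (simp add: degree_mult_eq)
    then obtain d where "h = [:d:]" by (elim degree_eq_zeroE)
    then show False using g1 f1 fh unfolding h by simp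
  qed
  then obtain h where h: "h \<in> carrier_vec n" "h \<bullet> (t *\<^sub>v u) = 0" "h \<bullet> (t *\<^sub>v (t *\<^sub>v u)) = 0" "h \<bullet> u \<noteq> 0"
    using functional_separating_from_plane[OF tu ttu u] by blast
  have "inv\<^bsub>SL n\<^esub> t *\<^sub>v (t *\<^sub>v u) = u"
    using assoc_square_vec[OF SL_carrier_mat[OF SL_inv(1)[OF t]] tc u] SL_inv[OF t] u by simp
  then show ?thesis using h tu by (intro bexI[of _ "t *\<^sub>v u"] bexI[of _ h]) simp_all
qed

text \<open>
  The conjugate by \<open>s\<close> is \<open>transv (s\<^sup>-\<^sup>1 v) (s\<^sup>T f)\<close>, and the hypotheses are the orthogonality
  relations under which the commutator is a nontrivial transvection.
\<close>

lemma comm_conj_transv_power_neq_1: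
  fixes v :: "'a::{field,finite} vec"
  assumes v: "v \<in> carrier_vec n" and f: "f \<in> carrier_vec n" "f \<bullet> v = 0" and z: "transv v f \<in> carrier (SL n)"
    and s: "s \<in> carrier (SL n)" and fs: "f \<bullet> (s *\<^sub>v v) = 0" "f \<bullet> (inv\<^bsub>SL n\<^esub> s *\<^sub>v v) \<noteq> 0"
  shows "comm_mat n (transv v f) (conj_mat n s (transv v f)) ^\<^sub>m semisimple_exponent TYPE('a) n \<noteq> 1\<^sub>m n"
proof -
  note sc = SL_carrier_mat[OF s]
  have st: "(s\<^sup>T *\<^sub>v f) \<bullet> u = f \<bullet> (s *\<^sub>v u)" if "u \<in> carrier_vec n" for u
    by (rule transpose_vec_mult_scalar[OF sc that f(1)])
  have si: "s *\<^sub>v (inv\<^bsub>SL n\<^esub> s *\<^sub>v u) = u" "inv\<^bsub>SL n\<^esub> s *\<^sub>v (s *\<^sub>v u) = u" if "u \<in> carrier_vec n" for u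
    using assoc_square_vec[OF SL_carrier_mat[OF SL_inv(1)[OF s]] sc that]
      assoc_square_vec[OF sc SL_carrier_mat[OF SL_inv(1)[OF s]] that] SL_inv[OF s] that by simp_all
  note c = conj_mat_transv[OF s v f(1)]
  have "f \<noteq> 0\<^sub>v n" "inv\<^bsub>SL n\<^esub> s *\<^sub>v v \<noteq> 0\<^sub>v n" using scalar_prod_nonzero[OF f(1) c(2) fs(2)] .
  have v0: "v \<noteq> 0\<^sub>v n"
  proof
    assume "v = 0\<^sub>v n"
    then have "inv\<^bsub>SL n\<^esub> s *\<^sub>v v = 0\<^sub>v n" using mult_mat_zero_vec[OF SL_carrier_mat[OF SL_inv(1)[OF s]]] by simp
    then show False using \<open>inv\<^bsub>SL n\<^esub> s *\<^sub>v v \<noteq> 0\<^sub>v n\<close> by simp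
  qed
  have g0: "s\<^sup>T *\<^sub>v f \<noteq> 0\<^sub>v n"
  proof
    assume "s\<^sup>T *\<^sub>v f = 0\<^sub>v n"
    moreover have iv: "inv\<^bsub>SL n\<^esub> s *\<^sub>v (inv\<^bsub>SL n\<^esub> s *\<^sub>v v) \<in> carrier_vec n"
      using SL_carrier_mat[OF SL_inv(1)[OF s]] v by simp
    ultimately have "f \<bullet> (s *\<^sub>v (inv\<^bsub>SL n\<^esub> s *\<^sub>v (inv\<^bsub>SL n\<^esub> s *\<^sub>v v))) = 0" using st[OF iv] by simp
    then show False using fs(2) unfolding si(1)[OF c(2)] by simp
  qed
  have cz: "transv (inv\<^bsub>SL n\<^esub> s *\<^sub>v v) (s\<^sup>T *\<^sub>v f) \<in> carrier (SL n)"
    unfolding c(1)[symmetric] by (rule conj_mat_closed[OF s z])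
  show ?thesis unfolding c(1)
    by (rule comm_mat_power_neq_1[OF v f z c(2,3) _ cz _ fs(2) g0 v0]) (use c(4) f(2) st[OF v] fs(1) in simp_all)
qed

lemma conj_mat_mult:
  fixes A :: "'a::field mat"
  assumes P: "P \<in> carrier (SL n)" and A: "A \<in> carrier_mat n n" and B: "B \<in> carrier_mat n n"
  shows "conj_mat n P (A * B) = conj_mat n P A * conj_mat n P B"
proof -
  note Pc = SL_carrier_mat[OF P] SL_carrier_mat[OF SL_inv(1)[OF P]]
  let ?I = "inv\<^bsub>SL n\<^esub> P"
  have "conj_mat n P A * conj_mat n P B = ?I * A * (P * ?I) * (B * P)"
    unfolding conj_mat_def using Pc A B by (simp add: assoc_mult_mat[of _ n n _ n _ n] del: SL_inv)
  also have "P * ?I = 1\<^sub>m n" using SL_inv[OF P] by simp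
  also have "?I * A * 1\<^sub>m n * (B * P) = ?I * (A * B) * P"
    using Pc A B by (simp add: assoc_mult_mat[of _ n n _ n _ n])
  finally show ?thesis by (simp add: conj_mat_def)
qed

lemma conj_mat_one: "P \<in> carrier (SL n) \<Longrightarrow> conj_mat n P (1\<^sub>m n) = (1\<^sub>m n :: 'a::field mat)"
  using conj_mat_scalar[of P n 1] by simp

lemma conj_mat_inv:
  fixes A :: "'a::field mat"
  assumes P: "P \<in> carrier (SL n)" and A: "A \<in> carrier (SL n)"
  shows "conj_mat n P (inv\<^bsub>SL n\<^esub> A) = inv\<^bsub>SL n\<^esub> (conj_mat n P A)"
proof (rule SL_inv_eqI[symmetric])
  show "conj_mat n P (inv\<^bsub>SL n\<^esub> A) * conj_mat n P A = 1\<^sub>m n"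
    using conj_mat_mult[OF P SL_carrier_mat[OF SL_inv(1)[OF A]] SL_carrier_mat[OF A]] SL_inv[OF A] conj_mat_one[OF P] by simp
qed (intro conj_mat_closed P A SL_inv(1))+

lemma conj_mat_pow:
  fixes A :: "'a::field mat"
  assumes P: "P \<in> carrier (SL n)" and A: "A \<in> carrier (SL n)"
  shows "conj_mat n P (A ^\<^sub>m k) = conj_mat n P A ^\<^sub>m k"
proof (induction k)
  case 0
  show ?case using conj_mat_one[OF P] SL_carrier_mat[OF A] SL_carrier_mat[OF conj_mat_closed[OF P A]] by simp
next
  case (Suc k)
  then show ?case
    using conj_mat_mult[OF P pow_carrier_mat[OF SL_carrier_mat[OF A], of k] SL_carrier_mat[OF A]] by simp
qed

lemma conj_mat_comm_mat:
  fixes A :: "'a::field mat"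
  assumes P: "P \<in> carrier (SL n)" and A: "A \<in> carrier (SL n)" and B: "B \<in> carrier (SL n)"
  shows "conj_mat n P (comm_mat n A B) = comm_mat n (conj_mat n P A) (conj_mat n P B)"
  unfolding comm_mat_def conj_mat_inv[OF P A, symmetric] conj_mat_inv[OF P B, symmetric]
  using SL_carrier_mat[OF A] SL_carrier_mat[OF B] SL_carrier_mat[OF SL_inv(1)[OF A]] SL_carrier_mat[OF SL_inv(1)[OF B]]
  by (simp add: conj_mat_mult[OF P] mult_carrier_square)

lemma conj_mat_conj_mat:
  fixes A :: "'a::field mat"
  assumes P: "P \<in> carrier (SL n)" and A: "A \<in> carrier (SL n)" and B: "B \<in> carrier (SL n)"
  shows "conj_mat n P (conj_mat n A B) = conj_mat n (conj_mat n P A) (conj_mat n P B)"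
  unfolding conj_mat_def[of n A] conj_mat_def[of n "conj_mat n P A"] conj_mat_inv[OF P A, symmetric]
  using SL_carrier_mat[OF A] SL_carrier_mat[OF B] SL_carrier_mat[OF SL_inv(1)[OF A]]
  by (simp only: conj_mat_mult[OF P] mult_carrier_square)

lemma conj_mat_of_conjugate:
  fixes A :: "'a::field mat"
  assumes P: "P \<in> carrier (SL n)" and A: "A \<in> carrier_mat n n"
  shows "conj_mat n P (P * A * inv\<^bsub>SL n\<^esub> P) = A"
proof -
  note Pc = SL_carrier_mat[OF P] SL_carrier_mat[OF SL_inv(1)[OF P]]
  let ?I = "inv\<^bsub>SL n\<^esub> P"
  have "conj_mat n P (P * A * ?I) = (?I * P) * A * (?I * P)"
    unfolding conj_mat_def using Pc A by (simp add: assoc_mult_mat[of _ n n _ n _ n] del: SL_inv)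
  also have "?I * P = 1\<^sub>m n" using SL_inv[OF P] by simp
  finally show ?thesis using A by simp
qed

lemma conj_mat_eq_1:
  fixes A :: "'a::field mat"
  assumes P: "P \<in> carrier (SL n)" and A: "A \<in> carrier (SL n)" and eq: "conj_mat n P A = 1\<^sub>m n"
  shows "A = 1\<^sub>m n"
proof -
  note Pc = SL_carrier_mat[OF P] SL_carrier_mat[OF SL_inv(1)[OF P]] and Ac = SL_carrier_mat[OF A]
  let ?I = "inv\<^bsub>SL n\<^esub> P"
  have "A = (P * ?I) * A * (P * ?I)" using Ac SL_inv[OF P] by simp
  also have "\<dots> = P * conj_mat n P A * ?I"
    unfolding conj_mat_def using Pc Ac by (simp add: assoc_mult_mat[of _ n n _ n _ n] del: SL_inv)
  also have "\<dots> = 1\<^sub>m n" unfolding eq using Pc SL_inv[OF P] by simp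
  finally show ?thesis .
qed

lemma large_prime_kernel_transvection:
  fixes x :: "'a::{field,finite} mat"
  assumes x: "x \<in> carrier (SL n)" and f: "prime_elem f"
    and u: "u \<in> carrier_vec n" "u \<noteq> 0\<^sub>v n" "mat_poly n x f *\<^sub>v u = 0\<^sub>v n"
    and deg: "n \<le> degree f + 2" "2 \<le> degree f"
  shows "x ^\<^sub>m semisimple_exponent TYPE('a) n \<in> {1\<^sub>m n} \<union> transvections n \<or>
    n = 4 \<and> degree f = 2 \<and> mat_poly n x (f ^ 2) = 0\<^sub>m n n"
proof -
  let ?M = "semisimple_exponent TYPE('a) n"
  note xc = SL_carrier_mat[OF x]
  have dx: "det x \<noteq> 0" using x by (simp add: SL_carrier_iff)
  have N: "x ^\<^sub>m ?M - 1\<^sub>m n = mat_poly n x ([:0, 1:] ^ ?M - 1)"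
    by (simp only: mat_poly_diff[OF xc] mat_poly_X_power[OF xc] mat_poly_1[OF xc])
  have "degree f \<le> n" by (rule degree_prime_le_dim[OF xc u(1,2) f u(3)])
  then have "CARD('a) ^ degree f - 1 dvd ?M" using deg by (intro semisimple_exponent_dvd) simp_all
  then have "f dvd [:0, 1:] ^ ?M - 1" by (rule prime_kernel_dvd_X_power_minus_1[OF xc u(1,2) dx f u(3)])
  from large_prime_kernel[OF xc N semisimple_part_nilpotent[OF x] f this u deg]
  show ?thesis
  proof (elim disjE bexE)
    fix v g assume "v \<in> carrier_vec n" "g \<in> carrier_vec n" "x ^\<^sub>m ?M - 1\<^sub>m n = outer_prod v g"
    then show ?thesis
      using unipotent_in_transvections[OF SL_pow_closed[OF x] _ _ _ semisimple_part_nilpotent[OF x]] by blast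
  next
    assume "n = 4 \<and> degree f = 2 \<and> mat_poly n x (f ^ 2) = 0\<^sub>m n n"
    then show ?thesis by (rule disjI2)
  qed
qed

definition small_degree_exponent :: "'a::{field,finite} itself \<Rightarrow> nat \<Rightarrow> nat" where
  "small_degree_exponent _ m = Lcm ((\<lambda>d. CARD('a) ^ d - 1) ` {1..<m})"

text \<open>
  If all irreducible polynomials with a kernel at \<open>x\<close> have degree below \<open>n - 2\<close>, they divide
  \<open>X\<^sup>L - 1\<close> and the first alternative holds; otherwise \<open>large_prime_kernel_transvection\<close> applies.
\<close>

lemma small_degree_power_or_transvection:
  fixes x :: "'a::{field,finite} mat"
  assumes n: "n \<ge> 5" and x: "x \<in> carrier (SL n)"
  shows "x ^\<^sub>m (small_degree_exponent TYPE('a) (n - 2) * CHAR('a) ^ n) = 1\<^sub>m n \<or>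
    x ^\<^sub>m semisimple_exponent TYPE('a) n \<in> {1\<^sub>m n} \<union> transvections n"
proof (rule disjCI)
  let ?L = "small_degree_exponent TYPE('a) (n - 2)"
  note xc = SL_carrier_mat[OF x]
  have dx: "det x \<noteq> 0" using x by (simp add: SL_carrier_iff)
  assume no: "x ^\<^sub>m semisimple_exponent TYPE('a) n \<notin> {1\<^sub>m n} \<union> transvections n"
  have "f dvd [:0, 1:] ^ ?L - [:1:]"
    if f: "prime_elem f" and v: "v \<in> carrier_vec n" "v \<noteq> 0\<^sub>v n" "mat_poly n x f *\<^sub>v v = 0\<^sub>v n" for f v
  proof -
    have "degree f < n - 2"
    proof (rule ccontr)
      assume "\<not> degree f < n - 2"
      then show False using large_prime_kernel_transvection[OF x f v] no n by linarith
    qed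
    then have "CARD('a) ^ degree f - 1 dvd ?L"
      using degree_prime_poly_pos[OF f] unfolding small_degree_exponent_def by (intro dvd_Lcm) auto
    then have "f dvd [:0, 1:] ^ ?L - 1" by (rule prime_kernel_dvd_X_power_minus_1[OF xc v(1,2) dx f v(3)])
    then show ?thesis by (simp add: one_pCons)
  qed
  from scalar_power_if_prime_kernels_dvd[OF xc CHAR_power_ge this]
  show "x ^\<^sub>m (?L * CHAR('a) ^ n) = 1\<^sub>m n" by simp
qed

text \<open>
  The word is \<open>[z, z\<^sup>h]\<^sup>M\<close> with \<open>h = t\<^sup>y\<close>, where \<open>z = x\<^sup>M\<close> and \<open>t = x\<^sup>L\<^sup>P\<close> for \<open>P = p\<^sup>n\<close>. If \<open>z\<close>
  is neither trivial nor a transvection, then \<open>t = 1\<close> and \<open>z\<^sup>h = z\<close>.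
\<close>

theorem word_values_SL_ge_5:
  assumes n: "n \<ge> 5"
  shows "\<exists>w\<in>carrier (free_group 2).
    word_values (SL n :: 'a::{field,finite} mat monoid) 2 w = {1\<^sub>m n} \<union> transvections n"
proof -
  let ?G = "SL n :: 'a mat monoid" and ?M = "semisimple_exponent TYPE('a) n" and ?q = "CARD('a)"
  let ?L = "small_degree_exponent TYPE('a) (n - 2)" and ?P = "CHAR('a) ^ n"
  define z where "z x = x ^\<^sub>m ?M" for x :: "'a mat"
  define t where "t x = x ^\<^sub>m (?L * ?P)" for x :: "'a mat"
  define F where "F x y = comm_mat n (z x) (conj_mat n (conj_mat n y (t x)) (z x)) ^\<^sub>m ?M" for x y :: "'a mat"
  note cl = SL_pow_closed conj_mat_closed comm_mat_closed
  show ?thesis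
  proof (rule word_values_transvections[of _ F])
    show "n \<ge> 3" using n by simp
    show "is_word_map ?G F"
      unfolding F_def z_def t_def
      by (intro is_word_map_pow_mat is_word_map_comm_mat is_word_map_conj_mat is_word_map_proj cl group_SL)
  next
    fix x y assume x: "x \<in> carrier ?G" and y: "y \<in> carrier ?G"
    show "F x y \<in> {1\<^sub>m n} \<union> transvections n"
      using small_degree_power_or_transvection[OF n x]
    proof
      assume "x ^\<^sub>m (?L * ?P) = 1\<^sub>m n"
      then have t: "t x = 1 \<cdot>\<^sub>m 1\<^sub>m n" by (simp add: t_def)
      have zc: "z x \<in> carrier ?G" unfolding z_def by (rule SL_pow_closed[OF x])
      have one: "1\<^sub>m n \<in> carrier ?G" by (simp add: SL_carrier_iff)
      have "conj_mat n y (t x) = 1\<^sub>m n" unfolding t conj_mat_scalar[OF y] by simp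
      moreover have "conj_mat n (1\<^sub>m n) (z x) = z x"
        using SL_carrier_mat[OF zc] by (intro conj_mat_commuting one) simp_all
      ultimately have "F x y = 1\<^sub>m n" unfolding F_def by (simp add: comm_mat_self[OF zc])
      then show ?thesis by simp
    next
      assume "x ^\<^sub>m ?M \<in> {1\<^sub>m n} \<union> transvections n"
      then show ?thesis unfolding F_def z_def t_def
        using n by (intro comm_mat_power_transvections conj_mat_transvections cl x y) simp_all
    qed
  next
    define m where "m = n - 2"
    have m: "m \<ge> 3" "n = m + 2" using n by (simp_all add: m_def)
    let ?K = "\<Sum>i<m. ?q ^ i" and ?E = "?L * ?P * ((?q - 1) * ?P)"
    have K: "(?q - 1) * ?K = ?q ^ m - 1"
    proof -
      have "int ((?q - 1) * ?K + 1) = int (?q ^ m)"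
        using power_diff_1_eq[of "int ?q" m] card_gt_1[where 'a='a] by (simp add: of_nat_diff)
      then have "(?q - 1) * ?K + 1 = ?q ^ m" by (simp only: of_nat_eq_iff)
      then show ?thesis by simp
    qed
    have "\<not> ?K dvd ?E"
    proof
      assume dvd: "?K dvd ?E"
      obtain k where k: "m = Suc k" using m by (cases m) auto
      have "of_nat ?K = (1::'a)" unfolding k sum.lessThan_Suc_shift by (simp add: of_nat_CARD)
      then have cop: "coprime ?K ?P" by (intro coprime_CHAR) simp
      have "?E = ?L * (?q - 1) * ?P * ?P" by (simp only: ac_simps)
      then have "?K dvd ?L * (?q - 1)" using dvd cop by (simp only: coprime_dvd_mult_left_iff)
      then have "(?q - 1) * ?K dvd (?q - 1) * (?L * (?q - 1))" by (rule mult_dvd_mono[OF dvd_refl])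
      then have "?q ^ m - 1 dvd ?L * (?q - 1)\<^sup>2" unfolding K by (simp add: power2_eq_square ac_simps)
      then show False
        using power_minus_1_not_dvd_Lcm[of ?q m] m card_gt_1[where 'a='a]
        unfolding small_degree_exponent_def m_def by simp
    qed
    then obtain C :: "'a mat" where C: "C \<in> carrier (SL m)" "C ^\<^sub>m ?E \<noteq> 1\<^sub>m m"
      using exists_SL_not_killed[of m ?E] m by auto
    note Cc = SL_carrier_mat[OF C(1)]
    define J where "J = jordan_block 2 (1::'a)"
    have Jc: "J \<in> carrier_mat 2 2" by (simp add: J_def)
    have Jpow: "(J ^\<^sub>m k) $$ (0, 0) = 1" "(J ^\<^sub>m k) $$ (1, 0) = 0" "(J ^\<^sub>m k) $$ (0, 1) = of_nat k" for k
      unfolding J_def jordan_block_pow by simp_all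
    have "upper_triangular J" by (auto simp: J_def jordan_block_def)
    then have dJ: "det J = 1" using det_upper_triangular[OF _ Jc] by (simp add: prod_list_diag_prod J_def jordan_block_def)
    (* The unipotent block survives the exponent M, and the block C survives the exponent E. *)
    define x where "x = four_block_mat C (0\<^sub>m m 2) (0\<^sub>m 2 m) J"
    have xc: "x \<in> carrier_mat n n" unfolding x_def m(2) using Cc Jc by (rule four_block_carrier_mat)
    have "det x = det C * det J" unfolding x_def by (rule det_four_block_mat_lower_left_zero[OF Cc _ _ Jc]) simp_all
    then have x: "x \<in> carrier ?G" using xc C(1) dJ by (simp add: SL_carrier_iff)
    have xpow: "x ^\<^sub>m k = four_block_mat (C ^\<^sub>m k) (0\<^sub>m m 2) (0\<^sub>m 2 m) (J ^\<^sub>m k)" for k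
      unfolding x_def by (rule pow_four_block_mat[OF Cc Jc])
    have Cd: "dim_row (C ^\<^sub>m k) = m" "dim_col (C ^\<^sub>m k) = m" "dim_row (J ^\<^sub>m k) = 2" "dim_col (J ^\<^sub>m k) = 2" for k
      using pow_carrier_mat[OF Cc, of k] pow_carrier_mat[OF Jc, of k] by auto
    have blk: "(x ^\<^sub>m k) $$ (i, j) = (if i < m then if j < m then (C ^\<^sub>m k) $$ (i, j) else 0
        else if j < m then 0 else (J ^\<^sub>m k) $$ (i - m, j - m))" if "i < n" "j < n" for i j k
    proof -
      have "i - m < 2" "j - m < 2" using that m(2) by auto
      then show ?thesis
        using that unfolding xpow m(2) by (subst index_mat_four_block(1)) (simp_all only: Cd index_zero_mat split: if_split, simp_all)
    qed
    have xE: "x ^\<^sub>m ?E \<noteq> 1\<^sub>m n"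
    proof
      assume eq: "x ^\<^sub>m ?E = 1\<^sub>m n"
      have "C ^\<^sub>m ?E = 1\<^sub>m m"
      proof (rule eq_matI)
        fix i j assume ij: "i < dim_row (1\<^sub>m m :: 'a mat)" "j < dim_col (1\<^sub>m m :: 'a mat)"
        then have "(C ^\<^sub>m ?E) $$ (i, j) = (x ^\<^sub>m ?E) $$ (i, j)" using blk[of i j ?E] m(2) by simp
        then show "(C ^\<^sub>m ?E) $$ (i, j) = 1\<^sub>m m $$ (i, j)" unfolding eq using ij m(2) by simp
      qed (use pow_carrier_mat[OF Cc, of ?E] in \<open>simp_all only: carrier_mat_def mem_Collect_eq index_one_mat\<close>)
      then show False using C(2) by blast
    qed
    have zx: "z x \<noteq> 1\<^sub>m n"
    proof
      assume "z x = 1\<^sub>m n"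
      then have "(x ^\<^sub>m ?M) $$ (m, m + 1) = 0" using m(2) by (simp add: z_def)
      then have "of_nat ?M = (0::'a)" using blk[of m "m + 1" ?M] Jpow(3)[of ?M] m(2) by simp
      then show False using of_nat_semisimple_exponent[of n, where 'a='a] by blast
    qed
    have tG: "t x \<in> carrier ?G" unfolding t_def by (rule SL_pow_closed[OF x])
    have tE: "t x ^\<^sub>m ((?q - 1) * ?P) = x ^\<^sub>m ?E" unfolding t_def by (rule pow_mat_mult[OF xc, symmetric])
    have "t x \<noteq> 1\<^sub>m n" using xE unfolding tE[symmetric] by auto
    then have zT: "z x \<in> transvections n"
      using small_degree_power_or_transvection[OF n x] zx unfolding z_def t_def by blast
    (* If only linear polynomials had a kernel at t, then t would become 1 after raising it to (q
       - 1) times a power of p, against the choice of C. *)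
    have "\<exists>f u. prime_elem f \<and> 2 \<le> degree f \<and> u \<in> carrier_vec n \<and> u \<noteq> 0\<^sub>v n \<and> mat_poly n (t x) f *\<^sub>v u = 0\<^sub>v n"
    proof (rule ccontr)
      assume no: "\<not> ?thesis"
      have "f dvd [:0, 1:] ^ (?q - 1) - [:1:]"
        if f: "prime_elem f" and v: "v \<in> carrier_vec n" "v \<noteq> 0\<^sub>v n" "mat_poly n (t x) f *\<^sub>v v = 0\<^sub>v n" for f v
      proof -
        have "\<not> 2 \<le> degree f" using no f v by blast
        then have "degree f = 1" using degree_prime_poly_pos[OF f] by linarith
        then have "?q ^ degree f - 1 dvd ?q - 1" by simp
        then have "f dvd [:0, 1:] ^ (?q - 1) - 1"
          using tG by (intro prime_kernel_dvd_X_power_minus_1[OF SL_carrier_mat[OF tG] v(1,2) _ f v(3)]) (simp_all add: SL_carrier_iff)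
        then show ?thesis by (simp add: one_pCons)
      qed
      from scalar_power_if_prime_kernels_dvd[OF SL_carrier_mat[OF tG] CHAR_power_ge this]
      show False using xE unfolding tE[symmetric] by simp
    qed
    then obtain f u where f: "prime_elem f" "2 \<le> degree f"
      and u: "u \<in> carrier_vec n" "u \<noteq> 0\<^sub>v n" "mat_poly n (t x) f *\<^sub>v u = 0\<^sub>v n" by blast
    have te: "t x *\<^sub>v unit_vec n m = unit_vec n m"
    proof -
      have "t x *\<^sub>v unit_vec n m = col (t x) m" using SL_carrier_mat[OF tG] m(2) by (intro mat_mult_unit_vec) simp_all
      also have "\<dots> = unit_vec n m"
      proof (rule eq_vecI)
        fix i assume "i < dim_vec (unit_vec n m :: 'a vec)"
        then have i: "i < m \<or> i = m \<or> i = m + 1" "i < n" using m(2) by auto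
        then show "col (t x) m $ i = unit_vec n m $ i"
          unfolding t_def using blk[of i m "?L * ?P"] Jpow(1,2)[of "?L * ?P"] m(2) xc by auto
      qed (use SL_carrier_mat[OF tG] in simp)
      finally show ?thesis .
    qed
    obtain v h where vh: "v \<in> carrier_vec n" "h \<in> carrier_vec n" "h \<bullet> v = 0" "h \<bullet> (t x *\<^sub>v v) = 0"
      "h \<bullet> (inv\<^bsub>?G\<^esub> (t x) *\<^sub>v v) \<noteq> 0"
      using cyclic_vector_functional[OF tG f u _ _ te] m(2) by auto
    have n3: "n \<ge> 3" using n by simp
    have zG: "transv v h \<in> carrier ?G" by (rule transv_in_SL[OF n3 vh(1-3)])
    have neq: "comm_mat n (transv v h) (conj_mat n (t x) (transv v h)) ^\<^sub>m ?M \<noteq> 1\<^sub>m n"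
      by (rule comm_conj_transv_power_neq_1[OF vh(1-3) zG tG vh(4,5)])
    have "transv v h \<noteq> 1\<^sub>m n"
    proof
      assume "transv v h = 1\<^sub>m n"
      then have z1: "transv v h = 1 \<cdot>\<^sub>m 1\<^sub>m n" by simp
      have one: "1\<^sub>m n \<in> carrier ?G" by (simp add: SL_carrier_iff)
      show False using neq unfolding z1 conj_mat_scalar[OF tG] using comm_mat_self[OF one] by simp
    qed
    then have "transv v h \<in> transvections n" using transv_in_transvections[OF vh(1-3) zG] by blast
    then obtain y where y: "y \<in> carrier ?G" "transv v h = y * z x * inv\<^bsub>?G\<^esub> y"
      using transvections_conjugate[OF n3 zT] by blast
    have "z x = conj_mat n y (transv v h)"
      unfolding y(2) by (rule conj_mat_of_conjugate[OF y(1) SL_carrier_mat[OF SL_pow_closed[OF x, of ?M], folded z_def], symmetric])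
    then have "F x y = conj_mat n y (comm_mat n (transv v h) (conj_mat n (t x) (transv v h)) ^\<^sub>m ?M)"
      unfolding F_def conj_mat_pow[OF y(1) comm_mat_closed[OF zG conj_mat_closed[OF tG zG]]]
      by (simp only: conj_mat_comm_mat[OF y(1) zG conj_mat_closed[OF tG zG]] conj_mat_conj_mat[OF y(1) tG zG])
    then have "F x y \<noteq> 1\<^sub>m n"
      using neq conj_mat_eq_1[OF y(1) SL_pow_closed[OF comm_mat_closed[OF zG conj_mat_closed[OF tG zG]], of ?M]] by metis
    then show "\<exists>x\<in>carrier ?G. \<exists>y\<in>carrier ?G. F x y \<noteq> 1\<^sub>m n" using x y(1) by blast
  qed
qed

section \<open>The group of 4 x 4 matrices over the field of two elements\<close>

lemma pow_mat_2: "A \<in> carrier_mat n n \<Longrightarrow> A ^\<^sub>m 2 = A * (A :: 'a::semiring_1 mat)"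
  by (simp add: numeral_2_eq_2)

lemma pow_mat_4: "A \<in> carrier_mat n n \<Longrightarrow> A ^\<^sub>m 4 = A * A * (A * (A :: 'a::semiring_1 mat))"
  using pow_mat_add[of A n 2 2] by (simp add: pow_mat_2)

lemma one_plus_minus_one_mat: "A \<in> carrier_mat n n \<Longrightarrow> 1\<^sub>m n + (A - 1\<^sub>m n) = (A :: 'a::ring_1 mat)"
  by (intro eq_matI) auto

lemma not_outer_prod_columns:
  fixes K :: "'a::field mat"
  assumes K: "K \<in> carrier_mat n n" and no: "\<And>v f. v \<in> carrier_vec n \<Longrightarrow> f \<in> carrier_vec n \<Longrightarrow> K \<noteq> outer_prod v f"
  shows "\<exists>k<n. \<exists>j<n. col K k \<noteq> 0\<^sub>v n \<and> (\<nexists>a. col K j = a \<cdot>\<^sub>v col K k)"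
proof -
  have "\<exists>k<n. col K k \<noteq> 0\<^sub>v n"
  proof (rule ccontr)
    assume "\<not> ?thesis"
    then have "K = 0\<^sub>m n n" using K by (intro mat_col_eqI) auto
    then show False using no[of "0\<^sub>v n" "0\<^sub>v n"] by simp
  qed
  then obtain k where k: "k < n" "col K k \<noteq> 0\<^sub>v n" by blast
  have kc: "col K k \<in> carrier_vec n" using k K by simp
  have "\<exists>j<n. \<nexists>a. col K j = a \<cdot>\<^sub>v col K k" using outer_prodI[OF K kc] no[OF kc] by blast
  then show ?thesis using k by blast
qed

definition double_jordan :: "'a::comm_ring_1 mat" where
  "double_jordan = mat 4 4 (\<lambda>(i, j). if i = j \<or> (i, j) = (0, 1) \<or> (i, j) = (2, 3) then 1 else 0)"

lemma double_jordan: "jordan_matrix [(2, 1), (2, 1)] = (double_jordan :: 'a::comm_ring_1 mat)"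
  by (rule eq_matI) (auto simp: double_jordan_def jordan_matrix_def jordan_block_def Let_def)

lemma less_4_cases: "(i::nat) < 4 \<Longrightarrow> i = 0 \<or> i = 1 \<or> i = 2 \<or> i = 3"
  by auto

lemma sum_up_to_4: "(\<Sum>i = 0..<4::nat. h i) = h 0 + h 1 + h 2 + h (3::nat)"
  by (simp add: numeral_eq_Suc)

lemma mat_of_cols_4_mult_vec:
  fixes c0 :: "'a::comm_ring_1 vec"
  assumes c: "c0 \<in> carrier_vec 4" "c1 \<in> carrier_vec 4" "c2 \<in> carrier_vec 4" "c3 \<in> carrier_vec 4"
    and a: "a \<in> carrier_vec 4"
  shows "mat_of_cols 4 [c0, c1, c2, c3] *\<^sub>v a = a $ 0 \<cdot>\<^sub>v c0 + a $ 1 \<cdot>\<^sub>v c1 + a $ 2 \<cdot>\<^sub>v c2 + a $ 3 \<cdot>\<^sub>v c3"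
proof (rule eq_vecI)
  fix i assume "i < dim_vec (a $ 0 \<cdot>\<^sub>v c0 + a $ 1 \<cdot>\<^sub>v c1 + a $ 2 \<cdot>\<^sub>v c2 + a $ 3 \<cdot>\<^sub>v c3)"
  then have i: "i < 4" using c by simp
  have "(mat_of_cols 4 [c0, c1, c2, c3] *\<^sub>v a) $ i = (\<Sum>l = 0..<4. [c0, c1, c2, c3] ! l $ i * a $ l)"
    using i a by (auto simp: scalar_prod_def mat_of_cols_index intro!: sum.cong)
  then show "(mat_of_cols 4 [c0, c1, c2, c3] *\<^sub>v a) $ i = (a $ 0 \<cdot>\<^sub>v c0 + a $ 1 \<cdot>\<^sub>v c1 + a $ 2 \<cdot>\<^sub>v c2 + a $ 3 \<cdot>\<^sub>v c3) $ i"
    unfolding sum_up_to_4 using i c by (simp add: ac_simps numeral_3_eq_3 numeral_2_eq_2)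
qed (use c in simp)

text \<open>
  Two independent columns \<open>K e\<^sub>k\<close> and \<open>K e\<^sub>j\<close> of \<open>K\<close> lie in the kernel of \<open>K\<close>, and
  \<open>K e\<^sub>k, e\<^sub>k, K e\<^sub>j, e\<^sub>j\<close> is a Jordan basis.
\<close>

lemma similar_double_jordan:
  fixes K :: "'a::field mat"
  assumes K: "K \<in> carrier_mat 4 4" and sq: "K * K = 0\<^sub>m 4 4"
    and no: "\<And>v f. v \<in> carrier_vec 4 \<Longrightarrow> f \<in> carrier_vec 4 \<Longrightarrow> K \<noteq> outer_prod v f"
  shows "similar_mat (1\<^sub>m 4 + K) double_jordan"
proof -
  obtain k j where kj: "k < 4" "j < 4" "col K k \<noteq> 0\<^sub>v 4" "\<nexists>a. col K j = a \<cdot>\<^sub>v col K k"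
    using not_outer_prod_columns[OF K no] by blast
  have c: "col K k \<in> carrier_vec 4" "col K j \<in> carrier_vec 4" using K kj by simp_all
  have indep: "a = 0 \<and> b = 0" if "a \<cdot>\<^sub>v col K k + b \<cdot>\<^sub>v col K j = 0\<^sub>v 4" for a b
    using lin_comb_0_imp_multiple[OF c kj(3) that] kj(4) by blast
  have Kcol: "K *\<^sub>v unit_vec 4 k = col K k" "K *\<^sub>v unit_vec 4 j = col K j"
    using mat_mult_unit_vec[OF K] kj by simp_all
  have Kz: "K *\<^sub>v col K k = 0\<^sub>v 4" "K *\<^sub>v col K j = 0\<^sub>v 4"
    unfolding Kcol[symmetric] by (simp_all add: assoc_square_vec[OF K K, symmetric] sq zero_mat_mult_vec)
  define cs where "cs = [col K k, unit_vec 4 k, col K j, unit_vec 4 j]"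
  define P where "P = mat_of_cols 4 cs"
  have P: "P \<in> carrier_mat 4 4" by (rule carrier_matI) (simp_all add: P_def cs_def)
  have Pcol: "P *\<^sub>v unit_vec 4 i = cs ! i" if "i < 4" for i
    using that c unfolding mat_mult_unit_vec[OF P that]
    by (auto dest!: less_4_cases simp: P_def cs_def col_mat_of_cols)
  have Pvec: "P *\<^sub>v a = a $ 0 \<cdot>\<^sub>v col K k + a $ 1 \<cdot>\<^sub>v unit_vec 4 k + a $ 2 \<cdot>\<^sub>v col K j + a $ 3 \<cdot>\<^sub>v unit_vec 4 j"
    if a: "a \<in> carrier_vec 4" for a
    unfolding P_def cs_def by (rule mat_of_cols_4_mult_vec[OF c(1) _ c(2) _ a]) simp_all
  have "det P \<noteq> 0"
  proof
    assume "det P = 0"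
    then obtain a where a: "a \<in> carrier_vec 4" "a \<noteq> 0\<^sub>v 4" "P *\<^sub>v a = 0\<^sub>v 4"
      using det_0_iff_vec_prod_zero_field[OF P] by blast
    have "K *\<^sub>v (P *\<^sub>v a) = 0\<^sub>v 4" unfolding a(3) by (rule mult_mat_zero_vec[OF K])
    moreover have "K *\<^sub>v (P *\<^sub>v a) = a $ 1 \<cdot>\<^sub>v col K k + a $ 3 \<cdot>\<^sub>v col K j"
      unfolding Pvec[OF a(1)] using c K
      by (simp add: mult_add_distrib_mat_vec[of K 4 4] mult_mat_vec[of K 4 4] Kcol Kz)
    ultimately have 13: "a $ 1 = 0" "a $ 3 = 0" using indep by auto
    have "a $ 0 \<cdot>\<^sub>v col K k + a $ 2 \<cdot>\<^sub>v col K j = 0\<^sub>v 4"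
    proof (rule eq_vecI)
      fix i assume "i < dim_vec (0\<^sub>v 4 :: 'a vec)"
      then show "(a $ 0 \<cdot>\<^sub>v col K k + a $ 2 \<cdot>\<^sub>v col K j) $ i = 0\<^sub>v 4 $ i"
        using arg_cong[OF a(3)[unfolded Pvec[OF a(1)]], of "\<lambda>v. v $ i"] c K 13 by simp
    qed (use K in simp)
    then have "a $ 0 = 0" "a $ 2 = 0" using indep by auto
    then have "a = 0\<^sub>v 4" using 13 a(1) by (intro eq_vecI) (auto dest!: less_4_cases)
    then show False using a(2) by simp
  qed
  then obtain Q where Q: "Q \<in> carrier_mat 4 4" "P * Q = 1\<^sub>m 4" "Q * P = 1\<^sub>m 4"
    using det_nonzero_inverse[OF P] by blast
  have D: "(double_jordan :: 'a mat) \<in> carrier_mat 4 4" by (simp add: double_jordan_def)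
  have AP: "(1\<^sub>m 4 + K) * P = P * double_jordan"
  proof (rule mat_col_eqI)
    fix i assume "i < dim_col (P * (double_jordan :: 'a mat))"
    then have i: "i < 4" using D by simp
    have "col ((1\<^sub>m 4 + K) * P) i = (1\<^sub>m 4 + K) *\<^sub>v (cs ! i)"
      using mat_mult_unit_vec[of "(1\<^sub>m 4 + K) * P" 4 4 i] assoc_square_vec[of "1\<^sub>m 4 + K" 4 P "unit_vec 4 i"] K P i
      by (simp add: Pcol mult_carrier_square)
    also have "\<dots> = cs ! i + K *\<^sub>v (cs ! i)"
      using K c kj less_4_cases[OF i] by (auto simp: add_mult_distrib_mat_vec[of _ 4 4] cs_def)
    also have "\<dots> = P *\<^sub>v (col double_jordan i)"
    proof (rule eq_vecI)
      fix l assume "l < dim_vec (P *\<^sub>v col (double_jordan :: 'a mat) i)"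
      then have l: "l < 4" using P by simp
      have K0: "(K *\<^sub>v col K k) $ l = 0" "(K *\<^sub>v col K j) $ l = 0" using Kz l by simp_all
      have ent: "col (double_jordan :: 'a mat) i $ 0 = (if i = 0 \<or> i = 1 then 1 else 0)"
        "col (double_jordan :: 'a mat) i $ 1 = (if i = 1 then 1 else 0)"
        "col (double_jordan :: 'a mat) i $ 2 = (if i = 2 \<or> i = 3 then 1 else 0)"
        "col (double_jordan :: 'a mat) i $ 3 = (if i = 3 then 1 else 0)"
        using i by (simp_all add: double_jordan_def)
      have dims: "dim_vec (cs ! i) = 4" "dim_vec (K *\<^sub>v cs ! i) = 4"
        using less_4_cases[OF i] K by (elim disjE; simp add: cs_def)+
      have "(cs ! i) $ l + (K *\<^sub>v cs ! i) $ l =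
          col double_jordan i $ 0 * col K k $ l + col double_jordan i $ 1 * unit_vec 4 k $ l +
          col double_jordan i $ 2 * col K j $ l + col double_jordan i $ 3 * unit_vec 4 j $ l"
        unfolding ent using less_4_cases[OF i] K0
        by (elim disjE) (simp_all add: cs_def Kcol del: index_unit_vec index_col)
      then show "(cs ! i + K *\<^sub>v cs ! i) $ l = (P *\<^sub>v col double_jordan i) $ l"
        unfolding Pvec[OF col_carrier_vec[OF i D]] using l dims K by simp
    qed (use P K in simp)
    also have "\<dots> = col (P * double_jordan) i" using D P i by (simp add: col_mult2[of _ 4 4 _ 4])
    finally show "col ((1\<^sub>m 4 + K) * P) i = col (P * double_jordan) i" .
  qed (use P D K in simp_all)
  have AK: "1\<^sub>m 4 + K \<in> carrier_mat 4 4" using K by simp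
  have "1\<^sub>m 4 + K = (1\<^sub>m 4 + K) * (P * Q)" unfolding Q(2) by (rule right_mult_one_mat[OF AK, symmetric])
  also have "\<dots> = P * double_jordan * Q"
    unfolding AP[symmetric] using AK P Q(1) by (simp add: assoc_mult_mat[of _ 4 4 _ 4 _ 4])
  finally have "similar_mat_wit (1\<^sub>m 4 + K) double_jordan P Q"
    using AK D P Q by (intro similar_mat_witI[of _ _ 4]) simp_all
  then show ?thesis unfolding similar_mat_def by blast
qed

lemma word_eval_gen_power:
  assumes G: "Group.group G" and g: "g \<in> {1..2} \<rightarrow> carrier G"
  shows "word_eval G g (gen 1 [^]\<^bsub>free_group 2\<^esub> (k::nat)) = g 1 [^]\<^bsub>G\<^esub> k"
proof -
  have hom: "group_hom (free_group 2) G (word_eval G g)"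
    using group.word_eval_hom[OF G g] group_free_group G by (simp add: group_hom_def group_hom_axioms_def)
  interpret Group.group G by (rule G)
  have "g 1 \<in> carrier G" using g by auto
  then show ?thesis using group_hom.hom_nat_pow[OF hom gen_carrier[of 1], of k] by simp
qed

text \<open>
  The conjugating matrix may have any determinant, since it is applied to \<open>B\<close> and its inverse
  cancels.
\<close>

lemma similar_mat_power_in_SL:
  fixes A :: "'a::field mat"
  assumes A: "A \<in> carrier_mat n n" and sim: "similar_mat A (B ^\<^sub>m k)" and B: "B \<in> carrier (SL n)"
  shows "\<exists>x \<in> carrier (SL n). x ^\<^sub>m k = A"
proof -
  obtain P Q where w: "similar_mat_wit A (B ^\<^sub>m k) P Q" using sim unfolding similar_mat_def by blast
  note c = similar_mat_witD2[OF A w]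
  have Bc: "B \<in> carrier_mat n n" by (rule SL_carrier_mat[OF B])
  have wit: "similar_mat_wit (P * B * Q) B P Q"
    using c Bc by (intro similar_mat_witI[of _ _ n]) (simp_all add: mult_carrier_square)
  have "det (P * B * Q) = det P * det B * det Q"
    using c Bc by (simp add: det_mult[of _ n] mult_carrier_square)
  also have "\<dots> = det (P * Q)" using c B det_mult[OF c(6,7)] by (simp add: SL_carrier_iff)
  also have "\<dots> = 1" using c by simp
  finally have "P * B * Q \<in> carrier (SL n)" using c Bc by (simp add: SL_carrier_iff mult_carrier_square)
  moreover have "(P * B * Q) ^\<^sub>m k = A" using similar_mat_wit_pow_id[OF wit, of k] c by simp
  ultimately show ?thesis by blast
qed

text \<open>
  Every \<open>x\<^sup>1\<^sup>0\<^sup>5\<close> is unipotent, so \<open>x\<^sup>2\<^sup>1\<^sup>0 - 1\<close> is the square of a nilpotent matrix and has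
  square zero. Conversely, unipotent elements with Jordan blocks \<open>3 + 1\<close> and \<open>4\<close> have as squares,
  which are also their 210-th powers, a transvection and a double transvection.
\<close>

theorem word_values_SL4_2:
  assumes q: "CARD('a::{field,finite}) = 2"
  shows "word_values (SL 4 :: 'a mat monoid) 2 (gen 1 [^]\<^bsub>free_group 2\<^esub> (2 * 3 * 5 * 7 :: nat))
          = {1\<^sub>m 4} \<union> transvections 4 \<union> double_transvections"
proof -
  let ?G = "SL 4 :: 'a mat monoid"
  interpret G: Group.group ?G by (rule group_SL)
  have p: "CHAR('a) = 2"
  proof -
    have "prime (2::nat)" "2 dvd CARD('a)" using q by simp_all
    then show ?thesis using prime_dvd_CARD_imp_CHAR[of 2, where 'a='a] by simp
  qed
  have square: "u ^\<^sub>m 2 - 1\<^sub>m n = (u - 1\<^sub>m n) * (u - 1\<^sub>m n)" if "u \<in> carrier_mat n n" for u :: "'a mat" and n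
  proof -
    have "u - 1\<^sub>m n \<in> carrier_mat n n" using that by (intro minus_carrier_mat) simp
    then show ?thesis
      using power_CHAR_minus_1[OF that, of 1] unfolding p power_one_right by (simp only: pow_mat_2)
  qed
  have WV: "word_values ?G 2 (gen 1 [^]\<^bsub>free_group 2\<^esub> (2 * 3 * 5 * 7 :: nat)) = {x ^\<^sub>m 210 | x. x \<in> carrier ?G}"
  proof (intro Set.equalityI subsetI)
    fix h assume "h \<in> word_values ?G 2 (gen 1 [^]\<^bsub>free_group 2\<^esub> (2 * 3 * 5 * 7 :: nat))"
    then obtain g where g: "g \<in> {1..2} \<rightarrow> carrier ?G"
      and h': "h = word_eval ?G g (gen 1 [^]\<^bsub>free_group 2\<^esub> (2 * 3 * 5 * 7 :: nat)) \<or>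
        h = inv\<^bsub>?G\<^esub> (word_eval ?G g (gen 1 [^]\<^bsub>free_group 2\<^esub> (2 * 3 * 5 * 7 :: nat)))"
      unfolding word_values_def by blast
    have h: "h = g 1 [^]\<^bsub>?G\<^esub> (210::nat) \<or> h = inv\<^bsub>?G\<^esub> (g 1 [^]\<^bsub>?G\<^esub> (210::nat))"
      using h' unfolding word_eval_gen_power[OF group_SL g] by simp
    have g1: "g 1 \<in> carrier ?G" by (rule PiE[OF g, of 1]) simp_all
    have "inv\<^bsub>?G\<^esub> (g 1 [^]\<^bsub>?G\<^esub> (210::nat)) = (inv\<^bsub>?G\<^esub> g 1) [^]\<^bsub>?G\<^esub> (210::nat)"
      by (rule G.nat_pow_inv[OF g1, symmetric])
    then show "h \<in> {x ^\<^sub>m 210 | x. x \<in> carrier ?G}"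
      using h g1 SL_pow[OF g1] SL_pow[OF SL_inv(1)[OF g1]] SL_inv(1)[OF g1] by auto
  next
    fix h assume "h \<in> {x ^\<^sub>m 210 | x. x \<in> carrier ?G}"
    then obtain x where x: "x \<in> carrier ?G" "h = x ^\<^sub>m 210" by blast
    have g: "(\<lambda>_. x) \<in> {1..2} \<rightarrow> carrier ?G" using x by simp
    have "h = word_eval ?G (\<lambda>_. x) (gen 1 [^]\<^bsub>free_group 2\<^esub> (2 * 3 * 5 * 7 :: nat))"
      unfolding word_eval_gen_power[OF group_SL g] SL_pow[OF x(1)] x(2) by simp
    then show "h \<in> word_values ?G 2 (gen 1 [^]\<^bsub>free_group 2\<^esub> (2 * 3 * 5 * 7 :: nat))"
      unfolding word_values_def by (intro CollectI bexI[of _ "\<lambda>_. x"] disjI1 g)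
  qed
  have pow_210: "y ^\<^sub>m 105 = y" if "y \<in> carrier_mat 4 4" "(y - 1\<^sub>m 4) * (y - 1\<^sub>m 4) = 0\<^sub>m 4 4" for y :: "'a mat"
  proof -
    have "y ^\<^sub>m 2 = 1\<^sub>m 4"
      by (rule mat_diff_eq_0_imp_eq[OF pow_carrier_mat[OF that(1)] one_carrier_mat])
        (simp only: square[OF that(1)] that(2))
    then have "y ^\<^sub>m (2 * 52) = 1\<^sub>m 4" unfolding pow_mat_mult[OF that(1)] by simp
    then show ?thesis using pow_mat_add[OF that(1), of "2 * 52" 1] that(1) by simp
  qed
  have pow: "x ^\<^sub>m 210 = x ^\<^sub>m 2" if "x \<in> carrier_mat 4 4" "(x ^\<^sub>m 2 - 1\<^sub>m 4) * (x ^\<^sub>m 2 - 1\<^sub>m 4) = 0\<^sub>m 4 4" for x :: "'a mat"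
  proof -
    have "x ^\<^sub>m 210 = x ^\<^sub>m (2 * 105)" by (rule arg_cong[of _ _ "pow_mat x"]) simp
    also have "\<dots> = (x ^\<^sub>m 2) ^\<^sub>m 105" by (rule pow_mat_mult[OF that(1)])
    also have "\<dots> = x ^\<^sub>m 2" by (rule pow_210[OF pow_carrier_mat[OF that(1)] that(2)])
    finally show ?thesis .
  qed
  have val: "x ^\<^sub>m 210 \<in> {1\<^sub>m 4} \<union> transvections 4 \<union> double_transvections" if x: "x \<in> carrier ?G" for x
  proof -
    let ?u = "x ^\<^sub>m 105" and ?z = "x ^\<^sub>m 210"
    note xc = SL_carrier_mat[OF x]
    have uc: "?u \<in> carrier_mat 4 4" using xc by simp
    have dvd: "CARD('a) ^ d - 1 dvd 105" if "1 \<le> d" "d \<le> 4" for d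
    proof -
      have "d = 1 \<or> d = 2 \<or> d = 3 \<or> d = 4" using that by auto
      then show ?thesis unfolding q by (elim disjE) simp_all
    qed
    have nil: "(?u - 1\<^sub>m 4) ^\<^sub>m 4 = 0\<^sub>m 4 4"
      using x by (intro power_minus_1_nilpotent[OF xc _ dvd]) (simp_all add: SL_carrier_iff)
    have Nc: "?u - 1\<^sub>m 4 \<in> carrier_mat 4 4" using uc by (intro minus_carrier_mat) simp
    have z: "?z \<in> carrier ?G" by (rule SL_pow_closed[OF x])
    have K: "?z - 1\<^sub>m 4 = (?u - 1\<^sub>m 4) * (?u - 1\<^sub>m 4)" using square[OF uc] pow_mat_mult[OF xc, of 105 2] by simp
    have Kc: "?z - 1\<^sub>m 4 \<in> carrier_mat 4 4" using SL_carrier_mat[OF z] by (intro minus_carrier_mat) simp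
    have KK: "(?z - 1\<^sub>m 4) * (?z - 1\<^sub>m 4) = 0\<^sub>m 4 4"
      using nil unfolding K pow_mat_4[OF Nc] .
    then have KK2: "(?z - 1\<^sub>m 4) ^\<^sub>m 2 = 0\<^sub>m 4 4" unfolding pow_mat_2[OF Kc] .
    show ?thesis
    proof (cases "\<exists>v\<in>carrier_vec 4. \<exists>f\<in>carrier_vec 4. ?z - 1\<^sub>m 4 = outer_prod v f")
      case True
      then show ?thesis using unipotent_in_transvections[OF z _ _ _ KK2] by blast
    next
      case False
      then have "similar_mat (1\<^sub>m 4 + (?z - 1\<^sub>m 4)) double_jordan"
        by (intro similar_double_jordan[OF Kc KK]) blast
      moreover have "1\<^sub>m 4 + (?z - 1\<^sub>m 4) = ?z" by (rule one_plus_minus_one_mat[OF SL_carrier_mat[OF z]])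
      ultimately have "jordan_nf ?z [(2, 1), (2, 1)]" unfolding jordan_nf_def double_jordan by simp
      then show ?thesis using z unfolding double_transvections_def by blast
    qed
  qed
  have one: "1\<^sub>m 4 = 1\<^sub>m 4 ^\<^sub>m 210" "1\<^sub>m 4 \<in> carrier ?G" by (simp_all add: SL_carrier_iff)
  have tv: "\<exists>x\<in>carrier ?G. h = x ^\<^sub>m 210" if h: "h \<in> transvections 4" for h
  proof -
    let ?e = "\<lambda>i. unit_vec 4 i :: 'a vec"
    define N where "N = outer_prod (?e 0) (?e 1) + outer_prod (?e 1) (?e 2)"
    define x where "x = 1\<^sub>m 4 + N"
    have Nc: "N \<in> carrier_mat 4 4" by (simp add: N_def)
    have NN: "N * N = outer_prod (?e 0) (?e 2)"
      by (rule eq_matI) (auto dest!: less_4_cases simp: N_def scalar_prod_def sum_up_to_4)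
    have xc: "x \<in> carrier_mat 4 4" using Nc by (simp add: x_def)
    have ut: "upper_triangular x" by (auto dest!: less_4_cases simp: x_def N_def upper_triangular_def)
    have "det x = 1" unfolding det_upper_triangular[OF ut xc] prod_list_diag_prod
      using xc by (simp add: x_def N_def numeral_eq_Suc)
    then have x: "x \<in> carrier ?G" using xc by (simp add: SL_carrier_iff)
    have "x - 1\<^sub>m 4 = N" using Nc by (intro eq_matI) (auto simp: x_def)
    then have x2: "x ^\<^sub>m 2 - 1\<^sub>m 4 = outer_prod (?e 0) (?e 2)" using square[OF xc] NN by simp
    have o: "outer_prod (?e 0) (?e 2) * outer_prod (?e 0) (?e 2) = 0\<^sub>m 4 4"
      by (rule eq_matI) (auto dest!: less_4_cases simp: scalar_prod_def sum_up_to_4)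
    have x210: "x ^\<^sub>m 210 = x ^\<^sub>m 2" using pow[OF xc] x2 o by simp
    have "x ^\<^sub>m 2 = 1\<^sub>m 4 + (x ^\<^sub>m 2 - 1\<^sub>m 4)"
      by (rule one_plus_minus_one_mat[OF pow_carrier_mat[OF xc], symmetric])
    then have x2t: "x ^\<^sub>m 2 = transv (?e 0) (?e 2)" unfolding x2 by (simp add: transv_eq[of _ 4])
    have "?e 0 \<noteq> 0\<^sub>v 4" "?e 2 \<noteq> 0\<^sub>v 4" "?e 2 \<bullet> ?e 0 = 0" by simp_all
    then have T: "x ^\<^sub>m 210 \<in> transvections 4"
      using SL_pow_closed[OF x, of 210] unfolding x210 x2t transvections_transv by (metis unit_vec_carrier)
    obtain P where P: "P \<in> carrier ?G" "h = P * x ^\<^sub>m 210 * inv\<^bsub>?G\<^esub> P"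
      using transvections_conjugate[OF _ T h] by auto
    have "similar_mat_wit h (x ^\<^sub>m 210) P (inv\<^bsub>?G\<^esub> P)"
      using P SL_inv[OF P(1)] SL_carrier_mat[OF P(1)] SL_carrier_mat[OF SL_inv(1)[OF P(1)]] pow_carrier_mat[OF xc]
      by (intro similar_mat_witI[of _ _ 4]) (simp_all add: mult_carrier_square)
    then show ?thesis
      using similar_mat_power_in_SL[OF _ _ x, of h 210] h unfolding similar_mat_def transvections_def
      by (metis (no_types, lifting) SL_carrier_mat mem_Collect_eq)
  qed
  have dt: "\<exists>x\<in>carrier ?G. h = x ^\<^sub>m 210" if h: "h \<in> double_transvections" for h
  proof -
    have hG: "h \<in> carrier ?G" and sim: "similar_mat h double_jordan"
      using h by (simp_all add: double_transvections_def jordan_nf_def double_jordan)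
    define J where "J = jordan_block 4 (1::'a)"
    have Jc: "J \<in> carrier_mat 4 4" by (simp add: J_def)
    have "upper_triangular J" by (auto simp: J_def jordan_block_def)
    then have "det J = 1" using det_upper_triangular[OF _ Jc] by (simp add: prod_list_diag_prod J_def jordan_block_def)
    then have J: "J \<in> carrier ?G" using Jc by (simp add: SL_carrier_iff)
    have J0: "J - 1\<^sub>m 4 = jordan_block 4 0" by (intro eq_matI) (auto simp: J_def jordan_block_def)
    let ?K = "J ^\<^sub>m 2 - 1\<^sub>m 4"
    have K: "?K = jordan_block 4 0 ^\<^sub>m 2"
      unfolding square[OF Jc] J0 by (rule pow_mat_2[of _ 4, symmetric]) simp
    have Ki: "?K = mat 4 4 (\<lambda>(i, j). if i \<le> j \<and> j - i = 2 then 1 else 0)" unfolding K jordan_block_zero_pow ..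
    have Kc: "?K \<in> carrier_mat 4 4" unfolding Ki by simp
    have KK: "?K * ?K = 0\<^sub>m 4 4"
      unfolding Ki by (rule eq_matI) (auto dest!: less_4_cases simp: scalar_prod_def sum_up_to_4)
    have "?K \<noteq> outer_prod v f" if "v \<in> carrier_vec 4" "f \<in> carrier_vec 4" for v f
    proof
      assume e: "?K = outer_prod v f"
      have "?K $$ (0, 2) * ?K $$ (1, 3) = ?K $$ (0, 3) * ?K $$ (1, 2)" unfolding e using that by simp
      then show False unfolding Ki by simp
    qed
    from similar_double_jordan[OF Kc KK this] have "similar_mat (1\<^sub>m 4 + ?K) double_jordan" .
    moreover have "1\<^sub>m 4 + ?K = J ^\<^sub>m 210"
      unfolding pow[OF Jc KK] by (rule one_plus_minus_one_mat[OF pow_carrier_mat[OF Jc]])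
    ultimately have "similar_mat h (J ^\<^sub>m 210)" using sim similar_mat_trans similar_mat_sym by metis
    then show ?thesis using similar_mat_power_in_SL[OF SL_carrier_mat[OF hG] _ J] by metis
  qed
  show ?thesis unfolding WV using val one tv dt by blast
qed

section \<open>Dimension 4\<close>

text \<open>
  If every nonzero \<open>\<sigma>\<close> had the form \<open>r + 1 / r\<close>, then \<open>r \<mapsto> r + 1 / r\<close> would be injective on the
  units by counting; but \<open>r\<close> and \<open>1 / r\<close> have the same image, so only the units \<open>\<plusminus>1\<close> could exist.
\<close>

lemma exists_quadratic_without_root:
  assumes q: "CARD('a::{field,finite}) \<ge> 4"
  shows "\<exists>\<sigma>::'a. \<sigma> \<noteq> 0 \<and> (\<forall>r. r * r - \<sigma> * r + 1 \<noteq> 0)"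
proof (rule ccontr)
  assume no: "\<not> ?thesis"
  let ?S = "UNIV - {0 :: 'a}" and ?h = "\<lambda>r::'a. r + inverse r"
  have "?S \<subseteq> ?h ` ?S"
  proof
    fix s assume "s \<in> ?S"
    then obtain r where r: "r * r - s * r + 1 = 0" using no by auto
    then have r0: "r \<noteq> 0" by auto
    have "s * r = r * r + 1" using r by (simp add: algebra_simps)
    then have "s = (r * r + 1) * inverse r" using r0 by (simp add: field_simps)
    then have "s = ?h r" using r0 by (simp add: field_simps)
    then show "s \<in> ?h ` ?S" using r0 by blast
  qed
  then have "card ?S \<le> card (?h ` ?S)" by (intro card_mono) simp_all
  then have "card (?h ` ?S) = card ?S" using card_image_le[of ?S ?h] by simp
  then have inj: "inj_on ?h ?S" by (intro eq_card_imp_inj_on) simp_all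
  have "r = 1 \<or> r = - 1" if "r \<noteq> 0" for r :: 'a
  proof -
    have "?h r = ?h (inverse r)" by (simp only: inverse_inverse_eq add.commute)
    moreover have "inverse r \<noteq> 0" using that by simp
    ultimately have "r = inverse r" using that inj_onD[OF inj, of r "inverse r"] by blast
    then have "r * r = 1" using that by (metis right_inverse)
    then show ?thesis by (simp add: square_eq_1_iff)
  qed
  then have "(UNIV :: 'a set) \<subseteq> {0, 1, - 1}" by blast
  then have "CARD('a) \<le> card {0, 1, - 1 :: 'a}" by (intro card_mono) simp_all
  also have "\<dots> \<le> 3" by (simp add: card_insert_if)
  finally show False using q by simp
qed

lemma CHAR_power_eq_imp_eq:
  fixes x y :: "'b::field"
  assumes p: "prime CHAR('b)" and eq: "x ^ (CHAR('b) ^ k) = y ^ (CHAR('b) ^ k)"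
  shows "x = y"
proof -
  have "x ^ (CHAR('b) ^ k) = (x - y) ^ (CHAR('b) ^ k) + y ^ (CHAR('b) ^ k)"
    using freshmans_dream'[OF p refl, of "x - y" y k] by simp
  then have "(x - y) ^ (CHAR('b) ^ k) = 0" using eq by simp
  then show ?thesis by simp
qed

text \<open>
  The Frobenius map sends a root \<open>\<alpha>\<close> of \<open>X\<^sup>2 - \<sigma> X + 1\<close> to another root. It does not fix \<open>\<alpha>\<close>, and
  the product of the two roots is 1.
\<close>

lemma quadratic_root_in_closure:
  fixes \<sigma> :: "'a::{field,finite}"
  assumes no: "\<And>r. r * r - \<sigma> * r + 1 \<noteq> 0"
  shows "\<exists>\<alpha>. \<alpha> * \<alpha> = to_ac \<sigma> * \<alpha> - 1 \<and> \<alpha> \<notin> range to_ac \<and> \<alpha> ^ (CARD('a) + 1) = 1"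
proof -
  let ?f = "[:1, - to_ac \<sigma>, 1:]" and ?q = "CARD('a)"
  obtain \<alpha> where "poly ?f \<alpha> = 0" using alg_closed_imp_poly_has_root[of ?f] by auto
  then have root: "\<alpha> * \<alpha> = to_ac \<sigma> * \<alpha> - 1" by (simp add: algebra_simps add_eq_0_iff)
  have nr: "\<alpha> \<notin> range to_ac"
  proof
    assume "\<alpha> \<in> range to_ac"
    then obtain r where r: "\<alpha> = to_ac r" by blast
    have "to_ac (r * r - \<sigma> * r + 1) = to_ac 0" using root unfolding r by simp
    then show False using no[of r] by (simp only: to_ac_eq_iff)
  qed
  let ?\<beta> = "\<alpha> ^ ?q"
  have "?\<beta> * ?\<beta> = (to_ac \<sigma> * \<alpha> - 1) ^ ?q" unfolding power_mult_distrib[symmetric] root ..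
  moreover have "(to_ac \<sigma> * \<alpha>) ^ ?q = (to_ac \<sigma> * \<alpha> - 1) ^ ?q + 1"
    using add_power_CARD[of "to_ac \<sigma> * \<alpha> - 1" 1] by simp
  moreover have "to_ac \<sigma> ^ ?q = to_ac \<sigma>" using range_to_ac_iff[of "to_ac \<sigma>"] by simp
  ultimately have b: "?\<beta> * ?\<beta> = to_ac \<sigma> * ?\<beta> - 1" by (simp add: power_mult_distrib)
  have "(?\<beta> - \<alpha>) * (?\<beta> * \<alpha> - 1) = (?\<beta> * ?\<beta>) * \<alpha> - ?\<beta> * (\<alpha> * \<alpha>) - ?\<beta> + \<alpha>"
    by (simp add: algebra_simps)
  also have "\<dots> = 0" unfolding b root by (simp add: algebra_simps)
  finally have "?\<beta> = \<alpha> \<or> ?\<beta> * \<alpha> = 1" by auto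
  then have "\<alpha> ^ (?q + 1) = 1" using nr range_to_ac_iff[of \<alpha>] by (auto simp: mult.commute)
  then show ?thesis using root nr by blast
qed

text \<open>
  Multiplication by \<open>s + t \<alpha>\<close> with respect to the basis \<open>1, \<alpha>\<close>, where \<open>\<alpha>\<^sup>2 = \<sigma> \<alpha> - 1\<close>. Its
  determinant is the norm \<open>s\<^sup>2 + \<sigma> s t + t\<^sup>2\<close>.
\<close>

definition quad_mat :: "'a::comm_ring_1 \<Rightarrow> 'a \<Rightarrow> 'a \<Rightarrow> 'a mat" where
  "quad_mat \<sigma> s t = mat 2 2 (\<lambda>(i, j). if i = 0 then if j = 0 then s else - t else if j = 0 then t else s + \<sigma> * t)"

lemma quad_mat_carrier [simp]: "quad_mat \<sigma> s t \<in> carrier_mat 2 2"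
  "dim_row (quad_mat \<sigma> s t) = 2" "dim_col (quad_mat \<sigma> s t) = 2"
  by (simp_all add: quad_mat_def)

lemma quad_mat_index [simp]:
  "quad_mat \<sigma> s t $$ (0, 0) = s" "quad_mat \<sigma> s t $$ (0, Suc 0) = - t"
  "quad_mat \<sigma> s t $$ (Suc 0, 0) = t" "quad_mat \<sigma> s t $$ (Suc 0, Suc 0) = s + \<sigma> * t"
  by (simp_all add: quad_mat_def)

lemma quad_mat_const: "quad_mat \<sigma> s 0 = s \<cdot>\<^sub>m 1\<^sub>m 2"
  by (rule eq_matI) (auto simp: quad_mat_def)

lemma quad_mat_power:
  fixes \<sigma> :: "'a::{field,finite}"
  assumes \<alpha>: "\<alpha> * \<alpha> = to_ac \<sigma> * \<alpha> - 1"
  shows "\<exists>s t. quad_mat \<sigma> 0 1 ^\<^sub>m k = quad_mat \<sigma> s t \<and> \<alpha> ^ k = to_ac s + to_ac t * \<alpha> \<and> s * s + \<sigma> * s * t + t * t = 1"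
proof (induction k)
  case 0
  show ?case by (intro exI[of _ 1] exI[of _ 0]) (simp add: quad_mat_const)
next
  case (Suc k)
  then obtain s t where st: "quad_mat \<sigma> 0 1 ^\<^sub>m k = quad_mat \<sigma> s t" "\<alpha> ^ k = to_ac s + to_ac t * \<alpha>"
    "s * s + \<sigma> * s * t + t * t = 1" by blast
  have "quad_mat \<sigma> 0 1 ^\<^sub>m Suc k = quad_mat \<sigma> (- t) (s + \<sigma> * t)"
    unfolding pow_mat.simps st(1)
    by (rule eq_matI) (auto simp: quad_mat_def scalar_prod_def less_2_cases_iff algebra_simps sum_up_to_2)
  moreover have "\<alpha> ^ Suc k = to_ac s * \<alpha> + to_ac t * (\<alpha> * \<alpha>)" by (simp add: st(2) algebra_simps)
  then have "\<alpha> ^ Suc k = to_ac (- t) + to_ac (s + \<sigma> * t) * \<alpha>" unfolding \<alpha> by (simp add: algebra_simps)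
  moreover have "(- t) * (- t) + \<sigma> * (- t) * (s + \<sigma> * t) + (s + \<sigma> * t) * (s + \<sigma> * t) = s * s + \<sigma> * s * t + t * t"
    by (simp add: algebra_simps)
  ultimately show ?case using st(3) by metis
qed

lemma to_ac_linear_independent:
  fixes s t :: "'a::field"
  assumes "\<alpha> \<notin> range to_ac" "to_ac s + to_ac t * \<alpha> = to_ac c"
  shows "t = 0 \<and> s = c"
proof -
  have "t = 0"
  proof (rule ccontr)
    assume "t \<noteq> 0"
    have "to_ac t * \<alpha> = to_ac c - to_ac s" using assms(2) by (metis add_diff_cancel_left')
    then have "\<alpha> = to_ac ((c - s) / t)" using \<open>t \<noteq> 0\<close> by (simp add: field_simps)
    then show False using assms(1) by blast
  qed
  then show ?thesis using assms(2) by simp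
qed

lemma quad_mat_power_scalar:
  fixes \<sigma> :: "'a::{field,finite}"
  assumes "\<alpha> * \<alpha> = to_ac \<sigma> * \<alpha> - 1" "\<alpha> \<notin> range to_ac" "\<alpha> ^ k = to_ac c"
  shows "quad_mat \<sigma> 0 1 ^\<^sub>m k = c \<cdot>\<^sub>m 1\<^sub>m 2"
  using quad_mat_power[OF assms(1), of k] to_ac_linear_independent[OF assms(2), of _ _ c] assms(3)
  by (metis quad_mat_const)

lemma smult_mat_power:
  fixes A :: "'a::comm_ring_1 mat"
  assumes A: "A \<in> carrier_mat n n"
  shows "(c \<cdot>\<^sub>m A) ^\<^sub>m k = c ^ k \<cdot>\<^sub>m (A ^\<^sub>m k)"
proof (induction k)
  case (Suc k)
  have P: "A ^\<^sub>m k \<in> carrier_mat n n" using A by simp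
  have "(c \<cdot>\<^sub>m A) ^\<^sub>m Suc k = (c ^ k \<cdot>\<^sub>m (A ^\<^sub>m k)) * (c \<cdot>\<^sub>m A)" by (simp add: Suc)
  also have "\<dots> = c ^ k \<cdot>\<^sub>m (c \<cdot>\<^sub>m (A ^\<^sub>m k * A))"
    using mult_smult_assoc_mat[OF P smult_carrier_mat[OF A], of "c ^ k" c] mult_smult_distrib[OF P A, of c] by simp
  also have "\<dots> = c ^ Suc k \<cdot>\<^sub>m (A ^\<^sub>m k * A)" by (rule eq_matI) (simp_all add: algebra_simps)
  finally show ?case by simp
qed (use A in simp)

definition mat4 :: "'a list list \<Rightarrow> 'a mat" where
  "mat4 L = mat 4 4 (\<lambda>(i, j). L ! i ! j)"

lemma mat4_carrier [simp]: "mat4 L \<in> carrier_mat 4 4" "dim_row (mat4 L) = 4" "dim_col (mat4 L) = 4"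
  by (simp_all add: mat4_def)

lemma mat4_index [simp]: "i < 4 \<Longrightarrow> j < 4 \<Longrightarrow> mat4 L $$ (i, j) = L ! i ! j"
  by (simp add: mat4_def)

definition vec4 :: "'a list \<Rightarrow> 'a vec" where
  "vec4 L = vec 4 (\<lambda>i. L ! i)"

lemma vec4_carrier [simp]: "vec4 L \<in> carrier_vec 4" "dim_vec (vec4 L) = 4"
  by (simp_all add: vec4_def)

lemma vec4_index [simp]: "i < 4 \<Longrightarrow> vec4 L $ i = L ! i"
  by (simp add: vec4_def)

lemma mat4_mult_vec:
  "mat4 [[a0, a1, a2, a3], [b0, b1, b2, b3], [c0, c1, c2, c3], [d0, d1, d2, d3]] *\<^sub>v vec4 [x, y, z, w] =
   vec4 [a0 * x + a1 * y + a2 * z + a3 * w, b0 * x + b1 * y + b2 * z + b3 * w,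
     c0 * x + c1 * y + c2 * z + c3 * w, d0 * x + d1 * y + d2 * z + (d3::'a::semiring_0) * w]"
  by (rule eq_vecI) (auto dest!: less_4_cases simp: scalar_prod_def sum_up_to_4)

lemma mat4_mult:
  "mat4 [[a0, a1, a2, a3], [a4, a5, a6, a7], [a8, a9, a10, a11], [a12, a13, a14, a15]] *
   mat4 [[b0, b1, b2, b3], [b4, b5, b6, b7], [b8, b9, b10, b11], [b12, b13, b14, b15]] =
   mat4 [[a0 * b0 + a1 * b4 + a2 * b8 + a3 * b12, a0 * b1 + a1 * b5 + a2 * b9 + a3 * b13, a0 * b2 + a1 * b6 + a2 * b10 + a3 * b14, a0 * b3 + a1 * b7 + a2 * b11 + a3 * b15],
     [a4 * b0 + a5 * b4 + a6 * b8 + a7 * b12, a4 * b1 + a5 * b5 + a6 * b9 + a7 * b13, a4 * b2 + a5 * b6 + a6 * b10 + a7 * b14, a4 * b3 + a5 * b7 + a6 * b11 + a7 * b15],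
     [a8 * b0 + a9 * b4 + a10 * b8 + a11 * b12, a8 * b1 + a9 * b5 + a10 * b9 + a11 * b13, a8 * b2 + a9 * b6 + a10 * b10 + a11 * b14, a8 * b3 + a9 * b7 + a10 * b11 + a11 * b15],
     [(a12::'a::semiring_0) * b0 + a13 * b4 + a14 * b8 + a15 * b12, a12 * b1 + a13 * b5 + a14 * b9 + a15 * b13, a12 * b2 + a13 * b6 + a14 * b10 + a15 * b14, a12 * b3 + a13 * b7 + a14 * b11 + a15 * b15]]"
  by (rule eq_matI) (auto dest!: less_4_cases simp: scalar_prod_def sum_up_to_4)

lemma mat4_one: "1\<^sub>m 4 = mat4 [[1, 0, 0, 0], [0, 1, 0, 0], [0, 0, 1, 0], [0, 0, 0, 1]]"
  by (rule eq_matI) (auto dest!: less_4_cases)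

lemma vec4_scalar_prod:
  "vec4 [a, b, c, d] \<bullet> vec4 [x, y, z, w] = a * x + b * y + c * z + d * (w :: 'a::semiring_0)"
  by (simp add: scalar_prod_def sum_up_to_4)

lemma det_mat4:
  fixes a0 :: "'a::comm_ring_1"
  shows "det (mat4 [[a0, a1, a2, a3], [b0, b1, b2, b3], [c0, c1, c2, c3], [d0, d1, d2, d3]]) =
    a0 * det (mat3 [[b1, b2, b3], [c1, c2, c3], [d1, d2, d3]]) - a1 * det (mat3 [[b0, b2, b3], [c0, c2, c3], [d0, d2, d3]])
    + a2 * det (mat3 [[b0, b1, b3], [c0, c1, c3], [d0, d1, d3]]) - a3 * det (mat3 [[b0, b1, b2], [c0, c1, c2], [d0, d1, d2]])"
proof -
  let ?A = "mat4 [[a0, a1, a2, a3], [b0, b1, b2, b3], [c0, c1, c2, c3], [d0, d1, d2, d3]]"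
  have d: "mat_delete ?A 0 0 = mat3 [[b1, b2, b3], [c1, c2, c3], [d1, d2, d3]]"
    "mat_delete ?A 0 1 = mat3 [[b0, b2, b3], [c0, c2, c3], [d0, d2, d3]]"
    "mat_delete ?A 0 2 = mat3 [[b0, b1, b3], [c0, c1, c3], [d0, d1, d3]]"
    "mat_delete ?A 0 3 = mat3 [[b0, b1, b2], [c0, c1, c2], [d0, d1, d2]]"
    by (rule eq_matI; auto dest!: less_3_cases simp: mat_delete_def)+
  have "det ?A = (\<Sum>j = 0..<4. ?A $$ (0, j) * cofactor ?A 0 j)"
    unfolding lessThan_atLeast0[symmetric] by (intro laplace_expansion_row) simp_all
  then show ?thesis unfolding sum_up_to_4 cofactor_def d by simp
qed

lemma prod_linear_factors:
  "(\<Prod>c\<in>UNIV. [:- c, 1:]) = [:0, 1:] ^ CARD('a) - [:0, 1 :: 'a::{field,finite}:]"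
proof (rule poly_eqI_degree_lead_coeff[of _ "CARD('a)" _ UNIV])
  let ?q = "CARD('a)"
  have q: "?q > 1" by (rule card_gt_1)
  have deg: "degree (\<Prod>c\<in>UNIV. [:- c, 1 :: 'a:]) = ?q" by (subst degree_prod_eq_sum_degree) simp_all
  then show "degree (\<Prod>c\<in>UNIV. [:- c, 1 :: 'a:]) \<le> ?q" by simp
  have X: "[:0, 1:] ^ ?q = monom (1::'a) ?q" by (simp add: monom_altdef)
  show "degree ([:0, 1:] ^ ?q - [:0, 1 :: 'a:]) \<le> ?q"
    unfolding X using q by (intro degree_diff_le) (simp_all add: degree_monom_eq)
  have "coeff (\<Prod>c\<in>UNIV. [:- c, 1 :: 'a:]) ?q = 1"
    using lead_coeff_prod[of "\<lambda>c. [:- c, 1 :: 'a:]" UNIV] deg by simp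
  moreover have "coeff [:0, 1 :: 'a:] ?q = 0" using q by (intro coeff_eq_0) simp
  ultimately show "coeff (\<Prod>c\<in>UNIV. [:- c, 1 :: 'a:]) ?q = coeff ([:0, 1:] ^ ?q - [:0, 1 :: 'a:]) ?q"
    unfolding X by simp
  fix z :: 'a
  have "poly (\<Prod>c\<in>UNIV. [:- c, 1 :: 'a:]) z = 0" unfolding poly_prod by (intro prod_zero) (auto intro!: bexI[of _ z])
  then show "poly (\<Prod>c\<in>UNIV. [:- c, 1 :: 'a:]) z = poly ([:0, 1:] ^ ?q - [:0, 1 :: 'a:]) z"
    using power_card_eq_same[of z] by simp
qed simp

text \<open>
  Substituting \<open>Y = X\<^sup>e\<close> into \<open>Y\<^sup>q - Y = \<Prod>\<^sub>c (Y - c)\<close>.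
\<close>

lemma prime_dvd_power_minus_const:
  fixes f :: "'a::{field,finite} poly"
  assumes f: "prime_elem f" and dvd: "f dvd [:0, 1:] ^ (e * (CARD('a) - 1)) - 1"
  shows "\<exists>c. f dvd [:0, 1:] ^ e - [:c:]"
proof -
  let ?Y = "[:0, 1 :: 'a:] ^ e" and ?q = "CARD('a)"
  have q: "?q = Suc (?q - 1)" using card_gt_1[where 'a='a] by simp
  have "?Y ^ ?q = ?Y * ?Y ^ (?q - 1)" unfolding power_Suc[symmetric] q[symmetric] ..
  then have "?Y ^ ?q - ?Y = ?Y * (?Y ^ (?q - 1) - 1)" by (simp add: algebra_simps)
  also have "?Y ^ (?q - 1) = [:0, 1:] ^ (e * (?q - 1))" by (simp add: power_mult)
  finally have "f dvd ?Y ^ ?q - ?Y" using dvd by simp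
  also have "?Y ^ ?q - ?Y = pcompose ([:0, 1:] ^ ?q - [:0, 1:]) ?Y"
    by (simp add: pcompose_diff pcompose_hom.hom_power pcompose_pCons)
  also have "\<dots> = (\<Prod>c\<in>UNIV. ?Y - [:c:])"
    unfolding prod_linear_factors[symmetric] pcompose_prod by (intro prod.cong refl) (simp add: pcompose_pCons)
  finally have "f dvd (\<Prod>c\<in>UNIV. ?Y - [:c:])" .
  moreover have "\<exists>c. f dvd h c" if "finite A" "f dvd prod h A" for A and h :: "'a \<Rightarrow> 'a poly"
    using that
  proof (induction A rule: finite_induct)
    case empty
    then show ?case using prime_elem_not_unit[OF f] by simp
  next
    case (insert c A)
    then show ?case using prime_elem_dvd_mult_iff[OF f, of "h c" "prod h A"] by auto
  qed
  ultimately show ?thesis by (meson finite)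
qed

lemma nilpotent_prime_kernel:
  fixes x :: "'a::field mat"
  assumes x: "x \<in> carrier_mat n n" and ne: "mat_poly n x f \<noteq> 0\<^sub>m n n" and sq: "mat_poly n x (f ^ 2) = 0\<^sub>m n n"
  shows "\<exists>v\<in>carrier_vec n. mat_poly n x f *\<^sub>v v \<noteq> 0\<^sub>v n \<and> mat_poly n x f *\<^sub>v (mat_poly n x f *\<^sub>v v) = 0\<^sub>v n"
proof -
  have "\<exists>v\<in>carrier_vec n. mat_poly n x f *\<^sub>v v \<noteq> 0\<^sub>v n"
  proof (rule ccontr)
    assume "\<not> ?thesis"
    then have "mat_poly n x f = 0\<^sub>m n n"
      using x by (intro mat_eq_on_vecI[of _ n n]) (simp_all add: zero_mat_mult_vec)
    then show False using ne by blast
  qed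
  then obtain v where v: "v \<in> carrier_vec n" "mat_poly n x f *\<^sub>v v \<noteq> 0\<^sub>v n" by blast
  have "mat_poly n x f *\<^sub>v (mat_poly n x f *\<^sub>v v) = mat_poly n x (f ^ 2) *\<^sub>v v"
    unfolding power2_eq_square by (rule mat_poly_mult_vec[OF x v(1), symmetric])
  then show ?thesis using v unfolding sq by (auto simp: zero_mat_mult_vec)
qed

text \<open>
  The third alternative holds if all irreducible polynomials with a kernel at \<open>x\<close> are linear.
  Otherwise \<open>large_prime_kernel_transvection\<close> leaves the exceptional elements with \<open>f(x)\<^sup>2 = 0\<close>
  for a quadratic \<open>f\<close>. For them \<open>f\<close> is the only irreducible polynomial with a kernel, and the
  hypothesis makes a power of \<open>x\<close> scalar.
\<close>

lemma SL4_power_cases: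
  fixes x :: "'a::{field,finite} mat"
  assumes dvd: "\<And>f x :: 'a mat. prime_elem f \<Longrightarrow> degree f = 2 \<Longrightarrow> x \<in> carrier (SL 4) \<Longrightarrow>
      mat_poly 4 x f \<noteq> 0\<^sub>m 4 4 \<Longrightarrow> mat_poly 4 x (f ^ 2) = 0\<^sub>m 4 4 \<Longrightarrow> \<exists>c. f dvd [:0, 1:] ^ e - [:c:]"
    and x: "x \<in> carrier (SL 4)"
  shows "x ^\<^sub>m semisimple_exponent TYPE('a) 4 \<in> {1\<^sub>m 4} \<union> transvections 4 \<or>
    (\<exists>c. x ^\<^sub>m (e * CHAR('a) ^ 4) = c \<cdot>\<^sub>m 1\<^sub>m 4) \<or> x ^\<^sub>m ((CARD('a) - 1) * CHAR('a) ^ 4) = 1\<^sub>m 4"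
proof (rule ccontr)
  let ?M = "semisimple_exponent TYPE('a) 4" and ?q = "CARD('a)"
  assume no: "\<not> ?thesis"
  have no2: "\<not> (\<exists>c. x ^\<^sub>m (e * CHAR('a) ^ 4) = c \<cdot>\<^sub>m 1\<^sub>m 4)"
    by (rule notI, rule notE[OF no], rule disjI2, rule disjI1, assumption)
  note xc = SL_carrier_mat[OF x]
  have dx: "det x \<noteq> 0" using x by (simp add: SL_carrier_iff)
  have "\<exists>f u. prime_elem f \<and> 2 \<le> degree f \<and> u \<in> carrier_vec 4 \<and> u \<noteq> 0\<^sub>v 4 \<and> mat_poly 4 x f *\<^sub>v u = 0\<^sub>v 4"
  proof (rule ccontr)
    assume no': "\<not> ?thesis"
    have "f dvd [:0, 1:] ^ (?q - 1) - [:1:]"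
      if f: "prime_elem f" and v: "v \<in> carrier_vec 4" "v \<noteq> 0\<^sub>v 4" "mat_poly 4 x f *\<^sub>v v = 0\<^sub>v 4" for f v
    proof -
      have "\<not> 2 \<le> degree f" using no' f v by blast
      then have "degree f = 1" using degree_prime_poly_pos[OF f] by linarith
      then have "?q ^ degree f - 1 dvd ?q - 1" by simp
      then have "f dvd [:0, 1:] ^ (?q - 1) - 1" by (rule prime_kernel_dvd_X_power_minus_1[OF xc v(1,2) dx f v(3)])
      then show ?thesis by (simp add: one_pCons)
    qed
    from scalar_power_if_prime_kernels_dvd[OF xc CHAR_power_ge this] show False using no by simp
  qed
  then obtain f u where f: "prime_elem f" "2 \<le> degree f"
    and u: "u \<in> carrier_vec 4" "u \<noteq> 0\<^sub>v 4" "mat_poly 4 x f *\<^sub>v u = 0\<^sub>v 4" by blast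
  then have deg: "degree f = 2" and sq: "mat_poly 4 x (f ^ 2) = 0\<^sub>m 4 4"
    using large_prime_kernel_transvection[OF x f(1) u _ f(2)] no f(2) by simp_all
  have ne: "mat_poly 4 x f \<noteq> 0\<^sub>m 4 4"
  proof
    assume z: "mat_poly 4 x f = 0\<^sub>m 4 4"
    have "?q ^ degree f - 1 dvd ?M" using deg by (intro semisimple_exponent_dvd) simp_all
    then have "f dvd [:0, 1:] ^ ?M - 1" by (rule prime_kernel_dvd_X_power_minus_1[OF xc u(1,2) dx f(1) u(3)])
    then obtain g where g: "[:0, 1:] ^ ?M - 1 = f * g" by (elim dvdE)
    have "x ^\<^sub>m ?M - 1\<^sub>m 4 = mat_poly 4 x (f * g)"
      unfolding g[symmetric] by (simp only: mat_poly_diff[OF xc] mat_poly_X_power[OF xc] mat_poly_1[OF xc])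
    also have "\<dots> = 0\<^sub>m 4 4" unfolding mat_poly_mult[OF xc] z using mat_poly_carrier[OF xc] by (intro left_mult_zero_mat) simp_all
    finally have "x ^\<^sub>m ?M = 1\<^sub>m 4" by (rule mat_diff_eq_0_imp_eq[OF pow_carrier_mat[OF xc] one_carrier_mat])
    then show False using no by simp
  qed
  obtain c where c: "f dvd [:0, 1:] ^ e - [:c:]" using dvd[OF f(1) deg x ne sq] by blast
  have "f' dvd [:0, 1:] ^ e - [:c:]"
    if f': "prime_elem f'" and v: "v \<in> carrier_vec 4" "v \<noteq> 0\<^sub>v 4" "mat_poly 4 x f' *\<^sub>v v = 0\<^sub>v 4" for f' v
  proof -
    have "mat_poly 4 x (f ^ 2) *\<^sub>v v = 0\<^sub>v 4" unfolding sq by (rule zero_mat_mult_vec[OF v(1)])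
    then have "f' dvd f ^ 2" by (rule mat_poly_prime_kernel[OF xc v(1,2) f' v(3)])
    then have "f' dvd f" by (rule prime_elem_dvd_power[OF f'])
    then show ?thesis using c by (rule dvd_trans)
  qed
  from scalar_power_if_prime_kernels_dvd[OF xc CHAR_power_ge this]
  have "\<exists>c. x ^\<^sub>m (e * CHAR('a) ^ 4) = c \<cdot>\<^sub>m 1\<^sub>m 4" by (rule exI)
  then show False using no2 by (rule notE[rotated])
qed

lemma conj_mat_mult_vec:
  fixes A :: "'a::field mat"
  assumes P: "P \<in> carrier (SL n)" and A: "A \<in> carrier_mat n n" and u: "u \<in> carrier_vec n"
  shows "conj_mat n P A *\<^sub>v u = inv\<^bsub>SL n\<^esub> P *\<^sub>v (A *\<^sub>v (P *\<^sub>v u))"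
proof -
  note Pc = SL_carrier_mat[OF P] SL_carrier_mat[OF SL_inv(1)[OF P]]
  have "conj_mat n P A *\<^sub>v u = (inv\<^bsub>SL n\<^esub> P * A) *\<^sub>v (P *\<^sub>v u)"
    unfolding conj_mat_def using Pc A u by (intro assoc_square_vec[of _ n] mult_carrier_square) simp_all
  also have "\<dots> = inv\<^bsub>SL n\<^esub> P *\<^sub>v (A *\<^sub>v (P *\<^sub>v u))"
    using Pc A u by (intro assoc_square_vec[of _ n]) simp_all
  finally show ?thesis .
qed

lemma SL_left_inverse_unique:
  fixes A :: "'a::field mat"
  assumes A: "A \<in> carrier (SL n)" and B: "B \<in> carrier_mat n n" "B * A = 1\<^sub>m n"
  shows "inv\<^bsub>SL n\<^esub> A = B"
proof -
  have "det B * det A = 1" using det_mult[OF B(1) SL_carrier_mat[OF A]] B(2) by simp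
  then have "B \<in> carrier (SL n)" using A B(1) by (simp add: SL_carrier_iff)
  then show ?thesis by (rule SL_inv_eqI[OF A _ B(2)])
qed

text \<open>
  The word is \<open>[z, z\<^sup>h]\<^sup>M\<close> with \<open>h = t\<^sub>B\<^sup>g\<close> and \<open>g = t\<^sub>A\<^sup>y\<close>, where \<open>z\<close>, \<open>t\<^sub>A\<close> and \<open>t\<^sub>B\<close> are powers
  of \<open>x\<close>. If \<open>t\<^sub>A\<close> is scalar, then \<open>h = t\<^sub>B\<close> commutes with \<open>z\<close>; if \<open>t\<^sub>B = 1\<close>, then \<open>h = 1\<close>; in
  both cases the commutator is trivial. The element that shows the word to be nontrivial consists
  of a Jordan block with eigenvalue \<open>a\<close> and of \<open>a\<^sup>-\<^sup>1\<close> times multiplication by \<open>\<alpha>\<close>, a norm-one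
  element outside the field. The hypothesis on \<open>\<mu>\<close> means that \<open>\<alpha>\<^sup>e = \<mu>\<close>, and \<open>a\<^sup>2\<^sup>e \<noteq> \<mu>\<close> that
  \<open>t\<^sub>A\<close> has distinct eigenvalues on the two blocks.
\<close>

theorem word_values_SL4_if:
  fixes \<sigma> a \<mu> :: "'a::{field,finite}"
  assumes dvd: "\<And>f x :: 'a mat. prime_elem f \<Longrightarrow> degree f = 2 \<Longrightarrow> x \<in> carrier (SL 4) \<Longrightarrow>
      mat_poly 4 x f \<noteq> 0\<^sub>m 4 4 \<Longrightarrow> mat_poly 4 x (f ^ 2) = 0\<^sub>m 4 4 \<Longrightarrow> \<exists>c. f dvd [:0, 1:] ^ e - [:c:]"
    and a: "a \<noteq> 0" "a ^ (2 * e) \<noteq> \<mu>"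
    and \<sigma>: "\<sigma> \<noteq> 0" "\<And>r. r * r - \<sigma> * r + 1 \<noteq> 0"
    and \<mu>: "\<And>\<alpha>. \<alpha> * \<alpha> = to_ac \<sigma> * \<alpha> - 1 \<Longrightarrow> \<alpha> ^ (CARD('a) + 1) = 1 \<Longrightarrow> \<alpha> ^ e = to_ac \<mu>"
  shows "\<exists>w\<in>carrier (free_group 2). word_values (SL 4 :: 'a mat monoid) 2 w = {1\<^sub>m 4} \<union> transvections 4"
proof -
  let ?G = "SL 4 :: 'a mat monoid" and ?M = "semisimple_exponent TYPE('a) 4" and ?q = "CARD('a)"
  let ?P = "CHAR('a) ^ 4"
  define z where "z x = x ^\<^sub>m ?M" for x :: "'a mat"
  define tA where "tA x = x ^\<^sub>m (e * ?P)" for x :: "'a mat"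
  define tB where "tB x = x ^\<^sub>m ((?q - 1) * ?P)" for x :: "'a mat"
  define h where "h x y = conj_mat 4 (conj_mat 4 y (tA x)) (tB x)" for x y
  define F where "F x y = comm_mat 4 (z x) (conj_mat 4 (h x y) (z x)) ^\<^sub>m ?M" for x y :: "'a mat"
  note cl = SL_pow_closed conj_mat_closed comm_mat_closed
  show ?thesis
  proof (rule word_values_transvections[of _ F])
    show "is_word_map ?G F"
      unfolding F_def z_def tA_def tB_def h_def
      by (intro is_word_map_pow_mat is_word_map_comm_mat is_word_map_conj_mat is_word_map_proj cl group_SL)
  next
    fix x y assume x: "x \<in> carrier ?G" and y: "y \<in> carrier ?G"
    have zG: "z x \<in> carrier ?G" unfolding z_def by (rule SL_pow_closed[OF x])
    have AG: "tA x \<in> carrier ?G" unfolding tA_def by (rule SL_pow_closed[OF x])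
    have BG: "tB x \<in> carrier ?G" unfolding tB_def by (rule SL_pow_closed[OF x])
    have hG: "h x y \<in> carrier ?G" unfolding h_def by (rule conj_mat_closed[OF conj_mat_closed[OF y AG] BG])
    note zc = SL_carrier_mat[OF zG] and Bc = SL_carrier_mat[OF BG]
    have F1: "F x y = 1\<^sub>m 4" if "conj_mat 4 (h x y) (z x) = z x"
      unfolding F_def that by (simp add: comm_mat_self[OF zG])
    have "z x \<in> {1\<^sub>m 4} \<union> transvections 4 \<or> (\<exists>c. tA x = c \<cdot>\<^sub>m 1\<^sub>m 4) \<or> tB x = 1\<^sub>m 4"
      unfolding z_def tA_def tB_def by (rule SL4_power_cases[OF dvd x])
    then consider "z x \<in> {1\<^sub>m 4} \<union> transvections 4" | c where "tA x = c \<cdot>\<^sub>m 1\<^sub>m 4" | "tB x = 1\<^sub>m 4"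
      by (elim disjE exE)
    then show "F x y \<in> {1\<^sub>m 4} \<union> transvections 4"
    proof cases
      case 1
      then show ?thesis unfolding F_def
        by (intro comm_mat_power_transvections conj_mat_transvections hG) simp_all
    next
      case 2
      have g: "conj_mat 4 y (tA x) = tA x" unfolding 2 by (rule conj_mat_scalar[OF y])
      have "tB x * tA x = tA x * tB x" unfolding 2 by (rule scalar_mat_commutes[OF Bc, symmetric])
      then have "h x y = tB x" unfolding h_def g by (rule conj_mat_commuting[OF Bc AG])
      moreover have "conj_mat 4 (tB x) (z x) = z x"
        by (rule conj_mat_commuting[OF zc BG]) (unfold z_def tB_def, rule SL_powers_commute[OF x])
      ultimately have "F x y = 1\<^sub>m 4" using F1 by simp
      then show ?thesis by simp
    next
      case 3
      have one: "1\<^sub>m 4 \<in> carrier ?G" by (simp add: SL_carrier_iff)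
      have "h x y = 1\<^sub>m 4" unfolding h_def 3 by (rule conj_mat_one[OF conj_mat_closed[OF y AG]])
      moreover have "conj_mat 4 (1\<^sub>m 4) (z x) = z x" using zc by (intro conj_mat_commuting one) simp_all
      ultimately have "F x y = 1\<^sub>m 4" using F1 by simp
      then show ?thesis by simp
    qed
  next
    have p: "prime CHAR('a)" by (rule prime_CHAR_finite_field)
    obtain \<alpha> where \<alpha>: "\<alpha> * \<alpha> = to_ac \<sigma> * \<alpha> - 1" "\<alpha> \<notin> range to_ac" "\<alpha> ^ (?q + 1) = 1"
      using quadratic_root_in_closure[OF \<sigma>(2)] by blast
    let ?C = "quad_mat \<sigma> 0 1" and ?b = "inverse a"
    define x where "x = four_block_mat (jordan_block 2 a) (0\<^sub>m 2 2) (0\<^sub>m 2 2) (?b \<cdot>\<^sub>m ?C)"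
    have xpow: "x ^\<^sub>m k = mat4 [[a ^ k, of_nat k * a ^ (k - 1), 0, 0], [0, a ^ k, 0, 0],
        [0, 0, ?b ^ k * s, - (?b ^ k * t)], [0, 0, ?b ^ k * t, ?b ^ k * (s + \<sigma> * t)]]"
      if "?C ^\<^sub>m k = quad_mat \<sigma> s t" for k s t
    proof -
      have "x ^\<^sub>m k = four_block_mat (jordan_block 2 a ^\<^sub>m k) (0\<^sub>m 2 2) (0\<^sub>m 2 2) ((?b \<cdot>\<^sub>m ?C) ^\<^sub>m k)"
        unfolding x_def by (rule pow_four_block_mat) simp_all
      also have "(?b \<cdot>\<^sub>m ?C) ^\<^sub>m k = ?b ^ k \<cdot>\<^sub>m quad_mat \<sigma> s t"
        unfolding smult_mat_power[OF quad_mat_carrier(1)] that ..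
      finally show ?thesis unfolding jordan_block_pow
        by (intro eq_matI) (auto dest!: less_4_cases)
    qed
    have Jc: "jordan_block 2 a \<in> carrier_mat 2 2" and bC: "?b \<cdot>\<^sub>m ?C \<in> carrier_mat 2 2" by simp_all
    have "det (jordan_block 2 a) = a * a"
      using det_upper_triangular[OF _ Jc] by (simp add: upper_triangular_def jordan_block_def prod_list_diag_prod numeral_2_eq_2)
    moreover have "det (?b \<cdot>\<^sub>m ?C) = ?b * ?b"
      by (simp add: det_smult quad_mat_def det_mat_2 power2_eq_square)
    moreover have "det x = det (jordan_block 2 a) * det (?b \<cdot>\<^sub>m ?C)"
      unfolding x_def by (rule det_four_block_mat_lower_left_zero[OF Jc _ _ bC]) simp_all
    ultimately have "det x = 1" using a(1) by (simp add: field_simps)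
    moreover have "x \<in> carrier_mat 4 4" using four_block_carrier_mat[OF Jc bC, of "0\<^sub>m 2 2" "0\<^sub>m 2 2"] by (simp add: x_def)
    ultimately have x: "x \<in> carrier ?G" by (simp add: SL_carrier_iff)
    have P0: "of_nat ?P = (0::'a)" by simp
    define l where "l = a ^ (e * ?P)"
    define l' where "l' = ?b ^ (e * ?P) * \<mu> ^ ?P"
    have l0: "l \<noteq> 0" "\<mu> \<noteq> 0" using a(1) \<mu>[OF \<alpha>(1,3)] \<alpha>(2) by (auto simp: l_def)
    then have l'0: "l' \<noteq> 0" using a(1) by (simp add: l'_def)
    have ll': "l \<noteq> l'"
    proof
      assume "l = l'"
      then have "a ^ (e * ?P) * a ^ (e * ?P) = \<mu> ^ ?P" using a(1) unfolding l_def l'_def by (simp add: field_simps)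
      moreover have "a ^ (e * ?P) * a ^ (e * ?P) = (a ^ (2 * e)) ^ ?P"
        unfolding power_mult[symmetric] power_add[symmetric] by (rule arg_cong[of _ _ "power a"]) simp
      ultimately have "a ^ (2 * e) = \<mu>" using CHAR_power_eq_imp_eq[OF p, of "a ^ (2 * e)" 4 \<mu>] by simp
      then show False using a(2) by blast
    qed
    have tAx: "tA x = mat4 [[l, 0, 0, 0], [0, l, 0, 0], [0, 0, l', 0], [0, 0, 0, l']]"
    proof -
      have "\<alpha> ^ (e * ?P) = to_ac (\<mu> ^ ?P)" unfolding power_mult \<mu>[OF \<alpha>(1,3)] by simp
      then have "?C ^\<^sub>m (e * ?P) = quad_mat \<sigma> (\<mu> ^ ?P) 0"
        unfolding quad_mat_const by (rule quad_mat_power_scalar[OF \<alpha>(1,2)])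
      from xpow[OF this] show ?thesis unfolding tA_def l_def l'_def using P0 by simp
    qed
    have a1: "a ^ k = 1" "?b ^ k = 1" if k: "?q - 1 dvd k" for k
    proof -
      obtain j where j: "k = (?q - 1) * j" using k by (elim dvdE)
      show "a ^ k = 1" unfolding j power_mult power_card_minus_1[OF a(1)] by simp
      then show "?b ^ k = 1" by (simp add: power_inverse)
    qed
    have dM: "?q - 1 dvd ?M" "?q ^ 2 - 1 dvd ?M"
      using semisimple_exponent_dvd[of 1 4, where 'a='a] semisimple_exponent_dvd[of 2 4, where 'a='a] by simp_all
    define m where "m = of_nat ?M * a ^ (?M - 1)"
    have m0: "m \<noteq> 0" using a(1) of_nat_semisimple_exponent[of 4, where 'a='a] by (simp add: m_def)
    let ?v = "vec4 [m, 0, 0, 0]" and ?f = "vec4 [0, 1, 0, 0 :: 'a]"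
    have zx: "z x = transv ?v ?f"
    proof -
      have "?q ^ 2 - 1 = (?q + 1) * (?q - 1)" by (simp add: power2_eq_square algebra_simps diff_mult_distrib2)
      then obtain j where j: "?M = (?q + 1) * ((?q - 1) * j)" using dM(2) by (metis dvdE mult.assoc)
      have "\<alpha> ^ ?M = to_ac 1" unfolding j power_mult[of \<alpha> "?q + 1"] \<alpha>(3) by simp
      then have "?C ^\<^sub>m ?M = quad_mat \<sigma> 1 0" unfolding quad_mat_const by (rule quad_mat_power_scalar[OF \<alpha>(1,2)])
      from xpow[OF this] have "z x = mat4 [[1, m, 0, 0], [0, 1, 0, 0], [0, 0, 1, 0], [0, 0, 0, 1]]"
        unfolding z_def m_def a1[OF dM(1)] by simp
      also have "\<dots> = transv ?v ?f" by (rule eq_matI) (auto dest!: less_4_cases simp: transv_def)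
      finally show ?thesis .
    qed
    obtain s t where st: "?C ^\<^sub>m ((?q - 1) * ?P) = quad_mat \<sigma> s t" "\<alpha> ^ ((?q - 1) * ?P) = to_ac s + to_ac t * \<alpha>"
      "s * s + \<sigma> * s * t + t * t = 1" using quad_mat_power[OF \<alpha>(1)] by blast
    have tBx: "tB x = mat4 [[1, 0, 0, 0], [0, 1, 0, 0], [0, 0, s, - t], [0, 0, t, s + \<sigma> * t]]"
      using xpow[OF st(1)] P0 unfolding tB_def a1[OF dvd_triv_left] by simp
    have t0: "t \<noteq> 0"
    proof
      assume t: "t = 0"
      have "\<alpha> ^ ((?q - 1) * ?P) * (\<alpha> ^ 2) ^ ?P = \<alpha> ^ ((?q + 1) * ?P)"
        using card_gt_1[where 'a='a] by (simp add: power_mult[symmetric] power_add[symmetric] add_mult_distrib[symmetric])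
      also have "\<dots> = 1" unfolding power_mult \<alpha>(3) by simp
      finally have s: "to_ac s * (\<alpha> ^ 2) ^ ?P = 1" using st(2) t by simp
      then have "s \<noteq> 0" by auto
      then have "(\<alpha> ^ 2) ^ ?P = to_ac (inverse s)" using s by (simp add: field_simps)
      then have "(\<alpha> ^ 2) ^ ?P \<in> range to_ac" by (simp only: rangeI)
      then have "((\<alpha> ^ 2) ^ ?P) ^ ?q = (\<alpha> ^ 2) ^ ?P" by (simp only: range_to_ac_iff)
      then have "((\<alpha> ^ 2) ^ ?q) ^ ?P = (\<alpha> ^ 2) ^ ?P" by (simp only: power_mult[symmetric] ac_simps)
      then have "(\<alpha> ^ 2) ^ ?q = \<alpha> ^ 2"
        using CHAR_power_eq_imp_eq[of "(\<alpha> ^ 2) ^ ?q" 4 "\<alpha> ^ 2"] p by simp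
      then have "\<alpha> ^ 2 \<in> range to_ac" by (simp only: range_to_ac_iff)
      then obtain r where "\<alpha> ^ 2 = to_ac r" by blast
      then have "to_ac (- 1) + to_ac \<sigma> * \<alpha> = to_ac r" using \<alpha>(1) by (simp add: power2_eq_square)
      then show False using to_ac_linear_independent[OF \<alpha>(2)] \<sigma>(1) by blast
    qed
    (* The determinant of T - 1, where T is the lower block of t_B; it vanishes only if the
       quadratic has a root. *)
    define D where "D = (s - 1) * (s + \<sigma> * t - 1) + t * t"
    have D0: "D \<noteq> 0"
    proof
      assume "D = 0"
      have "t * t * ((1 - s) / t * ((1 - s) / t) - \<sigma> * ((1 - s) / t) + 1) = D"
        unfolding D_def using t0 by (simp add: field_simps)
      then show False using \<sigma>(2)[of "(1 - s) / t"] t0 \<open>D = 0\<close> by simp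
    qed
    (* The vector w = (w1, w2) is the solution of (T - 1) w = (1, 0). *)
    define w1 where "w1 = (s + \<sigma> * t - 1) / D"
    define w2 where "w2 = - t / D"
    have w: "s * w1 - t * w2 = w1 + 1" "t * w1 + (s + \<sigma> * t) * w2 = w2"
    proof -
      have wD: "w1 * D = s + \<sigma> * t - 1" "w2 * D = - t" using D0 by (simp_all add: w1_def w2_def)
      have "((s - 1) * w1 - t * w2) * D = (s - 1) * (w1 * D) - t * (w2 * D)" by (simp only: left_diff_distrib mult.assoc)
      also have "\<dots> = 1 * D" unfolding wD by (simp add: D_def)
      finally have "(s - 1) * w1 - t * w2 = 1" unfolding mult_right_cancel[OF D0] .
      then show "s * w1 - t * w2 = w1 + 1" by (simp add: algebra_simps)
      have "(t * w1 + (s + \<sigma> * t - 1) * w2) * D = t * (w1 * D) + (s + \<sigma> * t - 1) * (w2 * D)"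
        by (simp only: distrib_right mult.assoc)
      also have "\<dots> = 0 * D" unfolding wD by (simp add: algebra_simps)
      finally have "t * w1 + (s + \<sigma> * t - 1) * w2 = 0" unfolding mult_right_cancel[OF D0] .
      then show "t * w1 + (s + \<sigma> * t) * w2 = w2" by (simp add: algebra_simps)
    qed
    have w': "s * w2 - t * w1 = w2 + t"
    proof -
      have "s * (t * w1 + (s + \<sigma> * t) * w2) - t * (s * w1 - t * w2) = (s * s + \<sigma> * s * t + t * t) * w2"
        by (simp add: algebra_simps)
      then show ?thesis unfolding w st(3) by (simp add: algebra_simps)
    qed
    (* The columns of the inverse y' are eigenvectors of g = y' t_A y. They are chosen such that g
       maps the first unit vector to l e0 + d (e1 + w), while the functional of the transvection,
       transported by g, is proportional to the last coordinate on the lower block, which kills (T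
       - 1) w. *)
    define y where "y = mat4 [[1, - w2, 0, 1], [0, - w2, 0, 1], [1, 1 - w2, 0, 1], [0, - w1, 1, 0]]"
    define y' where "y' = mat4 [[1, - 1, 0, 0], [- 1, 0, 1, 0], [- w1, 0, w1, 1], [- w2, 1, w2, 0]]"
    have y: "y \<in> carrier ?G" unfolding SL_carrier_iff y_def by (simp add: det_mat4 det_mat3)
    have iy: "inv\<^bsub>?G\<^esub> y = y'"
      by (rule SL_left_inverse_unique[OF y]) (simp_all add: y_def y'_def mat4_mult mat4_one algebra_simps)
    define A' where "A' = mat4 [[inverse l, 0, 0, 0], [0, inverse l, 0, 0], [0, 0, inverse l', 0], [0, 0, 0, inverse l']]"
    define B' where "B' = mat4 [[1, 0, 0, 0], [0, 1, 0, 0], [0, 0, s + \<sigma> * t, t], [0, 0, - t, s]]"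
    have AG: "tA x \<in> carrier ?G" unfolding tA_def by (rule SL_pow_closed[OF x])
    have BG: "tB x \<in> carrier ?G" unfolding tB_def by (rule SL_pow_closed[OF x])
    have iA: "inv\<^bsub>?G\<^esub> (tA x) = A'"
      by (rule SL_left_inverse_unique[OF AG]) (use l0 l'0 in \<open>simp_all add: A'_def tAx mat4_mult mat4_one\<close>)
    have "B' * tB x = 1\<^sub>m 4"
      using st(3) unfolding B'_def tBx mat4_mult mat4_one by (simp add: algebra_simps)
    then have iB: "inv\<^bsub>?G\<^esub> (tB x) = B'"
      by (intro SL_left_inverse_unique[OF BG]) (simp add: B'_def)
    define g where "g = conj_mat 4 y (tA x)"
    have gG: "g \<in> carrier ?G" unfolding g_def by (rule conj_mat_closed[OF y AG])
    have gv: "g *\<^sub>v u = y' *\<^sub>v (tA x *\<^sub>v (y *\<^sub>v u))" if "u \<in> carrier_vec 4" for u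
      unfolding g_def conj_mat_mult_vec[OF y SL_carrier_mat[OF AG] that] iy ..
    have igv: "inv\<^bsub>?G\<^esub> g *\<^sub>v u = y' *\<^sub>v (A' *\<^sub>v (y *\<^sub>v u))" if "u \<in> carrier_vec 4" for u
      unfolding g_def conj_mat_inv[OF y AG, symmetric] iA
      using conj_mat_mult_vec[OF y _ that, of A'] by (simp add: A'_def iy)
    have hG: "h x y \<in> carrier ?G" unfolding h_def by (rule conj_mat_closed[OF conj_mat_closed[OF y AG] BG])
    define d where "d = l' - l"
    have d0: "d \<noteq> 0" using ll' by (simp add: d_def)
    have yv: "y *\<^sub>v ?v = vec4 [m, 0, m, 0]" unfolding y_def mat4_mult_vec by simp
    have Av: "tA x *\<^sub>v vec4 [m, 0, m, 0] = vec4 [l * m, 0, l' * m, 0]" unfolding tAx mat4_mult_vec by simp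
    have v': "g *\<^sub>v ?v = vec4 [l * m, d * m, d * m * w1, d * m * w2]"
      unfolding gv[OF vec4_carrier(1)] yv Av unfolding y'_def mat4_mult_vec by (simp add: d_def algebra_simps)
    have hv: "h x y *\<^sub>v ?v = y' *\<^sub>v (A' *\<^sub>v vec4 [l * m, 0, l' * m, d * m])"
    proof -
      have e1: "s * (d * m * w1) + - t * (d * m * w2) = d * m * (w1 + 1)"
        unfolding w(1)[symmetric] by (simp add: algebra_simps)
      have e2: "t * (d * m * w1) + (s + \<sigma> * t) * (d * m * w2) = d * m * w2"
        using arg_cong[OF w(2), of "\<lambda>r. d * m * r"] by (simp add: algebra_simps)
      have Bv: "tB x *\<^sub>v vec4 [l * m, d * m, d * m * w1, d * m * w2] = vec4 [l * m, d * m, d * m * (w1 + 1), d * m * w2]"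
        unfolding tBx mat4_mult_vec using e1 e2 by simp
      have yu: "y *\<^sub>v vec4 [l * m, d * m, d * m * (w1 + 1), d * m * w2] = vec4 [l * m, 0, l' * m, d * m]"
        unfolding y_def mat4_mult_vec by (simp add: d_def algebra_simps)
      show ?thesis
        unfolding h_def g_def[symmetric] conj_mat_mult_vec[OF gG SL_carrier_mat[OF BG] vec4_carrier(1)] v' Bv
          igv[OF vec4_carrier(1)] yu ..
    qed
    have ihv: "inv\<^bsub>?G\<^esub> (h x y) *\<^sub>v ?v =
        y' *\<^sub>v (A' *\<^sub>v vec4 [l * m + d * m * t, d * m * t, l' * m + d * m * t, d * m * ((s + \<sigma> * t) * w1 + t * w2 - w1)])"
    proof -
      have e2: "- t * (d * m * w1) + s * (d * m * w2) = d * m * (w2 + t)"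
        unfolding w'[symmetric] by (simp add: algebra_simps)
      have e1: "(s + \<sigma> * t) * (d * m * w1) + t * (d * m * w2) = d * m * ((s + \<sigma> * t) * w1 + t * w2)"
        by (simp add: algebra_simps)
      have Bv: "B' *\<^sub>v vec4 [l * m, d * m, d * m * w1, d * m * w2] =
          vec4 [l * m, d * m, d * m * ((s + \<sigma> * t) * w1 + t * w2), d * m * (w2 + t)]"
        unfolding B'_def mat4_mult_vec using e1 e2 by simp
      have yu: "y *\<^sub>v vec4 [l * m, d * m, d * m * ((s + \<sigma> * t) * w1 + t * w2), d * m * (w2 + t)] =
          vec4 [l * m + d * m * t, d * m * t, l' * m + d * m * t, d * m * ((s + \<sigma> * t) * w1 + t * w2 - w1)]"
        unfolding y_def mat4_mult_vec by (simp add: d_def algebra_simps)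
      have B'c: "B' \<in> carrier_mat 4 4" by (simp add: B'_def)
      show ?thesis
        unfolding h_def g_def[symmetric] conj_mat_inv[OF gG BG, symmetric] iB
          conj_mat_mult_vec[OF gG B'c vec4_carrier(1)] v' Bv igv[OF vec4_carrier(1)] yu ..
    qed
    have fv: "?f \<bullet> ?v = 0" by (simp add: vec4_scalar_prod)
    have fh: "?f \<bullet> (h x y *\<^sub>v ?v) = 0"
      unfolding hv A'_def y'_def mat4_mult_vec vec4_scalar_prod using l0 l'0 by simp
    have fih: "?f \<bullet> (inv\<^bsub>?G\<^esub> (h x y) *\<^sub>v ?v) \<noteq> 0"
    proof -
      have "?f \<bullet> (inv\<^bsub>?G\<^esub> (h x y) *\<^sub>v ?v) = - (inverse l * (l * m + d * m * t)) + inverse l' * (l' * m + d * m * t)"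
        unfolding ihv A'_def y'_def mat4_mult_vec vec4_scalar_prod by simp
      also have "\<dots> = d * m * t * (inverse l' - inverse l)" using l0 l'0 by (simp add: field_simps)
      finally show ?thesis using d0 m0 t0 ll' by (simp add: inverse_eq_iff_eq)
    qed
    have zG: "transv ?v ?f \<in> carrier ?G" unfolding zx[symmetric] z_def by (rule SL_pow_closed[OF x])
    have "F x y \<noteq> 1\<^sub>m 4"
      unfolding F_def zx by (rule comm_conj_transv_power_neq_1[OF vec4_carrier(1) vec4_carrier(1) fv zG hG fh fih])
    then show "\<exists>x\<in>carrier ?G. \<exists>y\<in>carrier ?G. F x y \<noteq> 1\<^sub>m 4" using x y by blast
  qed simp
qed

lemma degree_2_polyE:
  assumes "degree f = 2"
  obtains c b d where "f = [:c, b, d:]" "d \<noteq> 0"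
proof -
  have "f = [:coeff f 0, coeff f 1, coeff f 2:]"
  proof (rule poly_eqI)
    fix i :: nat
    consider "i = 0" | "i = 1" | "i = 2" | "i > 2" by linarith
    then show "coeff f i = coeff [:coeff f 0, coeff f 1, coeff f 2:] i"
      by cases (use assms in \<open>simp_all add: coeff_eq_0 numeral_2_eq_2 coeff_pCons split: nat.split\<close>)
  qed
  moreover have "coeff f 2 \<noteq> 0" using assms by (metis degree_0 leading_coeff_0_iff zero_neq_numeral)
  ultimately show ?thesis by (rule that)
qed

text \<open>
  With respect to the basis \<open>v, x v, f(x) v, x f(x) v\<close> the matrix of \<open>x\<close> is block triangular, with
  two diagonal blocks equal to the companion matrix of \<open>f / d\<close>, of determinant \<open>c / d\<close>.
\<close>

lemma det_if_quadratic_square_zero: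
  fixes x :: "'a::field mat"
  assumes x: "x \<in> carrier_mat 4 4" and f: "prime_elem f" "f = [:c, b, d:]" "d \<noteq> 0"
    and ne: "mat_poly 4 x f \<noteq> 0\<^sub>m 4 4" and sq: "mat_poly 4 x (f ^ 2) = 0\<^sub>m 4 4"
  shows "det x = (c / d)\<^sup>2"
proof -
  let ?N = "mat_poly 4 x f"
  obtain v where v: "v \<in> carrier_vec 4" "?N *\<^sub>v v \<noteq> 0\<^sub>v 4" "?N *\<^sub>v (?N *\<^sub>v v) = 0\<^sub>v 4"
    using nilpotent_prime_kernel[OF x ne sq] by blast
  define u where "u = ?N *\<^sub>v v"
  have Nc: "?N \<in> carrier_mat 4 4" using x by simp
  have u: "u \<in> carrier_vec 4" "u \<noteq> 0\<^sub>v 4" "?N *\<^sub>v u = 0\<^sub>v 4" using v x by (simp_all add: u_def)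
  have deg: "degree f = 2" using f(2,3) by simp
  have lin: "mat_poly 4 x [:a0, a1:] *\<^sub>v w = a0 \<cdot>\<^sub>v w + a1 \<cdot>\<^sub>v (x *\<^sub>v w)" if w: "w \<in> carrier_vec 4" for a0 a1 w
  proof -
    have "[:a0, a1:] = smult a0 1 + smult a1 [:0, 1:]" by simp
    then have "mat_poly 4 x [:a0, a1:] = a0 \<cdot>\<^sub>m 1\<^sub>m 4 + a1 \<cdot>\<^sub>m x"
      by (simp only: mat_poly_add[OF x] mat_poly_smult[OF x] mat_poly_1[OF x] mat_poly_X[OF x])
    then show ?thesis
      using x w by (simp add: add_mult_distrib_mat_vec[of _ 4 4] smult_one_mat_mult_vec smult_mat_mult_vec[of _ 4 4])
  qed
  have quad: "?N *\<^sub>v w = c \<cdot>\<^sub>v w + b \<cdot>\<^sub>v (x *\<^sub>v w) + d \<cdot>\<^sub>v (x *\<^sub>v (x *\<^sub>v w))" if w: "w \<in> carrier_vec 4" for w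
  proof -
    have "f = [:c, b:] + smult d ([:0, 1:] * [:0, 1:])" by (simp add: f(2))
    then have "?N = mat_poly 4 x [:c, b:] + d \<cdot>\<^sub>m (x * x)"
      by (simp only: mat_poly_add[OF x] mat_poly_smult[OF x] mat_poly_mult[OF x] mat_poly_X[OF x])
    then have "?N *\<^sub>v w = mat_poly 4 x [:c, b:] *\<^sub>v w + (d \<cdot>\<^sub>m (x * x)) *\<^sub>v w"
      using x w by (simp add: add_mult_distrib_mat_vec[of _ 4 4])
    then show ?thesis
      using x w by (simp add: lin smult_mat_mult_vec[of _ 4 4] assoc_square_vec[of _ 4])
  qed
  have indep: "a0 = 0 \<and> a1 = 0" if "mat_poly 4 x [:a0, a1:] *\<^sub>v u = 0\<^sub>v 4" for a0 a1
  proof -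
    have "f dvd [:a0, a1:]" by (rule mat_poly_prime_kernel[OF x u(1,2) f(1) u(3) that])
    moreover have "degree [:a0, a1:] < degree f" using deg by simp
    ultimately have "[:a0, a1:] = 0" using dvd_imp_degree_le[of f "[:a0, a1:]"] by linarith
    then show ?thesis by simp
  qed
  note xv = mult_mat_vec_carrier[OF x v(1)] mult_mat_vec_carrier[OF x u(1)]
  define P where "P = mat_of_cols 4 [v, x *\<^sub>v v, u, x *\<^sub>v u]"
  have P: "P \<in> carrier_mat 4 4" by (rule carrier_matI) (simp_all add: P_def)
  have Pvec: "P *\<^sub>v a = a $ 0 \<cdot>\<^sub>v v + a $ 1 \<cdot>\<^sub>v (x *\<^sub>v v) + a $ 2 \<cdot>\<^sub>v u + a $ 3 \<cdot>\<^sub>v (x *\<^sub>v u)"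
    if "a \<in> carrier_vec 4" for a
    unfolding P_def by (rule mat_of_cols_4_mult_vec[OF v(1) xv(1) u(1) xv(2) that])
  have "det P \<noteq> 0"
  proof
    assume "det P = 0"
    then obtain a where a: "a \<in> carrier_vec 4" "a \<noteq> 0\<^sub>v 4" "P *\<^sub>v a = 0\<^sub>v 4"
      using det_0_iff_vec_prod_zero_field[OF P] by blast
    have lu: "mat_poly 4 x [:a $ 2, a $ 3:] *\<^sub>v u \<in> carrier_vec 4" and lv: "mat_poly 4 x [:a $ 0, a $ 1:] *\<^sub>v v \<in> carrier_vec 4"
      using x u v by simp_all
    have eq: "mat_poly 4 x [:a $ 0, a $ 1:] *\<^sub>v v + mat_poly 4 x [:a $ 2, a $ 3:] *\<^sub>v u = 0\<^sub>v 4"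
      using a(3) xv u(1) v(1) unfolding Pvec[OF a(1)] lin[OF v(1)] lin[OF u(1)]
      by (simp add: assoc_add_vec[of _ 4])
    have comm: "?N *\<^sub>v (mat_poly 4 x g *\<^sub>v w) = mat_poly 4 x g *\<^sub>v (?N *\<^sub>v w)" if "w \<in> carrier_vec 4" for g w
      unfolding mat_poly_mult_vec[OF x that, symmetric] mult.commute[of f g] ..
    have "0\<^sub>v 4 = ?N *\<^sub>v (mat_poly 4 x [:a $ 0, a $ 1:] *\<^sub>v v + mat_poly 4 x [:a $ 2, a $ 3:] *\<^sub>v u)"
      unfolding eq by (rule mult_mat_zero_vec[OF Nc, symmetric])
    also have "\<dots> = mat_poly 4 x [:a $ 0, a $ 1:] *\<^sub>v u + mat_poly 4 x [:a $ 2, a $ 3:] *\<^sub>v 0\<^sub>v 4"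
      unfolding mult_add_distrib_mat_vec[OF Nc lv lu] comm[OF v(1)] comm[OF u(1)] u(3) u_def[symmetric] ..
    also have "\<dots> = mat_poly 4 x [:a $ 0, a $ 1:] *\<^sub>v u"
      using mult_mat_zero_vec[OF mat_poly_carrier[OF x, of "[:a $ 2, a $ 3:]"]] x u(1) by simp
    finally have 1: "a $ 0 = 0" "a $ 1 = 0" using indep by simp_all
    have "mat_poly 4 x [:a $ 0, a $ 1:] *\<^sub>v v = 0\<^sub>v 4" unfolding 1 using v x by (simp add: zero_mat_mult_vec)
    then have "mat_poly 4 x [:a $ 2, a $ 3:] *\<^sub>v u = 0\<^sub>v 4" using eq lu by simp
    then have 2: "a $ 2 = 0" "a $ 3 = 0" using indep by simp_all
    have "a = 0\<^sub>v 4" using 1 2 a(1) by (intro eq_vecI) (auto dest!: less_4_cases)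
    then show False using a(2) by blast
  qed
  define B where "B = mat4 [[0, - (c / d), 0, 0], [1, - (b / d), 0, 0], [0, inverse d, 0, - (c / d)], [0, 0, 1, - (b / d)]]"
  have xx: "x *\<^sub>v (x *\<^sub>v w) = (- (c / d)) \<cdot>\<^sub>v w + (- (b / d)) \<cdot>\<^sub>v (x *\<^sub>v w) + inverse d \<cdot>\<^sub>v (?N *\<^sub>v w)"
    if w: "w \<in> carrier_vec 4" for w
    unfolding quad[OF w] using w x f(3) by (intro eq_vecI) (simp_all add: field_simps del: index_mult_mat_vec)
  have "x * P = P * B"
  proof (rule mat_col_eqI)
    fix i assume "i < dim_col (P * B)"
    then have i: "i < 4" by (simp add: B_def)
    have "col (x * P) i = x *\<^sub>v col P i" using x P i by (simp add: col_mult2[of _ 4 4 _ 4])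
    also have "\<dots> = x *\<^sub>v ([v, x *\<^sub>v v, u, x *\<^sub>v u] ! i)"
      unfolding P_def using less_4_cases[OF i] v(1) u(1) xv by (intro arg_cong[of _ _ "\<lambda>w. x *\<^sub>v w"] col_mat_of_cols) auto
    also have "\<dots> = P *\<^sub>v col B i"
    proof -
      have Bi: "col B i = vec4 (map (\<lambda>r. r ! i) [[0, - (c / d), 0, 0], [1, - (b / d), 0, 0], [0, inverse d, 0, - (c / d)], [0, 0, 1, - (b / d)]])"
        using i by (intro eq_vecI) (auto dest!: less_4_cases simp: B_def)
      have z: "0 \<cdot>\<^sub>v w = 0\<^sub>v 4" "1 \<cdot>\<^sub>v w = w" if "w \<in> carrier_vec 4" for w :: "'a vec"
        using that by (auto intro: eq_vecI)
      show ?thesis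
        unfolding Bi Pvec[OF vec4_carrier(1)] using less_4_cases[OF i]
        by (elim disjE) (use xv u v(1) xx[OF v(1)] xx[OF u(1)] in \<open>simp_all add: z u_def[symmetric] comm_add_vec[of _ 4]\<close>)
    qed
    also have "\<dots> = col (P * B) i" using P i by (simp add: col_mult2[of _ 4 4 _ 4] B_def)
    finally show "col (x * P) i = col (P * B) i" .
  qed (use x P in \<open>simp_all add: B_def\<close>)
  then have "det x * det P = det P * det B"
    using det_mult[OF x P] det_mult[OF P, of B] by (simp add: B_def)
  then have "det x = det B" using \<open>det P \<noteq> 0\<close> by simp
  also have "\<dots> = (c / d)\<^sup>2" by (simp add: B_def det_mat4 det_mat3 power2_eq_square)
  finally show ?thesis .
qed

lemma field_5_cases:
  assumes q: "CARD('a::{field,finite}) = 5"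
  shows "(5::'a) = 0" and "(2::'a) \<noteq> 0" and "(3::'a) \<noteq> 0" and "(r::'a) = 0 \<or> r = 1 \<or> r = - 1 \<or> r = 2 \<or> r = - 2"
proof -
  have "of_nat CARD('a) = (0::'a)" by (rule of_nat_CARD)
  then show five: "(5::'a) = 0" unfolding q by simp
  have "CHAR('a) = 5"
  proof -
    have "prime (5::nat)" "5 dvd CARD('a)" using q by simp_all
    then show ?thesis using prime_dvd_CARD_imp_CHAR[of 5, where 'a='a] by simp
  qed
  then have ne: "(of_nat k :: 'a) \<noteq> 0" if "\<not> 5 dvd k" for k using that by (simp add: of_nat_eq_0_iff_char_dvd)
  have n: "(1::'a) \<noteq> 0" "(2::'a) \<noteq> 0" "(3::'a) \<noteq> 0" "(4::'a) \<noteq> 0"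
    using ne[of 1] ne[of 2] ne[of 3] ne[of 4] by simp_all
  show "(2::'a) \<noteq> 0" "(3::'a) \<noteq> 0" using n by simp_all
  have "distinct [0, 1, - 1, 2, - 2 :: 'a]"
  proof -
    have p: "x \<noteq> - y" if "x + y \<noteq> 0" for x y :: 'a using that by (simp add: eq_neg_iff_add_eq_0)
    have m: "x \<noteq> y" if "x - y \<noteq> 0" for x y :: 'a using that by auto
    have "(1::'a) \<noteq> - 1" "(1::'a) \<noteq> - 2" "(2::'a) \<noteq> - 1" "(2::'a) \<noteq> - 2"
      by (rule p, use n in simp)+
    moreover have "(1::'a) \<noteq> 2" "(- 1 :: 'a) \<noteq> - 2" by (rule m, use n in simp)+
    moreover have "(- 1 :: 'a) \<noteq> 2" using \<open>(2::'a) \<noteq> - 1\<close> by (rule not_sym)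
    moreover have "(0::'a) \<noteq> 1" "(0::'a) \<noteq> - 1" "(0::'a) \<noteq> 2" "(0::'a) \<noteq> - 2" using n by simp_all
    ultimately show ?thesis
      by (simp only: distinct.simps list.set insert_iff empty_iff simp_thms)
  qed
  then have "card (set [0, 1, - 1, 2, - 2 :: 'a]) = length [0, 1, - 1, 2, - 2 :: 'a]" by (rule distinct_card)
  then have "card {0, 1, - 1, 2, - 2 :: 'a} = CARD('a)" unfolding q by simp
  then have "{0, 1, - 1, 2, - 2 :: 'a} = UNIV" by (intro card_subset_eq) simp_all
  then have "r \<in> {0, 1, - 1, 2, - 2}" by simp
  then show "r = 0 \<or> r = 1 \<or> r = - 1 \<or> r = 2 \<or> r = - 2" by simp
qed

text \<open>
  The roots of an irreducible \<open>X\<^sup>2 + b X + c\<close> over \<open>GF(5)\<close> have norm \<open>c = \<plusminus>1\<close>, so their order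
  divides 12 and their cubes lie in the field. Inspection of the possible coefficients shows
  \<open>b\<^sup>2 = c\<close>, which makes the quotient explicit.
\<close>

lemma quadratic_dvd_cube_minus_const:
  fixes c b :: "'a::{field,finite}"
  assumes q: "CARD('a) = 5" and c: "c\<^sup>2 = 1" and no: "\<And>r. c + b * r + r * r \<noteq> 0"
  shows "[:c, b, 1:] dvd [:0, 1:] ^ 3 - [:b * c:]"
proof -
  have five: "(5::'a) = 0" by (rule field_5_cases(1)[OF q])
  have "(4::'a) + 1 = 0" using five by simp
  then have four: "(4::'a) = - 1" by (simp only: add_eq_0_iff2)
  have "c = 1 \<or> c = - 1" using c by (simp add: power2_eq_1_iff)
  then have "b * b = c"
    using field_5_cases(4)[OF q, of b]
    by (elim disjE) (use no[of 1] no[of "- 1"] no[of 2] no[of "- 2"] five four in simp_all)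
  then have "[:0, 1:] ^ 3 - [:b * c:] = [:c, b, 1:] * [:- b, 1:]"
    by (simp add: power3_eq_cube algebra_simps)
  then show ?thesis by (simp only: dvd_triv_left)
qed

text \<open>
  The exponent \<open>e = q + 1\<close> works because \<open>\<alpha>\<^sup>q\<^sup>+\<^sup>1\<close> is a norm and hence in the field; it needs a
  unit \<open>a\<close> with \<open>a\<^sup>4 \<noteq> 1\<close>, which exists unless \<open>q = 5\<close>. For \<open>q = 5\<close> the exponent \<open>e = 3\<close> suffices,
  since in the exceptional elements the norm of a root of \<open>f\<close> is \<open>\<plusminus>1\<close>.
\<close>

theorem word_values_SL4:
  assumes q: "CARD('a::{field,finite}) \<ge> 4"
  shows "\<exists>w\<in>carrier (free_group 2). word_values (SL 4 :: 'a mat monoid) 2 w = {1\<^sub>m 4} \<union> transvections 4"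
proof (cases "CARD('a) = 5")
  case True
  note five = field_5_cases(1)[OF True]
  show ?thesis
  proof (rule word_values_SL4_if[where a = 1 and \<sigma> = 1 and \<mu> = "- 1" and e = 3])
    fix f :: "'a poly" and x :: "'a mat"
    assume f: "prime_elem f" "degree f = 2" and x: "x \<in> carrier (SL 4)"
      and ne: "mat_poly 4 x f \<noteq> 0\<^sub>m 4 4" "mat_poly 4 x (f ^ 2) = 0\<^sub>m 4 4"
    obtain c b d where cbd: "f = [:c, b, d:]" "d \<noteq> 0" using degree_2_polyE[OF f(2)] .
    have "(c / d)\<^sup>2 = 1"
      using det_if_quadratic_square_zero[OF SL_carrier_mat[OF x] f(1) cbd ne] x by (simp add: SL_carrier_iff)
    moreover have "c / d + b / d * r + r * r \<noteq> 0" for r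
    proof
      assume "c / d + b / d * r + r * r = 0"
      moreover have "poly f r = d * (c / d + b / d * r + r * r)" using cbd(2) by (simp add: cbd(1) field_simps)
      ultimately have "poly f r = 0" by simp
      then show False using prime_poly_no_root[OF f(1), of r] f(2) by simp
    qed
    ultimately have "[:c / d, b / d, 1:] dvd [:0, 1:] ^ 3 - [:b / d * (c / d):]"
      by (rule quadratic_dvd_cube_minus_const[OF True])
    moreover have "f = smult d [:c / d, b / d, 1:]" using cbd by simp
    ultimately have "f dvd [:0, 1:] ^ 3 - [:b / d * (c / d):]" using cbd(2) by (simp only: smult_dvd_iff) simp
    then show "\<exists>k. f dvd [:0, 1:] ^ 3 - [:k:]" by (rule exI)
  next
    note n = field_5_cases(2,3)[OF True]
    show "(1::'a) ^ (2 * 3) \<noteq> - 1" using n by (simp add: eq_neg_iff_add_eq_0)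
    have "(7::'a) = 5 + 2" by simp
    then have seven: "(7::'a) = 2" using five by simp
    fix r :: 'a
    show "r * r - 1 * r + 1 \<noteq> 0"
    proof
      assume r: "r * r - 1 * r + 1 = 0"
      from field_5_cases(4)[OF True, of r] show False
        by (elim disjE) (use r n seven in simp_all)
    qed
  next
    fix \<alpha> :: "'a alg_closure"
    assume a: "\<alpha> * \<alpha> = to_ac 1 * \<alpha> - 1"
    then have a': "\<alpha> * \<alpha> = \<alpha> - 1" by simp
    have "\<alpha> ^ 3 = (\<alpha> - 1) * \<alpha>" unfolding power3_eq_cube a' ..
    also have "\<dots> = \<alpha> * \<alpha> - \<alpha>" by (simp only: left_diff_distrib mult_1)
    also have "\<dots> = - 1" unfolding a' by simp
    finally show "\<alpha> ^ 3 = to_ac (- 1)" by simp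
  qed simp_all
next
  case False
  let ?q = "CARD('a)"
  obtain \<sigma> :: 'a where \<sigma>: "\<sigma> \<noteq> 0" "\<And>r. r * r - \<sigma> * r + 1 \<noteq> 0" using exists_quadratic_without_root[OF q] by blast
  have "\<exists>a::'a. a \<noteq> 0 \<and> a ^ 4 \<noteq> 1"
  proof (rule ccontr)
    assume no: "\<not> ?thesis"
    show False
    proof (cases "?q = 4")
      case True
      have "(UNIV :: 'a set) \<noteq> {0, 1}"
      proof
        assume "(UNIV :: 'a set) = {0, 1}"
        then have "?q = card {0, 1 :: 'a}" by simp
        then show False using q by simp
      qed
      then obtain a :: 'a where a: "a \<noteq> 0" "a \<noteq> 1" by blast
      have "a ^ 4 = a" using power_card_eq_same[of a] unfolding True .
      then show False using no a by auto
    next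
      case 4: False
      let ?p = "monom 1 4 - 1 :: 'a poly"
      have "coeff ?p 4 = 1" by simp
      then have p0: "?p \<noteq> 0" by force
      have "degree ?p \<le> 4" by (intro degree_diff_le) (simp_all add: degree_monom_eq)
      then have "card {a. poly ?p a = 0} \<le> 4" using card_poly_roots_bound[OF p0] by linarith
      moreover have "UNIV \<subseteq> insert 0 {a. poly ?p a = 0}" using no by (auto simp: poly_monom)
      then have "?q \<le> card (insert 0 {a. poly ?p a = 0})" by (intro card_mono) simp_all
      moreover have "card (insert 0 {a. poly ?p a = 0}) \<le> Suc (card {a. poly ?p a = 0})" by (rule card_insert_le_m1) simp_all
      ultimately show False using q False 4 by linarith
    qed
  qed
  then obtain a :: 'a where a: "a \<noteq> 0" "a ^ 4 \<noteq> 1" by blast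
  show ?thesis
  proof (rule word_values_SL4_if[OF _ a(1) _ \<sigma>, where \<mu> = 1 and e = "?q + 1"])
    fix f :: "'a poly" and x :: "'a mat"
    assume f: "prime_elem f" "degree f = 2" and x: "x \<in> carrier (SL 4)"
      and ne: "mat_poly 4 x f \<noteq> 0\<^sub>m 4 4" "mat_poly 4 x (f ^ 2) = 0\<^sub>m 4 4"
    note xc = SL_carrier_mat[OF x]
    have dx: "det x \<noteq> 0" using x by (simp add: SL_carrier_iff)
    obtain v where v: "v \<in> carrier_vec 4" "mat_poly 4 x f *\<^sub>v v \<noteq> 0\<^sub>v 4" "mat_poly 4 x f *\<^sub>v (mat_poly 4 x f *\<^sub>v v) = 0\<^sub>v 4"
      using nilpotent_prime_kernel[OF xc ne] by blast
    have u: "mat_poly 4 x f *\<^sub>v v \<in> carrier_vec 4" using xc v(1) by simp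
    have "?q ^ degree f - 1 = (?q + 1) * (?q - 1)" unfolding f(2) by (simp add: power2_eq_square algebra_simps diff_mult_distrib2)
    then have "?q ^ degree f - 1 dvd (?q + 1) * (?q - 1)" by simp
    then have "f dvd [:0, 1:] ^ ((?q + 1) * (?q - 1)) - 1"
      by (rule prime_kernel_dvd_X_power_minus_1[OF xc u v(2) dx f(1) v(3)])
    then show "\<exists>c. f dvd [:0, 1:] ^ (?q + 1) - [:c:]" by (rule prime_dvd_power_minus_const[OF f(1)])
  next
    have "2 * (?q + 1) = 4 + (?q - 1) * 2" using card_gt_1[where 'a='a] by simp
    then have "a ^ (2 * (?q + 1)) = a ^ 4 * (a ^ (?q - 1)) ^ 2" by (simp only: power_add power_mult)
    then show "a ^ (2 * (?q + 1)) \<noteq> 1" using a(2) power_card_minus_1[OF a(1)] by simp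
  qed simp_all
qed

section \<open>All dimensions\<close>

theorem theorem3:
  shows
    "(\<forall>n q. n \<ge> 2 \<and> q = CARD('a::{field,finite}) \<and> (n, q) \<noteq> (4, 2) \<longrightarrow>
        (\<exists>w \<in> carrier (free_group 2).
           word_values (SL n :: 'a mat monoid) 2 w = {1\<^sub>m n} \<union> transvections n))
     \<and>
     (CARD('a) = 2 \<longrightarrow>
        word_values (SL 4 :: 'a mat monoid) 2 (gen 1 [^]\<^bsub>free_group 2\<^esub> (2 * 3 * 5 * 7 :: nat))
          = {1\<^sub>m 4} \<union> transvections 4 \<union> double_transvections)"
proof (intro conjI allI impI)
  fix n q :: nat
  assume nq: "n \<ge> 2 \<and> q = CARD('a) \<and> (n, q) \<noteq> (4, 2)"
  consider "n = 2" | "n = 3" | "n = 4" | "n \<ge> 5" using nq by linarith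
  then show "\<exists>w \<in> carrier (free_group 2). word_values (SL n :: 'a mat monoid) 2 w = {1\<^sub>m n} \<union> transvections n"
  proof cases
    case 1
    show ?thesis unfolding 1 by (rule word_values_SL2)
  next
    case 2
    show ?thesis
    proof (cases "CHAR('a) = 2")
      case True
      then show ?thesis using 2 by (intro SL_power_word_values) simp_all
    next
      case False
      show ?thesis unfolding 2 by (rule word_values_SL3_odd[OF False])
    qed
  next
    case 3
    show ?thesis
    proof (cases "CARD('a) = 3")
      case True
      then have "prime (3::nat)" "3 dvd CARD('a)" by simp_all
      then have "CHAR('a) = 3" using prime_dvd_CARD_imp_CHAR[of 3, where 'a='a] by simp
      then show ?thesis using 3 by (intro SL_power_word_values) simp_all
    next
      case False
      then have "CARD('a) \<ge> 4" using nq 3 card_gt_1[where 'a='a] by auto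
      then show ?thesis unfolding 3 by (rule word_values_SL4)
    qed
  next
    case 4
    then show ?thesis by (rule word_values_SL_ge_5)
  qed
next
  assume "CARD('a) = 2"
  then show "word_values (SL 4 :: 'a mat monoid) 2 (gen 1 [^]\<^bsub>free_group 2\<^esub> (2 * 3 * 5 * 7 :: nat))
      = {1\<^sub>m 4} \<union> transvections 4 \<union> double_transvections"
    by (rule word_values_SL4_2)
qed

end
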